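(* The algebraic variety $\mathcal{A}_n$ is projective.
   Context: Everything is over $\mathbb{C}$; $[k]=\{0<1<\dots<k\}$; $n\ge1$. Multiscaled lines. A multiscaled line is a tuple $(\Sigma,p_\infty,\preceq,\omega_\bullet)$ where: (1) $\Sigma$ is a connected (complete) nodal complex curve of arithmetic genus $0$ with a smooth marked point $p_\infty$; its dual graph is a tree with vertex set $V(\Sigma)$, $\Sigma_v$ is the component of $v$, and the root $v_0$ is the vertex whose component contains $p_\infty$. Write $v\subseteq u$ if $v$ lies on the simple path from $u$ to $v_0$; $u\wedge v$ is the $\subseteq$-maximal vertex common to the simple paths from $u$ and from $v$ to $v_0$; terminal vertices are the $\subseteq$-maximal ones. (2) $\preceq$ is a total preorder on $V(\Sigma)$ such that (a) each $v\neq v_0$ has a unique adjacent $w$ with $w\prec v$ (the corresponding node is the descending node of $v$), and (b) any two terminal vertices are equivalent, where $v\sim w$ means $v\preceq w$ and $w\preceq v$. (3) For each $v$, $\omega_v$ is a meromorphic differential on $\Sigma_v$ with a pole of order $2$ at the descending node of $v$ (at $p_\infty$ if $v=v_0$) and no other zeros or poles. An $n$-marked multiscaled line has in addition smooth points $p_1,\dots,p_n$ (which may coincide with each other but not with $p_\infty$) lying on terminal components. It is stable if every terminal component contains at least one $p_i$ and every nonterminal component contains at least $3$ nodes, or at least $2$ nodes and $p_\infty$. A complex projective isomorphism is an isomorphism of curves $f:\Sigma\to\Sigma'$ preserving preorders and all marked points, with $f^*(\omega'_v)=c_v\omega_v$ for constants $c_v\in\mathbb{C}^*$ such that $c_v=c_w$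 if $v\sim w$ and $c_v=1$ if $v$ is terminal. $\mathcal{A}_n$ is the set of complex projective isomorphism classes of stable $n$-marked multiscaled lines. Dual level trees. $\Gamma(\Sigma)$ is the dual tree of $\Sigma$ with root $v_0$, preorder $\preceq$ and marking $h:\{1,\dots,n\}\to V(\Sigma)$, $h(i)=v$ if $p_i\in\Sigma_v$. A dual level tree is any marked preordered rooted tree arising this way. Its level function is the order-preserving map $\lambda: V\to V/{\sim}\cong[\ell]$; $\ell$ is its length. A contraction $\Gamma\twoheadrightarrow\Gamma'$ is a surjection $f$ on vertices, compatible with the markings, such that $v\preceq w\Rightarrow f(v)\preceq' f(w)$, adjacent vertices have equal or adjacent images, and fibers span connected subgraphs. Variety structure. $\Pi_{ij}:\mathcal{A}_n\to\mathbb{P}^1$: $\Pi_{ij}(\Sigma)=\int_{p_i}^{p_j}\omega_v$ (any path in the smooth locus of $\Sigma_v$) if $p_i,p_j$ lie on the same terminal component $\Sigma_v$, and $\Pi_{ij}(\Sigma)=\infty$ otherwise. $I_{ij}(\Sigma)=\int_{n_i}^{n_j}\omega_v$ where $v=h(i)\wedge h(j)$ in $\Gamma(\Sigma)$, and $n_i,n_j$ are $p_i,p_j$ if $h(i)=h(j)$, and otherwise the nodes of $\Sigma_v$ through which $\Sigma_v$ is connected to $\Sigma_{h(i)},\Sigma_{h(j)}$. For a dual level tree $\Gamma$ of length $\ell$ with marking $h$, $U_\Gamma\subset\mathcal{A}_n$ is the set of $\Sigma$ such that there is a contraction $\Gamma\twoheadrightarrow\Gamma(\Sigma)$ and $\Pi_{ij}(\Sigma)\neq0$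 whenever $h(i)\neq h(j)$ in $\Gamma$. Choose, for each $0\le m\le\ell-1$, a pair $(i_m,j_m)$ such that $v_m:=h(i_m)\wedge h(j_m)$ is on level $m$ of $\Gamma$; let $v_\ell$ be any terminal vertex. For $\Sigma\in U_\Gamma$ with (unique) contraction $f:\Gamma\twoheadrightarrow\Gamma(\Sigma)$ put $s_\ell=1$, $s_m=I_{i_mj_m}(\Sigma)$ for $m<\ell$; for $1\le m\le\ell$, $t_m=s_m/s_{m-1}$ if $f(v_m)\sim f(v_{m-1})$ and $t_m=0$ otherwise; $z_{ij}=I_{ij}(\Sigma)/s_m$ if $h(i)\wedge h(j)$ is on level $m$ of $\Gamma$. With $A$ (resp. $B$) the set of pairs $i<j$ with $h(i)\ne h(j)$ (resp. $h(i)=h(j)$) in $\Gamma$, this gives a map $\psi_\Gamma=(z_{ij},t_m):U_\Gamma\to(\mathbb{C}^* )^A\times\mathbb{C}^B\times\mathbb{C}^\ell$. $\mathcal{A}_n$ carries the unique structure of algebraic variety such that all $U_\Gamma$ are Zariski open and all $\psi_\Gamma$ are closed immersions; it is smooth and proper of dimension $n-1$. *)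

theory Defs
  imports "HOL-Complex_Analysis.Complex_Analysis"
begin

section \<open>Complex algebraic varieties as spaces with functions\<close>

text \<open>
  A variety is a point set with a Zariski topology and a sheaf of complex-valued functions (as in
  Serre's FAC), so it is reduced, and it is not required to be irreducible.  The functions in
  \<open>regular X U\<close> are kept extensional on \<open>U\<close>, and \<open>regular X U\<close> is empty unless \<open>U\<close> is open, so
  that a structure of variety on a given set is determined as an element of the record type.
\<close>

record 'a fun_space =
  zariski :: "'a topology"
  regular :: "'a set \<Rightarrow> ('a \<Rightarrow> complex) set"

abbreviation points :: "'a fun_space \<Rightarrow> 'a set" where
  "points X \<equiv> topspace (zariski X)"

definition space_with_functions :: "'a fun_space \<Rightarrow> bool" where
  "space_with_functions X \<longleftrightarrow>
     (\<forall>U. \<not> openin (zariski X) U \<longrightarrow> regular X U = {}) \<and>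
     (\<forall>U. openin (zariski X) U \<longrightarrow>
        regular X U \<subseteq> extensional U \<and>
        (\<forall>c. (\<lambda>x\<in>U. c) \<in> regular X U) \<and>
        (\<forall>f\<in>regular X U. \<forall>g\<in>regular X U.
           (\<lambda>x\<in>U. f x + g x) \<in> regular X U \<and> (\<lambda>x\<in>U. f x * g x) \<in> regular X U) \<and>
        (\<forall>f\<in>regular X U. \<forall>V. openin (zariski X) V \<and> V \<subseteq> U \<longrightarrow> restrict f V \<in> regular X V) \<and>
        (\<forall>f\<in>extensional U.
           (\<forall>x\<in>U. \<exists>V. openin (zariski X) V \<and> x \<in> V \<and> V \<subseteq> U \<and> restrict f V \<in> regular X V)
             \<longrightarrow> f \<in> regular X U))"

definition fun_morphism :: "('a \<Rightarrow> 'b) \<Rightarrow> 'a fun_space \<Rightarrow> 'b fun_space \<Rightarrow> bool" where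
  "fun_morphism \<phi> X Y \<longleftrightarrow>
     continuous_map (zariski X) (zariski Y) \<phi> \<and>
     (\<forall>V. openin (zariski Y) V \<longrightarrow>
        (\<forall>g\<in>regular Y V.
           (\<lambda>x \<in> {x \<in> points X. \<phi> x \<in> V}. g (\<phi> x)) \<in> regular X {x \<in> points X. \<phi> x \<in> V}))"

definition fun_isomorphism :: "('a \<Rightarrow> 'b) \<Rightarrow> 'a fun_space \<Rightarrow> 'b fun_space \<Rightarrow> bool" where
  "fun_isomorphism \<phi> X Y \<longleftrightarrow>
     bij_betw \<phi> (points X) (points Y) \<and>
     fun_morphism \<phi> X Y \<and> fun_morphism (inv_into (points X) \<phi>) Y X"

text \<open>
  The structure induced on a subset \<open>Z\<close>: regular functions are locally restrictions of regular
  functions of the ambient space.  For open \<open>Z\<close> this is the open subspace, for closed \<open>Z\<close> the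
  reduced closed subspace.
\<close>

definition induced_space :: "'a fun_space \<Rightarrow> 'a set \<Rightarrow> 'a fun_space" where
  "induced_space X Z = \<lparr>
     zariski = subtopology (zariski X) Z,
     regular = (\<lambda>U. if openin (subtopology (zariski X) Z) U then
       {f \<in> extensional U. \<forall>x\<in>U. \<exists>V g. openin (zariski X) V \<and> x \<in> V \<and> V \<inter> Z \<subseteq> U \<and>
          g \<in> regular X V \<and> (\<forall>y \<in> V \<inter> Z. f y = g y)} else {})\<rparr>"

definition closed_immersion :: "('a \<Rightarrow> 'b) \<Rightarrow> 'a fun_space \<Rightarrow> 'b fun_space \<Rightarrow> bool" where
  "closed_immersion \<phi> X Y \<longleftrightarrow>
     closedin (zariski Y) (\<phi> ` points X) \<and>
     fun_isomorphism \<phi> X (induced_space Y (\<phi> ` points X))"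

inductive polynomial_fn :: "'i set \<Rightarrow> (('i \<Rightarrow> complex) \<Rightarrow> complex) \<Rightarrow> bool" for I where
  "polynomial_fn I (\<lambda>_. c)"
| "i \<in> I \<Longrightarrow> polynomial_fn I (\<lambda>x. x i)"
| "polynomial_fn I p \<Longrightarrow> polynomial_fn I q \<Longrightarrow> polynomial_fn I (\<lambda>x. p x + q x)"
| "polynomial_fn I p \<Longrightarrow> polynomial_fn I q \<Longrightarrow> polynomial_fn I (\<lambda>x. p x * q x)"

inductive homogeneous_fn :: "'i set \<Rightarrow> nat \<Rightarrow> (('i \<Rightarrow> complex) \<Rightarrow> complex) \<Rightarrow> bool" for I where
  "homogeneous_fn I 0 (\<lambda>_. c)"
| "i \<in> I \<Longrightarrow> homogeneous_fn I 1 (\<lambda>x. x i)"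
| "homogeneous_fn I d p \<Longrightarrow> homogeneous_fn I d q \<Longrightarrow> homogeneous_fn I d (\<lambda>x. p x + q x)"
| "homogeneous_fn I d p \<Longrightarrow> homogeneous_fn I e q \<Longrightarrow> homogeneous_fn I (d + e) (\<lambda>x. p x * q x)"

text \<open>
  The coordinates of affine space are indexed by a finite set \<open>I\<close>.  The Zariski topologies are
  generated by the principal open sets, which are closed under finite intersections.
\<close>

definition affine_space :: "'i set \<Rightarrow> ('i \<Rightarrow> complex) fun_space" where
  "affine_space I =
     (let A = (I \<rightarrow>\<^sub>E (UNIV :: complex set));
          T = topology_generated_by {{x \<in> A. p x \<noteq> 0} | p. polynomial_fn I p}
      in \<lparr> zariski = T,
           regular = (\<lambda>U. if openin T U then
             {f \<in> extensional U. \<forall>x\<in>U. \<exists>V p q. openin T V \<and> x \<in> V \<and> V \<subseteq> U \<and>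
                polynomial_fn I p \<and> polynomial_fn I q \<and> (\<forall>y\<in>V. q y \<noteq> 0 \<and> f y = p y / q y)}
             else {}) \<rparr>)"

text \<open>
  A point of projective \<open>N\<close>-space is the set of its homogeneous coordinate vectors.
\<close>

definition proj_points :: "nat \<Rightarrow> (nat \<Rightarrow> complex) set set" where
  "proj_points N =
     {{(\<lambda>i\<in>{..N}. c * x i) | c. c \<noteq> 0} | x. x \<in> {..N} \<rightarrow>\<^sub>E UNIV \<and> (\<exists>i\<le>N. x i \<noteq> 0)}"

definition proj_space :: "nat \<Rightarrow> (nat \<Rightarrow> complex) set fun_space" where
  "proj_space N =
     (let T = topology_generated_by
                {{P \<in> proj_points N. \<forall>x\<in>P. p x \<noteq> 0} | p. \<exists>d. homogeneous_fn {..N} d p}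
      in \<lparr> zariski = T,
           regular = (\<lambda>U. if openin T U then
             {f \<in> extensional U. \<forall>P\<in>U. \<exists>V d p q. openin T V \<and> P \<in> V \<and> V \<subseteq> U \<and>
                homogeneous_fn {..N} d p \<and> homogeneous_fn {..N} d q \<and>
                (\<forall>Q\<in>V. \<forall>x\<in>Q. q x \<noteq> 0 \<and> f Q = p x / q x)}
             else {}) \<rparr>)"

definition affine_variety :: "'a fun_space \<Rightarrow> bool" where
  "affine_variety X \<longleftrightarrow> (\<exists>(N::nat) \<phi>. closed_immersion \<phi> X (affine_space {..<N}))"

text \<open>
  The topology of the product variety, which is finer than the product topology.
\<close>

definition zariski_product :: "'a fun_space \<Rightarrow> 'b fun_space \<Rightarrow> ('a \<times> 'b) topology" where
  "zariski_product X Y = topology_generated_by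
     {{(x, y). x \<in> U \<and> y \<in> V \<and> (\<Sum>k<m. f k x * g k y) \<noteq> 0} | U V (m::nat) f g.
        openin (zariski X) U \<and> openin (zariski Y) V \<and>
        (\<forall>k<m. f k \<in> regular X U \<and> g k \<in> regular Y V)}"

definition variety :: "'a fun_space \<Rightarrow> bool" where
  "variety X \<longleftrightarrow>
     space_with_functions X \<and>
     (\<exists>\<U>. finite \<U> \<and> \<Union>\<U> = points X \<and>
        (\<forall>U\<in>\<U>. openin (zariski X) U \<and> affine_variety (induced_space X U))) \<and>
     closedin (zariski_product X X) {(x, x) | x. x \<in> points X}"

definition projective_variety :: "'a fun_space \<Rightarrow> bool" where
  "projective_variety X \<longleftrightarrow> variety X \<and> (\<exists>N \<phi>. closed_immersion \<phi> X (proj_space N))"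


section \<open>The projective line and meromorphic differentials on it\<close>

datatype sphere = Pt complex | Infty

fun proj_moebius :: "complex \<Rightarrow> complex \<Rightarrow> complex \<Rightarrow> complex \<Rightarrow> sphere \<Rightarrow> sphere" where
  "proj_moebius a b c d (Pt z) = (if c * z + d = 0 then Infty else Pt (moebius a b c d z))"
| "proj_moebius a b c d Infty = (if c = 0 then Infty else Pt (a / c))"

definition sphere_aut :: "(sphere \<Rightarrow> sphere) set" where
  "sphere_aut = {proj_moebius a b c d | a b c d. a * d - b * c \<noteq> 0}"

text \<open>
  A meromorphic differential is given by its coefficient \<open>g\<close> in the standard affine chart, i.e. it
  is \<open>g(z) dz\<close>.  The pullback along an automorphism \<open>\<phi>\<close> has the coefficient \<open>g(\<phi>(z)) \<phi>'(z)\<close>; at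
  the points where this expression is not defined (\<open>\<phi>(z) = \<infinity>\<close>) it is extended by
  \<^const>\<open>remove_sings\<close>.  Coefficients are normalised to be \<open>0\<close> at their poles
  (\<^const>\<open>nicely_meromorphic_on\<close>), so equality of differentials is equality of functions.
\<close>

definition affine_part :: "(sphere \<Rightarrow> sphere) \<Rightarrow> complex \<Rightarrow> complex" where
  "affine_part \<phi> z = (case \<phi> (Pt z) of Pt w \<Rightarrow> w | Infty \<Rightarrow> 0)"

definition pullback_diff :: "(sphere \<Rightarrow> sphere) \<Rightarrow> (complex \<Rightarrow> complex) \<Rightarrow> complex \<Rightarrow> complex" where
  "pullback_diff \<phi> g = remove_sings (\<lambda>z. g (affine_part \<phi> z) * deriv (affine_part \<phi>) z)"

abbreviation sphere_inversion :: "sphere \<Rightarrow> sphere" where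
  "sphere_inversion \<equiv> proj_moebius 0 1 1 0"

definition meromorphic_diff :: "(complex \<Rightarrow> complex) \<Rightarrow> bool" where
  "meromorphic_diff g \<longleftrightarrow>
     g nicely_meromorphic_on UNIV \<and> pullback_diff sphere_inversion g nicely_meromorphic_on UNIV"

fun diff_order :: "(complex \<Rightarrow> complex) \<Rightarrow> sphere \<Rightarrow> int" where
  "diff_order g (Pt z) = zorder g z"
| "diff_order g Infty = zorder (pullback_diff sphere_inversion g) 0"

text \<open>
  The integral from \<open>p\<close> to \<open>q\<close> along any path avoiding the poles.  If there is a pole, then such a
  path lies in some affine chart \<open>z \<mapsto> \<phi>(Pt z)\<close> of the sphere, where it is an ordinary contour
  integral.  The value does not depend on the path for the differentials used below, since they have
  a single pole.
\<close>

definition has_sphere_integral ::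
  "(complex \<Rightarrow> complex) \<Rightarrow> sphere \<Rightarrow> sphere \<Rightarrow> complex \<Rightarrow> bool" where
  "has_sphere_integral g p q J \<longleftrightarrow>
     (\<exists>\<phi>\<in>sphere_aut. \<exists>\<gamma>. valid_path \<gamma> \<and>
        \<phi> (Pt (pathstart \<gamma>)) = p \<and> \<phi> (Pt (pathfinish \<gamma>)) = q \<and>
        (\<forall>z\<in>path_image \<gamma>. diff_order g (\<phi> (Pt z)) \<ge> 0) \<and>
        (pullback_diff \<phi> g has_contour_integral J) \<gamma>)"

definition sphere_integral :: "(complex \<Rightarrow> complex) \<Rightarrow> sphere \<Rightarrow> sphere \<Rightarrow> complex" where
  "sphere_integral g p q = (THE J. has_sphere_integral g p q J)"


section \<open>Marked preordered rooted trees\<close>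

record ltree =
  tverts :: "nat set"
  tadj :: "nat \<Rightarrow> nat \<Rightarrow> bool"
  troot :: nat
  tpre :: "(nat \<times> nat) set"   \<comment> \<open>\<open>(v, w)\<close> belongs to it iff \<open>v \<preceq> w\<close>\<close>
  tmark :: "nat \<Rightarrow> nat"

definition sim :: "(nat \<times> nat) set \<Rightarrow> nat \<Rightarrow> nat \<Rightarrow> bool" where
  "sim r v w \<longleftrightarrow> (v, w) \<in> r \<and> (w, v) \<in> r"

definition prec :: "(nat \<times> nat) set \<Rightarrow> nat \<Rightarrow> nat \<Rightarrow> bool" where
  "prec r v w \<longleftrightarrow> (v, w) \<in> r \<and> (w, v) \<notin> r"

definition simple_path :: "ltree \<Rightarrow> nat \<Rightarrow> nat \<Rightarrow> nat list \<Rightarrow> bool" where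
  "simple_path T u v xs \<longleftrightarrow>
     xs \<noteq> [] \<and> hd xs = u \<and> last xs = v \<and> set xs \<subseteq> tverts T \<and> distinct xs \<and>
     successively (tadj T) xs"

definition on_path :: "ltree \<Rightarrow> nat \<Rightarrow> nat \<Rightarrow> nat \<Rightarrow> bool" where
  "on_path T u v w \<longleftrightarrow> (\<exists>xs. simple_path T u v xs \<and> w \<in> set xs)"

definition tree_le :: "ltree \<Rightarrow> nat \<Rightarrow> nat \<Rightarrow> bool" where
  "tree_le T v u \<longleftrightarrow> on_path T u (troot T) v"

definition meet :: "ltree \<Rightarrow> nat \<Rightarrow> nat \<Rightarrow> nat" where
  "meet T u v = (THE w. tree_le T w u \<and> tree_le T w v \<and>
                   (\<forall>w'. tree_le T w' u \<and> tree_le T w' v \<longrightarrow> tree_le T w' w))"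

definition terminal :: "ltree \<Rightarrow> nat \<Rightarrow> bool" where
  "terminal T v \<longleftrightarrow> v \<in> tverts T \<and> (\<forall>u\<in>tverts T. tree_le T v u \<longrightarrow> u = v)"

definition level_classes :: "ltree \<Rightarrow> nat set set" where
  "level_classes T = tverts T // {(v, w). sim (tpre T) v w}"

text \<open>
  The order isomorphism of the classes with \<open>0 < 1 < \<dots> < \<ell>\<close> counts the classes strictly below.
\<close>

definition level :: "ltree \<Rightarrow> nat \<Rightarrow> nat" where
  "level T v = card {K \<in> level_classes T. \<forall>w\<in>K. prec (tpre T) w v}"

definition tree_length :: "ltree \<Rightarrow> nat" where
  "tree_length T = card (level_classes T) - 1"

definition contraction :: "nat \<Rightarrow> ltree \<Rightarrow> ltree \<Rightarrow> (nat \<Rightarrow> nat) \<Rightarrow> bool" where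
  "contraction n T T' f \<longleftrightarrow>
     f \<in> extensional (tverts T) \<and> f ` tverts T = tverts T' \<and>
     (\<forall>i\<in>{1..n}. f (tmark T i) = tmark T' i) \<and>
     (\<forall>v\<in>tverts T. \<forall>w\<in>tverts T. (v, w) \<in> tpre T \<longrightarrow> (f v, f w) \<in> tpre T') \<and>
     (\<forall>v\<in>tverts T. \<forall>w\<in>tverts T. tadj T v w \<longrightarrow> f v = f w \<or> tadj T' (f v) (f w)) \<and>
     (\<forall>v\<in>tverts T. \<forall>w\<in>tverts T. f v = f w \<longrightarrow>
        (\<lambda>a b. tadj T a b \<and> a \<in> tverts T \<and> b \<in> tverts T \<and> f a = f v \<and> f b = f v)\<^sup>*\<^sup>* v w)"


section \<open>Multiscaled lines\<close>

text \<open>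
  A connected nodal curve of arithmetic genus \<open>0\<close> is given by its normalisation and its nodes.  All
  components of the normalisation are projective lines, so the normalisation is a union of copies of
  the sphere indexed by the vertices, and its points are pairs \<open>(v, x)\<close>.  A node is the set of its two
  preimages in the normalisation.
\<close>

record mline =
  verts :: "nat set"
  nodes :: "(nat \<times> sphere) set set"
  inf_pt :: "nat \<times> sphere"
  preord :: "(nat \<times> nat) set"
  diff_form :: "nat \<Rightarrow> complex \<Rightarrow> complex"
  mark :: "nat \<Rightarrow> nat \<times> sphere"

definition dual_tree :: "mline \<Rightarrow> ltree" where
  "dual_tree L = \<lparr>
     tverts = verts L,
     tadj = (\<lambda>v w. \<exists>x y. {(v, x), (w, y)} \<in> nodes L),
     troot = fst (inf_pt L),
     tpre = preord L,
     tmark = (\<lambda>i. fst (mark L i))\<rparr>"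

text \<open>
  The last condition is the arithmetic genus formula for rational components: the genus is the number
  of nodes minus the number of components plus \<open>1\<close>.
\<close>

definition nodal_curve_genus0 :: "mline \<Rightarrow> bool" where
  "nodal_curve_genus0 L \<longleftrightarrow>
     finite (verts L) \<and> verts L \<noteq> {} \<and> finite (nodes L) \<and>
     (\<forall>e\<in>nodes L. card e = 2 \<and> e \<subseteq> verts L \<times> UNIV) \<and>
     (\<forall>e\<in>nodes L. \<forall>e'\<in>nodes L. e \<noteq> e' \<longrightarrow> e \<inter> e' = {}) \<and>
     (\<forall>v\<in>verts L. \<forall>w\<in>verts L. (tadj (dual_tree L))\<^sup>*\<^sup>* v w) \<and>
     int (card (nodes L)) - int (card (verts L)) + 1 = 0"

definition smooth_points :: "mline \<Rightarrow> (nat \<times> sphere) set" where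
  "smooth_points L = verts L \<times> UNIV - \<Union>(nodes L)"

text \<open>
  \<open>branch_point L v w\<close> is the node joining the adjacent components \<open>v\<close> and \<open>w\<close>, seen on component \<open>v\<close>.
\<close>

definition branch_point :: "mline \<Rightarrow> nat \<Rightarrow> nat \<Rightarrow> sphere" where
  "branch_point L v w = (THE x. \<exists>y. {(v, x), (w, y)} \<in> nodes L)"

definition pole_point :: "mline \<Rightarrow> nat \<Rightarrow> sphere" where
  "pole_point L v =
     (if v = fst (inf_pt L) then snd (inf_pt L)
      else branch_point L v (THE w. tadj (dual_tree L) v w \<and> prec (preord L) w v))"

definition multiscaled_line :: "mline \<Rightarrow> bool" where
  "multiscaled_line L \<longleftrightarrow>
     nodal_curve_genus0 L \<and> inf_pt L \<in> smooth_points L \<and>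
     preorder_on (verts L) (preord L) \<and> total_on (verts L) (preord L) \<and>
     (\<forall>v\<in>verts L. v \<noteq> fst (inf_pt L) \<longrightarrow>
        (\<exists>!w. tadj (dual_tree L) v w \<and> prec (preord L) w v)) \<and>
     (\<forall>v w. terminal (dual_tree L) v \<and> terminal (dual_tree L) w \<longrightarrow> sim (preord L) v w) \<and>
     (\<forall>v\<in>verts L.
        meromorphic_diff (diff_form L v) \<and> (\<exists>z. diff_form L v z \<noteq> 0) \<and>
        diff_order (diff_form L v) (pole_point L v) = -2 \<and>
        (\<forall>p. p \<noteq> pole_point L v \<longrightarrow> diff_order (diff_form L v) p = 0))"

definition marked_multiscaled_line :: "nat \<Rightarrow> mline \<Rightarrow> bool" where
  "marked_multiscaled_line n L \<longleftrightarrow>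
     multiscaled_line L \<and>
     (\<forall>i\<in>{1..n}. mark L i \<in> smooth_points L \<and> mark L i \<noteq> inf_pt L \<and>
        terminal (dual_tree L) (fst (mark L i)))"

definition node_count :: "mline \<Rightarrow> nat \<Rightarrow> nat" where
  "node_count L v = card {e \<in> nodes L. \<exists>x. (v, x) \<in> e}"

definition stable_line :: "nat \<Rightarrow> mline \<Rightarrow> bool" where
  "stable_line n L \<longleftrightarrow>
     marked_multiscaled_line n L \<and>
     (\<forall>v\<in>verts L.
        if terminal (dual_tree L) v then \<exists>i\<in>{1..n}. fst (mark L i) = v
        else node_count L v \<ge> 3 \<or> (node_count L v \<ge> 2 \<and> v = fst (inf_pt L)))"

text \<open>
  An isomorphism of nodal curves is an isomorphism of the normalisations (a bijection \<open>\<sigma>\<close> of the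
  components and Moebius transformations \<open>f v\<close>) which carries nodes to nodes.
\<close>

definition cp_isomorphic :: "nat \<Rightarrow> mline \<Rightarrow> mline \<Rightarrow> bool" where
  "cp_isomorphic n L L' \<longleftrightarrow>
     (\<exists>\<sigma> f (c :: nat \<Rightarrow> complex).
        let F = (\<lambda>(v, x). (\<sigma> v, f v x)) in
        bij_betw \<sigma> (verts L) (verts L') \<and> (\<forall>v\<in>verts L. f v \<in> sphere_aut) \<and>
        nodes L' = (\<lambda>e. F ` e) ` nodes L \<and>
        inf_pt L' = F (inf_pt L) \<and> (\<forall>i\<in>{1..n}. mark L' i = F (mark L i)) \<and>
        (\<forall>v\<in>verts L. \<forall>w\<in>verts L. (v, w) \<in> preord L \<longleftrightarrow> (\<sigma> v, \<sigma> w) \<in> preord L') \<and>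
        (\<forall>v\<in>verts L. c v \<noteq> 0 \<and>
           pullback_diff (f v) (diff_form L' (\<sigma> v)) = (\<lambda>z. c v * diff_form L v z)) \<and>
        (\<forall>v\<in>verts L. \<forall>w\<in>verts L. sim (preord L) v w \<longrightarrow> c v = c w) \<and>
        (\<forall>v. terminal (dual_tree L) v \<longrightarrow> c v = 1))"

text \<open>
  The set underlying the moduli space.  The vertices are natural numbers; this represents all
  isomorphism classes.
\<close>

definition moduli_points :: "nat \<Rightarrow> mline set set" where
  "moduli_points n =
     {L. stable_line n L} // {(L, L'). stable_line n L \<and> stable_line n L' \<and> cp_isomorphic n L L'}"


section \<open>The variety structure\<close>

definition Pi_map :: "mline \<Rightarrow> nat \<Rightarrow> nat \<Rightarrow> sphere" where
  "Pi_map L i j =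
     (if fst (mark L i) = fst (mark L j)
      then Pt (sphere_integral (diff_form L (fst (mark L i))) (snd (mark L i)) (snd (mark L j)))
      else Infty)"

text \<open>
  \<open>toward L v u\<close> is the node of the component \<open>v\<close> through which it is connected to the component \<open>u \<noteq> v\<close>.
\<close>

definition toward :: "mline \<Rightarrow> nat \<Rightarrow> nat \<Rightarrow> sphere" where
  "toward L v u =
     branch_point L v (THE w. tadj (dual_tree L) v w \<and> on_path (dual_tree L) v u w)"

definition I_map :: "mline \<Rightarrow> nat \<Rightarrow> nat \<Rightarrow> complex" where
  "I_map L i j =
     (let u = fst (mark L i); w = fst (mark L j); v = meet (dual_tree L) u w
      in if u = w then sphere_integral (diff_form L v) (snd (mark L i)) (snd (mark L j))
         else sphere_integral (diff_form L v) (toward L v u) (toward L v w))"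

definition dual_level_trees :: "nat \<Rightarrow> ltree set" where
  "dual_level_trees n = {dual_tree L | L. stable_line n L}"

definition U_chart :: "nat \<Rightarrow> ltree \<Rightarrow> mline set set" where
  "U_chart n T =
     {K \<in> moduli_points n. \<exists>L\<in>K. (\<exists>f. contraction n T (dual_tree L) f) \<and>
        (\<forall>i\<in>{1..n}. \<forall>j\<in>{1..n}. tmark T i \<noteq> tmark T j \<longrightarrow> Pi_map L i j \<noteq> Pt 0)}"

datatype chart_coord = Zc nat nat | Tc nat

definition chart_index :: "nat \<Rightarrow> ltree \<Rightarrow> chart_coord set" where
  "chart_index n \<Gamma> =
     {Zc i j | i j. 1 \<le> i \<and> i < j \<and> j \<le> n} \<union> {Tc m | m. 1 \<le> m \<and> m \<le> tree_length \<Gamma>}"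

definition chart_target :: "nat \<Rightarrow> ltree \<Rightarrow> (chart_coord \<Rightarrow> complex) fun_space" where
  "chart_target n \<Gamma> = induced_space (affine_space (chart_index n \<Gamma>))
     {x \<in> chart_index n \<Gamma> \<rightarrow>\<^sub>E UNIV.
        \<forall>i j. 1 \<le> i \<and> i < j \<and> j \<le> n \<and> tmark \<Gamma> i \<noteq> tmark \<Gamma> j \<longrightarrow> x (Zc i j) \<noteq> 0}"

text \<open>
  The choices entering the chart: \<open>pr m\<close> is the pair \<open>(i\<^sub>m, j\<^sub>m)\<close> for \<open>m < \<ell>\<close>, and \<open>e\<close> is the terminal
  vertex \<open>v\<^sub>\<ell>\<close>.
\<close>

definition chart_choice :: "nat \<Rightarrow> ltree \<Rightarrow> (nat \<Rightarrow> nat \<times> nat) \<Rightarrow> nat \<Rightarrow> bool" where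
  "chart_choice n \<Gamma> pr e \<longleftrightarrow>
     (\<forall>m < tree_length \<Gamma>. fst (pr m) \<in> {1..n} \<and> snd (pr m) \<in> {1..n} \<and>
        level \<Gamma> (meet \<Gamma> (tmark \<Gamma> (fst (pr m))) (tmark \<Gamma> (snd (pr m)))) = m) \<and>
     terminal \<Gamma> e"

definition chart_vertex :: "ltree \<Rightarrow> (nat \<Rightarrow> nat \<times> nat) \<Rightarrow> nat \<Rightarrow> nat \<Rightarrow> nat" where
  "chart_vertex \<Gamma> pr e m =
     (if m < tree_length \<Gamma> then meet \<Gamma> (tmark \<Gamma> (fst (pr m))) (tmark \<Gamma> (snd (pr m))) else e)"

definition chart_scale :: "ltree \<Rightarrow> (nat \<Rightarrow> nat \<times> nat) \<Rightarrow> mline \<Rightarrow> nat \<Rightarrow> complex" where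
  "chart_scale \<Gamma> pr L m = (if m < tree_length \<Gamma> then I_map L (fst (pr m)) (snd (pr m)) else 1)"

definition psi_line ::
  "nat \<Rightarrow> ltree \<Rightarrow> (nat \<Rightarrow> nat \<times> nat) \<Rightarrow> nat \<Rightarrow> mline \<Rightarrow> chart_coord \<Rightarrow> complex" where
  "psi_line n \<Gamma> pr e L =
     (let f = (THE f. contraction n \<Gamma> (dual_tree L) f);
          s = chart_scale \<Gamma> pr L;
          v = chart_vertex \<Gamma> pr e
      in (\<lambda>k \<in> chart_index n \<Gamma>.
            case k of
              Zc i j \<Rightarrow> I_map L i j / s (level \<Gamma> (meet \<Gamma> (tmark \<Gamma> i) (tmark \<Gamma> j)))
            | Tc m \<Rightarrow> (if sim (preord L) (f (v m)) (f (v (m - 1))) then s m / s (m - 1) else 0)))"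

text \<open>
  The coordinates take the same value on all representatives of an isomorphism class, although
  \<^const>\<open>I_map\<close> does not; \<^const>\<open>the_elem\<close> extracts this value.
\<close>

definition psi_chart ::
  "nat \<Rightarrow> ltree \<Rightarrow> (nat \<Rightarrow> nat \<times> nat) \<Rightarrow> nat \<Rightarrow> mline set \<Rightarrow> chart_coord \<Rightarrow> complex" where
  "psi_chart n \<Gamma> pr e K = the_elem (psi_line n \<Gamma> pr e ` K)"

definition moduli_structure :: "nat \<Rightarrow> mline set fun_space \<Rightarrow> bool" where
  "moduli_structure n X \<longleftrightarrow>
     variety X \<and> points X = moduli_points n \<and>
     (\<forall>\<Gamma>\<in>dual_level_trees n.
        openin (zariski X) (U_chart n \<Gamma>) \<and>
        (\<forall>pr e. chart_choice n \<Gamma> pr e \<longrightarrow>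
           closed_immersion (psi_chart n \<Gamma> pr e) (induced_space X (U_chart n \<Gamma>))
             (chart_target n \<Gamma>)))"

definition moduli_variety :: "nat \<Rightarrow> mline set fun_space" where
  "moduli_variety n = (THE X. moduli_structure n X)"

end

theory Submission
  imports Defs
begin

text \<open>
  A stable line is determined up to isomorphism by the levels of the meets \<open>h(i) \<and> h(j)\<close> and by the
  periods \<open>I\<^sub>i\<^sub>j\<close>, up to rescaling the periods of each nonterminal level. For every set \<open>S\<close> of labels,
  consisting of pairs \<open>(i, j)\<close> and of an extra label for the constant \<open>1\<close> on the terminal level,
  the periods on the lowest level that occurs in \<open>S\<close> are the homogeneous coordinates of a point
  of a projective space. The points of the product over all \<open>S\<close> that arise in this way are exactly
  those that satisfy the cocycle relations and agree up to scale for \<open>S \<subseteq> T\<close>. These conditions are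
  closed, so the Segre map embeds the moduli space as a closed subset of a projective space. On each
  chart, suitable ratios of the homogeneous coordinates are polynomials in the chart coordinates, and
  every chart coordinate is such a ratio; hence the induced structure satisfies the characterization
  of the moduli variety.
\<close>

section \<open>Spaces of local fractions\<close>

text \<open>The periods of different levels have independent scales, so no single projective space
  can hold them all: on a boundary curve the vector of all labels shows its lowest level and nothing
  above it. A smaller set of labels that avoids the lowest level shows the next one, which is why
  every set \<open>S\<close> gets its own factor. Conversely, for \<open>S \<subseteq> T\<close> the
  point of \<open>T\<close> either vanishes on \<open>S\<close> or determines the point of
  \<open>S\<close>; this is enough to rebuild the levels recursively. The extra label lies in every
  \<open>S\<close> because periods on the terminal level may be 0, and each factor needs a nonzero
  coordinate.

  The geometry of curves enters the embedding through one bijection only, from isomorphism classes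
  to level data up to rescaling. The charts are brought into the same language by describing
  contractions through levels. Since \<open>moduli_variety\<close> is a definite description, the
  embedded space must also be shown to be the only space with the required charts; this holds
  because a closed immersion determines the structure of its source and the charts cover.\<close>

definition fraction_open :: "'a set \<Rightarrow> (('a \<Rightarrow> complex) \<times> ('a \<Rightarrow> complex)) set \<Rightarrow> 'a set \<Rightarrow> bool" where
  "fraction_open M F U \<longleftrightarrow>
     U \<subseteq> M \<and> (\<forall>x\<in>U. \<exists>p q. (p, q) \<in> F \<and> q x \<noteq> 0 \<and> {y \<in> M. q y \<noteq> 0} \<subseteq> U)"

text \<open>The topology depends only on the denominators occurring in \<open>F\<close>, and
  \<open>M\<close> enters only as a restriction. Affine space, projective space, their subsets and
  the moduli space all become such spaces, with \<open>F\<close> made of quotients of polynomials or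
  of forms of equal degree.\<close>

definition fraction_space :: "'a set \<Rightarrow> (('a \<Rightarrow> complex) \<times> ('a \<Rightarrow> complex)) set \<Rightarrow> 'a fun_space" where
  "fraction_space M F = \<lparr>
     zariski = topology (fraction_open M F),
     regular = (\<lambda>U. if fraction_open M F U then
       {f \<in> extensional U. \<forall>x\<in>U. \<exists>p q. (p, q) \<in> F \<and> q x \<noteq> 0 \<and>
          (\<forall>y\<in>M. q y \<noteq> 0 \<longrightarrow> y \<in> U \<and> f y = p y / q y)} else {})\<rparr>"

text \<open>\<open>denominator\<close> together with \<open>mult\<close> permits extending a
  fraction by a further denominator, which shrinks its domain. \<open>divide\<close> serves to pull
  back a quotient whose numerator and denominator have themselves become fractions.\<close>

locale fraction_family =
  fixes F :: "(('a \<Rightarrow> complex) \<times> ('a \<Rightarrow> complex)) set"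
  assumes const: "(\<lambda>_. c, \<lambda>_. 1) \<in> F"
    and denominator: "(p, q) \<in> F \<Longrightarrow> (q, q) \<in> F"
    and add: "(p, q) \<in> F \<Longrightarrow> (p', q') \<in> F \<Longrightarrow> (\<lambda>x. p x * q' x + p' x * q x, \<lambda>x. q x * q' x) \<in> F"
    and mult: "(p, q) \<in> F \<Longrightarrow> (p', q') \<in> F \<Longrightarrow> (\<lambda>x. p x * p' x, \<lambda>x. q x * q' x) \<in> F"
    and divide: "(p, q) \<in> F \<Longrightarrow> (p', q') \<in> F \<Longrightarrow> (\<lambda>x. p x * q' x, \<lambda>x. q x * p' x) \<in> F"
begin

lemma fraction_open_Int:
  assumes "fraction_open M F U" "fraction_open M F V"
  shows "fraction_open M F (U \<inter> V)"
  unfolding fraction_open_def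
proof safe
  fix x assume x: "x \<in> U" "x \<in> V"
  then show "x \<in> M" using assms by (auto simp: fraction_open_def)
  obtain p q where pq: "(p, q) \<in> F" "q x \<noteq> 0" "{y \<in> M. q y \<noteq> 0} \<subseteq> U"
    using assms x unfolding fraction_open_def by blast
  obtain p' q' where pq': "(p', q') \<in> F" "q' x \<noteq> 0" "{y \<in> M. q' y \<noteq> 0} \<subseteq> V"
    using assms x unfolding fraction_open_def by blast
  show "\<exists>p q. (p, q) \<in> F \<and> q x \<noteq> 0 \<and> {y \<in> M. q y \<noteq> 0} \<subseteq> U \<inter> V"
    using mult[OF pq(1) pq'(1)] pq pq' by (intro exI conjI) (assumption, auto)
qed

lemma istopology_fraction_open: "istopology (fraction_open M F)"
  unfolding istopology_def
proof (intro conjI allI impI)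
  show "fraction_open M F (\<Union>\<K>)" if "\<forall>K\<in>\<K>. fraction_open M F K" for \<K>
    using that unfolding fraction_open_def by (meson Sup_le_iff UnionE Union_upper subset_trans)
qed (rule fraction_open_Int)

lemma openin_fraction_space [simp]:
  "openin (zariski (fraction_space M F)) = fraction_open M F"
  by (simp add: fraction_space_def topology_inverse'[OF istopology_fraction_open])

lemma fraction_open_space: "fraction_open M F M"
  unfolding fraction_open_def using const[of 1] by fastforce

lemma fraction_open_subset: "fraction_open M F U \<Longrightarrow> U \<subseteq> M"
  by (auto simp: fraction_open_def)

lemma fraction_open_basic:
  "(p, q) \<in> F \<Longrightarrow> fraction_open M F {y \<in> M. q y \<noteq> 0}"
  by (auto simp: fraction_open_def)

lemma fraction_open_locally:
  assumes "\<And>x. x \<in> U \<Longrightarrow> \<exists>V. fraction_open M F V \<and> x \<in> V \<and> V \<subseteq> U"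
  shows "fraction_open M F U"
  using assms unfolding fraction_open_def by (meson subset_iff)

lemma topspace_fraction_space [simp]: "topspace (zariski (fraction_space M F)) = M"
  by (rule antisym)
    (use fraction_open_space[of M] openin_subset[of "zariski (fraction_space M F)" M]
      fraction_open_subset[of M "topspace (zariski (fraction_space M F))"] in
      \<open>auto simp flip: openin_fraction_space\<close>)

lemma regular_fraction_spaceI:
  assumes "fraction_open M F U" "f \<in> extensional U"
    and "\<And>x. x \<in> U \<Longrightarrow> \<exists>V p q. fraction_open M F V \<and> x \<in> V \<and> V \<subseteq> U \<and> (p, q) \<in> F \<and>
           (\<forall>y\<in>V. q y \<noteq> 0 \<and> f y = p y / q y)"
  shows "f \<in> regular (fraction_space M F) U"
proof -
  have "\<exists>p q. (p, q) \<in> F \<and> q x \<noteq> 0 \<and> (\<forall>y\<in>M. q y \<noteq> 0 \<longrightarrow> y \<in> U \<and> f y = p y / q y)"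
    if "x \<in> U" for x
  proof -
    obtain V p q where V: "fraction_open M F V" "x \<in> V" "V \<subseteq> U" "(p, q) \<in> F"
      "\<forall>y\<in>V. q y \<noteq> 0 \<and> f y = p y / q y"
      using assms(3)[OF \<open>x \<in> U\<close>] by blast
    obtain p' q' where q': "(p', q') \<in> F" "q' x \<noteq> 0" "{y \<in> M. q' y \<noteq> 0} \<subseteq> V"
      using V unfolding fraction_open_def by blast
    \<comment> \<open>Extending by \<open>q'\<close> keeps the value and makes the nonvanishing
      locus of the denominator lie inside \<open>V\<close>.\<close>
    have "(\<lambda>x. p x * q' x, \<lambda>x. q x * q' x) \<in> F"
      by (rule mult[OF V(4) denominator[OF q'(1)]])
    then show ?thesis
      using V q' by (intro exI conjI) (assumption, auto)
  qed
  with assms(1,2) show ?thesis by (simp add: fraction_space_def)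
qed

lemma regular_fraction_spaceE:
  assumes "f \<in> regular (fraction_space M F) U" "x \<in> U"
  obtains p q where "(p, q) \<in> F" "q x \<noteq> 0" "\<And>y. y \<in> M \<Longrightarrow> q y \<noteq> 0 \<Longrightarrow> y \<in> U \<and> f y = p y / q y"
  using assms by (auto simp: fraction_space_def split: if_splits)

lemma regular_fraction_spaceD:
  assumes "f \<in> regular (fraction_space M F) U"
  shows "fraction_open M F U" "f \<in> extensional U"
  using assms by (auto simp: fraction_space_def split: if_splits)

lemma regular_quotient:
  assumes "fraction_open M F U" "(p, q) \<in> F" "\<And>x. x \<in> U \<Longrightarrow> q x \<noteq> 0"
  shows "(\<lambda>x\<in>U. p x / q x) \<in> regular (fraction_space M F) U"
  using assms by (intro regular_fraction_spaceI) auto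

lemma regular_restrict:
  assumes f: "f \<in> regular (fraction_space M F) U" and V: "fraction_open M F V" "V \<subseteq> U"
  shows "restrict f V \<in> regular (fraction_space M F) V"
proof (rule regular_fraction_spaceI)
  fix x assume "x \<in> V"
  with V obtain p q where pq: "(p, q) \<in> F" "q x \<noteq> 0" "\<And>y. y \<in> M \<Longrightarrow> q y \<noteq> 0 \<Longrightarrow> y \<in> U \<and> f y = p y / q y"
    using regular_fraction_spaceE[OF f, of x] by blast
  show "\<exists>W p q. fraction_open M F W \<and> x \<in> W \<and> W \<subseteq> V \<and> (p, q) \<in> F \<and>
          (\<forall>y\<in>W. q y \<noteq> 0 \<and> restrict f V y = p y / q y)"
    using fraction_open_Int[OF V(1) fraction_open_basic[OF pq(1), of M]] \<open>x \<in> V\<close> pq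
      fraction_open_subset[OF V(1)]
    by (intro exI[of _ "V \<inter> {y \<in> M. q y \<noteq> 0}"] exI[of _ p] exI[of _ q]) auto
qed (use V in auto)

lemma regular_local:
  assumes U: "fraction_open M F U" and f: "f \<in> extensional U"
    and loc: "\<And>x. x \<in> U \<Longrightarrow>
      \<exists>V. fraction_open M F V \<and> x \<in> V \<and> V \<subseteq> U \<and> restrict f V \<in> regular (fraction_space M F) V"
  shows "f \<in> regular (fraction_space M F) U"
proof (rule regular_fraction_spaceI[OF U f])
  fix x assume "x \<in> U"
  then obtain V where V: "fraction_open M F V" "x \<in> V" "V \<subseteq> U"
    "restrict f V \<in> regular (fraction_space M F) V"
    using loc by blast
  obtain p q where pq: "(p, q) \<in> F" "q x \<noteq> 0"
    "\<And>y. y \<in> M \<Longrightarrow> q y \<noteq> 0 \<Longrightarrow> y \<in> V \<and> restrict f V y = p y / q y"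
    using regular_fraction_spaceE[OF V(4,2)] by blast
  show "\<exists>V p q. fraction_open M F V \<and> x \<in> V \<and> V \<subseteq> U \<and> (p, q) \<in> F \<and>
           (\<forall>y\<in>V. q y \<noteq> 0 \<and> f y = p y / q y)"
  proof (intro exI conjI ballI)
    show "fraction_open M F {y \<in> M. q y \<noteq> 0}"
      by (rule fraction_open_basic[OF pq(1)])
    show "x \<in> {y \<in> M. q y \<noteq> 0}"
      using pq V fraction_open_subset[OF V(1)] by blast
    show "{y \<in> M. q y \<noteq> 0} \<subseteq> U" using pq(3) V by blast
    show "f y = p y / q y" if "y \<in> {y \<in> M. q y \<noteq> 0}" for y
      using pq(3)[of y] that by auto
  qed (use pq in auto)
qed

lemma space_with_functions_fraction_space: "space_with_functions (fraction_space M F)"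
  unfolding space_with_functions_def openin_fraction_space
proof (intro conjI allI impI ballI)
  fix U assume "\<not> fraction_open M F U"
  then show "regular (fraction_space M F) U = {}"
    using regular_fraction_spaceD by blast
next
  fix U assume U: "fraction_open M F U"
  show "regular (fraction_space M F) U \<subseteq> extensional U"
    using regular_fraction_spaceD by blast
  show "(\<lambda>x\<in>U. c) \<in> regular (fraction_space M F) U" for c
    using regular_quotient[OF U const, of c] by simp
  fix f g assume f: "f \<in> regular (fraction_space M F) U" and g: "g \<in> regular (fraction_space M F) U"
  \<comment> \<open>Sums and products are treated together: \<open>h\<close> is the operation on
    functions and \<open>k\<close> the numerator it produces over the common denominator
    \<open>q * q'\<close>.\<close>
  have *: "(\<lambda>x\<in>U. h (f x) (g x)) \<in> regular (fraction_space M F) U"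
    if h: "\<And>p q p' q'. (p, q) \<in> F \<Longrightarrow> (p', q') \<in> F \<Longrightarrow>
         (\<lambda>x. k (p x) (q x) (p' x) (q' x), \<lambda>x. q x * q' x) \<in> F"
    and k: "\<And>p q p' q'. q \<noteq> 0 \<Longrightarrow> q' \<noteq> 0 \<Longrightarrow> h (p / q) (p' / q') = k p q p' q' / (q * q')" for h k
  proof (rule regular_fraction_spaceI[OF U])
    fix x assume x: "x \<in> U"
    obtain p q where pq: "(p, q) \<in> F" "q x \<noteq> 0"
      "\<And>y. y \<in> M \<Longrightarrow> q y \<noteq> 0 \<Longrightarrow> y \<in> U \<and> f y = p y / q y"
      using regular_fraction_spaceE[OF f x] by blast
    obtain p' q' where pq': "(p', q') \<in> F" "q' x \<noteq> 0"
      "\<And>y. y \<in> M \<Longrightarrow> q' y \<noteq> 0 \<Longrightarrow> y \<in> U \<and> g y = p' y / q' y"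
      using regular_fraction_spaceE[OF g x] by blast
    note kF = h[OF pq(1) pq'(1)]
    show "\<exists>V P Q. fraction_open M F V \<and> x \<in> V \<and> V \<subseteq> U \<and> (P, Q) \<in> F \<and>
          (\<forall>y\<in>V. Q y \<noteq> 0 \<and> (\<lambda>x\<in>U. h (f x) (g x)) y = P y / Q y)"
      by (intro exI conjI, rule fraction_open_basic[OF kF, of M]; (rule kF)?)
        (use pq pq' x fraction_open_subset[OF U] k in auto)
  qed auto
  show "(\<lambda>x\<in>U. f x + g x) \<in> regular (fraction_space M F) U"
    by (rule *[of "\<lambda>p q p' q'. p * q' + p' * q" "(+)"]) (rule add, auto simp: field_simps)
  show "(\<lambda>x\<in>U. f x * g x) \<in> regular (fraction_space M F) U"
    by (rule *[of "\<lambda>p q p' q'. p * p'" "(*)"]) (rule mult, auto)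
qed (use regular_restrict regular_local in blast)+

text \<open>An open subset of \<open>Z\<close> extends to the union of all principal open sets of
  \<open>M\<close> whose trace lies in it. The pairs in \<open>F\<close> are functions on the whole
  type, so the same pairs serve \<open>M\<close> and \<open>Z\<close>.\<close>

lemma fraction_open_trace:
  assumes "Z \<subseteq> M"
  shows "fraction_open Z F W \<longleftrightarrow> (\<exists>U. fraction_open M F U \<and> W = U \<inter> Z)"
proof
  assume W: "fraction_open Z F W"
  define U where "U = \<Union>{{y \<in> M. q y \<noteq> 0} | p q. (p, q) \<in> F \<and> {y \<in> Z. q y \<noteq> 0} \<subseteq> W}"
  have "fraction_open M F U"
    by (rule fraction_open_locally) (auto simp: U_def intro: fraction_open_basic)
  moreover have "W = U \<inter> Z"
  proof (intro equalityI subsetI IntI)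
    fix x assume x: "x \<in> W"
    then show "x \<in> Z" using W by (auto simp: fraction_open_def)
    obtain p q where "(p, q) \<in> F" "q x \<noteq> 0" "{y \<in> Z. q y \<noteq> 0} \<subseteq> W"
      using W x unfolding fraction_open_def by blast
    then show "x \<in> U"
      using \<open>x \<in> Z\<close> assms unfolding U_def by blast
  qed (auto simp: U_def)
  ultimately show "\<exists>U. fraction_open M F U \<and> W = U \<inter> Z" by blast
next
  assume "\<exists>U. fraction_open M F U \<and> W = U \<inter> Z"
  then obtain U where U: "fraction_open M F U" "W = U \<inter> Z" by blast
  show "fraction_open Z F W"
    unfolding fraction_open_def
  proof (intro conjI ballI)
    fix x assume "x \<in> W"
    then obtain p q where "(p, q) \<in> F" "q x \<noteq> 0" "{y \<in> M. q y \<noteq> 0} \<subseteq> U"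
      using U unfolding fraction_open_def by blast
    then show "\<exists>p q. (p, q) \<in> F \<and> q x \<noteq> 0 \<and> {y \<in> Z. q y \<noteq> 0} \<subseteq> W"
      using assms U by (intro exI conjI) (assumption, auto)
  qed (use U in auto)
qed

text \<open>Passing to a subset keeps \<open>F\<close> and only shrinks the carrier, so subvarieties
  and charts stay inside this class of spaces.\<close>

lemma induced_fraction_space:
  assumes "Z \<subseteq> M"
  shows "induced_space (fraction_space M F) Z = fraction_space Z F"
proof -
  have top: "subtopology (zariski (fraction_space M F)) Z = zariski (fraction_space Z F)"
    by (rule topology_eq[THEN iffD2]) (auto simp: openin_subtopology fraction_open_trace[OF assms])
  have reg: "{f \<in> extensional U. \<forall>x\<in>U. \<exists>V g. openin (zariski (fraction_space M F)) V \<and> x \<in> V \<and>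
        V \<inter> Z \<subseteq> U \<and> g \<in> regular (fraction_space M F) V \<and> (\<forall>y \<in> V \<inter> Z. f y = g y)}
      = regular (fraction_space Z F) U" (is "?L = ?R") if U: "fraction_open Z F U" for U
  proof (intro equalityI subsetI)
    fix f assume f: "f \<in> ?L"
    show "f \<in> ?R"
    proof (rule regular_fraction_spaceI[OF U])
      fix x assume x: "x \<in> U"
      then obtain V g where V: "fraction_open M F V" "x \<in> V" "V \<inter> Z \<subseteq> U"
          "g \<in> regular (fraction_space M F) V" "\<forall>y \<in> V \<inter> Z. f y = g y"
        using f by auto
      obtain p q where pq: "(p, q) \<in> F" "q x \<noteq> 0" "\<And>y. y \<in> M \<Longrightarrow> q y \<noteq> 0 \<Longrightarrow> y \<in> V \<and> g y = p y / q y"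
        using regular_fraction_spaceE[OF V(4,2)] by blast
      show "\<exists>W p q. fraction_open Z F W \<and> x \<in> W \<and> W \<subseteq> U \<and> (p, q) \<in> F \<and>
           (\<forall>y\<in>W. q y \<noteq> 0 \<and> f y = p y / q y)"
      proof (intro exI conjI ballI)
        show "fraction_open Z F {y \<in> Z. q y \<noteq> 0}"
          by (rule fraction_open_basic[OF pq(1)])
        show "x \<in> {y \<in> Z. q y \<noteq> 0}"
          using pq x fraction_open_subset[OF U] by blast
        show "{y \<in> Z. q y \<noteq> 0} \<subseteq> U" using pq(3) V assms by blast
        show "f y = p y / q y" if "y \<in> {y \<in> Z. q y \<noteq> 0}" for y
          using pq(3)[of y] that V assms by auto
      qed (use pq in auto)
    qed (use f in simp)
  next
    fix f assume f: "f \<in> ?R"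
    have "\<exists>V g. openin (zariski (fraction_space M F)) V \<and> x \<in> V \<and>
        V \<inter> Z \<subseteq> U \<and> g \<in> regular (fraction_space M F) V \<and> (\<forall>y \<in> V \<inter> Z. f y = g y)" if x: "x \<in> U" for x
    proof -
      obtain p q where pq: "(p, q) \<in> F" "q x \<noteq> 0" "\<And>y. y \<in> Z \<Longrightarrow> q y \<noteq> 0 \<Longrightarrow> y \<in> U \<and> f y = p y / q y"
        using regular_fraction_spaceE[OF f x] by blast
      show ?thesis
        using regular_quotient[OF fraction_open_basic[OF pq(1), of M] pq(1)] pq x assms
          fraction_open_basic[OF pq(1), of M] fraction_open_subset[OF U]
        by (intro exI[of _ "{y \<in> M. q y \<noteq> 0}"] exI[of _ "\<lambda>y\<in>{y \<in> M. q y \<noteq> 0}. p y / q y"]) auto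
    qed
    with regular_fraction_spaceD[OF f] show "f \<in> ?L" by auto
  qed
  have "regular (induced_space (fraction_space M F) Z) U = regular (fraction_space Z F) U" for U
  proof (cases "fraction_open Z F U")
    case True
    then show ?thesis
      using reg[OF True] by (simp only: induced_space_def top openin_fraction_space fun_space.simps if_True)
  next
    case False
    then have "regular (fraction_space Z F) U = {}"
      using regular_fraction_spaceD by blast
    with False show ?thesis
      by (simp add: induced_space_def top)
  qed
  then show ?thesis
    by (intro fun_space.equality) (auto simp: induced_space_def top)
qed

end

text \<open>Morphisms are tested on fractions: near each point a pulled-back fraction must agree
  with a fraction of the source. Asking \<open>q' (\<phi> y)\<close> to be nonzero wherever
  \<open>q y\<close> is gives continuity at the same time.\<close>

definition fraction_map ::
    "('a \<Rightarrow> 'b) \<Rightarrow> 'a set \<Rightarrow> (('a \<Rightarrow> complex) \<times> ('a \<Rightarrow> complex)) set \<Rightarrow>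
      (('b \<Rightarrow> complex) \<times> ('b \<Rightarrow> complex)) set \<Rightarrow> bool" where
  "fraction_map \<phi> M F F' \<longleftrightarrow>
     (\<forall>p' q' x. (p', q') \<in> F' \<longrightarrow> x \<in> M \<longrightarrow> q' (\<phi> x) \<noteq> 0 \<longrightarrow>
        (\<exists>p q. (p, q) \<in> F \<and> q x \<noteq> 0 \<and>
          (\<forall>y\<in>M. q y \<noteq> 0 \<longrightarrow> q' (\<phi> y) \<noteq> 0 \<and> p y / q y = p' (\<phi> y) / q' (\<phi> y))))"

lemma fun_morphism_fraction_space:
  assumes "fraction_family F" "fraction_family F'"
    and map: "\<phi> \<in> M \<rightarrow> M'" and \<phi>: "fraction_map \<phi> M F F'"
  shows "fun_morphism \<phi> (fraction_space M F) (fraction_space M' F')"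
proof -
  interpret F: fraction_family F by fact
  interpret F': fraction_family F' by fact
  have cont: "fraction_open M F {x \<in> M. \<phi> x \<in> V}" if V: "fraction_open M' F' V" for V
  proof (rule F.fraction_open_locally)
    fix x assume x: "x \<in> {x \<in> M. \<phi> x \<in> V}"
    then obtain p' q' where pq': "(p', q') \<in> F'" "q' (\<phi> x) \<noteq> 0" "{y \<in> M'. q' y \<noteq> 0} \<subseteq> V"
      using V unfolding fraction_open_def by blast
    then obtain p q where "(p, q) \<in> F" "q x \<noteq> 0" "\<forall>y\<in>M. q y \<noteq> 0 \<longrightarrow> q' (\<phi> y) \<noteq> 0"
      using \<phi>[unfolded fraction_map_def, rule_format, OF pq'(1) _ pq'(2)] x by auto
    then show "\<exists>W. fraction_open M F W \<and> x \<in> W \<and> W \<subseteq> {x \<in> M. \<phi> x \<in> V}"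
      using pq' x map F.fraction_open_basic[of p q M]
      by (intro exI[of _ "{y \<in> M. q y \<noteq> 0}"]) auto
  qed
  show ?thesis
    unfolding fun_morphism_def continuous_map_def F.openin_fraction_space F'.openin_fraction_space
      F.topspace_fraction_space F'.topspace_fraction_space
  proof (intro conjI allI impI ballI)
    fix V g assume V: "fraction_open M' F' V" and g: "g \<in> regular (fraction_space M' F') V"
    show "(\<lambda>x \<in> {x \<in> M. \<phi> x \<in> V}. g (\<phi> x)) \<in> regular (fraction_space M F) {x \<in> M. \<phi> x \<in> V}"
    proof (rule F.regular_fraction_spaceI[OF cont[OF V]])
      fix x assume x: "x \<in> {x \<in> M. \<phi> x \<in> V}"
      then obtain p' q' where pq': "(p', q') \<in> F'" "q' (\<phi> x) \<noteq> 0"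
        "\<And>y. y \<in> M' \<Longrightarrow> q' y \<noteq> 0 \<Longrightarrow> y \<in> V \<and> g y = p' y / q' y"
        using F'.regular_fraction_spaceE[OF g, of "\<phi> x"] by blast
      then obtain p q where pq: "(p, q) \<in> F" "q x \<noteq> 0"
        "\<forall>y\<in>M. q y \<noteq> 0 \<longrightarrow> q' (\<phi> y) \<noteq> 0 \<and> p y / q y = p' (\<phi> y) / q' (\<phi> y)"
        using \<phi>[unfolded fraction_map_def, rule_format, OF pq'(1) _ pq'(2)] x by auto
      show "\<exists>W p q. fraction_open M F W \<and> x \<in> W \<and> W \<subseteq> {x \<in> M. \<phi> x \<in> V} \<and> (p, q) \<in> F \<and>
           (\<forall>y\<in>W. q y \<noteq> 0 \<and> (\<lambda>x \<in> {x \<in> M. \<phi> x \<in> V}. g (\<phi> x)) y = p y / q y)"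
        using pq pq' x map F.fraction_open_basic[OF pq(1), of M]
        by (intro exI[of _ "{y \<in> M. q y \<noteq> 0}"] exI[of _ p] exI[of _ q]) auto
    qed auto
  qed (use map cont in auto)
qed

lemma fun_isomorphism_fraction_space:
  assumes F: "fraction_family F" "fraction_family F'" and bij: "bij_betw \<phi> M M'"
    and \<phi>: "fraction_map \<phi> M F F'" and inv: "fraction_map (inv_into M \<phi>) M' F' F"
  shows "fun_isomorphism \<phi> (fraction_space M F) (fraction_space M' F')"
proof -
  interpret F: fraction_family F by fact
  interpret F': fraction_family F' by fact
  show ?thesis
    unfolding fun_isomorphism_def F.topspace_fraction_space F'.topspace_fraction_space
    using bij bij_betw_inv_into[OF bij] \<phi> inv F
    by (auto intro!: fun_morphism_fraction_space dest: bij_betwE)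
qed

text \<open>Regularity of the inverse is phrased along \<open>\<phi>\<close>: each fraction on
  \<open>M\<close> must come locally from a fraction of the target. This keeps
  \<open>inv_into\<close> out of the applications.\<close>

lemma closed_immersion_fraction_space:
  assumes F: "fraction_family F" "fraction_family F'"
    and inj: "inj_on \<phi> M" and closed: "closedin (zariski (fraction_space M' F')) (\<phi> ` M)"
    and \<phi>: "fraction_map \<phi> M F F'"
    and inv: "\<And>p q x. (p, q) \<in> F \<Longrightarrow> x \<in> M \<Longrightarrow> q x \<noteq> 0 \<Longrightarrow>
      \<exists>p' q'. (p', q') \<in> F' \<and> q' (\<phi> x) \<noteq> 0 \<and>
        (\<forall>y\<in>M. q' (\<phi> y) \<noteq> 0 \<longrightarrow> q y \<noteq> 0 \<and> p' (\<phi> y) / q' (\<phi> y) = p y / q y)"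
  shows "closed_immersion \<phi> (fraction_space M F) (fraction_space M' F')"
proof -
  interpret F: fraction_family F by fact
  interpret F': fraction_family F' by fact
  have sub: "\<phi> ` M \<subseteq> M'"
    using closedin_subset[OF closed] by simp
  have "fraction_map (inv_into M \<phi>) (\<phi> ` M) F' F"
    unfolding fraction_map_def by (clarsimp simp: inj) (rule inv)
  then have "fun_isomorphism \<phi> (fraction_space M F) (fraction_space (\<phi> ` M) F')"
    by (intro fun_isomorphism_fraction_space F \<phi>) (auto simp: inj_on_imp_bij_betw inj)
  then show ?thesis
    unfolding closed_immersion_def using closed F'.induced_fraction_space[OF sub] by simp
qed

section \<open>Affine and projective spaces as spaces of fractions\<close>

lemma polynomial_fn_prod:
  "(\<And>a. a \<in> A \<Longrightarrow> polynomial_fn I (f a)) \<Longrightarrow> polynomial_fn I (\<lambda>x. \<Prod>a\<in>A. f a x)"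
  by (induction A rule: infinite_finite_induct) (auto intro: polynomial_fn.intros)

lemma polynomial_fn_uminus: "polynomial_fn I p \<Longrightarrow> polynomial_fn I (\<lambda>x. - p x)"
  using polynomial_fn.intros(4)[OF polynomial_fn.intros(1)[of I "-1"], of p] by simp

lemma polynomial_fn_diff:
  "polynomial_fn I p \<Longrightarrow> polynomial_fn I q \<Longrightarrow> polynomial_fn I (\<lambda>x. p x - q x)"
  using polynomial_fn.intros(3)[OF _ polynomial_fn_uminus, of I p q] by simp

lemma polynomial_fn_subst:
  assumes "polynomial_fn I p" "\<And>i. i \<in> I \<Longrightarrow> polynomial_fn J (\<lambda>x. g x i)"
  shows "polynomial_fn J (\<lambda>x. p (g x))"
  using assms by induction (auto intro: polynomial_fn.intros)

lemma homogeneous_fn_imp_polynomial_fn: "homogeneous_fn I d p \<Longrightarrow> polynomial_fn I p"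
  by (induction rule: homogeneous_fn.induct) (auto intro: polynomial_fn.intros)

lemma homogeneous_fn_scale:
  assumes "homogeneous_fn I d p" "\<And>i. i \<in> I \<Longrightarrow> y i = c * x i"
  shows "p y = c ^ d * p x"
  using assms by induction (auto simp: algebra_simps power_add)

lemma homogeneous_fn_mult':
  "homogeneous_fn I d p \<Longrightarrow> homogeneous_fn I e q \<Longrightarrow> d + e = k \<Longrightarrow> homogeneous_fn I k (\<lambda>x. p x * q x)"
  using homogeneous_fn.intros(4) by blast

lemma homogeneous_fn_uminus: "homogeneous_fn I d p \<Longrightarrow> homogeneous_fn I d (\<lambda>x. - p x)"
  using homogeneous_fn_mult'[OF homogeneous_fn.intros(1)[of I "-1"], of d p d] by simp

lemma homogeneous_fn_diff:
  "homogeneous_fn I d p \<Longrightarrow> homogeneous_fn I d q \<Longrightarrow> homogeneous_fn I d (\<lambda>x. p x - q x)"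
  using homogeneous_fn.intros(3)[OF _ homogeneous_fn_uminus, of I d p q] by simp

lemma homogeneous_fn_prod:
  "finite A \<Longrightarrow> (\<And>a. a \<in> A \<Longrightarrow> homogeneous_fn I (d a) (f a)) \<Longrightarrow>
    homogeneous_fn I (\<Sum>a\<in>A. d a) (\<lambda>x. \<Prod>a\<in>A. f a x)"
  by (induction A rule: finite_induct) (auto intro: homogeneous_fn.intros)

lemma homogeneous_fn_power: "homogeneous_fn I d p \<Longrightarrow> homogeneous_fn I (k * d) (\<lambda>x. p x ^ k)"
  using homogeneous_fn_prod[of "{..<k}" I "\<lambda>_. d" "\<lambda>_. p"] by simp

definition affine_fractions :: "'i set \<Rightarrow> ((('i \<Rightarrow> complex) \<Rightarrow> complex) \<times> (('i \<Rightarrow> complex) \<Rightarrow> complex)) set" where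
  "affine_fractions I = {(p, q). polynomial_fn I p \<and> polynomial_fn I q}"

lemma fraction_family_affine: "fraction_family (affine_fractions I)"
  by unfold_locales (auto simp: affine_fractions_def intro!: polynomial_fn.intros)

text \<open>A product of polynomials is nonzero exactly where both factors are, so the principal
  open sets form a base and generate the topology of \<open>fraction_open\<close>.\<close>

lemma affine_space_eq: "affine_space I = fraction_space (I \<rightarrow>\<^sub>E UNIV) (affine_fractions I)"
proof -
  interpret fraction_family "affine_fractions I" by (rule fraction_family_affine)
  define A :: "('a \<Rightarrow> complex) set" where "A = (I \<rightarrow>\<^sub>E UNIV)"
  define B where "B = {{x \<in> A. p x \<noteq> 0} | p. polynomial_fn I p}"
  define T where "T = topology_generated_by B"
  have "fraction_open A (affine_fractions I) U" if "generate_topology_on B U" for U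
    using that
  proof induction
    case (UN K)
    then show ?case by (intro fraction_open_locally) blast
  next
    case (Basis s)
    then obtain p where p: "polynomial_fn I p" "s = {x \<in> A. p x \<noteq> 0}" by (auto simp: B_def)
    then show ?case using fraction_open_basic[of p p A] by (auto simp: affine_fractions_def)
  next
    case (Int a b)
    then show ?case by (intro fraction_open_Int)
  qed (auto simp: fraction_open_def)
  moreover have "openin T U" if U: "fraction_open A (affine_fractions I) U" for U
  proof (subst openin_subopen, intro ballI)
    fix x assume x: "x \<in> U"
    then obtain p q where q: "(p, q) \<in> affine_fractions I" "q x \<noteq> 0" "{y \<in> A. q y \<noteq> 0} \<subseteq> U"
      using U unfolding fraction_open_def by blast
    have "openin T {y \<in> A. q y \<noteq> 0}"
      unfolding T_def by (rule topology_generated_by_Basis) (use q in \<open>auto simp: B_def affine_fractions_def\<close>)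
    then show "\<exists>W. openin T W \<and> x \<in> W \<and> W \<subseteq> U"
      using q x fraction_open_subset[OF U] by (intro exI[of _ "{y \<in> A. q y \<noteq> 0}"]) auto
  qed
  ultimately have op: "openin T U \<longleftrightarrow> fraction_open A (affine_fractions I) U" for U
    using openin_topology_generated_by unfolding T_def by blast
  have top: "T = zariski (fraction_space A (affine_fractions I))"
    by (simp add: topology_eq op)
  have "(if openin T U then
             {f \<in> extensional U. \<forall>x\<in>U. \<exists>V p q. openin T V \<and> x \<in> V \<and> V \<subseteq> U \<and>
                polynomial_fn I p \<and> polynomial_fn I q \<and> (\<forall>y\<in>V. q y \<noteq> 0 \<and> f y = p y / q y)}
             else {}) = regular (fraction_space A (affine_fractions I)) U" (is "?L = ?R") for U
  proof (intro equalityI subsetI)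
    fix f assume f: "f \<in> ?L"
    then have "openin T U" by (auto split: if_splits)
    with f show "f \<in> ?R"
      by (intro regular_fraction_spaceI) (auto simp: op affine_fractions_def)
  next
    fix f assume f: "f \<in> ?R"
    have "\<exists>V p q. openin T V \<and> x \<in> V \<and> V \<subseteq> U \<and>
                polynomial_fn I p \<and> polynomial_fn I q \<and> (\<forall>y\<in>V. q y \<noteq> 0 \<and> f y = p y / q y)" if x: "x \<in> U" for x
    proof -
      obtain p q where pq: "(p, q) \<in> affine_fractions I" "q x \<noteq> 0"
        "\<And>y. y \<in> A \<Longrightarrow> q y \<noteq> 0 \<Longrightarrow> y \<in> U \<and> f y = p y / q y"
        using regular_fraction_spaceE[OF f x] by blast
      then show ?thesis
        using fraction_open_basic[OF pq(1), of A] x fraction_open_subset[OF regular_fraction_spaceD(1)[OF f]]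
        by (intro exI[of _ "{y \<in> A. q y \<noteq> 0}"] exI[of _ p] exI[of _ q])
          (auto simp: op affine_fractions_def)
    qed
    with regular_fraction_spaceD[OF f] show "f \<in> ?L" by (auto simp: op)
  qed
  then have "affine_space I = \<lparr>zariski = T, regular = regular (fraction_space A (affine_fractions I))\<rparr>"
    unfolding affine_space_def Let_def A_def[symmetric] B_def[symmetric] T_def[symmetric]
    by (simp only:)
  then show ?thesis
    by (simp add: top A_def)
qed

text \<open>\<open>y\<close> assigns to each point a vector of homogeneous coordinates. With
  \<open>y = proj_rep\<close> this describes projective space itself, with the coordinates of an
  embedding it describes the embedded set. Equal degrees make the quotient independent of the scale
  of the vector.\<close>

definition projective_fractions ::
    "nat \<Rightarrow> ('a \<Rightarrow> nat \<Rightarrow> complex) \<Rightarrow> (('a \<Rightarrow> complex) \<times> ('a \<Rightarrow> complex)) set" where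
  "projective_fractions N y =
     {(\<lambda>x. p (y x), \<lambda>x. q (y x)) | p q. \<exists>d. homogeneous_fn {..N} d p \<and> homogeneous_fn {..N} d q}"

lemma projective_fractionsI:
  "homogeneous_fn {..N} d p \<Longrightarrow> homogeneous_fn {..N} d q \<Longrightarrow>
    (\<lambda>x. p (y x), \<lambda>x. q (y x)) \<in> projective_fractions N y"
  unfolding projective_fractions_def by blast

lemma projective_fractionsE:
  assumes "(P, Q) \<in> projective_fractions N y"
  obtains d p q where "homogeneous_fn {..N} d p" "homogeneous_fn {..N} d q"
    "P = (\<lambda>x. p (y x))" "Q = (\<lambda>x. q (y x))"
  using assms unfolding projective_fractions_def by blast

lemma fraction_family_projective: "fraction_family (projective_fractions N y)"
proof
  show "(\<lambda>_. c, \<lambda>_. 1) \<in> projective_fractions N y" for c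
    using projective_fractionsI[OF homogeneous_fn.intros(1) homogeneous_fn.intros(1)] .
  fix P Q assume "(P, Q) \<in> projective_fractions N y"
  then obtain d p q where pq: "homogeneous_fn {..N} d p" "homogeneous_fn {..N} d q"
    "P = (\<lambda>x. p (y x))" "Q = (\<lambda>x. q (y x))" by (rule projective_fractionsE)
  show "(Q, Q) \<in> projective_fractions N y"
    using projective_fractionsI[OF pq(2) pq(2)] by (simp add: pq)
  fix P' Q' assume "(P', Q') \<in> projective_fractions N y"
  then obtain d' p' q' where pq': "homogeneous_fn {..N} d' p'" "homogeneous_fn {..N} d' q'"
    "P' = (\<lambda>x. p' (y x))" "Q' = (\<lambda>x. q' (y x))" by (rule projective_fractionsE)
  note m = homogeneous_fn_mult'[OF _ _ refl]
  show "(\<lambda>x. P x * Q' x + P' x * Q x, \<lambda>x. Q x * Q' x) \<in> projective_fractions N y"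
    using projective_fractionsI[OF homogeneous_fn.intros(3)[OF m[OF pq(1) pq'(2)]
        homogeneous_fn_mult'[OF pq'(1) pq(2)]] m[OF pq(2) pq'(2)]] by (simp add: pq pq')
  show "(\<lambda>x. P x * P' x, \<lambda>x. Q x * Q' x) \<in> projective_fractions N y"
    using projective_fractionsI[OF m[OF pq(1) pq'(1)] m[OF pq(2) pq'(2)]] by (simp add: pq pq')
  show "(\<lambda>x. P x * Q' x, \<lambda>x. Q x * P' x) \<in> projective_fractions N y"
    using projective_fractionsI[OF m[OF pq(1) pq'(2)] m[OF pq(2) pq'(1)]] by (simp add: pq pq')
qed

section \<open>Points of projective space and their coordinate vectors\<close>

definition proj_point :: "nat \<Rightarrow> (nat \<Rightarrow> complex) \<Rightarrow> (nat \<Rightarrow> complex) set" where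
  "proj_point N x = {(\<lambda>i\<in>{..N}. c * x i) | c. c \<noteq> 0}"

text \<open>An arbitrary representative suffices, since the vanishing of forms and quotients of
  forms of equal degree do not depend on it.\<close>

definition proj_rep :: "(nat \<Rightarrow> complex) set \<Rightarrow> nat \<Rightarrow> complex" where
  "proj_rep P = (SOME x. x \<in> P)"

lemma proj_point_in_proj_points: "\<exists>i\<le>N. x i \<noteq> 0 \<Longrightarrow> proj_point N x \<in> proj_points N"
  unfolding proj_points_def proj_point_def
  by (rule CollectI, rule exI[of _ "restrict x {..N}"]) (auto intro!: Collect_cong ex_cong restrict_ext)

lemma proj_pointsE:
  assumes "P \<in> proj_points N"
  obtains x where "x \<in> {..N} \<rightarrow>\<^sub>E UNIV" "\<exists>i\<le>N. x i \<noteq> 0" "P = proj_point N x"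
  using assms unfolding proj_points_def proj_point_def by blast

lemma proj_point_memE:
  assumes "z \<in> proj_point N x"
  obtains c where "c \<noteq> 0" "z = (\<lambda>i\<in>{..N}. c * x i)"
  using assms unfolding proj_point_def by blast

lemma proj_rep_in:
  assumes "P \<in> proj_points N"
  shows "proj_rep P \<in> P"
proof -
  obtain x where x: "P = proj_point N x"
    using assms by (rule proj_pointsE)
  have "(\<lambda>i\<in>{..N}. 1 * x i) \<in> P"
    unfolding x proj_point_def by (rule CollectI, rule exI[of _ 1]) simp
  then show ?thesis
    unfolding proj_rep_def some_in_eq by blast
qed

lemma proj_rep_proj_point:
  assumes "\<exists>i\<le>N. x i \<noteq> 0"
  obtains c where "c \<noteq> 0" "\<And>i. i \<le> N \<Longrightarrow> proj_rep (proj_point N x) i = c * x i"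
proof -
  obtain c where "c \<noteq> 0" "proj_rep (proj_point N x) = (\<lambda>i\<in>{..N}. c * x i)"
    using proj_point_memE[OF proj_rep_in[OF proj_point_in_proj_points[OF assms]]] by blast
  then show ?thesis by (intro that[of c]) auto
qed

lemma proj_points_mem_scale:
  assumes "P \<in> proj_points N" "x \<in> P"
  obtains c where "c \<noteq> 0" "\<And>i. i \<le> N \<Longrightarrow> x i = c * proj_rep P i"
proof -
  obtain z where z: "P = proj_point N z" using proj_pointsE[OF assms(1)] by metis
  obtain c where c: "c \<noteq> 0" "x = (\<lambda>i\<in>{..N}. c * z i)" using assms(2) z proj_point_memE by metis
  obtain c' where c': "c' \<noteq> 0" "proj_rep P = (\<lambda>i\<in>{..N}. c' * z i)"
    using proj_rep_in[OF assms(1)] z proj_point_memE by metis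
  show ?thesis by (rule that[of "c / c'"]) (use c c' in auto)
qed

lemma homogeneous_fn_proj_points:
  assumes "P \<in> proj_points N" "homogeneous_fn {..N} d p"
  shows "(\<forall>x\<in>P. p x \<noteq> 0) \<longleftrightarrow> p (proj_rep P) \<noteq> 0"
proof
  assume nz: "p (proj_rep P) \<noteq> 0"
  show "\<forall>x\<in>P. p x \<noteq> 0"
  proof
    fix x assume x: "x \<in> P"
    obtain c where c: "c \<noteq> 0" "\<And>i. i \<le> N \<Longrightarrow> x i = c * proj_rep P i"
      using proj_points_mem_scale[OF assms(1) x] by blast
    have "p x = c ^ d * p (proj_rep P)"
      by (rule homogeneous_fn_scale[OF assms(2)]) (use c in auto)
    with c nz show "p x \<noteq> 0" by simp
  qed
qed (use proj_rep_in[OF assms(1)] in blast)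

lemma homogeneous_quotient_proj_points:
  assumes "P \<in> proj_points N" "homogeneous_fn {..N} d p" "homogeneous_fn {..N} d q"
  shows "(\<forall>x\<in>P. q x \<noteq> 0 \<and> a = p x / q x) \<longleftrightarrow>
    q (proj_rep P) \<noteq> 0 \<and> a = p (proj_rep P) / q (proj_rep P)"
proof
  assume *: "q (proj_rep P) \<noteq> 0 \<and> a = p (proj_rep P) / q (proj_rep P)"
  show "\<forall>x\<in>P. q x \<noteq> 0 \<and> a = p x / q x"
  proof
    fix x assume x: "x \<in> P"
    obtain c where c: "c \<noteq> 0" "\<And>i. i \<le> N \<Longrightarrow> x i = c * proj_rep P i"
      using proj_points_mem_scale[OF assms(1) x] by blast
    have "p x = c ^ d * p (proj_rep P)" "q x = c ^ d * q (proj_rep P)"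
      by (rule homogeneous_fn_scale[OF assms(2)] homogeneous_fn_scale[OF assms(3)]; use c in auto)+
    with c * show "q x \<noteq> 0 \<and> a = p x / q x" by simp
  qed
qed (use proj_rep_in[OF assms(1)] in blast)

lemma proj_space_eq: "proj_space N = fraction_space (proj_points N) (projective_fractions N proj_rep)"
proof -
  let ?F = "projective_fractions N proj_rep"
  interpret fraction_family ?F by (rule fraction_family_projective)
  define A where "A = proj_points N"
  define B where "B = {{P \<in> A. \<forall>x\<in>P. p x \<noteq> 0} | p. \<exists>d. homogeneous_fn {..N} d p}"
  define T where "T = topology_generated_by B"
  have bas: "{P \<in> A. \<forall>x\<in>P. p x \<noteq> 0} = {P \<in> A. p (proj_rep P) \<noteq> 0}" if "homogeneous_fn {..N} d p" for d p
    using homogeneous_fn_proj_points[OF _ that] by (auto simp: A_def)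
  have "fraction_open A ?F U" if "generate_topology_on B U" for U
    using that
  proof induction
    case (UN K)
    then show ?case by (intro fraction_open_locally) blast
  next
    case (Basis s)
    then obtain p d where p: "homogeneous_fn {..N} d p" "s = {P \<in> A. p (proj_rep P) \<noteq> 0}"
      unfolding B_def using bas by blast
    show ?case unfolding p(2) by (rule fraction_open_basic[OF projective_fractionsI[OF p(1) p(1)]])
  next
    case (Int a b)
    then show ?case by (intro fraction_open_Int)
  qed (auto simp: fraction_open_def)
  moreover have "openin T U" if U: "fraction_open A ?F U" for U
  proof (subst openin_subopen, intro ballI)
    fix x assume x: "x \<in> U"
    then obtain p q where q: "(p, q) \<in> ?F" "q x \<noteq> 0" "{y \<in> A. q y \<noteq> 0} \<subseteq> U"
      using U unfolding fraction_open_def by blast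
    obtain d q' where q': "homogeneous_fn {..N} d q'" "q = (\<lambda>x. q' (proj_rep x))"
      using q(1) by (rule projective_fractionsE)
    have "openin T {y \<in> A. q y \<noteq> 0}"
      unfolding T_def q'(2) using bas[OF q'(1)]
      by (intro topology_generated_by_Basis) (use q' in \<open>auto simp: B_def\<close>)
    then show "\<exists>W. openin T W \<and> x \<in> W \<and> W \<subseteq> U"
      using q x fraction_open_subset[OF U] by (intro exI[of _ "{y \<in> A. q y \<noteq> 0}"]) auto
  qed
  ultimately have op: "openin T U \<longleftrightarrow> fraction_open A ?F U" for U
    using openin_topology_generated_by unfolding T_def by blast
  have top: "T = zariski (fraction_space A ?F)"
    by (simp add: topology_eq op)
  have "(if openin T U then
             {f \<in> extensional U. \<forall>P\<in>U. \<exists>V d p q. openin T V \<and> P \<in> V \<and> V \<subseteq> U \<and>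
                homogeneous_fn {..N} d p \<and> homogeneous_fn {..N} d q \<and>
                (\<forall>Q\<in>V. \<forall>x\<in>Q. q x \<noteq> 0 \<and> f Q = p x / q x)}
             else {}) = regular (fraction_space A ?F) U" (is "?L = ?R") for U
  proof (intro equalityI subsetI)
    fix f assume f: "f \<in> ?L"
    then have U: "fraction_open A ?F U" and ext: "f \<in> extensional U" and
      loc: "\<And>P. P \<in> U \<Longrightarrow> \<exists>V d p q. openin T V \<and> P \<in> V \<and> V \<subseteq> U \<and>
                homogeneous_fn {..N} d p \<and> homogeneous_fn {..N} d q \<and>
                (\<forall>Q\<in>V. \<forall>x\<in>Q. q x \<noteq> 0 \<and> f Q = p x / q x)"
      unfolding op by (auto split: if_splits)
    show "f \<in> ?R"
    proof (rule regular_fraction_spaceI[OF U ext])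
      fix P assume "P \<in> U"
      from loc[OF this] obtain V d p q where V: "fraction_open A ?F V" "P \<in> V" "V \<subseteq> U"
        "homogeneous_fn {..N} d p" "homogeneous_fn {..N} d q"
        and q: "\<And>Q. Q \<in> V \<Longrightarrow> \<forall>x\<in>Q. q x \<noteq> 0 \<and> f Q = p x / q x"
        unfolding op by blast
      have "\<forall>y\<in>V. q (proj_rep y) \<noteq> 0 \<and> f y = p (proj_rep y) / q (proj_rep y)"
        using q homogeneous_quotient_proj_points[OF _ V(4,5)] fraction_open_subset[OF V(1)]
        unfolding A_def by blast
      with V projective_fractionsI[OF V(4,5), of proj_rep]
      show "\<exists>V p q. fraction_open A ?F V \<and> P \<in> V \<and> V \<subseteq> U \<and> (p, q) \<in> ?F \<and>
           (\<forall>y\<in>V. q y \<noteq> 0 \<and> f y = p y / q y)" by blast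
    qed
  next
    fix f assume f: "f \<in> ?R"
    have "\<exists>V d p q. openin T V \<and> P \<in> V \<and> V \<subseteq> U \<and>
                homogeneous_fn {..N} d p \<and> homogeneous_fn {..N} d q \<and>
                (\<forall>Q\<in>V. \<forall>x\<in>Q. q x \<noteq> 0 \<and> f Q = p x / q x)" if P: "P \<in> U" for P
    proof -
      obtain p q where pq: "(p, q) \<in> ?F" "q P \<noteq> 0"
        "\<And>y. y \<in> A \<Longrightarrow> q y \<noteq> 0 \<Longrightarrow> y \<in> U \<and> f y = p y / q y"
        using regular_fraction_spaceE[OF f P] by blast
      obtain d p' q' where h: "homogeneous_fn {..N} d p'" "homogeneous_fn {..N} d q'"
        "p = (\<lambda>x. p' (proj_rep x))" "q = (\<lambda>x. q' (proj_rep x))"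
        using pq(1) by (rule projective_fractionsE)
      have "\<forall>x\<in>Q. q' x \<noteq> 0 \<and> f Q = p' x / q' x" if "Q \<in> {y \<in> A. q y \<noteq> 0}" for Q
        using pq(3)[of Q] that homogeneous_quotient_proj_points[OF _ h(1,2), of Q "f Q"]
        by (simp add: h A_def)
      then show ?thesis
        using fraction_open_basic[OF pq(1), of A] P fraction_open_subset[OF regular_fraction_spaceD(1)[OF f]] h pq
        by (intro exI[of _ "{y \<in> A. q y \<noteq> 0}"] exI[of _ d] exI[of _ p'] exI[of _ q']) (auto simp: op)
    qed
    with regular_fraction_spaceD[OF f] show "f \<in> ?L" by (auto simp: op)
  qed
  then have "proj_space N = \<lparr>zariski = T, regular = regular (fraction_space A ?F)\<rparr>"
    unfolding proj_space_def Let_def A_def[symmetric] B_def[symmetric] T_def[symmetric]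
    by (simp only:)
  then show ?thesis
    by (simp add: top A_def)
qed

text \<open>\<open>Q\<close> may be infinite, because the complement is a union of principal open
  sets.\<close>

lemma closedin_fraction_space_zeros:
  assumes "fraction_family F" and "\<And>q. q \<in> Q \<Longrightarrow> (q, q) \<in> F"
  shows "closedin (zariski (fraction_space M F)) {x \<in> M. \<forall>q\<in>Q. q x = 0}"
proof -
  interpret fraction_family F by fact
  have "fraction_open M F (M - {x \<in> M. \<forall>q\<in>Q. q x = 0})"
    unfolding fraction_open_def using assms(2) by blast
  then show ?thesis by (simp add: closedin_def)
qed

lemma fraction_family_polynomial:
  assumes "fraction_family F" "polynomial_fn I r"
    and "\<And>i. i \<in> I \<Longrightarrow> \<exists>p q. (p, q) \<in> F \<and> (\<forall>x\<in>M. q x \<noteq> 0 \<and> \<phi> x i = p x / q x)"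
  shows "\<exists>p q. (p, q) \<in> F \<and> (\<forall>x\<in>M. q x \<noteq> 0 \<and> r (\<phi> x) = p x / q x)"
proof -
  interpret fraction_family F by fact
  show ?thesis
    using assms(2)
  proof induction
    case (1 c)
    show ?case using const[of c] by fastforce
  next
    case (2 i)
    then show ?case using assms(3) by simp
  next
    case (3 p q)
    then obtain a b a' b' where "(a, b) \<in> F" "\<forall>x\<in>M. b x \<noteq> 0 \<and> p (\<phi> x) = a x / b x"
      "(a', b') \<in> F" "\<forall>x\<in>M. b' x \<noteq> 0 \<and> q (\<phi> x) = a' x / b' x" by blast
    then show ?case using add[of a b a' b'] by (intro exI conjI) (assumption, simp add: add_frac_eq)
  next
    case (4 p q)
    then obtain a b a' b' where "(a, b) \<in> F" "\<forall>x\<in>M. b x \<noteq> 0 \<and> p (\<phi> x) = a x / b x"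
      "(a', b') \<in> F" "\<forall>x\<in>M. b' x \<noteq> 0 \<and> q (\<phi> x) = a' x / b' x" by blast
    then show ?case using mult[of a b a' b'] by (intro exI conjI) (assumption, simp)
  qed
qed

text \<open>For maps into affine space it is enough that the coordinates are fractions: polynomials
  in fractions are fractions, and closure under division handles a quotient of two of them.\<close>

lemma fraction_map_affine:
  assumes "fraction_family F"
    and "\<And>i. i \<in> I \<Longrightarrow> \<exists>p q. (p, q) \<in> F \<and> (\<forall>x\<in>M. q x \<noteq> 0 \<and> \<phi> x i = p x / q x)"
  shows "fraction_map \<phi> M F (affine_fractions I)"
  unfolding fraction_map_def
proof (intro allI impI)
  interpret fraction_family F by fact
  fix p' q' x assume "(p', q') \<in> affine_fractions I" and x: "x \<in> M" "q' (\<phi> x) \<noteq> 0"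
  then have "polynomial_fn I p'" "polynomial_fn I q'" by (auto simp: affine_fractions_def)
  then obtain a b a' b' where ab: "(a, b) \<in> F" "\<forall>x\<in>M. b x \<noteq> 0 \<and> p' (\<phi> x) = a x / b x"
      "(a', b') \<in> F" "\<forall>x\<in>M. b' x \<noteq> 0 \<and> q' (\<phi> x) = a' x / b' x"
    using fraction_family_polynomial[where I = I and \<phi> = \<phi> and r = p', OF assms(1) _ assms(2)]
      fraction_family_polynomial[where I = I and \<phi> = \<phi> and r = q', OF assms(1) _ assms(2)] by auto
  show "\<exists>p q. (p, q) \<in> F \<and> q x \<noteq> 0 \<and>
          (\<forall>y\<in>M. q y \<noteq> 0 \<longrightarrow> q' (\<phi> y) \<noteq> 0 \<and> p y / q y = p' (\<phi> y) / q' (\<phi> y))"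
    using divide[OF ab(1,3)] ab x by (intro exI conjI) (assumption, auto)
qed

section \<open>Sets embedded as closed subsets of projective space\<close>

text \<open>\<open>injective\<close> is injectivity of the map to projective space.
  \<open>closed\<close> says that the image is its own Zariski closure: a nonzero vector killed by
  all forms vanishing on \<open>M\<close> represents a point of \<open>M\<close>.\<close>

locale projective_embedding =
  fixes M :: "'a set" and N :: nat and y :: "'a \<Rightarrow> nat \<Rightarrow> complex"
  assumes nonzero: "K \<in> M \<Longrightarrow> \<exists>i\<le>N. y K i \<noteq> 0"
    and injective: "K \<in> M \<Longrightarrow> K' \<in> M \<Longrightarrow> c \<noteq> 0 \<Longrightarrow> (\<And>i. i \<le> N \<Longrightarrow> y K i = c * y K' i) \<Longrightarrow> K = K'"
    and closed: "\<exists>i\<le>N. v i \<noteq> 0 \<Longrightarrow>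
      (\<And>d q. homogeneous_fn {..N} d q \<Longrightarrow> (\<And>K. K \<in> M \<Longrightarrow> q (y K) = 0) \<Longrightarrow> q v = 0) \<Longrightarrow>
      \<exists>K\<in>M. \<exists>c. c \<noteq> 0 \<and> (\<forall>i\<le>N. v i = c * y K i)"
begin

abbreviation "fractions \<equiv> projective_fractions N y"

abbreviation "embedded_space \<equiv> fraction_space M fractions"

sublocale fraction_family fractions
  by (rule fraction_family_projective)

definition vanishing :: "((nat \<Rightarrow> complex) \<Rightarrow> complex) set" where
  "vanishing = {q. (\<exists>d. homogeneous_fn {..N} d q) \<and> (\<forall>K\<in>M. q (y K) = 0)}"

lemma zeros_of_vanishing:
  assumes "\<exists>i\<le>N. v i \<noteq> 0" "\<forall>q\<in>vanishing. q v = 0"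
  obtains K c where "K \<in> M" "c \<noteq> 0" "\<And>i. i \<le> N \<Longrightarrow> v i = c * y K i"
proof -
  have "q v = 0" if "homogeneous_fn {..N} d q" "\<And>K. K \<in> M \<Longrightarrow> q (y K) = 0" for d q
    using assms(2) that unfolding vanishing_def by blast
  then show ?thesis using closed[OF assms(1)] that by blast
qed

lemma inj_proj_point: "inj_on (\<lambda>K. proj_point N (y K)) M"
proof (rule inj_onI)
  fix K K' assume K: "K \<in> M" "K' \<in> M" "proj_point N (y K) = proj_point N (y K')"
  have "(\<lambda>i\<in>{..N}. 1 * y K i) \<in> proj_point N (y K)"
    unfolding proj_point_def by (rule CollectI, rule exI[of _ 1]) simp
  then obtain c where c: "c \<noteq> 0" "(\<lambda>i\<in>{..N}. 1 * y K i) = (\<lambda>i\<in>{..N}. c * y K' i)"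
    using proj_point_memE[of _ N "y K'"] K by metis
  have "y K i = c * y K' i" if "i \<le> N" for i
    using fun_cong[OF c(2), of i] that by simp
  then show "K = K'" using injective K c by blast
qed

lemma proj_point_image:
  "(\<lambda>K. proj_point N (y K)) ` M = {P \<in> proj_points N. \<forall>q\<in>vanishing. q (proj_rep P) = 0}"
proof (intro equalityI subsetI)
  fix P assume "P \<in> (\<lambda>K. proj_point N (y K)) ` M"
  then obtain K where K: "K \<in> M" "P = proj_point N (y K)" by blast
  obtain c where c: "c \<noteq> 0" "\<And>i. i \<le> N \<Longrightarrow> proj_rep P i = c * y K i"
    using proj_rep_proj_point[OF nonzero[OF K(1)]] K(2) by blast
  have "q (proj_rep P) = 0" if q: "q \<in> vanishing" for q
  proof -
    obtain d where d: "homogeneous_fn {..N} d q" using q by (auto simp: vanishing_def)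
    have "q (proj_rep P) = c ^ d * q (y K)"
      by (rule homogeneous_fn_scale[OF d]) (use c in auto)
    then show ?thesis using q K by (simp add: vanishing_def)
  qed
  then show "P \<in> {P \<in> proj_points N. \<forall>q\<in>vanishing. q (proj_rep P) = 0}"
    using proj_point_in_proj_points[OF nonzero[OF K(1)]] K by simp
next
  fix P assume P: "P \<in> {P \<in> proj_points N. \<forall>q\<in>vanishing. q (proj_rep P) = 0}"
  then obtain x where x: "x \<in> {..N} \<rightarrow>\<^sub>E UNIV" "\<exists>i\<le>N. x i \<noteq> 0" "P = proj_point N x"
    using proj_pointsE[of P N] by blast
  obtain c where c: "c \<noteq> 0" "\<And>i. i \<le> N \<Longrightarrow> proj_rep P i = c * x i"
    using proj_rep_proj_point[OF x(2)] x(3) by blast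
  have "\<exists>i\<le>N. proj_rep P i \<noteq> 0" using x(2) c by auto
  then obtain K c' where K: "K \<in> M" "c' \<noteq> 0" "\<And>i. i \<le> N \<Longrightarrow> proj_rep P i = c' * y K i"
    using zeros_of_vanishing[of "proj_rep P"] P by blast
  have xi: "x i = (c' / c) * y K i" if "i \<le> N" for i
    using c K(3)[OF that] that by (simp add: field_simps)
  have "proj_point N x = proj_point N (y K)"
    unfolding proj_point_def
  proof (intro equalityI subsetI; clarify)
    fix a :: complex assume "a \<noteq> 0"
    then show "\<exists>b. (\<lambda>i\<in>{..N}. a * x i) = (\<lambda>i\<in>{..N}. b * y K i) \<and> b \<noteq> 0"
      using xi c K by (intro exI[of _ "a * (c' / c)"]) (auto intro!: restrict_ext)
    show "\<exists>b. (\<lambda>i\<in>{..N}. a * y K i) = (\<lambda>i\<in>{..N}. b * x i) \<and> b \<noteq> 0"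
      using xi c K \<open>a \<noteq> 0\<close> by (intro exI[of _ "a * (c / c')"]) (auto intro!: restrict_ext)
  qed
  then show "P \<in> (\<lambda>K. proj_point N (y K)) ` M" using K x by blast
qed

lemma closed_immersion_proj_space:
  "closed_immersion (\<lambda>K. proj_point N (y K)) embedded_space (proj_space N)"
  unfolding proj_space_eq
proof (rule closed_immersion_fraction_space[OF fraction_family_projective fraction_family_projective inj_proj_point])
  show "closedin (zariski (fraction_space (proj_points N) (projective_fractions N proj_rep)))
     ((\<lambda>K. proj_point N (y K)) ` M)"
  proof -
    have eq: "{P \<in> proj_points N. \<forall>q\<in>vanishing. q (proj_rep P) = 0}
      = {P \<in> proj_points N. \<forall>q\<in>(\<lambda>q P. q (proj_rep P)) ` vanishing. q P = 0}" by simp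
    show ?thesis
      unfolding proj_point_image eq
      by (rule closedin_fraction_space_zeros[OF fraction_family_projective])
        (auto simp: vanishing_def intro: projective_fractionsI)
  qed
  \<comment> \<open>\<open>proj_rep\<close> may pick a multiple of \<open>y K\<close>; a form of
    degree \<open>d\<close> changes by \<open>c ^ d\<close>, which cancels in quotients of equal
    degree.\<close>
  have quot: "q (proj_rep (proj_point N (y K))) \<noteq> 0 \<longleftrightarrow> q (y K) \<noteq> 0"
    "p (proj_rep (proj_point N (y K))) / q (proj_rep (proj_point N (y K))) = p (y K) / q (y K)"
    if pq: "homogeneous_fn {..N} d p" "homogeneous_fn {..N} d q" and "K \<in> M" for d p q K
  proof -
    obtain c where c: "c \<noteq> 0" "\<And>i. i \<le> N \<Longrightarrow> proj_rep (proj_point N (y K)) i = c * y K i"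
      using proj_rep_proj_point[OF nonzero[OF \<open>K \<in> M\<close>]] by blast
    have "p (proj_rep (proj_point N (y K))) = c ^ d * p (y K)"
      "q (proj_rep (proj_point N (y K))) = c ^ d * q (y K)"
      by (rule homogeneous_fn_scale[OF pq(1)] homogeneous_fn_scale[OF pq(2)]; use c in auto)+
    with c show "q (proj_rep (proj_point N (y K))) \<noteq> 0 \<longleftrightarrow> q (y K) \<noteq> 0"
      "p (proj_rep (proj_point N (y K))) / q (proj_rep (proj_point N (y K))) = p (y K) / q (y K)"
      by simp_all
  qed
  show "fraction_map (\<lambda>K. proj_point N (y K)) M fractions (projective_fractions N proj_rep)"
    unfolding fraction_map_def
  proof (intro allI impI)
    fix p' q' K
    assume "(p', q') \<in> projective_fractions N proj_rep" and K: "K \<in> M" "q' (proj_point N (y K)) \<noteq> 0"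
    then obtain d p q where pq: "homogeneous_fn {..N} d p" "homogeneous_fn {..N} d q"
      "p' = (\<lambda>x. p (proj_rep x))" "q' = (\<lambda>x. q (proj_rep x))"
      by (auto elim: projective_fractionsE)
    show "\<exists>p q. (p, q) \<in> fractions \<and> q K \<noteq> 0 \<and> (\<forall>K\<in>M. q K \<noteq> 0 \<longrightarrow> q' (proj_point N (y K)) \<noteq> 0 \<and>
      p K / q K = p' (proj_point N (y K)) / q' (proj_point N (y K)))"
      by (intro exI conjI, rule projective_fractionsI[OF pq(1,2)])
        (use K in \<open>simp_all add: pq(3,4) quot[OF pq(1,2)]\<close>)
  qed
  fix p' q' K
  assume "(p', q') \<in> fractions" and K: "K \<in> M" "q' K \<noteq> 0"
  then obtain d p q where pq: "homogeneous_fn {..N} d p" "homogeneous_fn {..N} d q"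
    "p' = (\<lambda>x. p (y x))" "q' = (\<lambda>x. q (y x))"
    by (auto elim: projective_fractionsE)
  show "\<exists>p q. (p, q) \<in> projective_fractions N proj_rep \<and> q (proj_point N (y K)) \<noteq> 0 \<and>
    (\<forall>K\<in>M. q (proj_point N (y K)) \<noteq> 0 \<longrightarrow> q' K \<noteq> 0 \<and>
      p (proj_point N (y K)) / q (proj_point N (y K)) = p' K / q' K)"
    by (intro exI conjI, rule projective_fractionsI[OF pq(1,2)])
      (use K in \<open>simp_all add: pq(3,4) quot[OF pq(1,2)]\<close>)
qed

lemma coordinate_fraction:
  assumes "i \<le> N" "k \<le> N"
  shows "(\<lambda>K. y K i, \<lambda>K. y K k) \<in> fractions"
  using projective_fractionsI[OF homogeneous_fn.intros(2)[of i "{..N}"] homogeneous_fn.intros(2)[of k "{..N}"]] assms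
  by simp

section \<open>The standard affine cover\<close>

definition standard_open :: "nat \<Rightarrow> 'a set" where
  "standard_open k = {K \<in> M. y K k \<noteq> 0}"

text \<open>The coordinate number \<open>k\<close>, which is constantly 1, is kept. The image then
  lies in an affine space with \<open>Suc N\<close> coordinates and satisfies
  \<open>u k = 1\<close>, and forms can be evaluated on it without dehomogenizing.\<close>

definition affine_coords :: "nat \<Rightarrow> 'a \<Rightarrow> nat \<Rightarrow> complex" where
  "affine_coords k K = (\<lambda>i\<in>{..<Suc N}. y K i / y K k)"

lemma affine_coords_image:
  assumes k: "k \<le> N"
  shows "affine_coords k ` standard_open k =
    {u \<in> {..<Suc N} \<rightarrow>\<^sub>E UNIV. \<forall>q \<in> insert (\<lambda>u. u k - 1) vanishing. q u = 0}"
proof (intro equalityI subsetI)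
  fix u assume "u \<in> affine_coords k ` standard_open k"
  then obtain K where K: "K \<in> M" "y K k \<noteq> 0" "u = affine_coords k K"
    by (auto simp: standard_open_def)
  have "q u = 0" if q: "q \<in> vanishing" for q
  proof -
    obtain d where d: "homogeneous_fn {..N} d q" using q by (auto simp: vanishing_def)
    have "q u = (1 / y K k) ^ d * q (y K)"
      by (rule homogeneous_fn_scale[OF d]) (auto simp: K affine_coords_def)
    then show ?thesis using q K by (simp add: vanishing_def)
  qed
  then show "u \<in> {u \<in> {..<Suc N} \<rightarrow>\<^sub>E UNIV. \<forall>q \<in> insert (\<lambda>u. u k - 1) vanishing. q u = 0}"
    using K k by (auto simp: affine_coords_def)
next
  fix u assume u: "u \<in> {u \<in> {..<Suc N} \<rightarrow>\<^sub>E UNIV. \<forall>q \<in> insert (\<lambda>u. u k - 1) vanishing. q u = 0}"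
  then have "u k = 1" by simp
  then have "\<exists>i\<le>N. u i \<noteq> 0" using k by (intro exI[of _ k]) auto
  then obtain K c where K: "K \<in> M" "c \<noteq> 0" "\<And>i. i \<le> N \<Longrightarrow> u i = c * y K i"
    using zeros_of_vanishing[of u] u by blast
  have yk: "c * y K k = 1" using K(3)[OF k] \<open>u k = 1\<close> by simp
  then have "y K k \<noteq> 0" by auto
  moreover have "u = affine_coords k K"
  proof (rule extensionalityI[of _ "{..<Suc N}"])
    fix i assume "i \<in> {..<Suc N}"
    then have i: "i \<le> N" by simp
    have "u i * y K k = y K i" using K(3)[OF i] yk by (metis mult.assoc mult.commute mult_1)
    then show "u i = affine_coords k K i"
      using i \<open>y K k \<noteq> 0\<close> by (simp add: affine_coords_def field_simps)
  qed (use u in \<open>auto simp: affine_coords_def PiE_def\<close>)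
  ultimately show "u \<in> affine_coords k ` standard_open k"
    using K by (auto simp: standard_open_def)
qed

lemma affine_standard_open:
  assumes k: "k \<le> N"
  shows "affine_variety (fraction_space (standard_open k) fractions)"
  unfolding affine_variety_def
proof (intro exI)
  show "closed_immersion (affine_coords k) (fraction_space (standard_open k) fractions) (affine_space {..<Suc N})"
    unfolding affine_space_eq
  proof (rule closed_immersion_fraction_space[OF fraction_family_projective fraction_family_affine])
    show "inj_on (affine_coords k) (standard_open k)"
    proof (rule inj_onI)
      fix K K' assume K: "K \<in> standard_open k" "K' \<in> standard_open k" "affine_coords k K = affine_coords k K'"
      have "y K i = (y K k / y K' k) * y K' i" if "i \<le> N" for i
        using fun_cong[OF K(3), of i] that K by (simp add: affine_coords_def standard_open_def field_simps)
      then show "K = K'"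
        using injective[of K K' "y K k / y K' k"] K by (simp add: standard_open_def)
    qed
    have "polynomial_fn {..<Suc N} q" if "q \<in> insert (\<lambda>u. u k - 1) vanishing" for q
      using that k homogeneous_fn_imp_polynomial_fn unfolding vanishing_def lessThan_Suc_atMost
      by (fastforce intro: polynomial_fn_diff polynomial_fn.intros)
    then show "closedin (zariski (fraction_space ({..<Suc N} \<rightarrow>\<^sub>E UNIV) (affine_fractions {..<Suc N})))
     (affine_coords k ` standard_open k)"
      unfolding affine_coords_image[OF k]
      by (intro closedin_fraction_space_zeros fraction_family_affine) (auto simp: affine_fractions_def)
    show "fraction_map (affine_coords k) (standard_open k) fractions (affine_fractions {..<Suc N})"
    proof (rule fraction_map_affine[OF fraction_family_projective])
      fix i assume "i \<in> {..<Suc N}"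
      then show "\<exists>p q. (p, q) \<in> fractions \<and> (\<forall>x\<in>standard_open k. q x \<noteq> 0 \<and> affine_coords k x i = p x / q x)"
        using coordinate_fraction[of i k] k
        by (intro exI conjI) (assumption | auto simp: standard_open_def affine_coords_def)+
    qed
    fix p' q' K
    assume "(p', q') \<in> fractions" and K: "K \<in> standard_open k" "q' K \<noteq> 0"
    then obtain d p q where pq: "homogeneous_fn {..N} d p" "homogeneous_fn {..N} d q"
      "p' = (\<lambda>x. p (y x))" "q' = (\<lambda>x. q (y x))"
      by (auto elim: projective_fractionsE)
    have sc: "r (affine_coords k K) = (1 / y K k) ^ d * r (y K)" if "homogeneous_fn {..N} d r" for r K
      by (rule homogeneous_fn_scale[OF that]) (auto simp: affine_coords_def)
    have "(p, q) \<in> affine_fractions {..<Suc N}"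
      using homogeneous_fn_imp_polynomial_fn[OF pq(1)] homogeneous_fn_imp_polynomial_fn[OF pq(2)]
      by (simp add: affine_fractions_def lessThan_Suc_atMost)
    then show "\<exists>p q. (p, q) \<in> affine_fractions {..<Suc N} \<and> q (affine_coords k K) \<noteq> 0 \<and>
      (\<forall>K\<in>standard_open k. q (affine_coords k K) \<noteq> 0 \<longrightarrow> q' K \<noteq> 0 \<and>
        p (affine_coords k K) / q (affine_coords k K) = p' K / q' K)"
      using K by (intro exI conjI) (assumption, auto simp: sc[OF pq(1)] sc[OF pq(2)] pq(3,4) standard_open_def)
  qed
qed

text \<open>Distinct points of projective space are separated by a nonzero 2 by 2 minor of their
  coordinate vectors. Divided by coordinates that do not vanish near the points, the minor is a sum
  of two products of regular functions, and it vanishes on the diagonal.\<close>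

lemma diagonal_closed:
  "closedin (zariski_product embedded_space embedded_space) {(x, x) | x. x \<in> M}"
proof -
  let ?B = "{{(x, y). x \<in> U \<and> y \<in> V \<and> (\<Sum>k<m. f k x * g k y) \<noteq> 0} | U V (m::nat) f g.
        openin (zariski embedded_space) U \<and> openin (zariski embedded_space) V \<and>
        (\<forall>k<m. f k \<in> regular embedded_space U \<and> g k \<in> regular embedded_space V)}"
  have basic: "{(x, y). x \<in> U \<and> y \<in> V \<and> f0 x * g0 y + f1 x * g1 y \<noteq> 0} \<in> ?B"
    if "fraction_open M fractions U" "fraction_open M fractions V"
      "f0 \<in> regular embedded_space U" "g0 \<in> regular embedded_space V"
      "f1 \<in> regular embedded_space U" "g1 \<in> regular embedded_space V" for U V f0 f1 g0 g1
    using that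
    by (intro CollectI exI[of _ U] exI[of _ V] exI[of _ 2] exI[of _ "\<lambda>k::nat. if k = 0 then f0 else f1"]
        exI[of _ "\<lambda>k::nat. if k = 0 then g0 else g1"]) (simp add: numeral_2_eq_2)
  let ?T = "zariski_product embedded_space embedded_space"
  have sub: "topspace ?T \<subseteq> M \<times> M"
    unfolding zariski_product_def topology_generated_by_topspace
    by (auto dest!: fraction_open_subset)
  have one: "(\<lambda>x\<in>M. c) \<in> regular embedded_space M" for c
    using regular_quotient[OF fraction_open_space const[where c = c]] by simp
  \<comment> \<open>The constant 1, written as a sum of two products, shows that \<open>?T\<close>
    has all of \<open>M \<times> M\<close> as its underlying set.\<close>
  define S where "S = {(x, y). x \<in> M \<and> y \<in> M \<and>
    (\<lambda>x\<in>M. 1) x * (\<lambda>x\<in>M. 1) y + (\<lambda>x\<in>M. 0) x * (\<lambda>x\<in>M. 0) y \<noteq> (0::complex)}"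
  have "S \<in> ?B"
    unfolding S_def by (rule basic) (rule one fraction_open_space)+
  then have "S \<subseteq> topspace ?T"
    unfolding zariski_product_def topology_generated_by_topspace by (rule Union_upper)
  then have "M \<times> M \<subseteq> topspace ?T" by (auto simp: S_def)
  with sub have top: "topspace ?T = M \<times> M" by blast
  have "openin ?T (M \<times> M - {(x, x) | x. x \<in> M})"
  proof (subst openin_subopen, intro ballI)
    fix w assume "w \<in> M \<times> M - {(x, x) | x. x \<in> M}"
    then obtain K L where w: "w = (K, L)" "K \<in> M" "L \<in> M" "K \<noteq> L" by auto
    obtain k l where kl: "k \<le> N" "y K k \<noteq> 0" "l \<le> N" "y L l \<noteq> 0" using nonzero w by blast
    \<comment> \<open>If all minors with column \<open>l\<close> vanished, the two vectors would be
      proportional with factor \<open>y K l / y L l\<close>.\<close>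
    have "\<exists>i\<le>N. y K i * y L l \<noteq> y L i * y K l"
    proof (rule ccontr)
      assume "\<not> (\<exists>i\<le>N. y K i * y L l \<noteq> y L i * y K l)"
      then have *: "y K i * y L l = y L i * y K l" if "i \<le> N" for i using that by blast
      then have "y K l \<noteq> 0" using kl(1,2,4) by (metis mult_eq_0_iff)
      then show False
        using injective[of K L "y K l / y L l"] w * kl(4) by (simp add: field_simps)
    qed
    then obtain i where i: "i \<le> N" "y K i * y L l \<noteq> y L i * y K l" by blast
    let ?U = "standard_open k" and ?V = "standard_open l"
    have op: "fraction_open M fractions (standard_open j)" if "j \<le> N" for j
      using fraction_open_basic[OF coordinate_fraction[OF that that]] by (simp add: standard_open_def)
    have reg: "(\<lambda>x\<in>standard_open j. y x i / y x j) \<in> regular embedded_space (standard_open j)"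
      "(\<lambda>x\<in>standard_open j. - (y x i) / y x j) \<in> regular embedded_space (standard_open j)"
      if "i \<le> N" "j \<le> N" for i j
    proof -
      show "(\<lambda>x\<in>standard_open j. y x i / y x j) \<in> regular embedded_space (standard_open j)"
        by (rule regular_quotient[OF op[OF that(2)] coordinate_fraction[OF that]]) (simp add: standard_open_def)
      have "(\<lambda>K. - (y K i), \<lambda>K. y K j) \<in> fractions"
        using mult[OF const[where c = "-1"] coordinate_fraction[OF that]] by simp
      then show "(\<lambda>x\<in>standard_open j. - (y x i) / y x j) \<in> regular embedded_space (standard_open j)"
        by (rule regular_quotient[OF op[OF that(2)]]) (simp add: standard_open_def)
    qed
    \<comment> \<open>The sum is \<open>(x_i z_l - x_l z_i) / (x_k z_l)\<close>; the quotient
      \<open>y z l / y z l\<close> only gives the first summand the form of a product.\<close>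
    define W where "W = {(x, z). x \<in> ?U \<and> z \<in> ?V \<and>
        (\<lambda>x\<in>?U. y x i / y x k) x * (\<lambda>x\<in>?V. y x l / y x l) z
      + (\<lambda>x\<in>?U. y x l / y x k) x * (\<lambda>x\<in>?V. - (y x i) / y x l) z \<noteq> 0}"
    have "W \<in> ?B"
      unfolding W_def by (rule basic; intro op reg kl i)
    then have "openin ?T W"
      unfolding zariski_product_def by (rule topology_generated_by_Basis)
    moreover have "w \<in> W"
      using i kl w by (auto simp: W_def standard_open_def field_simps)
    moreover have "W \<subseteq> M \<times> M - {(x, x) | x. x \<in> M}"
      by (auto simp: W_def standard_open_def field_simps)
    ultimately show "\<exists>W. openin ?T W \<and> w \<in> W \<and> W \<subseteq> M \<times> M - {(x, x) | x. x \<in> M}" by blast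
  qed
  then show ?thesis
    unfolding closedin_def top by auto
qed

theorem projective_variety_embedded_space: "projective_variety embedded_space"
proof -
  have "variety embedded_space"
    unfolding variety_def
  proof (intro conjI exI)
    show "space_with_functions embedded_space" by (rule space_with_functions_fraction_space)
    show "finite (standard_open ` {..N})" by simp
    show "\<Union>(standard_open ` {..N}) = points embedded_space"
      using nonzero by (auto simp: standard_open_def)
    show "\<forall>U\<in>standard_open ` {..N}. openin (zariski embedded_space) U \<and> affine_variety (induced_space embedded_space U)"
    proof clarify
      fix k assume k: "k \<le> N"
      have "standard_open k \<subseteq> M" by (auto simp: standard_open_def)
      then show "openin (zariski embedded_space) (standard_open k) \<and> affine_variety (induced_space embedded_space (standard_open k))"
        using affine_standard_open[OF k] fraction_open_basic[OF coordinate_fraction[OF k k]]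
        by (simp add: induced_fraction_space standard_open_def)
    qed
    show "closedin (zariski_product embedded_space embedded_space) {(x, x) |x. x \<in> points embedded_space}"
      using diagonal_closed by simp
  qed
  then show ?thesis
    using closed_immersion_proj_space unfolding projective_variety_def by blast
qed

end

section \<open>Structures determined by charts\<close>

lemma regular_induced_space:
  "regular (induced_space X U) W \<subseteq> extensional W"
  "regular (induced_space X U) W \<noteq> {} \<Longrightarrow> openin (zariski (induced_space X U)) W"
  by (auto simp: induced_space_def split: if_splits)

lemma topspace_induced_space [simp]:
  "topspace (zariski (induced_space X U)) = points X \<inter> U"
  by (simp add: induced_space_def)

text \<open>Open sets and functions travel from \<open>A\<close> to \<open>B\<close> by the inverse
  of \<open>\<psi>\<close> and on to \<open>A'\<close> by \<open>\<psi>\<close>; as the point sets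
  agree, the round trip changes neither.\<close>

lemma fun_isomorphism_le:
  assumes \<psi>: "fun_isomorphism \<psi> A B" "fun_isomorphism \<psi> A' B" and pts: "points A = points A'"
    and W: "openin (zariski A) W"
  shows "openin (zariski A') W" "f \<in> regular A W \<Longrightarrow> f \<in> extensional W \<Longrightarrow> f \<in> regular A' W"
proof -
  let ?i = "inv_into (points A) \<psi>"
  have inv: "?i (\<psi> x) = x" "\<psi> x \<in> points B" if "x \<in> points A" for x
    using \<psi>(1) that by (auto simp: fun_isomorphism_def bij_betw_def)
  have i: "fun_morphism ?i B A" and m: "fun_morphism \<psi> A' B"
    using \<psi> by (auto simp: fun_isomorphism_def)
  define V where "V = {b \<in> points B. ?i b \<in> W}"
  have V: "openin (zariski B) V"
    using i W unfolding V_def fun_morphism_def continuous_map_def by blast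
  have VW: "{x \<in> points A'. \<psi> x \<in> V} = W"
    using inv openin_subset[OF W] by (auto simp: V_def simp flip: pts)
  have "openin (zariski A') {x \<in> points A'. \<psi> x \<in> V}"
    using m V unfolding fun_morphism_def continuous_map_def by blast
  then show "openin (zariski A') W" by (simp only: VW)
  assume f: "f \<in> regular A W" "f \<in> extensional W"
  have "(\<lambda>b\<in>V. f (?i b)) \<in> regular B V"
    using i W f unfolding fun_morphism_def V_def by blast
  then have "(\<lambda>x\<in>{x \<in> points A'. \<psi> x \<in> V}. (\<lambda>b\<in>V. f (?i b)) (\<psi> x)) \<in> regular A' {x \<in> points A'. \<psi> x \<in> V}"
    using m V unfolding fun_morphism_def by blast
  moreover have "(\<lambda>x\<in>{x \<in> points A'. \<psi> x \<in> V}. (\<lambda>b\<in>V. f (?i b)) (\<psi> x)) = f"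
  proof (rule extensionalityI[of _ W])
    fix x assume x: "x \<in> W"
    then have "x \<in> points A" using openin_subset[OF W] by blast
    moreover have "x \<in> {x \<in> points A'. \<psi> x \<in> V}" using x VW by simp
    ultimately show "(\<lambda>x\<in>{x \<in> points A'. \<psi> x \<in> V}. (\<lambda>b\<in>V. f (?i b)) (\<psi> x)) x = f x"
      by (simp add: inv)
  qed (use f in \<open>auto simp: VW\<close>)
  ultimately show "f \<in> regular A' W" by (simp only: VW)
qed

text \<open>The target determines the closed image with its induced structure, hence the structure
  on the source. This is how the charts pin down the variety structure.\<close>

lemma closed_immersion_unique:
  assumes "closed_immersion \<psi> (induced_space X U) Z" "closed_immersion \<psi> (induced_space Y U) Z"
    and pts: "points X = points Y"
  shows "induced_space X U = induced_space Y U"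
proof -
  have "points (induced_space X U) = points (induced_space Y U)" using pts by simp
  then obtain B where B: "fun_isomorphism \<psi> (induced_space X U) B" "fun_isomorphism \<psi> (induced_space Y U) B"
    using assms unfolding closed_immersion_def by metis
  have *: "openin (zariski (induced_space X U)) W \<longleftrightarrow> openin (zariski (induced_space Y U)) W" for W
    using fun_isomorphism_le(1)[OF B] fun_isomorphism_le(1)[OF B(2,1)] pts by auto
  have "regular (induced_space X U) W = regular (induced_space Y U) W" for W
    using fun_isomorphism_le(2)[OF B] fun_isomorphism_le(2)[OF B(2,1)] pts regular_induced_space(1)[of _ U W]
      regular_induced_space(2)[of _ U W]
    by (intro equalityI subsetI) (metis empty_iff subsetD topspace_induced_space)+
  with * show ?thesis by (intro fun_space.equality) (auto simp: topology_eq)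
qed

text \<open>One half of the principle that structures agreeing on an open cover agree; the other
  half follows by exchanging \<open>X\<close> and \<open>Y\<close>. Open sets glue as unions,
  functions by the sheaf condition in \<open>Y\<close>.\<close>

lemma fun_space_glue_le:
  assumes X: "space_with_functions X" and Y: "space_with_functions Y" and pts: "points X = points Y"
    and cover: "points X \<subseteq> \<Union>\<U>"
    and op: "\<And>U. U \<in> \<U> \<Longrightarrow> openin (zariski X) U \<and> openin (zariski Y) U"
    and eq: "\<And>U. U \<in> \<U> \<Longrightarrow> induced_space X U = induced_space Y U"
    and W: "openin (zariski X) W"
  shows "openin (zariski Y) W" "f \<in> regular X W \<Longrightarrow> f \<in> regular Y W"
proof -
  have top: "openin (zariski Y) (V \<inter> U)" if V: "openin (zariski X) V" and U: "U \<in> \<U>" for V U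
  proof -
    have "openin (zariski (induced_space X U)) (V \<inter> U)"
      using V by (auto simp: induced_space_def openin_subtopology)
    then have "openin (zariski (induced_space Y U)) (V \<inter> U)" using eq[OF U] by simp
    then obtain S where "openin (zariski Y) S" "V \<inter> U = S \<inter> U"
      by (auto simp: induced_space_def openin_subtopology)
    then show ?thesis using op[OF U] openin_Int by metis
  qed
  have WU: "W = \<Union>((\<inter>) W ` \<U>)" using cover openin_subset[OF W] by auto
  have "openin (zariski Y) (\<Union>((\<inter>) W ` \<U>))" using top[OF W] by blast
  then show opY: "openin (zariski Y) W" using WU by simp
  assume f: "f \<in> regular X W"
  have ext: "f \<in> extensional W" using X W f by (auto simp: space_with_functions_def)
  have "\<exists>V. openin (zariski Y) V \<and> x \<in> V \<and> V \<subseteq> W \<and> restrict f V \<in> regular Y V" if x: "x \<in> W" for x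
  proof -
    obtain U where U: "U \<in> \<U>" "x \<in> U" using cover openin_subset[OF W] x by blast
    define V where "V = W \<inter> U"
    have VX: "openin (zariski X) V" "V \<subseteq> W" using W op[OF U(1)] by (auto simp: V_def)
    then have fV: "restrict f V \<in> regular X V"
      using X[unfolded space_with_functions_def, THEN conjunct2, rule_format, OF W] f by blast
    have subV: "openin (subtopology (zariski X) U) V"
      using W by (auto simp: V_def openin_subtopology)
    have "restrict f V \<in> regular (induced_space X U) V"
      using fV VX subV by (fastforce simp: induced_space_def)
    then have "restrict f V \<in> regular (induced_space Y U) V" using eq[OF U(1)] by simp
    then have "\<forall>x\<in>V. \<exists>S g. openin (zariski Y) S \<and> x \<in> S \<and> S \<inter> U \<subseteq> V \<and>
          g \<in> regular Y S \<and> (\<forall>y \<in> S \<inter> U. restrict f V y = g y)"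
      by (simp add: induced_space_def split: if_splits) meson
    moreover have "x \<in> V" using x U by (simp add: V_def)
    ultimately obtain S g where S: "openin (zariski Y) S" "x \<in> S" "S \<inter> U \<subseteq> V"
          "g \<in> regular Y S" "\<forall>y \<in> S \<inter> U. restrict f V y = g y"
      by blast
    have SU: "openin (zariski Y) (S \<inter> U)" using S op[OF U(1)] by auto
    then have "restrict g (S \<inter> U) \<in> regular Y (S \<inter> U)"
      using Y[unfolded space_with_functions_def, THEN conjunct2, rule_format, OF S(1)] S(4) by blast
    moreover have "restrict g (S \<inter> U) = restrict f (S \<inter> U)"
      using S by (intro restrict_ext) (metis restrict_apply subsetD)
    ultimately show ?thesis using SU S U VX by (intro exI[of _ "S \<inter> U"]) auto
  qed
  moreover have "\<forall>f\<in>extensional W.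
      (\<forall>x\<in>W. \<exists>V. openin (zariski Y) V \<and> x \<in> V \<and> V \<subseteq> W \<and> restrict f V \<in> regular Y V)
        \<longrightarrow> f \<in> regular Y W"
    using Y[unfolded space_with_functions_def, THEN conjunct2, THEN spec, THEN mp, OF opY] by argo
  ultimately show "f \<in> regular Y W"
    using ext by simp
qed

lemma fun_space_glue:
  assumes X: "space_with_functions X" and Y: "space_with_functions Y" and pts: "points X = points Y"
    and cover: "points X \<subseteq> \<Union>\<U>"
    and op: "\<And>U. U \<in> \<U> \<Longrightarrow> openin (zariski X) U \<and> openin (zariski Y) U"
    and eq: "\<And>U. U \<in> \<U> \<Longrightarrow> induced_space X U = induced_space Y U"
  shows "X = (Y :: 'a fun_space)"
proof -
  note * = fun_space_glue_le[OF X Y pts cover op eq] fun_space_glue_le[OF Y X pts[symmetric] cover[unfolded pts] _ eq[symmetric]]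
  have o: "openin (zariski X) W \<longleftrightarrow> openin (zariski Y) W" for W
    using *(1,3) op by blast
  have "regular X W = regular Y W" for W
  proof (cases "openin (zariski X) W")
    case True
    then show ?thesis using *(2,4) op o by blast
  next
    case False
    then show ?thesis using X Y o unfolding space_with_functions_def by metis
  qed
  with o show ?thesis by (intro fun_space.equality) (auto simp: topology_eq)
qed

section \<open>Level data and their leading parts\<close>

text \<open>
  The label \<open>(0, 0)\<close> is not a pair of marks: it stands for the constant \<open>1\<close>, which lives on the
  terminal level because the differentials are not rescaled there.
\<close>

definition labels :: "nat \<Rightarrow> (nat \<times> nat) set" where
  "labels n = insert (0, 0) ({1..n} \<times> {1..n})"

definition label_sets :: "nat \<Rightarrow> (nat \<times> nat) set set" where
  "label_sets n = {S. S \<subseteq> labels n \<and> (0, 0) \<in> S}"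

definition level_part :: "('l \<Rightarrow> nat) \<Rightarrow> ('l \<Rightarrow> complex) \<Rightarrow> nat \<Rightarrow> 'l \<Rightarrow> complex" where
  "level_part lev I m a = (if lev a = m then I a else 0)"

text \<open>If the periods of each level become infinitely large compared with those of the levels
  above it, this vector is the limit in projective space of the periods labelled by
  \<open>S\<close>: only the lowest level survives.\<close>

definition leading_part :: "('l \<Rightarrow> nat) \<Rightarrow> ('l \<Rightarrow> complex) \<Rightarrow> 'l set \<Rightarrow> 'l \<Rightarrow> complex" where
  "leading_part lev I S a = level_part lev I (Min (lev ` S)) a"

text \<open>Periods below the terminal level join different nodes of a component and cannot vanish,
  while on the terminal level marks may coincide. Additivity is required only on the lowest of the
  three levels, since periods of different levels have unrelated scales.\<close>

definition level_data :: "nat \<Rightarrow> (nat \<times> nat \<Rightarrow> nat) \<Rightarrow> (nat \<times> nat \<Rightarrow> complex) \<Rightarrow> bool" where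
  "level_data n lev I \<longleftrightarrow>
     lev ` labels n = {..lev (0, 0)} \<and> I (0, 0) = 1 \<and>
     (\<forall>a\<in>labels n. lev a < lev (0, 0) \<longrightarrow> I a \<noteq> 0) \<and>
     (\<forall>i\<in>{1..n}. \<forall>j\<in>{1..n}. \<forall>k\<in>{1..n}. \<forall>m. m = min (lev (i, j)) (min (lev (j, k)) (lev (i, k))) \<longrightarrow>
        level_part lev I m (i, j) + level_part lev I m (j, k) = level_part lev I m (i, k))"

text \<open>The factor on the terminal level is 1, as for a complex projective isomorphism; this
  also preserves the value 1 of the extra label.\<close>

definition rescaled_data ::
    "nat \<Rightarrow> (nat \<times> nat \<Rightarrow> nat) \<Rightarrow> (nat \<times> nat \<Rightarrow> complex) \<Rightarrow>
      (nat \<times> nat \<Rightarrow> nat) \<Rightarrow> (nat \<times> nat \<Rightarrow> complex) \<Rightarrow> bool" where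
  "rescaled_data n lev I lev' I' \<longleftrightarrow>
     (\<exists>c. c (lev (0, 0)) = 1 \<and> (\<forall>m. c m \<noteq> 0) \<and>
       (\<forall>a\<in>labels n. lev' a = lev a \<and> I' a = c (lev a) * I a))"

text \<open>For families of nonzero vectors this is equality of two points of the product of the
  projective spaces with coordinate sets \<open>A S\<close>.\<close>

definition scaled_family :: "'k set \<Rightarrow> ('k \<Rightarrow> 'l set) \<Rightarrow> ('k \<Rightarrow> 'l \<Rightarrow> complex) \<Rightarrow> ('k \<Rightarrow> 'l \<Rightarrow> complex) \<Rightarrow> bool" where
  "scaled_family \<K> A w w' \<longleftrightarrow> (\<exists>c. \<forall>S\<in>\<K>. c S \<noteq> 0 \<and> (\<forall>a\<in>A S. w S a = c S * w' S a))"

text \<open>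
  These are the defining equations of the closure of the space of differences
  \<open>x\<^sub>j - x\<^sub>i\<close> in the product of the projective spaces with homogeneous coordinates \<open>S\<close>.
\<close>

definition compatible_family :: "nat \<Rightarrow> ((nat \<times> nat) set \<Rightarrow> nat \<times> nat \<Rightarrow> complex) \<Rightarrow> bool" where
  "compatible_family n w \<longleftrightarrow>
     (\<forall>S\<in>label_sets n. \<exists>a\<in>S. w S a \<noteq> 0) \<and>
     (\<forall>S\<in>label_sets n. \<forall>T\<in>label_sets n. S \<subseteq> T \<longrightarrow> (\<forall>a\<in>S. \<forall>b\<in>S. w S a * w T b = w S b * w T a)) \<and>
     (\<forall>S\<in>label_sets n. \<forall>i\<in>{1..n}. \<forall>j\<in>{1..n}. \<forall>k\<in>{1..n}.
        (i, j) \<in> S \<longrightarrow> (j, k) \<in> S \<longrightarrow> (i, k) \<in> S \<longrightarrow> w S (i, j) + w S (j, k) = w S (i, k))"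

section \<open>Elementary consequences of the axioms of level data\<close>

lemma finite_labels [simp]: "finite (labels n)"
  by (simp add: labels_def)

lemma finite_label_sets [simp]: "finite (label_sets n)"
  unfolding label_sets_def by (rule finite_subset[of _ "Pow (labels n)"]) auto

lemma label_setsD:
  assumes "S \<in> label_sets n"
  shows "finite S" "S \<noteq> {}" "(0, 0) \<in> S" "S \<subseteq> labels n"
  using assms finite_subset[OF _ finite_labels] by (auto simp: label_sets_def)

lemma label_sets_triple: "a \<in> labels n \<Longrightarrow> b \<in> labels n \<Longrightarrow> {(0, 0), a, b} \<in> label_sets n"
  by (auto simp: label_sets_def labels_def)

lemma labels_pair: "i \<in> {1..n} \<Longrightarrow> j \<in> {1..n} \<Longrightarrow> (i, j) \<in> labels n"
  by (simp add: labels_def)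

lemma labels_star [simp]: "(0, 0) \<in> labels n"
  by (simp add: labels_def)

lemma level_data_le:
  assumes "level_data n lev I" "a \<in> labels n"
  shows "lev a \<le> lev (0, 0)"
proof -
  have "lev a \<in> lev ` labels n" using assms(2) by blast
  then show ?thesis using assms(1) by (simp add: level_data_def)
qed

lemma level_data_ex:
  assumes "level_data n lev I" "m \<le> lev (0, 0)"
  obtains a where "a \<in> labels n" "lev a = m"
proof -
  have "m \<in> lev ` labels n" using assms by (simp add: level_data_def)
  then show ?thesis using that by blast
qed

lemma level_data_nonzero:
  "level_data n lev I \<Longrightarrow> a \<in> labels n \<Longrightarrow> lev a < lev (0, 0) \<Longrightarrow> I a \<noteq> 0"
  by (simp add: level_data_def)

lemma level_data_add:
  "level_data n lev I \<Longrightarrow> i \<in> {1..n} \<Longrightarrow> j \<in> {1..n} \<Longrightarrow> k \<in> {1..n} \<Longrightarrow>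
    m = min (lev (i, j)) (min (lev (j, k)) (lev (i, k))) \<Longrightarrow>
    level_part lev I m (i, j) + level_part lev I m (j, k) = level_part lev I m (i, k)"
  unfolding level_data_def by blast

text \<open>The cocycle relation for three equal indices forces the period to be 0, and zero periods
  occur only on the terminal level.\<close>

lemma level_data_diag:
  assumes "level_data n lev I" "i \<in> {1..n}"
  shows "lev (i, i) = lev (0, 0)" "I (i, i) = 0"
proof -
  show "I (i, i) = 0"
    using level_data_add[OF assms(1,2,2,2) refl] by (simp add: level_part_def)
  then show "lev (i, i) = lev (0, 0)"
    using level_data_nonzero[OF assms(1) labels_pair[OF assms(2,2)]]
      level_data_le[OF assms(1) labels_pair[OF assms(2,2)]] by linarith
qed

lemma level_data_sym:
  assumes D: "level_data n lev I" and i: "i \<in> {1..n}" and j: "j \<in> {1..n}"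
  shows "lev (j, i) = lev (i, j)" "I (j, i) = - I (i, j)"
proof -
  note le = level_data_le[OF D labels_pair[OF i j]] level_data_le[OF D labels_pair[OF j i]]
  note nz = level_data_nonzero[OF D labels_pair[OF i j]] level_data_nonzero[OF D labels_pair[OF j i]]
  have "level_part lev I (min (lev (i, j)) (lev (j, i))) (i, j) +
      level_part lev I (min (lev (i, j)) (lev (j, i))) (j, i) = 0"
    using level_data_add[OF D i j i refl] level_data_diag[OF D i] le
    by (auto simp: level_part_def min_def split: if_splits)
  with nz le show "lev (j, i) = lev (i, j)"
    by (auto simp: level_part_def min_def not_le split: if_splits)
  with \<open>level_part lev I (min (lev (i, j)) (lev (j, i))) (i, j) +
      level_part lev I (min (lev (i, j)) (lev (j, i))) (j, i) = 0\<close>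
  show "I (j, i) = - I (i, j)"
    by (simp add: level_part_def eq_neg_iff_add_eq_0 add.commute)
qed

text \<open>If the third level were strictly lower than the other two, additivity on it would make
  its period vanish, although it lies below the terminal level.\<close>

lemma level_data_ultrametric:
  assumes D: "level_data n lev I" and ijk: "i \<in> {1..n}" "j \<in> {1..n}" "k \<in> {1..n}"
  shows "min (lev (i, j)) (lev (j, k)) \<le> lev (i, k)"
proof (rule ccontr)
  assume "\<not> min (lev (i, j)) (lev (j, k)) \<le> lev (i, k)"
  then have lt: "lev (i, k) < lev (i, j)" "lev (i, k) < lev (j, k)" by auto
  then have "I (i, k) = 0"
    using level_data_add[OF D ijk refl] by (auto simp: level_part_def min_def split: if_splits)
  moreover have "lev (i, k) < lev (0, 0)"
    using lt level_data_le[OF D labels_pair[OF ijk(1,2)]] by linarith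
  ultimately show False
    using level_data_nonzero[OF D labels_pair[OF ijk(1,3)]] by blast
qed

text \<open>The zero pattern of a factor thus detects the labels on its lowest level, and small sets
  \<open>S\<close> permit comparing the levels of single labels.\<close>

lemma leading_part_nonzero_iff:
  assumes D: "level_data n lev I" and S: "S \<in> label_sets n" "a \<in> S"
  shows "leading_part lev I S a \<noteq> 0 \<longleftrightarrow> (\<forall>b\<in>S. lev a \<le> lev b) \<and> I a \<noteq> 0"
proof -
  have "Min (lev ` S) = lev a \<longleftrightarrow> (\<forall>b\<in>S. lev a \<le> lev b)"
    using label_setsD[OF S(1)] S(2) by (subst Min_eq_iff) auto
  then show ?thesis by (auto simp: leading_part_def level_part_def)
qed

text \<open>Below the terminal level every period is nonzero; if \<open>S\<close> lies entirely on
  the terminal level, the label \<open>(0, 0)\<close> contributes the value 1.\<close>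

lemma leading_part_ex_nonzero:
  assumes D: "level_data n lev I" and S: "S \<in> label_sets n"
  shows "\<exists>a\<in>S. leading_part lev I S a \<noteq> 0"
proof -
  have "Min (lev ` S) \<in> lev ` S" using label_setsD[OF S] by (intro Min_in) auto
  then obtain a where a: "a \<in> S" "lev a = Min (lev ` S)" by auto
  then have le: "lev a \<le> lev b" if "b \<in> S" for b
    using that label_setsD[OF S] by simp
  have "lev a \<le> lev (0, 0)" using le label_setsD[OF S] by blast
  then consider "lev a < lev (0, 0)" | "lev a = lev (0, 0)" by linarith
  then show ?thesis
  proof cases
    case 1
    then have "I a \<noteq> 0" using level_data_nonzero[OF D] a(1) label_setsD[OF S] by blast
    then show ?thesis using a leading_part_nonzero_iff[OF D S a(1)] le by blast
  next
    case 2
    have "I (0, 0) \<noteq> 0" using D by (simp add: level_data_def)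
    then show ?thesis
      using leading_part_nonzero_iff[OF D S, of "(0, 0)"] label_setsD[OF S] le 2 by auto
  qed
qed

lemma compatible_family_leading_part:
  assumes D: "level_data n lev I"
  shows "compatible_family n (leading_part lev I)"
  unfolding compatible_family_def
proof (intro conjI ballI impI)
  show "\<exists>a\<in>S. leading_part lev I S a \<noteq> 0" if "S \<in> label_sets n" for S
    using leading_part_ex_nonzero[OF D that] .
next
  fix S T a b assume S: "S \<in> label_sets n" "T \<in> label_sets n" "S \<subseteq> T" "a \<in> S" "b \<in> S"
  show "leading_part lev I S a * leading_part lev I T b = leading_part lev I S b * leading_part lev I T a"
  proof (cases "Min (lev ` S) = Min (lev ` T)")
    case True
    then show ?thesis by (simp add: leading_part_def)
  next
    case False
    \<comment> \<open>\<open>T\<close> contains a label of lower level than all of \<open>S\<close>,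
      so the coordinates of \<open>T\<close> indexed by \<open>S\<close> are 0 and both sides
      vanish.\<close>
    have "Min (lev ` T) \<le> Min (lev ` S)"
      using S label_setsD[OF S(1)] label_setsD[OF S(2)] by (intro Min_antimono) auto
    moreover have "Min (lev ` S) \<le> lev c" if "c \<in> S" for c
      using that label_setsD[OF S(1)] by simp
    ultimately have "leading_part lev I T c = 0" if "c \<in> S" for c
      using False that by (fastforce simp: leading_part_def level_part_def)
    then show ?thesis using S by simp
  qed
next
  fix S i j k assume S: "S \<in> label_sets n" and ijk: "i \<in> {1..n}" "j \<in> {1..n}" "k \<in> {1..n}"
    and mem: "(i, j) \<in> S" "(j, k) \<in> S" "(i, k) \<in> S"
  define m where "m = min (lev (i, j)) (min (lev (j, k)) (lev (i, k)))"
  have "Min (lev ` S) \<le> lev c" if "c \<in> S" for c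
    using that label_setsD[OF S] by simp
  then have "Min (lev ` S) \<le> lev (i, j)" "Min (lev ` S) \<le> lev (j, k)" "Min (lev ` S) \<le> lev (i, k)"
    using mem by blast+
  then show "leading_part lev I S (i, j) + leading_part lev I S (j, k) = leading_part lev I S (i, k)"
    using level_data_add[OF D ijk m_def]
    by (cases "Min (lev ` S) = m") (auto simp: leading_part_def level_part_def m_def)
qed

text \<open>
  The levels are read off the coordinates \<open>w S\<close> for the largest \<open>S\<close>: the labels with nonzero
  coordinate form the lowest level, and the procedure continues with the remaining labels.
\<close>

lemma ex_levels:
  assumes "finite S" "s \<in> S"
    and "\<And>T. T \<subseteq> S \<Longrightarrow> s \<in> T \<Longrightarrow> \<exists>a\<in>T. w T a \<noteq> (0::complex)"
    and "\<And>T T' a b. T \<subseteq> T' \<Longrightarrow> T' \<subseteq> S \<Longrightarrow> s \<in> T \<Longrightarrow> a \<in> T \<Longrightarrow> b \<in> T \<Longrightarrow> w T a * w T' b = w T b * w T' a"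
  shows "\<exists>lev I. lev ` S = {..lev s} \<and> I s = 1 \<and> (\<forall>a\<in>S. lev a < lev s \<longrightarrow> I a \<noteq> 0) \<and>
    (\<forall>T. T \<subseteq> S \<longrightarrow> s \<in> T \<longrightarrow> (\<exists>c. c \<noteq> 0 \<and> (\<forall>a\<in>T. w T a = c * leading_part lev I T a)))"
  using assms
proof (induction S rule: finite_psubset_induct)
  case (psubset S)
  note nz = psubset.prems(2) and compat = psubset.prems(3)
  show ?case
  proof (cases "w S s = 0")
    case False
    \<comment> \<open>If the coordinate of \<open>s\<close> is nonzero there is a single level, and
      the normalization \<open>I s = 1\<close> fixes its scale.\<close>
    have "\<exists>c. c \<noteq> 0 \<and> (\<forall>a\<in>T. w T a = c * leading_part (\<lambda>_. 0) (\<lambda>a. w S a / w S s) T a)"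
      if T: "T \<subseteq> S" "s \<in> T" for T
    proof (intro exI[of _ "w T s"] conjI ballI)
      have eq: "w T a * w S s = w T s * w S a" if "a \<in> T" for a
        using compat[OF T(1) subset_refl T(2) that T(2)] .
      then show "w T s \<noteq> 0" using nz[OF T] False by force
      fix a assume "a \<in> T"
      moreover have "(\<lambda>_. 0::nat) ` T = {0}" using T by auto
      ultimately show "w T a = w T s * leading_part (\<lambda>_. 0) (\<lambda>a. w S a / w S s) T a"
        using eq[of a] False by (simp add: leading_part_def level_part_def field_simps)
    qed
    moreover have "(\<lambda>_. 0::nat) ` S = {..0}" using psubset.prems(1) by auto
    ultimately show ?thesis
      using False by (intro exI[of _ "\<lambda>_. 0"] exI[of _ "\<lambda>a. w S a / w S s"]) simp
  next
    case True
    define S' where "S' = {a \<in> S. w S a = 0}"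
    have S': "S' \<subseteq> S" "s \<in> S'" using True psubset.prems(1) by (auto simp: S'_def)
    have "S' \<noteq> S" using nz[of S] psubset.prems(1) by (auto simp: S'_def)
    have A1: "\<exists>a\<in>T. w T a \<noteq> 0" if "T \<subseteq> S'" "s \<in> T" for T
      using nz[of T] that S'(1) by blast
    have A2: "w T a * w T' b = w T b * w T' a" if "T \<subseteq> T'" "T' \<subseteq> S'" "s \<in> T" "a \<in> T" "b \<in> T" for T T' a b
      using compat[of T T' a b] that S'(1) by blast
    obtain lev I where IH: "lev ` S' = {..lev s}" "I s = 1"
      "\<forall>a\<in>S'. lev a < lev s \<longrightarrow> I a \<noteq> 0"
      "\<And>T. T \<subseteq> S' \<Longrightarrow> s \<in> T \<Longrightarrow> \<exists>c. c \<noteq> 0 \<and> (\<forall>a\<in>T. w T a = c * leading_part lev I T a)"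
    proof -
      have "S' \<subset> S" using S'(1) \<open>S' \<noteq> S\<close> by blast
      from psubset.IH[OF this S'(2) A1 A2] that show ?thesis by blast
    qed
    define lev' where "lev' a = (if a \<in> S' then Suc (lev a) else 0)" for a
    \<comment> \<open>On the new lowest level the scale is free, so the coordinates of
      \<open>S\<close> itself can serve as periods.\<close>
    define I' where "I' a = (if a \<in> S' then I a else w S a)" for a
    have "I' s = 1" using IH(2) S' by (simp add: I'_def)
    have "lev' ` S' = Suc ` {..lev s}"
      by (simp add: lev'_def image_image flip: IH(1))
    moreover have "lev' ` (S - S') = {0}"
      using \<open>S' \<noteq> S\<close> S' by (auto simp: lev'_def)
    ultimately have "lev' ` S = {0} \<union> Suc ` {..lev s}"
      using S'(1) by (metis Un_Diff_cancel image_Un sup.absorb2 sup_commute)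
    also have "\<dots> = {..lev' s}"
      using S' by (auto simp: lev'_def image_iff) (metis Suc_le_D Suc_le_mono atMost_iff less_eq_Suc_le not_less_eq_eq zero_less_iff_neq_zero)
    finally have "lev' ` S = {..lev' s}" .
    moreover have "\<forall>a\<in>S. lev' a < lev' s \<longrightarrow> I' a \<noteq> 0"
      using IH(3) S' by (auto simp: lev'_def I'_def S'_def)
    moreover have "\<exists>c. c \<noteq> 0 \<and> (\<forall>a\<in>T. w T a = c * leading_part lev' I' T a)"
      if T: "T \<subseteq> S" "s \<in> T" for T
    \<comment> \<open>Inside \<open>S'\<close> all levels are shifted by one. Otherwise
      \<open>T\<close> contains a label of level 0, and compatibility makes its vector proportional
      to that of \<open>S\<close>.\<close>
    proof (cases "T \<subseteq> S'")
      case sub: True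
      have fin: "finite T" "T \<noteq> {}" using T psubset.hyps(1) finite_subset by auto
      have "lev' ` T = Suc ` lev ` T" using sub by (auto simp: lev'_def image_image)
      then have Min: "Min (lev' ` T) = Suc (Min (lev ` T))"
        using fin by (simp add: mono_Min_commute[of Suc] mono_Suc)
      have "leading_part lev' I' T a = leading_part lev I T a" if "a \<in> T" for a
        using sub that unfolding leading_part_def level_part_def Min by (auto simp: lev'_def I'_def)
      then show ?thesis using IH(4)[OF sub T(2)] by simp
    next
      case False
      then obtain b where b: "b \<in> T" "w S b \<noteq> 0" using T by (auto simp: S'_def)
      have fin: "finite T" using T psubset.hyps(1) finite_subset by auto
      have "Min (lev' ` T) = 0"
        using b T fin by (intro Min_eqI) (auto simp: lev'_def S'_def image_iff intro!: bexI[of _ b])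
      then have lead: "leading_part lev' I' T a = w S a" if "a \<in> T" for a
        using that T by (auto simp: leading_part_def level_part_def lev'_def I'_def S'_def)
      have eq: "w T a * w S b = w T b * w S a" if "a \<in> T" for a
        using compat[OF T(1) subset_refl T(2) that b(1)] .
      have "w T b \<noteq> 0"
        using nz[OF T] eq b(2) by force
      then show ?thesis
        using eq b lead by (intro exI[of _ "w T b / w S b"]) (auto simp: field_simps)
    qed
    ultimately show ?thesis
      using \<open>I' s = 1\<close> by (intro exI[of _ lev'] exI[of _ I']) blast
  qed
qed

lemma compatible_family_imp_level_data:
  assumes w: "compatible_family n w"
  obtains lev I where "level_data n lev I" "scaled_family (label_sets n) (\<lambda>S. S) w (leading_part lev I)"
proof -
  obtain lev I where L: "lev ` labels n = {..lev (0, 0)}" "I (0, 0) = 1"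
      "\<forall>a\<in>labels n. lev a < lev (0, 0) \<longrightarrow> I a \<noteq> 0"
    and sc: "\<And>S. S \<in> label_sets n \<Longrightarrow> \<exists>c. c \<noteq> 0 \<and> (\<forall>a\<in>S. w S a = c * leading_part lev I S a)"
  proof -
    have A1: "\<exists>a\<in>T. w T a \<noteq> 0" if "T \<subseteq> labels n" "(0, 0) \<in> T" for T
      using w that by (simp add: compatible_family_def label_sets_def)
    have A2: "w T a * w T' b = w T b * w T' a"
      if "T \<subseteq> T'" "T' \<subseteq> labels n" "(0, 0) \<in> T" "a \<in> T" "b \<in> T" for T T' a b
    proof -
      have "T \<in> label_sets n" "T' \<in> label_sets n" using that by (auto simp: label_sets_def)
      then show ?thesis using w that unfolding compatible_family_def by blast
    qed
    have "\<exists>lev I. lev ` labels n = {..lev (0, 0)} \<and> I (0, 0) = 1 \<and>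
        (\<forall>a\<in>labels n. lev a < lev (0, 0) \<longrightarrow> I a \<noteq> 0) \<and>
        (\<forall>T. T \<subseteq> labels n \<longrightarrow> (0, 0) \<in> T \<longrightarrow>
          (\<exists>c. c \<noteq> 0 \<and> (\<forall>a\<in>T. w T a = c * leading_part lev I T a)))"
      by (rule ex_levels[OF finite_labels labels_star]) (fact A1, fact A2)
    then show ?thesis
      by (elim exE conjE) (rule that, assumption+, unfold label_sets_def, blast)
  qed
  have le: "lev a \<le> lev (0, 0)" if "a \<in> labels n" for a
    using L(1) that by blast
  have "level_data n lev I"
    unfolding level_data_def
  proof (intro conjI ballI allI impI)
    fix i j k m assume ijk: "i \<in> {1..n}" "j \<in> {1..n}" "k \<in> {1..n}"
      and m: "m = min (lev (i, j)) (min (lev (j, k)) (lev (i, k)))"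
    define S where "S = {(0, 0), (i, j), (j, k), (i, k)}"
    have S: "S \<in> label_sets n" using ijk by (auto simp: S_def label_sets_def labels_def)
    \<comment> \<open>Adding \<open>(0, 0)\<close> does not change the minimum, because its level is
      the highest.\<close>
    have "lev (i, j) \<le> lev (0, 0)" using le labels_pair[OF ijk(1,2)] by blast
    then have "Min (lev ` S) = m"
      by (auto simp: S_def m min_def)
    moreover obtain c where c: "c \<noteq> 0" "\<And>a. a \<in> S \<Longrightarrow> w S a = c * leading_part lev I S a"
      using sc[OF S] by blast
    moreover have "w S (i, j) + w S (j, k) = w S (i, k)"
      using w S ijk unfolding compatible_family_def by (simp add: S_def)
    ultimately have "c * (level_part lev I m (i, j) + level_part lev I m (j, k)) = c * level_part lev I m (i, k)"
      by (simp add: S_def leading_part_def distrib_left)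
    then show "level_part lev I m (i, j) + level_part lev I m (j, k) = level_part lev I m (i, k)"
      using c by simp
  qed (use L in auto)
  moreover have "scaled_family (label_sets n) (\<lambda>S. S) w (leading_part lev I)"
    unfolding scaled_family_def using sc by metis
  ultimately show ?thesis by (rule that)
qed

text \<open>A function onto an initial segment of the natural numbers is determined by the preorder
  it induces, because its value at \<open>a\<close> is the number of its values below
  \<open>f a\<close>.\<close>

lemma rank_unique:
  fixes f g :: "'a \<Rightarrow> nat"
  assumes f: "f ` A = {..k}" and g: "g ` A = {..l}"
    and le: "\<And>a b. a \<in> A \<Longrightarrow> b \<in> A \<Longrightarrow> f a \<le> f b \<longleftrightarrow> g a \<le> g b"
    and "a \<in> A"
  shows "f a = g a"
  using \<open>a \<in> A\<close>
proof (induction "f a" arbitrary: a rule: less_induct)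
  case less
  have sub: "f ` {b \<in> A. f b < f a} = {..<f a}"
  proof (intro equalityI subsetI)
    fix m assume "m \<in> {..<f a}"
    moreover have "f a \<in> {..k}" using less.prems f by blast
    ultimately have "m \<in> f ` A" using f by simp
    then show "m \<in> f ` {b \<in> A. f b < f a}" using \<open>m \<in> {..<f a}\<close> by auto
  qed auto
  have subg: "g ` {b \<in> A. g b < g a} = {..<g a}"
  proof (intro equalityI subsetI)
    fix m assume "m \<in> {..<g a}"
    moreover have "g a \<in> {..l}" using less.prems g by blast
    ultimately have "m \<in> g ` A" using g by simp
    then show "m \<in> g ` {b \<in> A. g b < g a}" using \<open>m \<in> {..<g a}\<close> by auto
  qed auto
  have eq: "{b \<in> A. f b < f a} = {b \<in> A. g b < g a}"
    using le less.prems by (auto simp: not_le[symmetric])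
  have "f ` {b \<in> A. f b < f a} = g ` {b \<in> A. f b < f a}"
    by (rule image_cong[OF refl]) (use less.hyps in auto)
  then show ?case using sub subg eq by (simp add: lessThan_eq_iff)
qed

text \<open>Sets with at most three labels suffice: \<open>{(0, 0), a, b}\<close> compares the
  levels of \<open>a\<close> and \<open>b\<close>, so both level functions induce the same preorder
  and agree by \<open>rank_unique\<close>. The same sets compare the scales on one level.\<close>

lemma rescaled_dataI:
  assumes D: "level_data n lev I" and D': "level_data n lev' I'"
    and sc: "scaled_family (label_sets n) (\<lambda>S. S) (leading_part lev' I') (leading_part lev I)"
  shows "rescaled_data n lev I lev' I'"
proof -
  obtain c where c: "\<And>S. S \<in> label_sets n \<Longrightarrow> c S \<noteq> 0"
    "\<And>S a. S \<in> label_sets n \<Longrightarrow> a \<in> S \<Longrightarrow> leading_part lev' I' S a = c S * leading_part lev I S a"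
    using sc unfolding scaled_family_def by blast
  have nz: "(\<forall>b\<in>S. lev' a \<le> lev' b) \<and> I' a \<noteq> 0 \<longleftrightarrow> (\<forall>b\<in>S. lev a \<le> lev b) \<and> I a \<noteq> 0"
    if "S \<in> label_sets n" "a \<in> S" for S a
    using leading_part_nonzero_iff[OF D that] leading_part_nonzero_iff[OF D' that] c that by simp
  have one: "I (0, 0) = 1" "I' (0, 0) = 1" using D D' by (auto simp: level_data_def)
  \<comment> \<open>On the terminal level \<open>I a\<close> may be 0, so the comparison goes
    through \<open>(0, 0)\<close>, whose value is 1.\<close>
  have top: "lev' a = lev' (0, 0) \<longleftrightarrow> lev a = lev (0, 0)" if a: "a \<in> labels n" for a
  proof -
    have "(\<forall>b\<in>{(0, 0), a}. lev' (0, 0) \<le> lev' b) \<longleftrightarrow> (\<forall>b\<in>{(0, 0), a}. lev (0, 0) \<le> lev b)"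
      using nz[OF label_sets_triple[OF a a], of "(0, 0)"] one by simp
    then have "lev' (0, 0) \<le> lev' a \<longleftrightarrow> lev (0, 0) \<le> lev a" by simp
    then show ?thesis using level_data_le[OF D a] level_data_le[OF D' a] by linarith
  qed
  have le: "lev' a \<le> lev' b \<longleftrightarrow> lev a \<le> lev b" if ab: "a \<in> labels n" "b \<in> labels n" for a b
  proof (cases "lev a = lev (0, 0)")
    case True
    then show ?thesis
      using top ab level_data_le[OF D ab(2)] level_data_le[OF D' ab(2)] by (metis order_antisym order_refl)
  next
    case False
    then have lt: "lev a < lev (0, 0)" "lev' a < lev' (0, 0)"
      using top[OF ab(1)] level_data_le[OF D ab(1)] level_data_le[OF D' ab(1)] by auto
    then show ?thesis
      using nz[OF label_sets_triple[OF ab], of a] level_data_nonzero[OF D ab(1)] level_data_nonzero[OF D' ab(1)]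
      by auto
  qed
  have lev: "lev' a = lev a" if "a \<in> labels n" for a
    by (rule rank_unique[where A = "labels n"]) (use D D' le that in \<open>auto simp: level_data_def\<close>)
  have ex: "\<exists>a. a \<in> labels n \<and> lev a = m \<and> (m = lev (0, 0) \<longrightarrow> a = (0, 0))" if "m \<le> lev (0, 0)" for m
    using level_data_ex[OF D that] labels_star by metis
  \<comment> \<open>A reference label for each level; on the terminal level it is
    \<open>(0, 0)\<close>, which makes the factor there equal to 1.\<close>
  then obtain r where r: "\<And>m. m \<le> lev (0, 0) \<Longrightarrow> r m \<in> labels n \<and> lev (r m) = m \<and> (m = lev (0, 0) \<longrightarrow> r m = (0, 0))"
    by metis
  define d where "d m = (if m \<le> lev (0, 0) then I' (r m) / I (r m) else 1)" for m
  have rnz: "I (r m) \<noteq> 0" "I' (r m) \<noteq> 0" if "m \<le> lev (0, 0)" for m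
  proof -
    have "lev (r m) < lev (0, 0) \<or> r m = (0, 0)" using r[OF that] that by (cases "m = lev (0, 0)") auto
    then show "I (r m) \<noteq> 0" "I' (r m) \<noteq> 0"
      using level_data_nonzero[OF D, of "r m"] level_data_nonzero[OF D', of "r m"] r[OF that] one lev by auto
  qed
  show ?thesis
    unfolding rescaled_data_def
  proof (intro exI[of _ d] conjI ballI allI)
    show "d (lev (0, 0)) = 1" using r[of "lev (0, 0)"] one by (simp add: d_def)
    show "d m \<noteq> 0" for m using rnz by (simp add: d_def)
    fix a assume a: "a \<in> labels n"
    show "lev' a = lev a" using lev[OF a] .
    have la: "lev a \<le> lev (0, 0)" using level_data_le[OF D a] .
    define S where "S = {(0, 0), a, r (lev a)}"
    have S: "S \<in> label_sets n" unfolding S_def using label_sets_triple a r[OF la] by blast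
    have Min: "Min (lev ` S) = lev a" "Min (lev' ` S) = lev a"
      using r[OF la] la lev a labels_star[of n] by (auto simp: S_def min_def)
    have "I' b = c S * I b" if "b \<in> S" "lev b = lev a" for b
      using c(2)[OF S that(1)] that lev[of b] label_setsD(4)[OF S]
      by (auto simp: leading_part_def level_part_def Min)
    then have "I' a = c S * I a" "I' (r (lev a)) = c S * I (r (lev a))"
      using r[OF la] by (auto simp: S_def)
    then show "I' a = d (lev a) * I a"
      using rnz[OF la] la by (simp add: d_def)
  qed
qed

lemma rescaled_data_leading_part:
  assumes "rescaled_data n lev I lev' I'"
  shows "scaled_family (label_sets n) (\<lambda>S. S) (leading_part lev' I') (leading_part lev I)"
proof -
  obtain c where c: "\<And>m. c m \<noteq> 0" "\<And>a. a \<in> labels n \<Longrightarrow> lev' a = lev a \<and> I' a = c (lev a) * I a"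
    using assms unfolding rescaled_data_def by blast
  have "leading_part lev' I' S a = c (Min (lev ` S)) * leading_part lev I S a"
    if S: "S \<in> label_sets n" "a \<in> S" for S a
  proof -
    have "lev' ` S = lev ` S" using c(2) label_setsD(4)[OF S(1)] by (intro image_cong) auto
    then show ?thesis
      using c(2)[of a] label_setsD(4)[OF S(1)] S(2) by (auto simp: leading_part_def level_part_def)
  qed
  then show ?thesis
    unfolding scaled_family_def using c(1) by (intro exI[of _ "\<lambda>S. c (Min (lev ` S))"]) simp
qed

lemma scaled_family_sym: "scaled_family \<K> A w w' \<Longrightarrow> scaled_family \<K> A w' w"
  unfolding scaled_family_def
  by (elim exE, rule_tac x = "\<lambda>S. 1 / c S" in exI) (auto simp: field_simps)

lemma scaled_family_trans:
  assumes "scaled_family \<K> A w w'" "scaled_family \<K> A w' w''"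
  shows "scaled_family \<K> A w w''"
proof -
  obtain c c' where "\<forall>S\<in>\<K>. c S \<noteq> 0 \<and> (\<forall>a\<in>A S. w S a = c S * w' S a)"
    "\<forall>S\<in>\<K>. c' S \<noteq> 0 \<and> (\<forall>a\<in>A S. w' S a = c' S * w'' S a)"
    using assms unfolding scaled_family_def by blast
  then show ?thesis
    unfolding scaled_family_def by (intro exI[of _ "\<lambda>S. c S * c' S"]) auto
qed

section \<open>The Segre embedding\<close>

definition segre :: "'k set \<Rightarrow> ('k \<Rightarrow> 'l \<Rightarrow> complex) \<Rightarrow> ('k \<Rightarrow> 'l) \<Rightarrow> complex" where
  "segre \<K> w \<phi> = (\<Prod>S\<in>\<K>. w S (\<phi> S))"

lemma segre_update:
  assumes "finite \<K>" "S \<in> \<K>"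
  shows "segre \<K> w (\<phi>(S := a)) = w S a * segre (\<K> - {S}) w \<phi>"
proof -
  have "segre \<K> w (\<phi>(S := a)) = w S a * (\<Prod>T\<in>\<K> - {S}. w T ((\<phi>(S := a)) T))"
    unfolding segre_def using prod.remove[OF assms, of "\<lambda>T. w T ((\<phi>(S := a)) T)"] by simp
  also have "(\<Prod>T\<in>\<K> - {S}. w T ((\<phi>(S := a)) T)) = segre (\<K> - {S}) w \<phi>"
    unfolding segre_def by (intro prod.cong) auto
  finally show ?thesis .
qed

lemma segre_nonzero_iff: "finite \<K> \<Longrightarrow> segre \<K> w \<phi> \<noteq> 0 \<longleftrightarrow> (\<forall>S\<in>\<K>. w S (\<phi> S) \<noteq> 0)"
  by (simp add: segre_def)

lemma segre_scaled_family:
  assumes "finite \<K>" "scaled_family \<K> A w w'"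
  obtains c where "c \<noteq> 0" "\<And>\<phi>. \<phi> \<in> PiE \<K> A \<Longrightarrow> segre \<K> w \<phi> = c * segre \<K> w' \<phi>"
proof -
  obtain c where c: "\<And>S. S \<in> \<K> \<Longrightarrow> c S \<noteq> 0" "\<And>S a. S \<in> \<K> \<Longrightarrow> a \<in> A S \<Longrightarrow> w S a = c S * w' S a"
    using assms(2) unfolding scaled_family_def by blast
  show ?thesis
  proof (rule that[of "\<Prod>S\<in>\<K>. c S"])
    show "(\<Prod>S\<in>\<K>. c S) \<noteq> 0" using c(1) assms(1) by simp
    fix \<phi> assume "\<phi> \<in> PiE \<K> A"
    then have "segre \<K> w \<phi> = (\<Prod>S\<in>\<K>. c S * w' S (\<phi> S))"
      unfolding segre_def using c(2) by (intro prod.cong) (auto simp: PiE_def)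
    then show "segre \<K> w \<phi> = (\<Prod>S\<in>\<K>. c S) * segre \<K> w' \<phi>"
      by (simp add: segre_def prod.distrib)
  qed
qed

lemma fun_upd_PiE: "\<phi> \<in> PiE \<K> A \<Longrightarrow> S \<in> \<K> \<Longrightarrow> a \<in> A S \<Longrightarrow> \<phi>(S := a) \<in> PiE \<K> A"
  by (auto simp: PiE_def extensional_def)

text \<open>From a \<open>\<phi>\<close> with nonzero Segre coordinate, varying only the label
  chosen from \<open>S\<close> restricts the Segre vector to a nonzero multiple of
  \<open>w S\<close>. So it determines every factor up to scale.\<close>

lemma scaled_family_segre:
  assumes fin: "finite \<K>" and nz: "\<And>S. S \<in> \<K> \<Longrightarrow> \<exists>a\<in>A S. w S a \<noteq> 0"
    and eq: "\<And>\<phi>. \<phi> \<in> PiE \<K> A \<Longrightarrow> segre \<K> w \<phi> = c * segre \<K> w' \<phi>"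
  shows "scaled_family \<K> A w w'"
proof -
  obtain f where f: "\<And>S. S \<in> \<K> \<Longrightarrow> f S \<in> A S \<and> w S (f S) \<noteq> 0" using nz by metis
  define \<phi> where "\<phi> = restrict f \<K>"
  have \<phi>: "\<phi> \<in> PiE \<K> A" "\<forall>S\<in>\<K>. w S (\<phi> S) \<noteq> 0" using f by (auto simp: \<phi>_def)
  have "segre \<K> w \<phi> \<noteq> 0" using \<phi> fin by (simp add: segre_nonzero_iff)
  then have c: "c \<noteq> 0" and "segre \<K> w' \<phi> \<noteq> 0" using eq[OF \<phi>(1)] by auto
  then have nz': "segre (\<K> - {S}) w \<phi> \<noteq> 0" "segre (\<K> - {S}) w' \<phi> \<noteq> 0" for S
    using \<phi> fin by (simp_all add: segre_nonzero_iff)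
  show ?thesis
    unfolding scaled_family_def
  proof (intro exI[of _ "\<lambda>S. c * segre (\<K> - {S}) w' \<phi> / segre (\<K> - {S}) w \<phi>"] ballI conjI)
    fix S assume S: "S \<in> \<K>"
    show "c * segre (\<K> - {S}) w' \<phi> / segre (\<K> - {S}) w \<phi> \<noteq> 0" using c nz' by simp
    fix a assume a: "a \<in> A S"
    show "w S a = c * segre (\<K> - {S}) w' \<phi> / segre (\<K> - {S}) w \<phi> * w' S a"
      using eq[OF fun_upd_PiE[OF \<phi>(1) S a]] nz' by (simp add: segre_update[OF fin S] field_simps)
  qed
qed

text \<open>\<open>M\<close> is parametrized by level data up to rescaling. The projective embedding
  is built from this interface alone.\<close>

locale level_parametrization =
  fixes n :: nat and M :: "'a set" and lev :: "'a \<Rightarrow> nat \<times> nat \<Rightarrow> nat" and I :: "'a \<Rightarrow> nat \<times> nat \<Rightarrow> complex"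
  assumes data: "K \<in> M \<Longrightarrow> level_data n (lev K) (I K)"
    and separating: "K \<in> M \<Longrightarrow> K' \<in> M \<Longrightarrow> rescaled_data n (lev K) (I K) (lev K') (I K') \<Longrightarrow> K = K'"
    and exhausting: "level_data n l J \<Longrightarrow> \<exists>K\<in>M. rescaled_data n (lev K) (I K) l J"
begin

abbreviation "\<K> \<equiv> label_sets n"

definition W :: "'a \<Rightarrow> (nat \<times> nat) set \<Rightarrow> nat \<times> nat \<Rightarrow> complex" where
  "W K = leading_part (lev K) (I K)"

text \<open>A Segre coordinate is indexed by the choice of one label from each
  \<open>S\<close>.\<close>

definition \<Phi> :: "((nat \<times> nat) set \<Rightarrow> nat \<times> nat) set" where
  "\<Phi> = PiE \<K> (\<lambda>S. S)"

definition N :: nat where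
  "N = card \<Phi> - 1"

definition enum :: "nat \<Rightarrow> (nat \<times> nat) set \<Rightarrow> nat \<times> nat" where
  "enum = (SOME e. bij_betw e {..N} \<Phi>)"

definition coord :: "'a \<Rightarrow> nat \<Rightarrow> complex" where
  "coord K i = segre \<K> (W K) (enum i)"

lemma W_compatible: "K \<in> M \<Longrightarrow> compatible_family n (W K)"
  unfolding W_def by (intro compatible_family_leading_part data)

lemma W_nonzero: "K \<in> M \<Longrightarrow> S \<in> \<K> \<Longrightarrow> \<exists>a\<in>S. W K S a \<noteq> 0"
  using W_compatible[of K] unfolding compatible_family_def by meson

lemma W_nonzero_iff:
  "K \<in> M \<Longrightarrow> S \<in> \<K> \<Longrightarrow> a \<in> S \<Longrightarrow> W K S a \<noteq> 0 \<longleftrightarrow> (\<forall>b\<in>S. lev K a \<le> lev K b) \<and> I K a \<noteq> 0"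
  unfolding W_def by (rule leading_part_nonzero_iff[OF data])

lemma W_separating:
  assumes "K \<in> M" "K' \<in> M" "scaled_family \<K> (\<lambda>S. S) (W K) (W K')"
  shows "K = K'"
  using separating[OF assms(2,1) rescaled_dataI[OF data[OF assms(2)] data[OF assms(1)]]] assms(3)
  unfolding W_def by simp

lemma W_exhausting:
  assumes "compatible_family n w"
  obtains K where "K \<in> M" "scaled_family \<K> (\<lambda>S. S) w (W K)"
proof -
  obtain l J where l: "level_data n l J" "scaled_family \<K> (\<lambda>S. S) w (leading_part l J)"
    using compatible_family_imp_level_data[OF assms] .
  obtain K where K: "K \<in> M" "rescaled_data n (lev K) (I K) l J" using exhausting[OF l(1)] by blast
  show ?thesis
    by (rule that[OF K(1)])
      (use scaled_family_trans[OF l(2) rescaled_data_leading_part[OF K(2)]] in \<open>simp add: W_def\<close>)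
qed

lemma \<Phi>_ex: "\<exists>\<phi>. \<phi> \<in> \<Phi>"
proof -
  have "restrict (\<lambda>_. (0, 0)) \<K> \<in> \<Phi>" by (auto simp: \<Phi>_def label_setsD)
  then show ?thesis by blast
qed

lemma finite_\<Phi>: "finite \<Phi>"
  unfolding \<Phi>_def using label_setsD by (intro finite_PiE) auto

lemma bij_enum: "bij_betw enum {..N} \<Phi>"
proof -
  have "card \<Phi> > 0" using \<Phi>_ex finite_\<Phi> by (auto simp: card_gt_0_iff)
  then have "{0..<card \<Phi>} = {..N}" by (auto simp: N_def)
  then have "\<exists>e. bij_betw e {..N} \<Phi>" using ex_bij_betw_nat_finite[OF finite_\<Phi>] by simp
  then show ?thesis unfolding enum_def by (rule someI_ex)
qed

lemma enum_in: "i \<le> N \<Longrightarrow> enum i \<in> \<Phi>"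
  using bij_enum by (auto simp: bij_betw_def)

lemma enum_ex:
  assumes "\<phi> \<in> \<Phi>"
  obtains i where "i \<le> N" "enum i = \<phi>"
  using assms bij_enum unfolding bij_betw_def by (metis atMost_iff image_iff)

lemma \<Phi>_upd: "\<phi> \<in> \<Phi> \<Longrightarrow> S \<in> \<K> \<Longrightarrow> a \<in> S \<Longrightarrow> \<phi>(S := a) \<in> \<Phi>"
  unfolding \<Phi>_def by (rule fun_upd_PiE)

lemma \<Phi>_mem: "\<phi> \<in> \<Phi> \<Longrightarrow> S \<in> \<K> \<Longrightarrow> \<phi> S \<in> S"
  unfolding \<Phi>_def by auto

definition index :: "((nat \<times> nat) set \<Rightarrow> nat \<times> nat) \<Rightarrow> nat" where
  "index \<phi> = inv_into {..N} enum \<phi>"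

lemma index: "\<phi> \<in> \<Phi> \<Longrightarrow> index \<phi> \<le> N" "\<phi> \<in> \<Phi> \<Longrightarrow> enum (index \<phi>) = \<phi>"
  using bij_enum inv_into_into[of \<phi> enum "{..N}"] unfolding bij_betw_def index_def
  by (auto simp: f_inv_into_f)

lemma homogeneous_index: "\<phi> \<in> \<Phi> \<Longrightarrow> homogeneous_fn {..N} 1 (\<lambda>v. v (index \<phi>))"
  by (rule homogeneous_fn.intros) (simp add: index)

text \<open>Coordinate vectors satisfy the Segre relations, and also the relations of a compatible
  family multiplied by the remaining factors. All of these are forms, so they hold for
  \<open>v\<close> as well. Read off from \<open>v\<close> by varying one choice at a time, the
  factors form a compatible family whose Segre vector is proportional to \<open>v\<close>.\<close>

lemma segre_family_of_zeros:
  assumes v: "\<exists>i\<le>N. v i \<noteq> 0"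
    and van: "\<And>d q. homogeneous_fn {..N} d q \<Longrightarrow> (\<And>K. K \<in> M \<Longrightarrow> q (coord K) = 0) \<Longrightarrow> q v = 0"
  obtains w c where "compatible_family n w" "c \<noteq> 0" "\<And>i. i \<le> N \<Longrightarrow> v i = c * segre \<K> w (enum i)"
proof -
  obtain i0 where i0: "i0 \<le> N" "v i0 \<noteq> 0" using v by blast
  define \<phi> where "\<phi> = enum i0"
  have \<phi>: "\<phi> \<in> \<Phi>" "v (index \<phi>) \<noteq> 0"
    using enum_in[OF i0(1)] i0 bij_enum by (auto simp: \<phi>_def index_def bij_betw_def)
  \<comment> \<open>Over \<open>coord K\<close> this is the factor for \<open>S\<close> times the
    common contribution of all other factors at \<open>\<phi>\<close>.\<close>
  define w where "w S a = v (index (\<phi>(S := a)))" for S a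
  have up: "\<phi>(S := a) \<in> \<Phi>" if "S \<in> \<K>" "a \<in> S" for S a using \<Phi>_upd[OF \<phi>(1) that] .
  have hom: "homogeneous_fn {..N} 1 (\<lambda>v. v (index (\<phi>(S := a))))" if "S \<in> \<K>" "a \<in> S" for S a
    using homogeneous_index[OF up[OF that]] .
  have co: "coord K (index (\<phi>(S := a))) = W K S a * segre (\<K> - {S}) (W K) \<phi>"
    if "S \<in> \<K>" "a \<in> S" for K S a
    using that up[OF that] by (simp add: coord_def index segre_update)
  have "compatible_family n w"
    unfolding compatible_family_def
  proof (intro conjI ballI impI)
    fix S assume S: "S \<in> \<K>"
    have "w S (\<phi> S) \<noteq> 0" using \<phi> by (simp add: w_def)
    then show "\<exists>a\<in>S. w S a \<noteq> 0" using \<Phi>_mem[OF \<phi>(1) S] by blast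
  next
    fix S T a b assume S: "S \<in> \<K>" "T \<in> \<K>" "S \<subseteq> T" "a \<in> S" "b \<in> S"
    then have ab: "a \<in> T" "b \<in> T" by auto
    \<comment> \<open>Over \<open>coord K\<close> each of the four coordinates splits off a factor
      that does not depend on the varied label, so the compatibility of \<open>S\<close> and
      \<open>T\<close> becomes a quadratic relation.\<close>
    define q where "q = (\<lambda>v. v (index (\<phi>(S := a))) * v (index (\<phi>(T := b)))
      - v (index (\<phi>(S := b))) * v (index (\<phi>(T := a))) :: complex)"
    have "homogeneous_fn {..N} 2 q"
      unfolding q_def by (intro homogeneous_fn_diff homogeneous_fn_mult'[OF hom hom]) (use S ab in auto)
    moreover have "q (coord K) = 0" if "K \<in> M" for K
    proof -
      have "W K S a * W K T b = W K S b * W K T a"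
        using W_compatible[OF that, unfolded compatible_family_def, THEN conjunct2, THEN conjunct1] S by blast
      then show ?thesis using S ab by (simp add: q_def co algebra_simps)
    qed
    ultimately have "q v = 0" by (rule van)
    then show "w S a * w T b = w S b * w T a" by (simp add: q_def w_def)
  next
    fix S i j k assume S: "S \<in> \<K>" "i \<in> {1..n}" "j \<in> {1..n}" "k \<in> {1..n}" "(i, j) \<in> S" "(j, k) \<in> S" "(i, k) \<in> S"
    define q where "q = (\<lambda>v. v (index (\<phi>(S := (i, j)))) + v (index (\<phi>(S := (j, k))))
      - v (index (\<phi>(S := (i, k)))) :: complex)"
    have "homogeneous_fn {..N} 1 q"
      unfolding q_def by (intro homogeneous_fn_diff homogeneous_fn.intros(3) hom) (use S in auto)
    moreover have "q (coord K) = 0" if "K \<in> M" for K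
    proof -
      have "W K S (i, j) + W K S (j, k) = W K S (i, k)"
        using W_compatible[OF that, unfolded compatible_family_def, THEN conjunct2, THEN conjunct2, rule_format, OF S] .
      then show ?thesis using S by (simp add: q_def co flip: distrib_right)
    qed
    ultimately have "q v = 0" by (rule van)
    then show "w S (i, j) + w S (j, k) = w S (i, k)" by (simp add: q_def w_def)
  qed
  \<comment> \<open>The constant is \<open>v (index \<phi>)\<close> to the power
    \<open>1 - card \<K>\<close>; it comes from solving the Segre relation \<open>q\<close> below
    for \<open>v i\<close>.\<close>
  moreover have "v i = v (index \<phi>) / v (index \<phi>) ^ card \<K> * segre \<K> w (enum i)" if i: "i \<le> N" for i
  proof -
    define \<psi> where "\<psi> = enum i"
    have \<psi>: "\<psi> \<in> \<Phi>" "index \<psi> = i"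
      using enum_in[OF i] i bij_enum by (auto simp: \<psi>_def index_def bij_betw_def)
    \<comment> \<open>Replacing the choices of \<open>\<phi>\<close> by those of
      \<open>\<psi>\<close> for one set at a time uses each factor at \<open>\<phi>\<close> exactly
      \<open>card \<K> - 1\<close> times. The power with exponent 0 is just 1.\<close>
    define q where "q = (\<lambda>v. v (index \<psi>) * v (index \<phi>) ^ (card \<K> - 1)
      - v (index \<phi>) ^ 0 * (\<Prod>S\<in>\<K>. v (index (\<phi>(S := \<psi> S)))) :: complex)"
    have "{(0, 0)} \<in> \<K>" by (simp add: label_sets_def)
    then have "\<K> \<noteq> {}" by (metis empty_iff)
    then have card: "card \<K> > 0" by (simp add: card_gt_0_iff)
    have "homogeneous_fn {..N} (card \<K>) q"
      unfolding q_def
    proof (intro homogeneous_fn_diff)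
      show "homogeneous_fn {..N} (card \<K>) (\<lambda>v. v (index \<psi>) * v (index \<phi>) ^ (card \<K> - 1))"
        by (rule homogeneous_fn_mult'[OF homogeneous_index[OF \<psi>(1)] homogeneous_fn_power[OF homogeneous_index[OF \<phi>(1)]]])
          (use card in simp)
      have "homogeneous_fn {..N} (\<Sum>S\<in>\<K>. 1) (\<lambda>v. \<Prod>S\<in>\<K>. v (index (\<phi>(S := \<psi> S))))"
        by (intro homogeneous_fn_prod hom) (use \<Phi>_mem[OF \<psi>(1)] in auto)
      then show "homogeneous_fn {..N} (card \<K>) (\<lambda>v. v (index \<phi>) ^ 0 * (\<Prod>S\<in>\<K>. v (index (\<phi>(S := \<psi> S)))))"
        by simp
    qed
    moreover have "q (coord K) = 0" for K
    proof -
      have "(\<Prod>S\<in>\<K>. coord K (index (\<phi>(S := \<psi> S)))) = (\<Prod>S\<in>\<K>. W K S (\<psi> S) * segre (\<K> - {S}) (W K) \<phi>)"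
        using co \<Phi>_mem[OF \<psi>(1)] by (intro prod.cong) auto
      also have "\<dots> = segre \<K> (W K) \<psi> * (\<Prod>S\<in>\<K>. segre (\<K> - {S}) (W K) \<phi>)"
        by (simp add: prod.distrib segre_def)
      also have "(\<Prod>S\<in>\<K>. segre (\<K> - {S}) (W K) \<phi>) = segre \<K> (W K) \<phi> ^ (card \<K> - 1)"
      proof -
        have "(\<Prod>S\<in>\<K>. segre (\<K> - {S}) (W K) \<phi>) = (\<Prod>S\<in>\<K>. \<Prod>T\<in>\<K> - {S}. W K T (\<phi> T))"
          by (simp add: segre_def)
        also have "\<dots> = (\<Prod>S\<in>\<K>. \<Prod>T\<in>{T\<in>\<K>. T \<noteq> S}. W K T (\<phi> T))"
          by (intro prod.cong) auto
        \<comment> \<open>After interchanging the products, the factor of \<open>T\<close> is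
          missing only for \<open>S = T\<close>.\<close>
        also have "\<dots> = (\<Prod>T\<in>\<K>. \<Prod>S\<in>{S\<in>\<K>. T \<noteq> S}. W K T (\<phi> T))"
          by (rule prod.swap_restrict) auto
        also have "\<dots> = (\<Prod>T\<in>\<K>. W K T (\<phi> T) ^ (card \<K> - 1))"
        proof (rule prod.cong[OF refl])
          fix T assume "T \<in> \<K>"
          have "{S\<in>\<K>. T \<noteq> S} = \<K> - {T}" by auto
          then show "(\<Prod>S\<in>{S\<in>\<K>. T \<noteq> S}. W K T (\<phi> T)) = W K T (\<phi> T) ^ (card \<K> - 1)"
            using \<open>T \<in> \<K>\<close> by simp
        qed
        finally show ?thesis by (simp add: segre_def prod_power_distrib)
      qed
      finally have eq: "(\<Prod>S\<in>\<K>. coord K (index (\<phi>(S := \<psi> S)))) =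
          segre \<K> (W K) \<psi> * segre \<K> (W K) \<phi> ^ (card \<K> - 1)" .
      have "coord K (index \<psi>) = segre \<K> (W K) \<psi>" "coord K (index \<phi>) = segre \<K> (W K) \<phi>"
        using \<psi>(1) \<phi>(1) by (simp_all add: coord_def index)
      then show ?thesis
        unfolding q_def eq by simp
    qed
    ultimately have "q v = 0" using van by blast
    then have "v i * v (index \<phi>) ^ (card \<K> - 1) = segre \<K> w \<psi>"
      using \<psi> by (simp add: q_def segre_def w_def)
    moreover have "v (index \<phi>) ^ card \<K> = v (index \<phi>) * v (index \<phi>) ^ (card \<K> - 1)"
      using card by (metis Suc_diff_1 power_Suc)
    ultimately show ?thesis
      using \<phi>(2) by (simp add: \<psi>_def field_simps)
  qed
  moreover have "v (index \<phi>) / v (index \<phi>) ^ card \<K> \<noteq> 0" using \<phi>(2) by simp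
  ultimately show ?thesis using that by blast
qed

sublocale projective_embedding M N coord
proof
  fix K assume K: "K \<in> M"
  obtain f where f: "\<And>S. S \<in> \<K> \<Longrightarrow> f S \<in> S \<and> W K S (f S) \<noteq> 0" using W_nonzero[OF K] by metis
  then have "restrict f \<K> \<in> \<Phi>" by (auto simp: \<Phi>_def)
  then obtain i where i: "i \<le> N" "enum i = restrict f \<K>" by (rule enum_ex)
  have "coord K i \<noteq> 0"
    unfolding coord_def i(2) by (subst segre_nonzero_iff) (use f in auto)
  with i show "\<exists>i\<le>N. coord K i \<noteq> 0" by blast
next
  fix K K' c assume K: "K \<in> M" "K' \<in> M" "c \<noteq> 0" "\<And>i. i \<le> N \<Longrightarrow> coord K i = c * coord K' i"
  have "scaled_family \<K> (\<lambda>S. S) (W K) (W K')"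
  proof (rule scaled_family_segre)
    fix \<phi> assume "\<phi> \<in> PiE \<K> (\<lambda>S. S)"
    then obtain i where "i \<le> N" "enum i = \<phi>" using enum_ex \<Phi>_def by blast
    then show "segre \<K> (W K) \<phi> = c * segre \<K> (W K') \<phi>"
      using K(4)[of i] by (simp add: coord_def)
  qed (use W_nonzero[OF K(1)] in auto)
  then show "K = K'" by (rule W_separating[OF K(1,2)])
next
  fix v :: "nat \<Rightarrow> complex"
  assume "\<exists>i\<le>N. v i \<noteq> 0"
    "\<And>d q. homogeneous_fn {..N} d q \<Longrightarrow> (\<And>K. K \<in> M \<Longrightarrow> q (coord K) = 0) \<Longrightarrow> q v = 0"
  then obtain w c where w: "compatible_family n w" "c \<noteq> 0" "\<And>i. i \<le> N \<Longrightarrow> v i = c * segre \<K> w (enum i)"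
    using segre_family_of_zeros by blast
  obtain K where K: "K \<in> M" "scaled_family \<K> (\<lambda>S. S) w (W K)" using W_exhausting[OF w(1)] .
  obtain c' where c': "c' \<noteq> 0" "\<And>\<phi>. \<phi> \<in> \<Phi> \<Longrightarrow> segre \<K> w \<phi> = c' * segre \<K> (W K) \<phi>"
    using segre_scaled_family[OF finite_label_sets K(2)] unfolding \<Phi>_def by blast
  show "\<exists>K\<in>M. \<exists>c. c \<noteq> 0 \<and> (\<forall>i\<le>N. v i = c * coord K i)"
    using K(1) w(2,3) c' enum_in by (intro bexI[of _ K] exI[of _ "c * c'"]) (auto simp: coord_def)
qed

end

section \<open>Charts\<close>

text \<open>\<open>g\<close> and \<open>J\<close> are the level data of a curve with dual tree
  \<open>\<Gamma>\<close>, and \<open>b m\<close> is the pair chosen for level \<open>m\<close>. On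
  the top level it is \<open>(0, 0)\<close>, in accordance with the convention that the last scale
  is 1.\<close>

locale level_chart = level_parametrization n M lev I
  for n :: nat and M :: "'a set" and lev :: "'a \<Rightarrow> nat \<times> nat \<Rightarrow> nat" and I :: "'a \<Rightarrow> nat \<times> nat \<Rightarrow> complex" +
  fixes \<Gamma> :: ltree and g :: "nat \<times> nat \<Rightarrow> nat" and J :: "nat \<times> nat \<Rightarrow> complex" and b :: "nat \<Rightarrow> nat \<times> nat"
  assumes chart_data: "level_data n g J"
    and top_level: "g (0, 0) = tree_length \<Gamma>"
    and tmark_iff: "i \<in> {1..n} \<Longrightarrow> j \<in> {1..n} \<Longrightarrow> tmark \<Gamma> i \<noteq> tmark \<Gamma> j \<longleftrightarrow> g (i, j) < g (0, 0)"
    and base: "m \<le> g (0, 0) \<Longrightarrow> b m \<in> labels n" "m \<le> g (0, 0) \<Longrightarrow> g (b m) = m"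
    and base_top: "b (g (0, 0)) = (0, 0)"
begin

text \<open>\<open>U_chart\<close> in terms of level data: monotonicity of the levels is the
  existence of a contraction, nonvanishing of the periods is the condition on
  \<open>Pi_map\<close>.\<close>

definition chart_domain :: "'a set" where
  "chart_domain = {K \<in> M. (\<forall>a\<in>labels n. \<forall>c\<in>labels n. g a \<le> g c \<longrightarrow> lev K a \<le> lev K c) \<and>
     (\<forall>a\<in>labels n. g a < g (0, 0) \<longrightarrow> I K a \<noteq> 0)}"

definition chart_map :: "'a \<Rightarrow> chart_coord \<Rightarrow> complex" where
  "chart_map K = (\<lambda>k\<in>chart_index n \<Gamma>. case k of
     Zc i j \<Rightarrow> I K (i, j) / I K (b (g (i, j)))
   | Tc m \<Rightarrow> if lev K (b m) = lev K (b (m - 1)) then I K (b m) / I K (b (m - 1)) else 0)"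

text \<open>These are the labels whose coordinate cannot vanish on the chart. On the top level of
  \<open>\<Gamma>\<close> periods of pairs may be 0, so only \<open>(0, 0)\<close> qualifies
  there.\<close>

definition dominant :: "(nat \<times> nat) set \<Rightarrow> nat \<times> nat \<Rightarrow> bool" where
  "dominant S a \<longleftrightarrow> a \<in> S \<and> (\<forall>c\<in>S. g a \<le> g c) \<and> (g a = g (0, 0) \<longrightarrow> a = (0, 0))"

definition chart_points :: "(chart_coord \<Rightarrow> complex) set" where
  "chart_points = {x \<in> chart_index n \<Gamma> \<rightarrow>\<^sub>E UNIV.
        \<forall>i j. 1 \<le> i \<and> i < j \<and> j \<le> n \<and> tmark \<Gamma> i \<noteq> tmark \<Gamma> j \<longrightarrow> x (Zc i j) \<noteq> 0}"

section \<open>The domain of a chart as a principal open set\<close>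

lemma dominant_ex:
  assumes S: "S \<in> \<K>"
  obtains a where "dominant S a"
proof -
  have "Min (g ` S) \<in> g ` S" using label_setsD[OF S] by (intro Min_in) auto
  then obtain a where a: "a \<in> S" "g a = Min (g ` S)" by auto
  have le: "g a \<le> g c" if "c \<in> S" for c
    using a that label_setsD[OF S] by simp
  show ?thesis
  proof (cases "g a = g (0, 0)")
    case True
    then show ?thesis using that[of "(0, 0)"] le label_setsD[OF S] by (auto simp: dominant_def)
  next
    case False
    then show ?thesis using that[of a] le a by (auto simp: dominant_def)
  qed
qed

lemma dominant_Min: "S \<in> \<K> \<Longrightarrow> dominant S a \<Longrightarrow> Min (g ` S) = g a"
  using label_setsD[of S n] by (intro Min_eqI) (auto simp: dominant_def)

lemma dominant_label: "S \<in> \<K> \<Longrightarrow> dominant S a \<Longrightarrow> a \<in> labels n"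
  using label_setsD(4)[of S n] by (auto simp: dominant_def)

lemma g_le: "a \<in> labels n \<Longrightarrow> g a \<le> g (0, 0)"
  by (rule level_data_le[OF chart_data])

lemma I_star: "K \<in> M \<Longrightarrow> I K (0, 0) = 1"
  using data by (simp add: level_data_def)

text \<open>A nonzero coordinate says that its label is lowest in \<open>S\<close> and has a nonzero
  period; applied to the sets \<open>{(0, 0), a, c}\<close> this returns both conditions of
  \<open>chart_domain\<close>.\<close>

lemma chart_domain_iff:
  assumes K: "K \<in> M"
  shows "K \<in> chart_domain \<longleftrightarrow> (\<forall>S\<in>\<K>. \<forall>a. dominant S a \<longrightarrow> W K S a \<noteq> 0)"
proof
  assume "K \<in> chart_domain"
  then have mono: "\<And>a c. a \<in> labels n \<Longrightarrow> c \<in> labels n \<Longrightarrow> g a \<le> g c \<Longrightarrow> lev K a \<le> lev K c"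
    and nz: "\<And>a. a \<in> labels n \<Longrightarrow> g a < g (0, 0) \<Longrightarrow> I K a \<noteq> 0"
    by (auto simp: chart_domain_def)
  show "\<forall>S\<in>\<K>. \<forall>a. dominant S a \<longrightarrow> W K S a \<noteq> 0"
  proof (intro ballI allI impI)
    fix S a assume S: "S \<in> \<K>" and a: "dominant S a"
    have aS: "a \<in> S" using a by (simp add: dominant_def)
    have "I K a \<noteq> 0"
      using nz[of a] a dominant_label[OF S a] g_le[of a] I_star[OF K] by (fastforce simp: dominant_def)
    moreover have "\<forall>c\<in>S. lev K a \<le> lev K c"
      using mono[OF dominant_label[OF S a]] a label_setsD(4)[OF S] unfolding dominant_def by blast
    ultimately show "W K S a \<noteq> 0" using W_nonzero_iff[OF K S aS] by blast
  qed
next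
  assume *: "\<forall>S\<in>\<K>. \<forall>a. dominant S a \<longrightarrow> W K S a \<noteq> 0"
  have D: "(\<forall>c\<in>S. lev K a \<le> lev K c) \<and> I K a \<noteq> 0" if "S \<in> \<K>" "dominant S a" for S a
  proof -
    have "a \<in> S" using that by (simp add: dominant_def)
    then show ?thesis using *[rule_format, OF that] W_nonzero_iff[OF K that(1)] by blast
  qed
  have "lev K a \<le> lev K c" if ac: "a \<in> labels n" "c \<in> labels n" "g a \<le> g c" for a c
  proof (cases "g a = g (0, 0)")
    case True
    then have "dominant {(0, 0), c, c} (0, 0)" using ac g_le[of c] by (auto simp: dominant_def)
    then have "lev K (0, 0) \<le> lev K c" using D[OF label_sets_triple[OF ac(2,2)]] by auto
    then show ?thesis using level_data_le[OF data[OF K] ac(1)] by linarith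
  next
    case False
    then have "dominant {(0, 0), a, c} a" using ac g_le[of a] by (auto simp: dominant_def)
    then show ?thesis using D[OF label_sets_triple[OF ac(1,2)]] by auto
  qed
  moreover have "I K a \<noteq> 0" if a: "a \<in> labels n" "g a < g (0, 0)" for a
  proof -
    have "dominant {(0, 0), a, a} a" using a by (auto simp: dominant_def)
    then show ?thesis using D[OF label_sets_triple[OF a(1,1)]] by auto
  qed
  ultimately show "K \<in> chart_domain" using K by (auto simp: chart_domain_def)
qed

definition dominant_choices :: "((nat \<times> nat) set \<Rightarrow> nat \<times> nat) set" where
  "dominant_choices = {\<phi> \<in> \<Phi>. \<forall>S\<in>\<K>. dominant S (\<phi> S)}"

lemma dominant_choices_ex:
  obtains \<phi> where "\<phi> \<in> dominant_choices"
proof -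
  have "\<forall>S\<in>\<K>. \<exists>a. dominant S a" using dominant_ex by blast
  then obtain f where "\<forall>S\<in>\<K>. dominant S (f S)" by metis
  then have "restrict f \<K> \<in> dominant_choices"
    by (auto simp: dominant_choices_def \<Phi>_def dominant_def)
  then show ?thesis by (rule that)
qed

lemma dominant_choices_upd:
  "\<phi> \<in> dominant_choices \<Longrightarrow> S \<in> \<K> \<Longrightarrow> dominant S a \<Longrightarrow> \<phi>(S := a) \<in> dominant_choices"
  using \<Phi>_upd[of \<phi> S a] by (auto simp: dominant_choices_def dominant_def)

lemma coord_index: "\<phi> \<in> \<Phi> \<Longrightarrow> coord K (index \<phi>) = segre \<K> (W K) \<phi>"
  by (simp add: coord_def index)

lemma chart_domain_choices:
  assumes K: "K \<in> M"
  shows "K \<in> chart_domain \<longleftrightarrow> (\<forall>\<phi>\<in>dominant_choices. segre \<K> (W K) \<phi> \<noteq> 0)"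
proof
  assume "K \<in> chart_domain"
  then show "\<forall>\<phi>\<in>dominant_choices. segre \<K> (W K) \<phi> \<noteq> 0"
    using chart_domain_iff[OF K] unfolding segre_nonzero_iff[OF finite_label_sets] dominant_choices_def
    by blast
next
  assume *: "\<forall>\<phi>\<in>dominant_choices. segre \<K> (W K) \<phi> \<noteq> 0"
  obtain \<phi> where \<phi>: "\<phi> \<in> dominant_choices" using dominant_choices_ex .
  have "W K S a \<noteq> 0" if "S \<in> \<K>" "dominant S a" for S a
    using *[rule_format, OF dominant_choices_upd[OF \<phi> that]] that by (auto simp: segre_nonzero_iff)
  then show "K \<in> chart_domain" using chart_domain_iff[OF K] by blast
qed

text \<open>A single form cuts out the complement: the product of the finitely many Segre
  coordinates all of whose choices are dominant.\<close>

lemma chart_domain_open: "fraction_open M fractions chart_domain"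
proof -
  define q where "q = (\<lambda>v. \<Prod>\<phi>\<in>dominant_choices. v (index \<phi>) :: complex)"
  have fin: "finite dominant_choices"
    using finite_subset[OF _ finite_\<Phi>] by (auto simp: dominant_choices_def)
  have "homogeneous_fn {..N} (\<Sum>\<phi>\<in>dominant_choices. 1) q"
    unfolding q_def by (intro homogeneous_fn_prod fin homogeneous_index) (simp add: dominant_choices_def)
  then have "(\<lambda>K. q (coord K), \<lambda>K. q (coord K)) \<in> fractions" by (intro projective_fractionsI)
  then have "fraction_open M fractions {K \<in> M. q (coord K) \<noteq> 0}" by (rule fraction_open_basic)
  moreover have "q (coord K) \<noteq> 0 \<longleftrightarrow> K \<in> chart_domain" if "K \<in> M" for K
    using chart_domain_choices[OF that] fin
    by (auto simp: q_def dominant_choices_def coord_index)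
  then have "{K \<in> M. q (coord K) \<noteq> 0} = chart_domain" by (auto simp: chart_domain_def)
  ultimately show ?thesis by simp
qed

lemma chart_domain_subset: "chart_domain \<subseteq> M"
  by (auto simp: chart_domain_def)

lemma chart_domainD:
  assumes "K \<in> chart_domain"
  shows "a \<in> labels n \<Longrightarrow> c \<in> labels n \<Longrightarrow> g a \<le> g c \<Longrightarrow> lev K a \<le> lev K c"
    "a \<in> labels n \<Longrightarrow> g a < g (0, 0) \<Longrightarrow> I K a \<noteq> 0" "K \<in> M"
    "m \<le> g (0, 0) \<Longrightarrow> I K (b m) \<noteq> 0"
    "a \<in> labels n \<Longrightarrow> c \<in> labels n \<Longrightarrow> g a = g c \<Longrightarrow> lev K a = lev K c"
proof -
  show K: "K \<in> M" and *: "a \<in> labels n \<Longrightarrow> g a < g (0, 0) \<Longrightarrow> I K a \<noteq> 0" for a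
    using assms by (auto simp: chart_domain_def)
  show mono: "a \<in> labels n \<Longrightarrow> c \<in> labels n \<Longrightarrow> g a \<le> g c \<Longrightarrow> lev K a \<le> lev K c" for a c
    using assms by (auto simp: chart_domain_def)
  show "m \<le> g (0, 0) \<Longrightarrow> I K (b m) \<noteq> 0"
    using *[of "b m"] base[of m] base_top I_star[OF K] by (cases "m = g (0, 0)") auto
  show "a \<in> labels n \<Longrightarrow> c \<in> labels n \<Longrightarrow> g a = g c \<Longrightarrow> lev K a = lev K c"
    using mono[of a c] mono[of c a] by simp
qed

lemma dominant_base:
  assumes "a \<in> labels n" "m \<le> g a"
  shows "dominant {(0, 0), a, b m} (b m)" "{(0, 0), a, b m} \<in> \<K>"
proof -
  have m: "m \<le> g (0, 0)" using assms g_le[of a] by simp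
  show "{(0, 0), a, b m} \<in> \<K>" using label_sets_triple[OF assms(1) base(1)[OF m]] .
  show "dominant {(0, 0), a, b m} (b m)"
    using base[OF m] m assms base_top by (auto simp: dominant_def)
qed

text \<open>A ratio of two coordinates of one factor becomes 0 by itself when the levels of
  \<open>a\<close> and \<open>b m\<close> differ. This matches the case distinction in the
  definition of the coordinates \<open>t_m\<close>.\<close>

lemma W_ratio:
  assumes K: "K \<in> chart_domain" and a: "a \<in> labels n" "m \<le> g a"
  defines "S \<equiv> {(0, 0), a, b m}"
  shows "W K S (b m) \<noteq> 0"
    "W K S a / W K S (b m) = (if lev K a = lev K (b m) then I K a / I K (b m) else 0)"
proof -
  have S: "S \<in> \<K>" "dominant S (b m)" unfolding S_def using dominant_base[OF a] by auto
  show nz: "W K S (b m) \<noteq> 0" using chart_domain_iff[of K] K S chart_domainD(3)[OF K] by blast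
  then have "Min (lev K ` S) = lev K (b m)"
    by (auto simp: W_def leading_part_def level_part_def split: if_splits)
  then show "W K S a / W K S (b m) = (if lev K a = lev K (b m) then I K a / I K (b m) else 0)"
    by (auto simp: W_def leading_part_def level_part_def)
qed

text \<open>Two Segre coordinates that differ only in the label chosen from \<open>S\<close> share
  all other factors, and these cancel.\<close>

lemma ratio_fraction:
  assumes a: "a \<in> labels n" "m \<le> g a"
  defines "S \<equiv> {(0, 0), a, b m}"
  shows "\<exists>p q. (p, q) \<in> fractions \<and> (\<forall>K\<in>chart_domain. q K \<noteq> 0 \<and> W K S a / W K S (b m) = p K / q K)"
proof -
  obtain \<phi> where \<phi>: "\<phi> \<in> dominant_choices" using dominant_choices_ex .
  have S: "S \<in> \<K>" "dominant S (b m)" "a \<in> S" "b m \<in> S" unfolding S_def using dominant_base[OF a] by auto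
  have up: "\<phi>(S := a) \<in> \<Phi>" "\<phi>(S := b m) \<in> \<Phi>"
    using \<phi> S by (auto simp: dominant_choices_def intro!: \<Phi>_upd)
  have "(\<lambda>K. coord K (index (\<phi>(S := a))), \<lambda>K. coord K (index (\<phi>(S := b m)))) \<in> fractions"
    by (intro coordinate_fraction index up)
  moreover have "coord K (index (\<phi>(S := b m))) \<noteq> 0 \<and>
      W K S a / W K S (b m) = coord K (index (\<phi>(S := a))) / coord K (index (\<phi>(S := b m)))"
    if K: "K \<in> chart_domain" for K
  proof -
    have KM: "K \<in> M" using chart_domainD(3)[OF K] .
    have nz: "segre \<K> (W K) (\<phi>(S := b m)) \<noteq> 0"
      using chart_domain_choices[OF KM] K dominant_choices_upd[OF \<phi> S(1,2)] by blast
    then show ?thesis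
      using S(1) up by (simp add: coord_index segre_update)
  qed
  ultimately show ?thesis by blast
qed

text \<open>The pair and its reference label have the same level in \<open>\<Gamma>\<close>, hence
  also on the curve, so the ratio is never cut to 0.\<close>

lemma chart_map_Zc:
  assumes K: "K \<in> chart_domain" and ij: "1 \<le> i" "i < j" "j \<le> n"
  shows "chart_map K (Zc i j) = W K {(0, 0), (i, j), b (g (i, j))} (i, j) /
    W K {(0, 0), (i, j), b (g (i, j))} (b (g (i, j)))"
proof -
  have l: "(i, j) \<in> labels n" using ij by (auto simp: labels_def)
  have "lev K (i, j) = lev K (b (g (i, j)))"
    by (rule chart_domainD(5)[OF K l]) (use base g_le[OF l] in auto)
  then show ?thesis
    using W_ratio(2)[OF K l order_refl] ij by (simp add: chart_map_def chart_index_def)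
qed

lemma chart_map_Tc:
  assumes K: "K \<in> chart_domain" and m: "1 \<le> m" "m \<le> tree_length \<Gamma>"
  shows "chart_map K (Tc m) = W K {(0, 0), b m, b (m - 1)} (b m) / W K {(0, 0), b m, b (m - 1)} (b (m - 1))"
  using W_ratio(2)[OF K, of "b m" "m - 1"] m base[of m] top_level
  by (simp add: chart_map_def chart_index_def)

text \<open>The normalized period \<open>I a / s_m\<close> on the level \<open>m\<close> of
  \<open>a\<close>, as a function of the chart coordinates; periods are antisymmetric, so the
  coordinates with \<open>i < j\<close> suffice.\<close>

definition coeff :: "(chart_coord \<Rightarrow> complex) \<Rightarrow> nat \<times> nat \<Rightarrow> complex" where
  "coeff u a = (if a = (0, 0) then 1 else if fst a < snd a then u (Zc (fst a) (snd a))
     else if snd a < fst a then - u (Zc (snd a) (fst a)) else 0)"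

text \<open>The product of the \<open>t_m\<close> is the ratio of the scales of the level of
  \<open>a\<close> and of the lowest level of \<open>S\<close>. So this is the vector of the factor
  \<open>S\<close>, normalized by the scale of its lowest level; it is polynomial because no
  \<open>t_m\<close> is inverted.\<close>

definition chart_family :: "(chart_coord \<Rightarrow> complex) \<Rightarrow> (nat \<times> nat) set \<Rightarrow> nat \<times> nat \<Rightarrow> complex" where
  "chart_family u S a = coeff u a * (\<Prod>m\<in>{Min (g ` S)<..g a}. u (Tc m))"

lemma coeff_chart_map:
  assumes K: "K \<in> chart_domain" and a: "a \<in> labels n"
  shows "coeff (chart_map K) a = I K a / I K (b (g a))"
proof -
  note D = data[OF chart_domainD(3)[OF K]]
  obtain i j where ij: "a = (i, j)" by fastforce
  consider "a = (0, 0)" | "1 \<le> i" "i \<le> n" "1 \<le> j" "j \<le> n" using a ij by (auto simp: labels_def)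
  then show ?thesis
  proof cases
    case 1
    then show ?thesis using I_star[OF chart_domainD(3)[OF K]] by (simp add: coeff_def base_top)
  next
    case 2
    then have ij': "i \<in> {1..n}" "j \<in> {1..n}" by auto
    consider "i < j" | "i = j" | "j < i" by linarith
    then show ?thesis
    proof cases
      case 1
      then show ?thesis using 2 ij by (simp add: coeff_def chart_map_def chart_index_def)
    next
      case 2
      then show ?thesis
        using ij level_data_diag[OF D ij'(1)] \<open>1 \<le> i\<close> by (simp add: coeff_def)
    next
      case 3
      then show ?thesis
        using ij 2 level_data_sym[OF D ij'] level_data_sym[OF chart_data ij']
        by (simp add: coeff_def chart_map_def chart_index_def)
    qed
  qed
qed

text \<open>Quotients of consecutive scales telescope. If two consecutive levels between
  \<open>\<mu>\<close> and \<open>k\<close> stay distinct on the curve, one factor is 0, and by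
  monotonicity the levels of \<open>b \<mu>\<close> and \<open>b k\<close> differ as well.\<close>

lemma prod_chart_map:
  assumes K: "K \<in> chart_domain" and le: "\<mu> \<le> k" "k \<le> g (0, 0)"
  shows "(\<Prod>m\<in>{\<mu><..k}. chart_map K (Tc m)) = (if lev K (b k) = lev K (b \<mu>) then I K (b k) / I K (b \<mu>) else 0)"
  using le
proof (induction k rule: dec_induct)
  case base
  then show ?case using chart_domainD(4)[OF K] by simp
next
  case (step k)
  have "{\<mu><..Suc k} = insert (Suc k) {\<mu><..k}" using step by auto
  then have "(\<Prod>m\<in>{\<mu><..Suc k}. chart_map K (Tc m)) =
      chart_map K (Tc (Suc k)) * (\<Prod>m\<in>{\<mu><..k}. chart_map K (Tc m))" by simp
  also have "\<dots> = (if lev K (b (Suc k)) = lev K (b k) then I K (b (Suc k)) / I K (b k) else 0) *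
      (if lev K (b k) = lev K (b \<mu>) then I K (b k) / I K (b \<mu>) else 0)"
    using step top_level by (simp add: chart_map_def chart_index_def)
  also have "\<dots> = (if lev K (b (Suc k)) = lev K (b \<mu>) then I K (b (Suc k)) / I K (b \<mu>) else 0)"
  proof -
    have "lev K (b \<mu>) \<le> lev K (b k)" "lev K (b k) \<le> lev K (b (Suc k))"
      by (rule chart_domainD(1)[OF K]; use base step in simp)+
    then show ?thesis using chart_domainD(4)[OF K, of k] step by auto
  qed
  finally show ?case .
qed

lemma chart_family_chart_map:
  assumes K: "K \<in> chart_domain"
  shows "scaled_family \<K> (\<lambda>S. S) (chart_family (chart_map K)) (W K)"
  unfolding scaled_family_def
proof (intro exI[of _ "\<lambda>S. 1 / I K (b (Min (g ` S)))"] ballI conjI)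
  fix S assume S: "S \<in> \<K>"
  obtain a0 where a0: "dominant S a0" using dominant_ex[OF S] .
  define \<mu> where "\<mu> = Min (g ` S)"
  have \<mu>: "\<mu> = g a0" unfolding \<mu>_def by (rule dominant_Min[OF S a0])
  have l0: "a0 \<in> labels n" using dominant_label[OF S a0] .
  have \<mu>le: "\<mu> \<le> g (0, 0)" using g_le[OF l0] \<mu> by simp
  show "1 / I K (b (Min (g ` S))) \<noteq> 0"
    using chart_domainD(4)[OF K \<mu>le] by (simp add: \<mu>_def)
  have lev\<mu>: "lev K a0 = lev K (b \<mu>)"
    by (rule chart_domainD(5)[OF K l0]) (use base \<mu>le \<mu> in auto)
  have Min: "Min (lev K ` S) = lev K (b \<mu>)"
    unfolding lev\<mu>[symmetric] using a0 label_setsD[OF S] chart_domainD(1)[OF K l0]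
    by (intro Min_eqI) (auto simp: dominant_def)
  fix a assume a: "a \<in> S"
  have l: "a \<in> labels n" using a label_setsD[OF S] by blast
  have lev: "lev K a = lev K (b (g a))"
    by (rule chart_domainD(5)[OF K l]) (use base g_le[OF l] in auto)
  have "\<mu> \<le> g a" using a0 a \<mu> by (auto simp: dominant_def)
  then have "chart_family (chart_map K) S a = I K a / I K (b (g a)) *
      (if lev K (b (g a)) = lev K (b \<mu>) then I K (b (g a)) / I K (b \<mu>) else 0)"
    using prod_chart_map[OF K _ g_le[OF l], of \<mu>] coeff_chart_map[OF K l]
    by (simp add: chart_family_def \<mu>_def)
  also have "\<dots> = (if lev K a = lev K (b \<mu>) then I K a else 0) / I K (b \<mu>)"
    using chart_domainD(4)[OF K g_le[OF l]] lev by simp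
  finally show "chart_family (chart_map K) S a = 1 / I K (b (Min (g ` S))) * W K S a"
    by (simp add: W_def leading_part_def level_part_def Min \<mu>_def)
qed

lemma polynomial_coeff:
  assumes "a \<in> labels n"
  shows "polynomial_fn (chart_index n \<Gamma>) (\<lambda>u. coeff u a)"
proof -
  have v: "polynomial_fn (chart_index n \<Gamma>) (\<lambda>u. u (Zc i j))" if "1 \<le> i" "i < j" "j \<le> n" for i j
    by (rule polynomial_fn.intros(2)) (use that in \<open>simp add: chart_index_def\<close>)
  obtain i j where ij: "a = (i, j)" by fastforce
  consider "a = (0, 0)" | "1 \<le> i" "i < j" "j \<le> n" | "a \<noteq> (0, 0)" "i = j" | "1 \<le> j" "j < i" "i \<le> n"
    by (cases i j rule: linorder_cases) (use assms in \<open>auto simp: ij labels_def\<close>)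
  then show ?thesis
    by cases (auto simp: ij coeff_def intro!: polynomial_fn.intros(1) v polynomial_fn_uminus)
qed

lemma polynomial_chart_family:
  assumes "a \<in> labels n"
  shows "polynomial_fn (chart_index n \<Gamma>) (\<lambda>u. chart_family u S a)"
  unfolding chart_family_def
proof (intro polynomial_fn.intros(4) polynomial_coeff assms polynomial_fn_prod)
  fix m assume "m \<in> {Min (g ` S)<..g a}"
  then show "polynomial_fn (chart_index n \<Gamma>) (\<lambda>u. u (Tc m))"
    using g_le[OF assms] top_level by (intro polynomial_fn.intros(2)) (simp add: chart_index_def)
qed

text \<open>The relations of a compatible family, pulled back along \<open>chart_family\<close>, and
  the normalization at the reference pairs. The latter removes the freedom of rescaling the
  \<open>z_ij\<close> of a level against the neighbouring \<open>t_m\<close>.\<close>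

definition chart_equations :: "((chart_coord \<Rightarrow> complex) \<Rightarrow> complex) set" where
  "chart_equations =
     {(\<lambda>u. chart_family u S a * chart_family u T c - chart_family u S c * chart_family u T a) | S T a c.
        S \<in> \<K> \<and> T \<in> \<K> \<and> S \<subseteq> T \<and> a \<in> S \<and> c \<in> S} \<union>
     {(\<lambda>u. chart_family u S (i, j) + chart_family u S (j, k) - chart_family u S (i, k)) | S i j k.
        S \<in> \<K> \<and> i \<in> {1..n} \<and> j \<in> {1..n} \<and> k \<in> {1..n} \<and> (i, j) \<in> S \<and> (j, k) \<in> S \<and> (i, k) \<in> S} \<union>
     {(\<lambda>u. coeff u (b m) - 1) | m. m \<le> g (0, 0)}"

lemma polynomial_chart_equations:
  assumes "q \<in> chart_equations"
  shows "polynomial_fn (chart_index n \<Gamma>) q"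
proof -
  have l: "a \<in> labels n" if "S \<in> \<K>" "a \<in> S" for S a using label_setsD(4) that by blast
  show ?thesis
    using assms unfolding chart_equations_def
    by (auto intro!: polynomial_fn.intros(1) polynomial_fn.intros(3) polynomial_fn.intros(4)
        polynomial_fn_diff polynomial_chart_family polynomial_coeff l base)
qed

lemma coeff_dominant:
  assumes "u \<in> chart_points" "S \<in> \<K>" "dominant S a"
  shows "coeff u a \<noteq> 0"
proof (cases "a = (0, 0)")
  case False
  obtain i j where ij: "a = (i, j)" by fastforce
  have l: "a \<in> labels n" using dominant_label assms by blast
  then have ij': "i \<in> {1..n}" "j \<in> {1..n}" using ij False by (auto simp: labels_def)
  have lt: "g a < g (0, 0)" using assms(3) False g_le[OF l] by (auto simp: dominant_def)
  then have ne: "tmark \<Gamma> i \<noteq> tmark \<Gamma> j" using tmark_iff[OF ij'] ij by simp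
  then have "i \<noteq> j" by auto
  then show ?thesis
    using ne ij' assms(1) False ij unfolding coeff_def chart_points_def
    by (cases i j rule: linorder_cases) auto
qed (simp add: coeff_def)

lemma chart_family_dominant:
  assumes "u \<in> chart_points" "S \<in> \<K>" "dominant S a"
  shows "chart_family u S a \<noteq> 0"
  using coeff_dominant[OF assms] dominant_Min[OF assms(2,3)] by (simp add: chart_family_def)

lemma chart_map_in_chart_points:
  assumes K: "K \<in> chart_domain"
  shows "chart_map K \<in> chart_points"
  unfolding chart_points_def
proof (intro CollectI conjI allI impI)
  fix i j assume ij: "1 \<le> i \<and> i < j \<and> j \<le> n \<and> tmark \<Gamma> i \<noteq> tmark \<Gamma> j"
  then have l: "(i, j) \<in> labels n" "g (i, j) < g (0, 0)"
    using tmark_iff[of i j] by (auto simp: labels_def)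
  show "chart_map K (Zc i j) \<noteq> 0"
    using ij chart_domainD(2)[OF K l] chart_domainD(4)[OF K, of "g (i, j)"] l(2)
    by (simp add: chart_map_def chart_index_def)
qed (auto simp: chart_map_def)

lemma chart_equations_chart_map:
  assumes K: "K \<in> chart_domain" and q: "q \<in> chart_equations"
  shows "q (chart_map K) = 0"
proof -
  obtain c where c: "\<And>S a. S \<in> \<K> \<Longrightarrow> a \<in> S \<Longrightarrow> chart_family (chart_map K) S a = c S * W K S a"
    using chart_family_chart_map[OF K] unfolding scaled_family_def by blast
  note comp = W_compatible[OF chart_domainD(3)[OF K], unfolded compatible_family_def, THEN conjunct2]
  have 1: "q (chart_map K) = 0"
    if "q = (\<lambda>u. chart_family u S a * chart_family u T d - chart_family u S d * chart_family u T a)"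
      "S \<in> \<K>" "T \<in> \<K>" "S \<subseteq> T" "a \<in> S" "d \<in> S" for S T a d
  proof -
    have "a \<in> T" "d \<in> T" using that by auto
    moreover have "W K S a * W K T d = W K S d * W K T a"
      by (rule comp[THEN conjunct1, rule_format]) (use that in auto)
    ultimately show ?thesis using that by (simp add: c algebra_simps)
  qed
  have 2: "q (chart_map K) = 0"
    if "q = (\<lambda>u. chart_family u S (i, j) + chart_family u S (j, k) - chart_family u S (i, k))"
      "S \<in> \<K>" "i \<in> {1..n}" "j \<in> {1..n}" "k \<in> {1..n}" "(i, j) \<in> S" "(j, k) \<in> S" "(i, k) \<in> S" for S i j k
  proof -
    have "W K S (i, j) + W K S (j, k) = W K S (i, k)"
      by (rule comp[THEN conjunct2, rule_format]) (use that in auto)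
    with that show ?thesis by (simp add: c flip: distrib_left)
  qed
  have 3: "q (chart_map K) = 0" if "q = (\<lambda>u. coeff u (b m) - 1)" "m \<le> g (0, 0)" for m
    using coeff_chart_map[OF K base(1)[OF that(2)]] base(2)[OF that(2)] chart_domainD(4)[OF K that(2)] that(1)
    by simp
  show ?thesis
    using q unfolding chart_equations_def
    by (elim UnE CollectE exE conjE) (rule 1 2 3; assumption)+
qed

text \<open>A solution \<open>u\<close> of the equations yields a compatible family, hence some
  \<open>K\<close>. Its dominant coordinates are nonzero, so \<open>K\<close> lies in the chart, and
  the ratios against the reference labels return \<open>u\<close>.\<close>

lemma chart_map_image: "chart_map ` chart_domain = {u \<in> chart_points. \<forall>q\<in>chart_equations. q u = 0}"
proof (intro equalityI subsetI)
  fix u assume "u \<in> {u \<in> chart_points. \<forall>q\<in>chart_equations. q u = 0}"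
  then have u: "u \<in> chart_points" "\<And>q. q \<in> chart_equations \<Longrightarrow> q u = 0" by auto
  have "compatible_family n (chart_family u)"
    unfolding compatible_family_def
  proof (intro conjI ballI impI)
    fix S assume S: "S \<in> \<K>"
    obtain a where a: "dominant S a" using dominant_ex[OF S] .
    then have "a \<in> S" by (simp add: dominant_def)
    then show "\<exists>a\<in>S. chart_family u S a \<noteq> 0" using chart_family_dominant[OF u(1) S a] by blast
  next
    fix S T a c assume "S \<in> \<K>" "T \<in> \<K>" "S \<subseteq> T" "a \<in> S" "c \<in> S"
    then have "(\<lambda>u. chart_family u S a * chart_family u T c - chart_family u S c * chart_family u T a) \<in> chart_equations"
      unfolding chart_equations_def by blast
    from u(2)[OF this] show "chart_family u S a * chart_family u T c = chart_family u S c * chart_family u T a"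
      by simp
  next
    fix S i j k assume "S \<in> \<K>" "i \<in> {1..n}" "j \<in> {1..n}" "k \<in> {1..n}" "(i, j) \<in> S" "(j, k) \<in> S" "(i, k) \<in> S"
    then have "(\<lambda>u. chart_family u S (i, j) + chart_family u S (j, k) - chart_family u S (i, k)) \<in> chart_equations"
      unfolding chart_equations_def by blast
    from u(2)[OF this] show "chart_family u S (i, j) + chart_family u S (j, k) = chart_family u S (i, k)"
      by simp
  qed
  then obtain K where K: "K \<in> M" "scaled_family \<K> (\<lambda>S. S) (chart_family u) (W K)"
    by (rule W_exhausting)
  then obtain c where c: "\<And>S. S \<in> \<K> \<Longrightarrow> c S \<noteq> 0"
    "\<And>S a. S \<in> \<K> \<Longrightarrow> a \<in> S \<Longrightarrow> chart_family u S a = c S * W K S a"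
    unfolding scaled_family_def by blast
  have Kd: "K \<in> chart_domain"
    using chart_domain_iff[OF K(1)] chart_family_dominant[OF u(1)] c by (fastforce simp: dominant_def)
  have base1: "coeff u (b m) = 1" if "m \<le> g (0, 0)" for m
  proof -
    have "(\<lambda>u. coeff u (b m) - 1) \<in> chart_equations"
      unfolding chart_equations_def using that by blast
    from u(2)[OF this] show ?thesis by simp
  qed
  \<comment> \<open>The unknown scale of the factor \<open>S\<close> cancels. The entry at
    \<open>b m\<close> is 1 by the normalization, because \<open>m\<close> is the lowest level of
    \<open>S\<close> and the product of the \<open>t_m\<close> is empty.\<close>
  have ratio: "W K S a / W K S (b m) = coeff u a * (\<Prod>m\<in>{m<..g a}. u (Tc m))"
    if a: "a \<in> labels n" "m \<le> g a" "S = {(0, 0), a, b m}" for S a m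
  proof -
    note S = dominant_base[OF a(1,2), folded a(3)]
    have m: "m \<le> g (0, 0)" using a g_le[OF a(1)] by simp
    have "W K S a / W K S (b m) = chart_family u S a / chart_family u S (b m)"
      using c[OF S(2)] a(3) by simp
    also have "chart_family u S (b m) = 1"
      using base1[OF m] base(2)[OF m] dominant_Min[OF S(2,1)] by (simp add: chart_family_def)
    also have "chart_family u S a / 1 = coeff u a * (\<Prod>m\<in>{m<..g a}. u (Tc m))"
      using base(2)[OF m] dominant_Min[OF S(2,1)] by (simp add: chart_family_def)
    finally show ?thesis .
  qed
  have "u = chart_map K"
  proof (rule extensionalityI[of _ "chart_index n \<Gamma>"])
    fix k assume k: "k \<in> chart_index n \<Gamma>"
    then consider i j where "k = Zc i j" "1 \<le> i" "i < j" "j \<le> n"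
      | m where "k = Tc m" "1 \<le> m" "m \<le> tree_length \<Gamma>"
      by (auto simp: chart_index_def)
    then show "u k = chart_map K k"
    proof cases
      case 1
      then have "(i, j) \<in> labels n" by (auto simp: labels_def)
      then show ?thesis
        using ratio[of "(i, j)" "g (i, j)", OF _ order_refl refl] chart_map_Zc[OF Kd 1(2-4)] 1
        by (simp add: coeff_def)
    next
      case 2
      then have m: "m \<le> g (0, 0)" using top_level by simp
      have "{m - 1<..m} = {m}" using 2 by auto
      then show ?thesis
        using ratio[of "b m" "m - 1", OF base(1)[OF m] _ refl] chart_map_Tc[OF Kd 2(2,3)] 2 base1[OF m] base(2)[OF m]
        by simp
    qed
  qed (use u in \<open>auto simp: chart_points_def chart_map_def PiE_def\<close>)
  then show "u \<in> chart_map ` chart_domain" using Kd by blast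
qed (use chart_map_in_chart_points chart_equations_chart_map in auto)

lemma chart_target_eq: "chart_target n \<Gamma> = fraction_space chart_points (affine_fractions (chart_index n \<Gamma>))"
proof -
  interpret A: fraction_family "affine_fractions (chart_index n \<Gamma>)" by (rule fraction_family_affine)
  show ?thesis
    unfolding chart_target_def affine_space_eq chart_points_def[symmetric]
    by (rule A.induced_fraction_space) (auto simp: chart_points_def)
qed

theorem closed_immersion_chart_map:
  "closed_immersion chart_map (induced_space embedded_space chart_domain) (chart_target n \<Gamma>)"
  unfolding chart_target_eq induced_fraction_space[OF chart_domain_subset]
proof (rule closed_immersion_fraction_space[OF fraction_family_projective fraction_family_affine])
  show "inj_on chart_map chart_domain"
  proof (rule inj_onI)
    fix K K' assume K: "K \<in> chart_domain" "K' \<in> chart_domain" "chart_map K = chart_map K'"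
    have "scaled_family \<K> (\<lambda>S. S) (W K) (W K')"
      using scaled_family_trans[OF scaled_family_sym[OF chart_family_chart_map[OF K(1)]]]
        chart_family_chart_map[OF K(2)] K(3) by metis
    then show "K = K'" using W_separating K chart_domainD(3) by blast
  qed
  show "closedin (zariski (fraction_space chart_points (affine_fractions (chart_index n \<Gamma>))))
     (chart_map ` chart_domain)"
    unfolding chart_map_image
    by (rule closedin_fraction_space_zeros[OF fraction_family_affine])
      (simp add: affine_fractions_def polynomial_chart_equations)
  show "fraction_map chart_map chart_domain fractions (affine_fractions (chart_index n \<Gamma>))"
  proof (rule fraction_map_affine[OF fraction_family_projective])
    fix k assume "k \<in> chart_index n \<Gamma>"
    then consider i j where "k = Zc i j" "1 \<le> i" "i < j" "j \<le> n"
      | m where "k = Tc m" "1 \<le> m" "m \<le> tree_length \<Gamma>"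
      by (auto simp: chart_index_def)
    then show "\<exists>p q. (p, q) \<in> fractions \<and> (\<forall>K\<in>chart_domain. q K \<noteq> 0 \<and> chart_map K k = p K / q K)"
    proof cases
      case 1
      then have "(i, j) \<in> labels n" by (auto simp: labels_def)
      from ratio_fraction[OF this order_refl] show ?thesis
        using chart_map_Zc 1 by simp
    next
      case 2
      then have m: "m \<le> g (0, 0)" using top_level by simp
      have "m - 1 \<le> g (b m)" using base(2)[OF m] by simp
      from ratio_fraction[OF base(1)[OF m] this] show ?thesis
        using chart_map_Tc 2 by simp
    qed
  qed
  fix p' q' K
  assume "(p', q') \<in> fractions" and K: "K \<in> chart_domain" "q' K \<noteq> 0"
  then obtain d p q where pq: "homogeneous_fn {..N} d p" "homogeneous_fn {..N} d q"
    "p' = (\<lambda>x. p (coord x))" "q' = (\<lambda>x. q (coord x))"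
    by (auto elim: projective_fractionsE)
  \<comment> \<open>A Segre vector with polynomial entries. At \<open>chart_map K\<close> it is
    proportional to \<open>coord K\<close>, so quotients of forms become quotients of polynomials in
    the chart coordinates.\<close>
  define Y where "Y u i = segre \<K> (chart_family u) (enum i)" for u i
  have poly: "polynomial_fn (chart_index n \<Gamma>) (\<lambda>u. r (Y u))" if r: "homogeneous_fn {..N} d r" for r
  proof (rule polynomial_fn_subst[OF homogeneous_fn_imp_polynomial_fn[OF r]])
    fix i assume "i \<in> {..N}"
    then have "enum i S \<in> labels n" if "S \<in> \<K>" for S
      using \<Phi>_mem[OF enum_in that] label_setsD(4)[OF that] by auto
    then show "polynomial_fn (chart_index n \<Gamma>) (\<lambda>u. Y u i)"
      unfolding Y_def segre_def by (intro polynomial_fn_prod polynomial_chart_family)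
  qed
  have scale: "\<exists>c. c \<noteq> 0 \<and> (\<forall>r. homogeneous_fn {..N} d r \<longrightarrow> r (Y (chart_map K)) = c * r (coord K))"
    if K: "K \<in> chart_domain" for K
  proof -
    obtain c where c: "c \<noteq> 0" "\<And>\<phi>. \<phi> \<in> \<Phi> \<Longrightarrow> segre \<K> (chart_family (chart_map K)) \<phi> = c * segre \<K> (W K) \<phi>"
      using segre_scaled_family[OF finite_label_sets chart_family_chart_map[OF K]] unfolding \<Phi>_def by blast
    have "r (Y (chart_map K)) = c ^ d * r (coord K)" if "homogeneous_fn {..N} d r" for r
      by (rule homogeneous_fn_scale[OF that]) (use c(2) enum_in in \<open>auto simp: Y_def coord_def\<close>)
    then show ?thesis using c(1) by (intro exI[of _ "c ^ d"]) auto
  qed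
  have eq: "q (Y (chart_map L)) \<noteq> 0 \<longleftrightarrow> q' L \<noteq> 0"
    "p (Y (chart_map L)) / q (Y (chart_map L)) = p' L / q' L" if L: "L \<in> chart_domain" for L
  proof -
    obtain c where "c \<noteq> 0" "p (Y (chart_map L)) = c * p (coord L)" "q (Y (chart_map L)) = c * q (coord L)"
      using scale[OF L] pq(1,2) by blast
    then show "q (Y (chart_map L)) \<noteq> 0 \<longleftrightarrow> q' L \<noteq> 0"
      "p (Y (chart_map L)) / q (Y (chart_map L)) = p' L / q' L" using pq(3,4) by auto
  qed
  have "(\<lambda>u. p (Y u), \<lambda>u. q (Y u)) \<in> affine_fractions (chart_index n \<Gamma>)"
    using poly pq by (simp add: affine_fractions_def)
  then show "\<exists>p q. (p, q) \<in> affine_fractions (chart_index n \<Gamma>) \<and> q (chart_map K) \<noteq> 0 \<and>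
      (\<forall>K\<in>chart_domain. q (chart_map K) \<noteq> 0 \<longrightarrow> q' K \<noteq> 0 \<and> p (chart_map K) / q (chart_map K) = p' K / q' K)"
    using K eq by (intro exI conjI) (assumption, auto)
qed

end

section \<open>Differentials on the projective line with a double pole\<close>

text \<open>The derivative of a Moebius transformation, set to 0 at its pole as required of
  normalized coefficients.\<close>

definition moebius_form :: "complex \<Rightarrow> complex \<Rightarrow> complex \<Rightarrow> complex \<Rightarrow> complex \<Rightarrow> complex" where
  "moebius_form a b c d z = (if c * z + d = 0 then 0 else (a * d - b * c) / (c * z + d)\<^sup>2)"

text \<open>The pullback of \<open>dz\<close>. All differentials of a multiscaled line arise in this
  way, with \<open>\<phi>\<close> sending the pole to \<open>Infty\<close>.\<close>

definition form :: "(sphere \<Rightarrow> sphere) \<Rightarrow> complex \<Rightarrow> complex" where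
  "form \<phi> = pullback_diff \<phi> (\<lambda>_. 1)"

abbreviation affine_map :: "complex \<Rightarrow> complex \<Rightarrow> sphere \<Rightarrow> sphere" where
  "affine_map k t \<equiv> proj_moebius k t 0 1"

fun pt_val :: "sphere \<Rightarrow> complex" where
  "pt_val (Pt z) = z"
| "pt_val Infty = 0"

section \<open>Moebius transformations of the sphere and their forms\<close>

lemma proj_moebius_comp:
  assumes "a' * d' - b' * c' \<noteq> 0"
  shows "proj_moebius a b c d (proj_moebius a' b' c' d' x) =
    proj_moebius (a * a' + b * c') (a * b' + b * d') (c * a' + d * c') (c * b' + d * d') x"
proof (cases x)
  case (Pt z)
  show ?thesis
  proof (cases "c' * z + d' = 0")
    case True
    then have d': "d' = - c' * z" by (simp add: eq_neg_iff_add_eq_0 add.commute)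
    \<comment> \<open>At the pole of the inner map its numerator is nonzero because the determinant
      is, and this number cancels in the composite.\<close>
    then have "a' * d' - b' * c' = - c' * (a' * z + b')" by (simp add: algebra_simps)
    then have c': "c' \<noteq> 0" and nz: "a' * z + b' \<noteq> 0" using assms by auto
    have "(c * a' + d * c') * z + (c * b' + d * d') = c * (a' * z + b')"
      "(a * a' + b * c') * z + (a * b' + b * d') = a * (a' * z + b')"
      by (simp_all add: d' algebra_simps)
    then show ?thesis using Pt True nz by (simp add: moebius_def)
  next
    case False
    have "(c * a' + d * c') * z + (c * b' + d * d') = (c * ((a' * z + b') / (c' * z + d')) + d) * (c' * z + d')"
      "(a * a' + b * c') * z + (a * b' + b * d') = (a * ((a' * z + b') / (c' * z + d')) + b) * (c' * z + d')"
      using False by (simp_all add: field_simps)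
    then show ?thesis using Pt False by (simp add: moebius_def)
  qed
next
  case Infty
  show ?thesis
  proof (cases "c' = 0")
    case True
    then show ?thesis using Infty assms by auto
  next
    case False
    then have "c * (a' / c') + d = (c * a' + d * c') / c'" "a * (a' / c') + b = (a * a' + b * c') / c'"
      by (simp_all add: field_simps)
    then show ?thesis using Infty False by (simp add: moebius_def)
  qed
qed

lemma proj_moebius_scalar: "k \<noteq> 0 \<Longrightarrow> proj_moebius k 0 0 k = id"
  by (rule ext, case_tac x) (auto simp: moebius_def)

lemma proj_moebius_inverse:
  assumes "a * d - b * c \<noteq> 0"
  shows "proj_moebius d (-b) (-c) a \<circ> proj_moebius a b c d = id"
    "proj_moebius a b c d \<circ> proj_moebius d (-b) (-c) a = id"
proof -
  have "proj_moebius d (-b) (-c) a (proj_moebius a b c d x) = x" for x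
    unfolding proj_moebius_comp[OF assms]
    using fun_cong[OF proj_moebius_scalar[OF assms], of x] by (simp add: algebra_simps)
  moreover have "proj_moebius a b c d (proj_moebius d (-b) (-c) a x) = x" for x
  proof -
    have "d * a - (- b) * (- c) \<noteq> 0" using assms by (simp add: algebra_simps)
    note eq = proj_moebius_comp[OF this, of a b c d x]
    show ?thesis
      unfolding eq using fun_cong[OF proj_moebius_scalar[OF assms], of x] by (simp add: algebra_simps)
  qed
  ultimately show "proj_moebius d (-b) (-c) a \<circ> proj_moebius a b c d = id"
    "proj_moebius a b c d \<circ> proj_moebius d (-b) (-c) a = id" by (auto simp: fun_eq_iff)
qed

lemma sphere_autI: "a * d - b * c \<noteq> 0 \<Longrightarrow> proj_moebius a b c d \<in> sphere_aut"
  unfolding sphere_aut_def by blast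

lemma sphere_autE:
  assumes "\<phi> \<in> sphere_aut"
  obtains a b c d where "a * d - b * c \<noteq> 0" "\<phi> = proj_moebius a b c d"
  using assms unfolding sphere_aut_def by blast

lemma sphere_aut_id: "id \<in> sphere_aut"
  using sphere_autI[of 1 1 0 0] proj_moebius_scalar[of 1] by simp

lemma sphere_aut_affine_map: "k \<noteq> 0 \<Longrightarrow> affine_map k t \<in> sphere_aut"
  by (rule sphere_autI) simp

lemma sphere_aut_comp:
  assumes "\<phi> \<in> sphere_aut" "\<psi> \<in> sphere_aut"
  shows "\<phi> \<circ> \<psi> \<in> sphere_aut"
proof -
  obtain a b c d where 1: "a * d - b * c \<noteq> 0" "\<phi> = proj_moebius a b c d" using assms(1) by (rule sphere_autE)
  obtain a' b' c' d' where 2: "a' * d' - b' * c' \<noteq> 0" "\<psi> = proj_moebius a' b' c' d'" using assms(2) by (rule sphere_autE)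
  have "(a * a' + b * c') * (c * b' + d * d') - (a * b' + b * d') * (c * a' + d * c')
      = (a * d - b * c) * (a' * d' - b' * c')" by (simp add: algebra_simps)
  then have "proj_moebius (a * a' + b * c') (a * b' + b * d') (c * a' + d * c') (c * b' + d * d') \<in> sphere_aut"
    using 1 2 by (intro sphere_autI) simp
  moreover have "\<phi> \<circ> \<psi> = proj_moebius (a * a' + b * c') (a * b' + b * d') (c * a' + d * c') (c * b' + d * d')"
    by (rule ext) (simp add: 1 2(2) proj_moebius_comp[OF 2(1)])
  ultimately show ?thesis by simp
qed

lemma sphere_aut_inverse:
  assumes "\<phi> \<in> sphere_aut"
  obtains \<psi> where "\<psi> \<in> sphere_aut" "\<psi> \<circ> \<phi> = id" "\<phi> \<circ> \<psi> = id"
proof -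
  obtain a b c d where 1: "a * d - b * c \<noteq> 0" "\<phi> = proj_moebius a b c d" using assms by (rule sphere_autE)
  have "proj_moebius d (-b) (-c) a \<in> sphere_aut" by (rule sphere_autI) (use 1 in \<open>simp add: algebra_simps\<close>)
  then show ?thesis using that proj_moebius_inverse[OF 1(1)] 1(2) by blast
qed

lemma inj_sphere_aut: "\<phi> \<in> sphere_aut \<Longrightarrow> inj \<phi>"
  using sphere_aut_inverse by (metis inj_on_id inj_on_imageI2)

text \<open>Where \<open>c * z + d\<close> is nonzero the function is analytic and unchanged; at the
  zero it has a pole, where \<open>remove_sings\<close> returns 0.\<close>

lemma remove_sings_moebius_form:
  assumes "a * d - b * c \<noteq> 0"
  shows "remove_sings (moebius_form a b c d) z = moebius_form a b c d z"
proof (cases "c * z + d = 0")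
  case False
  define S where "S = {z. c * z + d \<noteq> 0}"
  have "open S" unfolding S_def by (intro open_Collect_neq continuous_intros)
  moreover have "(\<lambda>z. (a * d - b * c) / (c * z + d)\<^sup>2) holomorphic_on S"
    by (intro holomorphic_intros) (auto simp: S_def)
  then have "moebius_form a b c d holomorphic_on S"
    by (rule holomorphic_transform) (auto simp: moebius_form_def S_def)
  ultimately have "moebius_form a b c d analytic_on {z}"
    using False analytic_at[of "moebius_form a b c d" z] by (auto simp: S_def)
  then show ?thesis by simp
next
  case True
  then have c: "c \<noteq> 0" using assms by auto
  then have d: "d = - c * z" using True by (simp add: eq_neg_iff_add_eq_0 add.commute)
  have "is_pole (\<lambda>w. ((a * d - b * c) / c\<^sup>2) * (1 / (w - z) ^ 2)) z"
    by (rule is_pole_cmult_iff[THEN iffD2, OF _ is_pole_inverse_power]) (use assms c in auto)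
  moreover have "((a * d - b * c) / c\<^sup>2) * (1 / (w - z) ^ 2) = moebius_form a b c d w" if "w \<noteq> z" for w
  proof -
    have "c * w + d = c * (w - z)" by (simp add: d algebra_simps)
    then show ?thesis using c that by (simp add: moebius_form_def power_mult_distrib)
  qed
  then have "eventually (\<lambda>w. ((a * d - b * c) / c\<^sup>2) * (1 / (w - z) ^ 2) = moebius_form a b c d w) (at z)"
    by (auto simp: eventually_at intro!: exI[of _ 1])
  note is_pole_cong[OF this refl]
  ultimately have "is_pole (moebius_form a b c d) z" by blast
  then show ?thesis using True by (simp add: moebius_form_def)
qed

text \<open>Away from the pole of the inner map this is the chain rule. \<open>remove_sings\<close>
  depends only on punctured neighbourhoods, so the single exceptional point is harmless.\<close>

lemma pullback_moebius_form:
  assumes 1: "a * d - b * c \<noteq> 0" and 2: "a' * d' - b' * c' \<noteq> 0"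
  shows "pullback_diff (proj_moebius a' b' c' d') (moebius_form a b c d) =
    moebius_form (a * a' + b * c') (a * b' + b * d') (c * a' + d * c') (c * b' + d * d')"
proof
  fix z0
  let ?f = "proj_moebius a' b' c' d'"
  let ?h = "\<lambda>z. moebius_form a b c d (affine_part ?f z) * deriv (affine_part ?f) z"
  let ?k = "moebius_form (a * a' + b * c') (a * b' + b * d') (c * a' + d * c') (c * b' + d * d')"
  have det: "(a * a' + b * c') * (c * b' + d * d') - (a * b' + b * d') * (c * a' + d * c')
      = (a * d - b * c) * (a' * d' - b' * c')" by (simp add: algebra_simps)
  have eq: "?h z = ?k z" if z: "c' * z + d' \<noteq> 0" for z
  proof -
    define S where "S = {z. c' * z + d' \<noteq> 0}"
    have "open S" unfolding S_def by (intro open_Collect_neq continuous_intros)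
    moreover have "((\<lambda>z. (a' * z + b') / (c' * z + d')) has_field_derivative (a' * d' - b' * c') / (c' * z + d')\<^sup>2) (at z)"
      using z by (auto intro!: derivative_eq_intros simp: field_simps power2_eq_square)
    ultimately have "(affine_part ?f has_field_derivative (a' * d' - b' * c') / (c' * z + d')\<^sup>2) (at z)"
      using z by (rule_tac has_field_derivative_transform_within_open[where S = S])
        (auto simp: S_def affine_part_def moebius_def)
    then have der: "deriv (affine_part ?f) z = (a' * d' - b' * c') / (c' * z + d')\<^sup>2"
      by (rule DERIV_imp_deriv)
    have ap: "affine_part ?f z = (a' * z + b') / (c' * z + d')"
      using z by (simp add: affine_part_def moebius_def)
    have fac: "(c * a' + d * c') * z + (c * b' + d * d') = (c * ((a' * z + b') / (c' * z + d')) + d) * (c' * z + d')"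
      using z by (simp add: field_simps)
    show ?thesis
      unfolding der ap moebius_form_def fac det using z by (simp add: power_mult_distrib)
  qed
  have "\<exists>w. \<forall>z. c' * z + d' = 0 \<longrightarrow> z = w"
    using 2 by (cases "c' = 0") (auto intro!: exI[of _ "- d' / c'"] simp: field_simps eq_neg_iff_add_eq_0)
  then obtain w where w: "\<And>z. c' * z + d' = 0 \<Longrightarrow> z = w" by blast
  have "eventually (\<lambda>z. z \<noteq> w) (at z0)"
    by (cases "z0 = w") (auto simp: eventually_neq_at_within)
  then have "eventually (\<lambda>z. ?h z = ?k z) (at z0)"
    by (rule eventually_mono) (use eq w in blast)
  then have "remove_sings ?h z0 = remove_sings ?k z0"
    by (intro remove_sings_cong) auto
  also have "\<dots> = ?k z0"
    by (rule remove_sings_moebius_form) (use 1 2 det in simp)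
  finally show "pullback_diff ?f (moebius_form a b c d) z0 = ?k z0"
    by (simp add: pullback_diff_def)
qed

lemma moebius_form_one: "moebius_form 1 t 0 1 = (\<lambda>_. 1)"
  by (auto simp: moebius_form_def)

lemma form_proj_moebius:
  assumes "a * d - b * c \<noteq> 0"
  shows "form (proj_moebius a b c d) = moebius_form a b c d"
  using pullback_moebius_form[of 1 1 0 0 a d b c] assms moebius_form_one[of 0] by (simp add: form_def)

lemma form_id: "form id = (\<lambda>_. 1)"
  using form_proj_moebius[of 1 1 0 0] proj_moebius_scalar[of 1] moebius_form_one[of 0] by simp

lemma pullback_form:
  assumes "\<phi> \<in> sphere_aut" "f \<in> sphere_aut"
  shows "pullback_diff f (form \<phi>) = form (\<phi> \<circ> f)"
proof -
  obtain a b c d where 1: "a * d - b * c \<noteq> 0" "\<phi> = proj_moebius a b c d" using assms(1) by (rule sphere_autE)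
  obtain a' b' c' d' where 2: "a' * d' - b' * c' \<noteq> 0" "f = proj_moebius a' b' c' d'" using assms(2) by (rule sphere_autE)
  have comp: "\<phi> \<circ> f = proj_moebius (a * a' + b * c') (a * b' + b * d') (c * a' + d * c') (c * b' + d * d')"
    by (rule ext) (simp add: 1 2(2) proj_moebius_comp[OF 2(1)])
  have "(a * a' + b * c') * (c * b' + d * d') - (a * b' + b * d') * (c * a' + d * c')
      = (a * d - b * c) * (a' * d' - b' * c')" by (simp add: algebra_simps)
  then have "form (\<phi> \<circ> f) = moebius_form (a * a' + b * c') (a * b' + b * d') (c * a' + d * c') (c * b' + d * d')"
    unfolding comp using 1 2 by (intro form_proj_moebius) simp
  then show ?thesis
    using pullback_moebius_form[OF 1(1) 2(1)] form_proj_moebius[OF 1(1)] 1(2) 2(2) by simp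
qed

lemma form_affine_comp:
  assumes "\<phi> \<in> sphere_aut" "k \<noteq> 0"
  shows "form (affine_map k t \<circ> \<phi>) = (\<lambda>z. k * form \<phi> z)"
proof -
  obtain a b c d where 1: "a * d - b * c \<noteq> 0" "\<phi> = proj_moebius a b c d" using assms(1) by (rule sphere_autE)
  have comp: "affine_map k t \<circ> \<phi> = proj_moebius (k * a + t * c) (k * b + t * d) c d"
    by (rule ext) (simp add: 1(2) proj_moebius_comp[OF 1(1)])
  have det: "(k * a + t * c) * d - (k * b + t * d) * c = k * (a * d - b * c)" by (simp add: algebra_simps)
  then have "form (affine_map k t \<circ> \<phi>) = moebius_form (k * a + t * c) (k * b + t * d) c d"
    unfolding comp using 1 assms(2) by (intro form_proj_moebius) simp
  then show ?thesis
    by (auto simp: 1(2) form_proj_moebius[OF 1(1)] moebius_form_def det)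
qed

text \<open>The transition map has constant derivative 1: \<open>c \<noteq> 0\<close> would give its
  form the value 0 at \<open>- d / c\<close>, and the value at 0 then makes the slope 1.\<close>

lemma form_eq_imp_affine:
  assumes \<phi>: "\<phi> \<in> sphere_aut" and \<psi>: "\<psi> \<in> sphere_aut" and eq: "form \<phi> = form \<psi>"
  obtains t where "\<phi> = affine_map 1 t \<circ> \<psi>"
proof -
  obtain \<psi>' where \<psi>': "\<psi>' \<in> sphere_aut" "\<psi>' \<circ> \<psi> = id" "\<psi> \<circ> \<psi>' = id" using sphere_aut_inverse[OF \<psi>] .
  obtain a b c d where 1: "a * d - b * c \<noteq> 0" "\<phi> \<circ> \<psi>' = proj_moebius a b c d"
    using sphere_aut_comp[OF \<phi> \<psi>'(1)] by (rule sphere_autE)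
  have "moebius_form a b c d = form (\<phi> \<circ> \<psi>')" using form_proj_moebius[OF 1(1)] 1(2) by simp
  also have "\<dots> = form (\<psi> \<circ> \<psi>')" using pullback_form[OF \<phi> \<psi>'(1)] pullback_form[OF \<psi> \<psi>'(1)] eq by simp
  finally have one: "moebius_form a b c d z = 1" for z using \<psi>' form_id by simp
  have "c = 0"
  proof (rule ccontr)
    assume "c \<noteq> 0"
    then have "moebius_form a b c d (- d / c) = 0" by (simp add: moebius_form_def)
    then show False using one by simp
  qed
  moreover from this have "d \<noteq> 0" using 1 by auto
  ultimately have "a = d" using one[of 0] by (simp add: moebius_form_def power2_eq_square)
  have "\<phi> \<circ> \<psi>' = affine_map 1 (b / d)"
    unfolding 1(2) \<open>c = 0\<close> \<open>a = d\<close> using \<open>d \<noteq> 0\<close>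
    by (intro ext, case_tac x) (auto simp: moebius_def field_simps)
  then have "\<phi> = affine_map 1 (b / d) \<circ> \<psi>"
    using \<psi>'(2) by (metis comp_assoc comp_id)
  then show ?thesis by (rule that)
qed

section \<open>Classification of differentials with a single double pole\<close>

lemma nicely_meromorphic_local_form:
  assumes g: "g nicely_meromorphic_on UNIV" and nz: "\<exists>\<^sub>F w in at z. g w \<noteq> 0"
  obtains h where "h analytic_on {z}" "h z \<noteq> 0"
    "eventually (\<lambda>w. g w = h w * (w - z) powi zorder g z) (at z)"
proof -
  have mero: "g meromorphic_on {z}"
    using g meromorphic_on_subset unfolding nicely_meromorphic_on_def by blast
  obtain r where r: "zor_poly g z z \<noteq> 0" "r > 0" "zor_poly g z holomorphic_on cball z r"
      "\<forall>w\<in>cball z r - {z}. g w = zor_poly g z w * (w - z) powi zorder g z"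
    using zorder_exist[OF meromorphic_on_isolated_singularity[OF mero] meromorphic_on_not_essential[OF mero] nz]
    by blast
  show ?thesis
  proof (rule that[of "zor_poly g z"])
    have "zor_poly g z holomorphic_on ball z r"
      using r(3) holomorphic_on_subset ball_subset_cball by blast
    then show "zor_poly g z analytic_on {z}"
      using r(2) analytic_at[of "zor_poly g z" z] by (intro iffD2[OF analytic_at] exI[of _ "ball z r"]) auto
    show "eventually (\<lambda>w. g w = zor_poly g z w * (w - z) powi zorder g z) (at z)"
      using r by (auto simp: eventually_at dist_commute intro!: exI[of _ r])
  qed (use r in auto)
qed

text \<open>Order 0 alone would permit a removable singularity with a wrong value; the normalization
  in \<open>nicely_meromorphic_on\<close> excludes this.\<close>

lemma zorder_0_imp_analytic:
  assumes g: "g nicely_meromorphic_on UNIV" and nz: "\<exists>\<^sub>F w in at z. g w \<noteq> 0" and "zorder g z = 0"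
  shows "g analytic_on {z}" "g z \<noteq> 0"
proof -
  obtain h where h: "h analytic_on {z}" "h z \<noteq> 0" "eventually (\<lambda>w. g w = h w) (at z)"
    by (rule nicely_meromorphic_local_form[OF g nz]) (simp add: assms(3))
  have "(h \<longlongrightarrow> h z) (at z)" using h(1) analytic_at_imp_isCont isContD by blast
  then have lim: "(g \<longlongrightarrow> h z) (at z)" using h(3) by (simp add: tendsto_cong)
  have "\<not> is_pole g z"
    unfolding is_pole_def using lim not_tendsto_and_filterlim_at_infinity[of "at z" g "h z"] by auto
  then show "g analytic_on {z}"
    using nicely_meromorphic_on_imp_analytic_at[OF g] by blast
  then have "(g \<longlongrightarrow> g z) (at z)" using analytic_at_imp_isCont isContD by blast
  then have "g z = h z" using lim tendsto_unique by (metis at_neq_bot)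
  then show "g z \<noteq> 0" using h by simp
qed

lemma affine_part_inversion: "affine_part sphere_inversion = (\<lambda>z. 1 / z)"
  by (auto simp: affine_part_def moebius_def)

lemma pullback_inversion:
  assumes "z \<noteq> 0" "g analytic_on {1 / z}"
  shows "pullback_diff sphere_inversion g z = - g (1 / z) / z\<^sup>2"
proof -
  obtain S where S: "open S" "1 / z \<in> S" "g holomorphic_on S"
    using assms(2) by (auto simp: analytic_at)
  define T where "T = (\<lambda>z. 1 / z) -` S \<inter> (- {0})"
  have cont: "continuous_on (- {0}) (\<lambda>z::complex. 1 / z)" by (intro continuous_intros) auto
  have T: "open T" "z \<in> T"
    using continuous_open_preimage[OF cont _ S(1)] assms S by (auto simp: T_def Int_commute)
  have der: "deriv (\<lambda>z::complex. 1 / z) w = - 1 / w\<^sup>2" if "w \<noteq> 0" for w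
    using that by (intro DERIV_imp_deriv) (auto intro!: derivative_eq_intros simp: power2_eq_square)
  have "(\<lambda>z. 1 / z) holomorphic_on T"
    by (intro holomorphic_intros) (auto simp: T_def)
  then have "(g \<circ> (\<lambda>z. 1 / z)) holomorphic_on T"
    by (rule holomorphic_on_compose_gen[OF _ S(3)]) (auto simp: T_def)
  then have "(\<lambda>z. g (1 / z)) holomorphic_on T" by (simp add: o_def)
  then have "(\<lambda>z. g (1 / z) * (- 1 / z\<^sup>2)) holomorphic_on T"
    by (intro holomorphic_intros) (auto simp: T_def)
  then have "(\<lambda>z. g (1 / z) * deriv (\<lambda>z. 1 / z) z) holomorphic_on T"
    by (rule holomorphic_transform) (auto simp: T_def der)
  then have "(\<lambda>z. g (1 / z) * deriv (\<lambda>z. 1 / z) z) analytic_on {z}"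
    using T analytic_at by blast
  then show ?thesis
    using assms(1) by (simp add: pullback_diff_def affine_part_inversion der)
qed

text \<open>Liouville's theorem. If the pole is at infinity, \<open>g\<close> is entire with a
  finite limit there; if it is at \<open>a\<close>, the same holds for
  \<open>g z * (z - a)\<^sup>2\<close>. The behaviour at infinity is read from the local form of the
  pullback at 0.\<close>

lemma form_classification:
  assumes g: "meromorphic_diff g" and nz: "\<exists>z. g z \<noteq> 0"
    and pole: "diff_order g p0 = -2" and ord: "\<And>p. p \<noteq> p0 \<Longrightarrow> diff_order g p = 0"
  obtains \<phi> where "\<phi> \<in> sphere_aut" "\<phi> p0 = Infty" "g = form \<phi>"
proof -
  let ?G = "pullback_diff sphere_inversion g"
  have mero: "g nicely_meromorphic_on UNIV" "?G nicely_meromorphic_on UNIV"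
    using g by (auto simp: meromorphic_diff_def)
  \<comment> \<open>The order is meaningful only if \<open>g\<close> does not vanish identically
    near the point; a nonzero \<open>g\<close> has isolated zeros.\<close>
  have freq: "\<exists>\<^sub>F w in at z. g w \<noteq> 0" for z
  proof -
    have "\<forall>\<^sub>\<approx>x\<in>UNIV. g x \<noteq> 0"
      using nicely_meromorphic_imp_constant_or_avoid[OF mero(1), of 0] nz by auto
    then have "eventually (\<lambda>w. g w \<noteq> 0) (at z)"
      by (auto simp: eventually_cosparse_open_eq)
    then show ?thesis by (rule eventually_frequently[rotated]) simp
  qed
  have an: "g analytic_on {z}" "g z \<noteq> 0" if "Pt z \<noteq> p0" for z
    using zorder_0_imp_analytic[OF mero(1) freq] ord[OF that] by auto
  \<comment> \<open>Points \<open>1 / z\<close> close to infinity avoid a finite pole, so the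
    transformation rule for the pullback applies to them.\<close>
  have ev: "eventually (\<lambda>z::complex. z \<noteq> 0 \<and> Pt (1 / z) \<noteq> p0) (at 0)"
  proof (cases "\<exists>a. p0 = Pt a \<and> a \<noteq> 0")
    case True
    then obtain a where a: "p0 = Pt a" "a \<noteq> 0" by blast
    then show ?thesis
      by (auto simp: eventually_at intro!: exI[of _ "norm (1 / a)"])
  qed (auto simp: eventually_at intro!: exI[of _ 1])
  have G: "eventually (\<lambda>z. ?G z = - g (1 / z) / z\<^sup>2) (at 0)"
    using ev by (rule eventually_mono) (use pullback_inversion an in blast)
  have freqG: "\<exists>\<^sub>F w in at 0. ?G w \<noteq> 0"
  proof -
    have "eventually (\<lambda>w. ?G w \<noteq> 0) (at 0)"
      using ev by (rule eventually_mono) (use pullback_inversion an in auto)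
    then show ?thesis by (rule eventually_frequently[rotated]) simp
  qed
  obtain h where h: "h analytic_on {0}" "h 0 \<noteq> 0"
    "eventually (\<lambda>w. ?G w = h w * w powi zorder ?G 0) (at 0)"
    by (rule nicely_meromorphic_local_form[OF mero(2) freqG]) simp
  have hlim: "(h \<longlongrightarrow> h 0) (at 0)" using h(1) analytic_at_imp_isCont isContD by blast
  show ?thesis
  proof (cases p0)
    case Infty
    then have "zorder ?G 0 = -2" using pole by simp
    have "eventually (\<lambda>z. g (inverse z) = - h z) (at 0)"
      using ev G h(3)
    proof eventually_elim
      case (elim z)
      have "z powi zorder ?G 0 = 1 / z\<^sup>2"
        by (simp add: \<open>zorder ?G 0 = -2\<close> power_int_minus inverse_eq_divide)
      then have "- g (1 / z) / z\<^sup>2 = h z * (1 / z\<^sup>2)" using elim by presburger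
      moreover have "z\<^sup>2 \<noteq> 0" using elim by simp
      ultimately have "- g (1 / z) = h z" by (metis divide_cancel_right mult.right_neutral times_divide_eq_right)
      then show ?case by (simp add: inverse_eq_divide minus_equation_iff)
    qed
    moreover have "((\<lambda>z. - h z) \<longlongrightarrow> - h 0) (at 0)" using hlim by (rule tendsto_minus)
    ultimately have "((\<lambda>z. g (inverse z)) \<longlongrightarrow> - h 0) (at 0)" by (simp add: tendsto_cong)
    then have "(g \<longlongrightarrow> - h 0) at_infinity" by (simp add: lim_at_infinity_0 o_def)
    moreover have "g holomorphic_on UNIV"
      using an Infty by (intro analytic_imp_holomorphic) (simp add: analytic_on_analytic_at[of g UNIV])
    ultimately have "g = (\<lambda>_. - h 0)" by (intro ext Liouville_weak)
    moreover have "form (affine_map (- h 0) 0) = (\<lambda>_. - h 0)"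
      using form_proj_moebius[of "- h 0" 1 0 0] h(2) by (auto simp: moebius_form_def)
    ultimately show ?thesis
      using that[of "affine_map (- h 0) 0"] sphere_aut_affine_map h(2) Infty by simp
  next
    case (Pt a)
    then have z0: "zorder ?G 0 = 0" using ord[of Infty] by simp
    obtain k where k: "k analytic_on {a}" "k a \<noteq> 0" "eventually (\<lambda>w. g w = k w * (w - a) powi (-2)) (at a)"
      using nicely_meromorphic_local_form[OF mero(1) freq, of a] pole Pt by auto
    \<comment> \<open>The value at \<open>a\<close> is prescribed by the local factor
      \<open>k\<close>, so that the double pole is removed.\<close>
    define f where "f z = (if z = a then k a else g z * (z - a)\<^sup>2)" for z
    have "f analytic_on {z}" for z
    proof (cases "z = a")
      case True
      have "eventually (\<lambda>w. f w = k w) (at a)"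
        using k(3) by (rule eventually_mono) (auto simp: f_def power_int_minus field_simps)
      then have "eventually (\<lambda>w. f w = k w) (nhds a)"
        by (simp add: eventually_nhds_conv_at f_def)
      from analytic_at_cong[OF this refl] show ?thesis using k(1) True by blast
    next
      case False
      have "(\<lambda>z. g z * (z - a)\<^sup>2) analytic_on {z}"
        using an False Pt by (intro analytic_intros) auto
      moreover have "eventually (\<lambda>w. w \<in> - {a}) (nhds z)"
        using False by (intro eventually_nhds_in_open) auto
      then have "eventually (\<lambda>w. f w = g w * (w - a)\<^sup>2) (nhds z)"
        by (rule eventually_mono) (auto simp: f_def)
      note analytic_at_cong[OF this refl]
      ultimately show ?thesis by blast
    qed
    then have holo: "f holomorphic_on UNIV"
      by (intro analytic_imp_holomorphic) (simp add: analytic_on_analytic_at[of f UNIV])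
    \<comment> \<open>This combines \<open>g (1 / z) = - h z * z\<^sup>2\<close> with
      \<open>(1 / z - a) * z = 1 - a * z\<close>.\<close>
    have "eventually (\<lambda>z. f (inverse z) = - h z * (1 - a * z)\<^sup>2) (at 0)"
      using ev G h(3)
    proof eventually_elim
      case (elim z)
      then have "- g (1 / z) / z\<^sup>2 = h z" using z0 by simp
      then have "- g (1 / z) = h z * z\<^sup>2" using elim by (simp add: field_simps)
      then have "g (1 / z) = - h z * z\<^sup>2" by (metis minus_minus minus_mult_left)
      moreover have "(1 / z - a)\<^sup>2 * z\<^sup>2 = (1 - a * z)\<^sup>2"
        using elim by (simp add: field_simps flip: power_mult_distrib)
      moreover have "1 / z \<noteq> a" using elim Pt by auto
      ultimately show ?case by (simp add: f_def inverse_eq_divide mult.assoc mult.commute[of "z\<^sup>2"])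
    qed
    moreover have "((\<lambda>z. - h z * (1 - a * z)\<^sup>2) \<longlongrightarrow> - h 0 * (1 - a * 0)\<^sup>2) (at 0)"
      by (intro tendsto_intros hlim)
    ultimately have "((\<lambda>z. f (inverse z)) \<longlongrightarrow> - h 0 * (1 - a * 0)\<^sup>2) (at 0)" by (simp add: tendsto_cong)
    then have "(f \<longlongrightarrow> - h 0) at_infinity" by (simp add: lim_at_infinity_0 o_def)
    with holo have f: "f z = - h 0" for z using Liouville_weak by blast
    have "is_pole g a"
    proof -
      have "is_pole (\<lambda>w. - h 0 * (1 / (w - a) ^ 2)) a"
        by (rule is_pole_cmult_iff[THEN iffD2, OF _ is_pole_inverse_power]) (use h(2) in auto)
      moreover have "- h 0 * (1 / (w - a) ^ 2) = g w" if "w \<noteq> a" for w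
        using f[of w] that by (simp add: f_def field_simps)
      then have "eventually (\<lambda>w. - h 0 * (1 / (w - a) ^ 2) = g w) (at a)"
        by (auto simp: eventually_at intro!: exI[of _ 1])
      note is_pole_cong[OF this refl]
      ultimately show ?thesis by blast
    qed
    \<comment> \<open>Normalized coefficients vanish at their poles.\<close>
    then have "g a = 0"
      using mero(1) not_tendsto_and_filterlim_at_infinity[of "at a" g "g a"]
      unfolding nicely_meromorphic_on_def is_pole_def by auto
    have "g = moebius_form 0 (h 0) 1 (- a)"
    proof
      fix z show "g z = moebius_form 0 (h 0) 1 (- a) z"
        using f[of z] \<open>g a = 0\<close> by (auto simp: moebius_form_def f_def field_simps)
    qed
    then have "g = form (proj_moebius 0 (h 0) 1 (- a))"
      using form_proj_moebius[of 0 "- a" "h 0" 1] h(2) by simp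
    then show ?thesis
      using that[of "proj_moebius 0 (h 0) 1 (- a)"] sphere_autI[of 0 "- a" "h 0" 1] h(2) Pt by simp
  qed
qed

text \<open>\<open>dz\<close> is the differential placed on every component of the curve that is
  built from level data.\<close>

lemma meromorphic_diff_one:
  "meromorphic_diff (\<lambda>_. 1)" "diff_order (\<lambda>_. 1) Infty = -2" "diff_order (\<lambda>_. 1) (Pt z) = 0"
proof -
  have inv: "pullback_diff sphere_inversion (\<lambda>_. 1) = moebius_form 0 1 1 0"
    using form_proj_moebius[of 0 0 1 1] by (simp add: form_def)
  have "(\<lambda>z::complex. - 1 / z\<^sup>2) meromorphic_on UNIV" by (intro meromorphic_intros)
  then have "moebius_form 0 1 1 0 meromorphic_on UNIV"
  proof (rule meromorphic_on_cong'[THEN iffD1, rotated 2])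
    show "\<forall>\<^sub>\<approx>z\<in>UNIV. - 1 / z\<^sup>2 = moebius_form 0 1 1 0 z"
      by (auto simp: moebius_form_def intro!: always_eventually)
  qed auto
  then have "remove_sings (moebius_form 0 1 1 0) nicely_meromorphic_on UNIV"
    by (rule remove_sings_nicely_meromorphic)
  moreover have "remove_sings (moebius_form 0 1 1 0) = moebius_form 0 1 1 0"
    by (rule ext, rule remove_sings_moebius_form) simp
  ultimately show "meromorphic_diff (\<lambda>_. 1)"
    by (auto simp: meromorphic_diff_def inv)
  have "zorder (moebius_form 0 1 1 0) 0 = -2"
    by (rule zorder_eqI[where S = UNIV and g = "\<lambda>_. -1"])
      (auto simp: moebius_form_def power_int_minus field_simps)
  then show "diff_order (\<lambda>_. 1) Infty = -2" by (simp add: inv)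
  show "diff_order (\<lambda>_. 1) (Pt z) = 0" by simp
qed

text \<open>\<open>\<phi>\<close> is a primitive. In the affine chart where it is the coordinate the
  form is \<open>dz\<close>, and a straight path gives the difference of coordinates. Along any
  other admissible path \<open>\<phi>\<close> is still a primitive, since a path through points of
  nonnegative order avoids the pole.\<close>

lemma sphere_integral_form:
  assumes \<phi>: "\<phi> \<in> sphere_aut" and p0: "\<phi> p0 = Infty"
    and pole: "diff_order (form \<phi>) p0 < 0" and ord: "\<And>p. p \<noteq> p0 \<Longrightarrow> diff_order (form \<phi>) p \<ge> 0"
    and p: "p \<noteq> p0" and q: "q \<noteq> p0"
  shows "sphere_integral (form \<phi>) p q = pt_val (\<phi> q) - pt_val (\<phi> p)"
  unfolding sphere_integral_def
proof (rule the_equality)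
  obtain \<theta> where \<theta>: "\<theta> \<in> sphere_aut" "\<theta> \<circ> \<phi> = id" "\<phi> \<circ> \<theta> = id" using sphere_aut_inverse[OF \<phi>] .
  have fin: "\<phi> r = Pt (pt_val (\<phi> r))" if "r \<noteq> p0" for r
    using inj_sphere_aut[OF \<phi>] p0 that by (cases "\<phi> r") (auto simp: inj_def)
  have inv: "\<theta> (Pt (pt_val (\<phi> r))) = r" if "r \<noteq> p0" for r
    using fin[OF that] \<theta>(2) by (metis comp_apply id_apply)
  show "has_sphere_integral (form \<phi>) p q (pt_val (\<phi> q) - pt_val (\<phi> p))"
    unfolding has_sphere_integral_def
  proof (intro bexI[of _ \<theta>] exI[of _ "linepath (pt_val (\<phi> p)) (pt_val (\<phi> q))"] conjI ballI)
    have "pullback_diff \<theta> (form \<phi>) = (\<lambda>_. 1)"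
      using pullback_form[OF \<phi> \<theta>(1)] \<theta>(3) form_id by simp
    then show "(pullback_diff \<theta> (form \<phi>) has_contour_integral pt_val (\<phi> q) - pt_val (\<phi> p))
        (linepath (pt_val (\<phi> p)) (pt_val (\<phi> q)))"
      using has_contour_integral_const_linepath[of 1 "pt_val (\<phi> q)" "pt_val (\<phi> p)"] by simp
    fix z
    have "\<theta> (Pt z) \<noteq> p0" using \<theta>(3) p0 by (metis comp_apply id_apply sphere.distinct(1))
    then show "0 \<le> diff_order (form \<phi>) (\<theta> (Pt z))" using ord by blast
  qed (use \<theta> p q inv in auto)
next
  fix L assume "has_sphere_integral (form \<phi>) p q L"
  then obtain \<theta> \<gamma> where \<theta>: "\<theta> \<in> sphere_aut" "valid_path \<gamma>" "\<theta> (Pt (pathstart \<gamma>)) = p" "\<theta> (Pt (pathfinish \<gamma>)) = q"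
    "\<forall>z\<in>path_image \<gamma>. 0 \<le> diff_order (form \<phi>) (\<theta> (Pt z))" "(pullback_diff \<theta> (form \<phi>) has_contour_integral L) \<gamma>"
    unfolding has_sphere_integral_def by blast
  obtain a b c d where 1: "a * d - b * c \<noteq> 0" "\<phi> \<circ> \<theta> = proj_moebius a b c d"
    using sphere_aut_comp[OF \<phi> \<theta>(1)] by (rule sphere_autE)
  have pb: "pullback_diff \<theta> (form \<phi>) = moebius_form a b c d"
    using pullback_form[OF \<phi> \<theta>(1)] form_proj_moebius[OF 1(1)] 1(2) by simp
  have nz: "c * z + d \<noteq> 0" if "z \<in> path_image \<gamma>" for z
  proof
    assume "c * z + d = 0"
    then have "\<phi> (\<theta> (Pt z)) = Infty" using fun_cong[OF 1(2), of "Pt z"] by simp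
    then have "\<theta> (Pt z) = p0" using p0 inj_sphere_aut[OF \<phi>] by (auto simp: inj_def)
    then show False using \<theta>(5) that pole by fastforce
  qed
  have "((\<lambda>z. (a * z + b) / (c * z + d)) has_field_derivative moebius_form a b c d z) (at z within path_image \<gamma>)"
    if "z \<in> path_image \<gamma>" for z
    using nz[OF that] unfolding moebius_form_def
    by (auto intro!: derivative_eq_intros simp: field_simps power2_eq_square)
  from contour_integral_primitive[OF this \<theta>(2) subset_refl]
  have "(moebius_form a b c d has_contour_integral
      (a * pathfinish \<gamma> + b) / (c * pathfinish \<gamma> + d) - (a * pathstart \<gamma> + b) / (c * pathstart \<gamma> + d)) \<gamma>" .
  then have L: "L = (a * pathfinish \<gamma> + b) / (c * pathfinish \<gamma> + d) - (a * pathstart \<gamma> + b) / (c * pathstart \<gamma> + d)"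
    using \<theta>(6) pb has_contour_integral_unique by metis
  have "\<phi> q = Pt ((a * pathfinish \<gamma> + b) / (c * pathfinish \<gamma> + d))"
    "\<phi> p = Pt ((a * pathstart \<gamma> + b) / (c * pathstart \<gamma> + d))"
    using fun_cong[OF 1(2), of "Pt (pathfinish \<gamma>)"] fun_cong[OF 1(2), of "Pt (pathstart \<gamma>)"] \<theta>(3,4) nz
    by (auto simp: moebius_def)
  then show "L = pt_val (\<phi> q) - pt_val (\<phi> p)" using L by simp
qed

section \<open>Level trees\<close>

text \<open>A tree given by its parent function. Parents are strictly lower in the preorder, so
  parent chains cannot cycle and end at the root; paths and meets reduce to chains of
  ancestors.\<close>

locale rooted_tree =
  fixes T :: ltree and par :: "nat \<Rightarrow> nat"
  assumes finite_verts: "finite (tverts T)" and root_vert: "troot T \<in> tverts T"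
    and par_vert: "v \<in> tverts T \<Longrightarrow> v \<noteq> troot T \<Longrightarrow> par v \<in> tverts T"
    and par_prec: "v \<in> tverts T \<Longrightarrow> v \<noteq> troot T \<Longrightarrow> prec (tpre T) (par v) v"
    and preorder: "preorder_on (tverts T) (tpre T)" and total: "total_on (tverts T) (tpre T)"
    and adj_iff: "tadj T v w \<longleftrightarrow> v \<in> tverts T \<and> v \<noteq> troot T \<and> w = par v \<or> w \<in> tverts T \<and> w \<noteq> troot T \<and> v = par w"
begin

abbreviation "V \<equiv> tverts T"
abbreviation "rt \<equiv> troot T"
abbreviation "lv \<equiv> level T"

definition child :: "nat \<Rightarrow> nat \<Rightarrow> bool" where
  "child v c \<longleftrightarrow> c \<in> V \<and> c \<noteq> rt \<and> par c = v"

text \<open>The order \<subseteq> on vertices, generated by the parent relation instead of simple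
  paths.\<close>

definition anc :: "nat \<Rightarrow> nat \<Rightarrow> bool" where
  "anc v u \<longleftrightarrow> u \<in> V \<and> (\<lambda>x y. child y x)\<^sup>*\<^sup>* u v"

section \<open>Levels of vertices\<close>

lemma refl_pre: "v \<in> V \<Longrightarrow> (v, v) \<in> tpre T"
  using preorder by (auto simp: preorder_on_def refl_on_def)

lemma trans_pre: "(u, v) \<in> tpre T \<Longrightarrow> (v, w) \<in> tpre T \<Longrightarrow> (u, w) \<in> tpre T"
  using preorder by (auto simp: preorder_on_def trans_def)

lemma pre_verts: "(u, v) \<in> tpre T \<Longrightarrow> u \<in> V \<and> v \<in> V"
  using preorder by (auto simp: preorder_on_def)

lemma total_pre: "u \<in> V \<Longrightarrow> v \<in> V \<Longrightarrow> (u, v) \<in> tpre T \<or> (v, u) \<in> tpre T"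
  using total refl_pre unfolding total_on_def by metis

definition sim_class :: "nat \<Rightarrow> nat set" where
  "sim_class v = {w. sim (tpre T) v w}"

lemma level_classes_eq: "level_classes T = sim_class ` V"
  by (auto simp: level_classes_def quotient_def sim_class_def)

lemma level_eq: "lv v = card (sim_class ` {x \<in> V. prec (tpre T) x v})"
proof -
  have "{K \<in> level_classes T. \<forall>w\<in>K. prec (tpre T) w v} = sim_class ` {x \<in> V. prec (tpre T) x v}"
  proof (intro equalityI subsetI)
    fix K assume "K \<in> {K \<in> level_classes T. \<forall>w\<in>K. prec (tpre T) w v}"
    then obtain x where "x \<in> V" "K = sim_class x" "\<forall>w\<in>sim_class x. prec (tpre T) w v"
      by (auto simp: level_classes_eq)
    moreover have "x \<in> sim_class x" using \<open>x \<in> V\<close> refl_pre by (simp add: sim_class_def sim_def)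
    ultimately show "K \<in> sim_class ` {x \<in> V. prec (tpre T) x v}" by blast
  next
    fix K assume "K \<in> sim_class ` {x \<in> V. prec (tpre T) x v}"
    then obtain x where x: "x \<in> V" "K = sim_class x" "prec (tpre T) x v" by blast
    have "\<forall>w\<in>K. prec (tpre T) w v"
    proof
      fix w assume "w \<in> K"
      then have "(x, w) \<in> tpre T" "(w, x) \<in> tpre T" using x by (auto simp: sim_class_def sim_def)
      moreover have "(x, v) \<in> tpre T" "(v, x) \<notin> tpre T" using x by (auto simp: prec_def)
      ultimately show "prec (tpre T) w v" using trans_pre unfolding prec_def by blast
    qed
    with x show "K \<in> {K \<in> level_classes T. \<forall>w\<in>K. prec (tpre T) w v}"
      by (auto simp: level_classes_eq)
  qed
  then show ?thesis by (simp add: level_def)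
qed

lemma level_mono: "(v, w) \<in> tpre T \<Longrightarrow> lv v \<le> lv w"
  unfolding level_eq using finite_verts trans_pre
  by (intro card_mono finite_imageI image_mono) (auto simp: prec_def)

lemma level_strict:
  assumes "prec (tpre T) v w"
  shows "lv v < lv w"
  unfolding level_eq
proof (rule psubset_card_mono)
  show "finite (sim_class ` {x \<in> V. prec (tpre T) x w})" using finite_verts by simp
  have vw: "v \<in> V" "(v, w) \<in> tpre T" using assms pre_verts by (auto simp: prec_def)
  have sub: "sim_class ` {x \<in> V. prec (tpre T) x v} \<subseteq> sim_class ` {x \<in> V. prec (tpre T) x w}"
    using vw trans_pre by (intro image_mono) (auto simp: prec_def)
  have "sim_class v \<in> sim_class ` {x \<in> V. prec (tpre T) x w}" using vw assms by blast
  moreover have "sim_class v \<notin> sim_class ` {x \<in> V. prec (tpre T) x v}"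
  proof
    assume "sim_class v \<in> sim_class ` {x \<in> V. prec (tpre T) x v}"
    then obtain x where x: "x \<in> V" "prec (tpre T) x v" "sim_class v = sim_class x" by blast
    have "v \<in> sim_class v" using vw refl_pre by (simp add: sim_class_def sim_def)
    then have "v \<in> sim_class x" using x by simp
    then show False using x by (simp add: sim_class_def sim_def prec_def)
  qed
  ultimately show "sim_class ` {x \<in> V. prec (tpre T) x v} \<subset> sim_class ` {x \<in> V. prec (tpre T) x w}"
    using sub by blast
qed

lemma level_le_iff: "v \<in> V \<Longrightarrow> w \<in> V \<Longrightarrow> lv v \<le> lv w \<longleftrightarrow> (v, w) \<in> tpre T"
  using level_mono level_strict[of w v] total_pre[of v w] unfolding prec_def by fastforce

text \<open>Inequivalent vertices have different levels, and all levels are smaller than the number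
  of classes. An injection of the classes into that many numbers is onto, so no level is
  skipped.\<close>

lemma level_image: "lv ` V = {..tree_length T}"
proof -
  have sim: "sim_class v = sim_class w \<longleftrightarrow> lv v = lv w" if "v \<in> V" "w \<in> V" for v w
  proof
    assume "sim_class v = sim_class w"
    moreover have "v \<in> sim_class v" using that refl_pre by (simp add: sim_class_def sim_def)
    ultimately have "sim (tpre T) w v" by (simp add: sim_class_def)
    then show "lv v = lv w" using level_mono[of v w] level_mono[of w v] by (simp add: sim_def)
  next
    assume "lv v = lv w"
    then have "(v, w) \<in> tpre T" "(w, v) \<in> tpre T"
      using level_le_iff[of v w] level_le_iff[of w v] that by auto
    then show "sim_class v = sim_class w" using trans_pre unfolding sim_class_def sim_def by blast
  qed
  have lt: "lv v < card (sim_class ` V)" if "v \<in> V" for v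
    unfolding level_eq
  proof (rule psubset_card_mono)
    have "sim_class v \<notin> sim_class ` {x \<in> V. prec (tpre T) x v}"
    proof
      assume "sim_class v \<in> sim_class ` {x \<in> V. prec (tpre T) x v}"
      then obtain x where "x \<in> V" "prec (tpre T) x v" "sim_class v = sim_class x" by blast
      then show False using sim[OF that] level_strict[of x v] by simp
    qed
    then show "sim_class ` {x \<in> V. prec (tpre T) x v} \<subset> sim_class ` V" using that by blast
  qed (use finite_verts in simp)
  define f where "f K = lv (SOME v. v \<in> V \<and> sim_class v = K)" for K
  have f: "f (sim_class v) = lv v" if "v \<in> V" for v
  proof -
    have "(SOME x. x \<in> V \<and> sim_class x = sim_class v) \<in> V \<and>
        sim_class (SOME x. x \<in> V \<and> sim_class x = sim_class v) = sim_class v"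
      by (rule someI[of _ v]) (use that in simp)
    then show ?thesis unfolding f_def using sim that by blast
  qed
  have "inj_on f (sim_class ` V)" by (rule inj_onI) (use f sim in \<open>elim imageE, simp\<close>)
  then have "card (f ` sim_class ` V) = card (sim_class ` V)" by (rule card_image)
  moreover have "f ` sim_class ` V = lv ` V" using f by (simp add: image_image)
  ultimately have "card (lv ` V) = card (sim_class ` V)" by simp
  moreover have "lv ` V \<subseteq> {..<card (sim_class ` V)}" using lt by auto
  ultimately have "lv ` V = {..<card (sim_class ` V)}"
    by (intro card_subset_eq) auto
  moreover have "card (sim_class ` V) > 0" using finite_verts root_vert by (auto simp: card_gt_0_iff)
  then have "{..<card (sim_class ` V)} = {..tree_length T}"
    by (auto simp: tree_length_def level_classes_eq)
  ultimately show ?thesis by simp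
qed

lemma level_le_length: "v \<in> V \<Longrightarrow> lv v \<le> tree_length T"
  using level_image by blast

lemma child_level: "child v c \<Longrightarrow> lv v < lv c"
  using par_prec level_strict by (auto simp: child_def)

lemma child_verts: "child v c \<Longrightarrow> v \<in> V \<and> c \<in> V"
  using par_vert by (auto simp: child_def)

section \<open>Chains of ancestors\<close>

lemma anc_refl: "v \<in> V \<Longrightarrow> anc v v"
  by (simp add: anc_def)

lemma anc_trans: "anc u v \<Longrightarrow> anc v w \<Longrightarrow> anc u w"
  unfolding anc_def by (meson rtranclp_trans)

lemma anc_child: "child v c \<Longrightarrow> anc v c"
  unfolding anc_def using child_verts by blast

lemma anc_verts: "anc v u \<Longrightarrow> v \<in> V \<and> u \<in> V"
proof -
  have "(\<lambda>x y. child y x)\<^sup>*\<^sup>* u v \<Longrightarrow> u \<in> V \<Longrightarrow> v \<in> V"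
    by (induction rule: rtranclp_induct) (auto dest: child_verts)
  then show "anc v u \<Longrightarrow> v \<in> V \<and> u \<in> V" by (auto simp: anc_def)
qed

lemma anc_cases:
  assumes "anc v u"
  obtains "v = u" | "u \<noteq> rt" "child (par u) u" "anc v (par u)"
proof -
  have "u \<in> V" "(\<lambda>x y. child y x)\<^sup>*\<^sup>* u v" using assms by (auto simp: anc_def)
  from this(2) show ?thesis
  proof (cases rule: converse_rtranclpE)
    case base
    then show ?thesis using that by blast
  next
    case (step y)
    then have "y = par u" "u \<noteq> rt" by (auto simp: child_def)
    then show ?thesis using that step child_verts by (auto simp: anc_def)
  qed
qed

lemma anc_level: "anc v u \<Longrightarrow> v \<noteq> u \<Longrightarrow> lv v < lv u"
proof -
  have "(\<lambda>x y. child y x)\<^sup>*\<^sup>* u v \<Longrightarrow> v = u \<or> lv v < lv u"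
    by (induction rule: rtranclp_induct) (auto dest: child_level)
  then show "anc v u \<Longrightarrow> v \<noteq> u \<Longrightarrow> lv v < lv u" by (auto simp: anc_def)
qed

lemma anc_level_le: "anc v u \<Longrightarrow> lv v \<le> lv u"
  using anc_level by (cases "v = u") fastforce+

lemma anc_antisym: "anc v u \<Longrightarrow> anc u v \<Longrightarrow> u = v"
  using anc_level[of v u] anc_level[of u v] by fastforce

lemma anc_linear:
  assumes "anc v u" "anc w u"
  shows "anc v w \<or> anc w v"
proof -
  have "(\<lambda>x y. child y x)\<^sup>*\<^sup>* u v \<Longrightarrow> u \<in> V \<Longrightarrow> anc w u \<Longrightarrow> anc v w \<or> anc w v"
  proof (induction rule: converse_rtranclp_induct)
    case base
    then show ?case by blast
  next
    case (step x y)
    from \<open>anc w x\<close> show ?case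
    proof (cases rule: anc_cases)
      case 1
      then have "anc v w" using step by (auto simp: anc_def intro: converse_rtranclp_into_rtranclp)
      then show ?thesis by blast
    next
      case 2
      then have "par x = y" using step by (auto simp: child_def)
      then show ?thesis using 2 step child_verts by blast
    qed
  qed
  then show ?thesis using assms by (auto simp: anc_def)
qed

lemma anc_comparable: "anc v u \<Longrightarrow> anc w u \<Longrightarrow> lv v \<le> lv w \<Longrightarrow> anc v w"
  using anc_linear[of v u w] anc_level[of w v] by fastforce

lemma anc_same_level: "anc v u \<Longrightarrow> anc w u \<Longrightarrow> lv v = lv w \<Longrightarrow> v = w"
  using anc_comparable[of v u w] anc_comparable[of w u v] anc_antisym by fastforce

lemma anc_root: "v \<in> V \<Longrightarrow> anc rt v"
proof (induction "lv v" arbitrary: v rule: less_induct)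
  case less
  show ?case
  proof (cases "v = rt")
    case False
    then have "child (par v) v" using less by (simp add: child_def)
    then show ?thesis using less.hyps[of "par v"] child_level child_verts anc_child anc_trans by blast
  qed (use less anc_refl in simp)
qed

lemma adj_child_iff: "tadj T v w \<longleftrightarrow> child w v \<or> child v w"
  by (auto simp: adj_iff child_def)

lemma child_unique: "child v c \<Longrightarrow> child w c \<Longrightarrow> v = w"
  by (simp add: child_def)

section \<open>Simple paths and meets\<close>

lemma anc_simple_path:
  assumes "anc w u"
  shows "\<exists>xs. simple_path T u w xs"
proof -
  have "(\<lambda>x y. child y x)\<^sup>*\<^sup>* u w \<Longrightarrow> u \<in> V \<Longrightarrow>
    \<exists>xs. simple_path T u w xs \<and> (\<forall>x\<in>set xs. anc x u)"
  proof (induction rule: converse_rtranclp_induct)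
    case base
    then show ?case by (intro exI[of _ "[w]"]) (auto simp: simple_path_def anc_refl)
  next
    case (step x y)
    then obtain xs where xs: "simple_path T y w xs" "\<forall>x\<in>set xs. anc x y" using child_verts by blast
    have "x \<notin> set xs" using xs(2) anc_level_le[of x y] child_level[OF step(1)] by fastforce
    moreover have "tadj T x y" using step(1) adj_child_iff by blast
    ultimately have "simple_path T x w (x # xs)"
      using xs(1) child_verts[OF step(1)] by (cases xs) (auto simp: simple_path_def)
    then show ?case
      using xs(2) anc_trans[OF _ anc_child[OF step(1)]] anc_refl step.prems by (intro exI[of _ "x # xs"]) auto
  qed
  then show ?thesis using assms by (auto simp: anc_def)
qed

text \<open>Parents are unique and a simple path does not return, so a path that has once moved to a
  child keeps moving away from the root.\<close>

lemma path_downwards: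
  "successively (tadj T) (u # x # ys) \<Longrightarrow> distinct (u # x # ys) \<Longrightarrow> child u x \<Longrightarrow> z \<in> set (x # ys) \<Longrightarrow> anc x z"
proof (induction ys arbitrary: u x)
  case Nil
  then show ?case using anc_refl child_verts by auto
next
  case (Cons y ys)
  have "child x y" using Cons.prems adj_child_iff child_unique by auto
  then show ?case
    using Cons.IH[of x y] Cons.prems anc_child[of x y] anc_trans anc_refl child_verts by fastforce
qed

text \<open>A first step to a child would keep the path among the descendants of that child, whereas
  \<open>w\<close> is an ancestor of \<open>u\<close>. So the path has to follow the
  parents.\<close>

lemma simple_path_set:
  "simple_path T u w xs \<Longrightarrow> anc w u \<Longrightarrow> set xs = {x. anc w x \<and> anc x u}"
proof (induction xs arbitrary: u)
  case Nil
  then show ?case by (simp add: simple_path_def)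
next
  case (Cons x xs)
  then have x: "x = u" by (simp add: simple_path_def)
  show ?case
  proof (cases xs)
    case Nil
    then have "w = u" using Cons.prems by (simp add: simple_path_def)
    then show ?thesis using Nil x anc_antisym anc_refl anc_verts[OF Cons.prems(2)] by auto
  next
    case (Cons y ys)
    note xs = this
    have p: "successively (tadj T) (u # y # ys)" "distinct (u # y # ys)" "last (y # ys) = w" "set xs \<subseteq> V"
      using Cons.prems xs x by (auto simp: simple_path_def)
    have w: "w \<in> set (y # ys)" using p(3) last_in_set[of "y # ys"] by simp
    consider "child u y" | "child y u" using p(1) adj_child_iff by auto
    then show ?thesis
    proof cases
      case 1
      then have "anc y w" using path_downwards[OF p(1,2) _ w] by blast
      then show ?thesis
        using anc_level_le[of y w] anc_level_le[OF Cons.prems(2)] child_level[OF 1] by linarith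
    next
      case 2
      then have y: "y = par u" by (simp add: child_def)
      have "w \<noteq> u" using w p(2) by auto
      then have "anc w y" using Cons.prems(2) y by (auto elim: anc_cases)
      moreover have "simple_path T y w xs" using Cons.prems(1) xs by (auto simp: simple_path_def)
      ultimately have "set xs = {z. anc w z \<and> anc z y}" using Cons.IH by blast
      then have "set (x # xs) = insert u {z. anc w z \<and> anc z y}" using x by simp
      also have "\<dots> = {z. anc w z \<and> anc z u}"
      proof (intro equalityI subsetI)
        fix z assume "z \<in> insert u {z. anc w z \<and> anc z y}"
        then show "z \<in> {z. anc w z \<and> anc z u}"
          using anc_trans[OF _ anc_child[OF 2]] Cons.prems(2) anc_refl[of u] child_verts[OF 2] by blast
      next
        fix z assume z: "z \<in> {z. anc w z \<and> anc z u}"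
        then have "anc z u" by simp
        then show "z \<in> insert u {z. anc w z \<and> anc z y}"
          by (cases rule: anc_cases) (use y z in auto)
      qed
      finally show ?thesis .
    qed
  qed
qed

lemma on_path_iff: "anc w u \<Longrightarrow> on_path T u w x \<longleftrightarrow> anc w x \<and> anc x u"
  using anc_simple_path simple_path_set unfolding on_path_def by blast

lemma simple_path_rev: "simple_path T u w xs \<Longrightarrow> simple_path T w u (rev xs)"
proof -
  have "tadj T x y \<longleftrightarrow> tadj T y x" for x y using adj_child_iff by blast
  then show "simple_path T u w xs \<Longrightarrow> simple_path T w u (rev xs)"
    unfolding simple_path_def by (auto simp: hd_rev last_rev successively_rev)
qed

lemma on_path_rev: "anc w u \<Longrightarrow> on_path T w u x \<longleftrightarrow> anc w x \<and> anc x u"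
  using on_path_iff[of w u x] simple_path_rev[of w u] simple_path_rev[of u w]
  unfolding on_path_def by (metis set_rev)

lemma tree_le_iff: "tree_le T v u \<longleftrightarrow> anc v u"
proof (cases "u \<in> V")
  case True
  then show ?thesis
    using on_path_iff[OF anc_root[OF True]] anc_root anc_verts by (auto simp: tree_le_def)
next
  case False
  have "\<not> on_path T u rt v"
    using False unfolding on_path_def simple_path_def by (metis hd_in_set subsetD)
  then show ?thesis using False anc_verts by (auto simp: tree_le_def)
qed

text \<open>The ancestors of a vertex form a chain, hence a common ancestor of maximal level is the
  greatest one.\<close>

lemma meet_props:
  assumes "u \<in> V" "v \<in> V"
  shows "anc (meet T u v) u" "anc (meet T u v) v" "\<And>w. anc w u \<Longrightarrow> anc w v \<Longrightarrow> anc w (meet T u v)"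
proof -
  define A where "A = {w. anc w u \<and> anc w v}"
  have "finite A" using finite_subset[OF _ finite_verts, of A] anc_verts by (auto simp: A_def)
  moreover have "A \<noteq> {}" using anc_root assms by (auto simp: A_def)
  ultimately have Max: "Max (lv ` A) \<in> lv ` A" "\<And>w. w \<in> A \<Longrightarrow> lv w \<le> Max (lv ` A)" by auto
  obtain m where m: "m \<in> A" "\<And>w. w \<in> A \<Longrightarrow> lv w \<le> lv m"
    using Max(1) by (rule imageE) (use Max(2) that in simp)
  have great: "anc w m" if "anc w u" "anc w v" for w
    using m that anc_comparable[of w u m] by (auto simp: A_def)
  have "meet T u v = m"
    unfolding meet_def tree_le_iff
    by (rule the_equality) (use m great anc_antisym in \<open>auto simp: A_def\<close>)
  then show "anc (meet T u v) u" "anc (meet T u v) v" "\<And>w. anc w u \<Longrightarrow> anc w v \<Longrightarrow> anc w (meet T u v)"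
    using m great by (auto simp: A_def)
qed

lemma meet_eqI:
  assumes "anc m u" "anc m v" "\<And>w. anc w u \<Longrightarrow> anc w v \<Longrightarrow> anc w m"
  shows "meet T u v = m"
  using meet_props[of u v] anc_verts[OF assms(1)] anc_verts[OF assms(2)] assms anc_antisym by blast

lemma meet_self: "u \<in> V \<Longrightarrow> meet T u u = u"
  by (rule meet_eqI) (auto intro: anc_refl)

lemma meet_commute: "meet T u v = meet T v u"
  unfolding meet_def by (rule arg_cong[of _ _ The]) auto

lemma terminal_iff: "terminal T v \<longleftrightarrow> v \<in> V \<and> (\<forall>c. \<not> child v c)"
proof -
  have "u = v" if "anc v u" "\<forall>c. \<not> child v c" for u
  proof -
    have "(\<lambda>x y. child y x)\<^sup>*\<^sup>* u v" using that by (auto simp: anc_def)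
    then show ?thesis by (cases rule: rtranclp.cases) (use that in auto)
  qed
  moreover have "child v c \<Longrightarrow> anc v c \<and> c \<noteq> v \<and> c \<in> V" for c
    using anc_child child_level child_verts by fastforce
  ultimately show ?thesis unfolding terminal_def tree_le_iff by metis
qed

lemma terminal_anc: "terminal T v \<Longrightarrow> anc v u \<Longrightarrow> u = v"
  using anc_verts unfolding terminal_def tree_le_iff by blast

end

text \<open>Stability in combinatorial form. \<open>branching\<close> replaces the count of nodes:
  apart from the descending node, a nonterminal component has at least two.\<close>

locale level_tree = rooted_tree T par for n :: nat and T :: ltree and par :: "nat \<Rightarrow> nat" +
  assumes terminal_sim: "terminal T v \<Longrightarrow> terminal T w \<Longrightarrow> sim (tpre T) v w"
    and mark_terminal: "i \<in> {1..n} \<Longrightarrow> terminal T (tmark T i)"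
    and terminal_marked: "terminal T v \<Longrightarrow> \<exists>i\<in>{1..n}. tmark T i = v"
    and branching: "v \<in> tverts T \<Longrightarrow> \<not> terminal T v \<Longrightarrow>
      \<exists>c c'. c \<noteq> c' \<and> c \<in> tverts T \<and> c' \<in> tverts T \<and> c \<noteq> troot T \<and> c' \<noteq> troot T \<and> par c = v \<and> par c' = v"
begin

abbreviation "h \<equiv> tmark T"

lemma mark_vert: "i \<in> {1..n} \<Longrightarrow> h i \<in> V"
  using mark_terminal by (auto simp: terminal_def)

text \<open>A descendant of maximal level has no children, so it is terminal and carries a
  mark.\<close>

lemma ex_mark_above:
  assumes "v \<in> V"
  obtains i where "i \<in> {1..n}" "anc v (h i)"
proof -
  define A where "A = {w. anc v w}"
  have "finite A" using finite_subset[OF _ finite_verts, of A] anc_verts by (auto simp: A_def)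
  moreover have "A \<noteq> {}" using anc_refl assms by (auto simp: A_def)
  ultimately have Max: "Max (lv ` A) \<in> lv ` A" "\<And>w. w \<in> A \<Longrightarrow> lv w \<le> Max (lv ` A)" by auto
  obtain m where m: "m \<in> A" "\<And>w. w \<in> A \<Longrightarrow> lv w \<le> lv m"
    using Max(1) by (rule imageE) (use Max(2) that in simp)
  have "\<not> child m c" for c
    using m anc_trans[of v m c] anc_child[of m c] child_level[of m c] by (fastforce simp: A_def)
  then have "terminal T m" using terminal_iff m anc_verts by (auto simp: A_def)
  then obtain i where "i \<in> {1..n}" "h i = m" using terminal_marked by blast
  then show ?thesis using that[of i] m by (simp add: A_def)
qed

lemma ex_child_toward:
  assumes "anc v u" "v \<noteq> u"
  obtains c where "child v c" "anc c u"
proof -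
  have "(\<lambda>x y. child y x)\<^sup>*\<^sup>* u v" "u \<in> V" using assms by (auto simp: anc_def)
  then show ?thesis
    by (cases rule: rtranclp.cases) (use that assms in \<open>auto simp: anc_def\<close>)
qed

lemma child_toward_unique: "child v c \<Longrightarrow> child v c' \<Longrightarrow> anc c u \<Longrightarrow> anc c' u \<Longrightarrow> c = c'"
proof -
  assume *: "child v c" "child v c'" "anc c u" "anc c' u"
  have "x = y" if "child v x" "child v y" "anc x y" for x y
    using \<open>anc x y\<close>
  proof (cases rule: anc_cases)
    case 2
    then have "anc x v" using that by (simp add: child_def)
    then show ?thesis using anc_level_le child_level[OF that(1)] by fastforce
  qed
  then show "c = c'" using * anc_linear[OF *(3,4)] by metis
qed

lemma meet_via_children:
  assumes "child v c" "child v c'" "c \<noteq> c'" "anc c u" "anc c' w"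
  shows "meet T u w = v"
proof (rule meet_eqI)
  show anc: "anc v u" "anc v w" using assms anc_child anc_trans by blast+
  fix x assume x: "anc x u" "anc x w"
  show "anc x v"
  proof (rule ccontr)
    assume n: "\<not> anc x v"
    then have "anc v x" "v \<noteq> x" using anc_linear[OF x(1) anc(1)] anc_refl anc_verts x by blast+
    then obtain d where d: "child v d" "anc d x" by (rule ex_child_toward)
    then have "anc d u" "anc d w" using x anc_trans by blast+
    then have "d = c" "d = c'" using child_toward_unique d assms by blast+
    then show False using assms by simp
  qed
qed

text \<open>At a nonterminal vertex the second mark is taken from another branch. As every vertex is
  the meet of two marks, a map between trees is determined by what it does to meets.\<close>

lemma ex_meet:
  assumes "anc v (h i)" "i \<in> {1..n}"
  obtains j where "j \<in> {1..n}" "v = meet T (h i) (h j)"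
proof (cases "terminal T v")
  case True
  then have "h i = v" using terminal_anc assms by blast
  then show ?thesis using that[OF assms(2)] meet_self mark_vert[OF assms(2)] by simp
next
  case False
  have v: "v \<in> V" using assms anc_verts by blast
  obtain c1 c2 where c: "c1 \<noteq> c2" "child v c1" "child v c2" using branching[OF v False] unfolding child_def by blast
  have "v \<noteq> h i" using False mark_terminal[OF assms(2)] by auto
  then obtain c where c0: "child v c" "anc c (h i)" using ex_child_toward[OF assms(1)] by blast
  obtain c' where c': "child v c'" "c' \<noteq> c" using c by metis
  then obtain j where j: "j \<in> {1..n}" "anc c' (h j)" using ex_mark_above child_verts by metis
  then show ?thesis using that meet_via_children[OF c0(1) c'(1) _ c0(2)] c'(2) by metis
qed

lemma ex_meet':
  assumes "v \<in> V"
  obtains i j where "i \<in> {1..n}" "j \<in> {1..n}" "v = meet T (h i) (h j)"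
proof -
  obtain i where i: "i \<in> {1..n}" "anc v (h i)" using ex_mark_above[OF assms] .
  then show ?thesis using ex_meet[of v i] that by metis
qed

definition tlev :: "nat \<times> nat \<Rightarrow> nat" where
  "tlev a = (if a = (0, 0) then tree_length T else lv (meet T (h (fst a)) (h (snd a))))"

lemma tlev_pair: "i \<in> {1..n} \<Longrightarrow> tlev (i, j) = lv (meet T (h i) (h j))"
  by (simp add: tlev_def)

lemma meet_vert: "i \<in> {1..n} \<Longrightarrow> j \<in> {1..n} \<Longrightarrow> meet T (h i) (h j) \<in> V"
  using meet_props[OF mark_vert mark_vert] anc_verts by blast

text \<open>Some vertex has the highest level, a mark above it has the same level, and all terminal
  vertices are equivalent.\<close>

lemma level_terminal:
  assumes "terminal T v"
  shows "lv v = tree_length T"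
proof -
  obtain w where w: "w \<in> V" "lv w = tree_length T" using level_image by (metis atMost_iff image_iff order_refl)
  obtain i where i: "i \<in> {1..n}" "anc w (h i)" using ex_mark_above[OF w(1)] .
  then have "lv (h i) = tree_length T" using anc_level_le[OF i(2)] level_le_length[OF mark_vert[OF i(1)]] w by simp
  moreover have "lv v = lv (h i)"
    using terminal_sim[OF assms mark_terminal[OF i(1)]] level_mono[of v "h i"] level_mono[of "h i" v]
    by (simp add: sim_def)
  ultimately show ?thesis by simp
qed

lemma level_top_iff: "v \<in> V \<Longrightarrow> lv v = tree_length T \<longleftrightarrow> terminal T v"
proof
  assume v: "v \<in> V" "lv v = tree_length T"
  then have "\<not> child v c" for c using child_level[of v c] child_verts[of v c] level_le_length[of c] by fastforce
  then show "terminal T v" using terminal_iff v by blast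
qed (rule level_terminal)

lemma tlev_diag: "i \<in> {1..n} \<Longrightarrow> tlev (i, i) = tree_length T"
  using meet_self[OF mark_vert] level_terminal[OF mark_terminal] by (simp add: tlev_pair)

lemma tlev_top_iff: "i \<in> {1..n} \<Longrightarrow> j \<in> {1..n} \<Longrightarrow> tlev (i, j) = tree_length T \<longleftrightarrow> h i = h j"
proof -
  assume ij: "i \<in> {1..n}" "j \<in> {1..n}"
  have "terminal T (meet T (h i) (h j)) \<longleftrightarrow> h i = h j"
    using meet_props[OF mark_vert[OF ij(1)] mark_vert[OF ij(2)]] terminal_anc
      mark_terminal[OF ij(1)] meet_self[OF mark_vert[OF ij(1)]] by metis
  then show "tlev (i, j) = tree_length T \<longleftrightarrow> h i = h j"
    using level_top_iff[OF meet_vert[OF ij]] ij by (simp add: tlev_pair)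
qed

lemma tlev_image: "tlev ` labels n = {..tree_length T}"
proof (intro equalityI subsetI)
  fix m assume "m \<in> tlev ` labels n"
  then show "m \<in> {..tree_length T}"
    using level_le_length meet_vert by (auto simp: labels_def tlev_def)
next
  fix m assume "m \<in> {..tree_length T}"
  then obtain v where v: "v \<in> V" "lv v = m" using level_image by (metis image_iff)
  then obtain i j where "i \<in> {1..n}" "j \<in> {1..n}" "v = meet T (h i) (h j)" using ex_meet' by blast
  then show "m \<in> tlev ` labels n"
    using v by (intro image_eqI[of _ _ "(i, j)"]) (auto simp: tlev_pair labels_pair)
qed

text \<open>Both meets are ancestors of \<open>h i\<close>, hence comparable, and their levels
  decide. The levels of meets therefore determine the tree order.\<close>

lemma anc_meet_iff:
  assumes "i \<in> {1..n}" "j \<in> {1..n}" "k \<in> {1..n}"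
  shows "anc (meet T (h i) (h j)) (h k) \<longleftrightarrow> tlev (i, j) \<le> tlev (i, k)"
proof -
  note m = meet_props[OF mark_vert[OF assms(1)] mark_vert[OF assms(2)]]
    and m' = meet_props[OF mark_vert[OF assms(1)] mark_vert[OF assms(3)]]
  show ?thesis
    unfolding tlev_pair[OF assms(1)]
  proof
    assume "anc (meet T (h i) (h j)) (h k)"
    then show "lv (meet T (h i) (h j)) \<le> lv (meet T (h i) (h k))"
      using m'(3)[OF m(1)] anc_level_le by blast
  next
    assume "lv (meet T (h i) (h j)) \<le> lv (meet T (h i) (h k))"
    then show "anc (meet T (h i) (h j)) (h k)"
      using anc_comparable[OF m(1) m'(1)] m'(2) anc_trans by blast
  qed
qed

end

section \<open>Contractions\<close>

locale level_tree_pair = T: level_tree n T par + T': level_tree n T' par'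
  for n :: nat and T par T' par'
begin

abbreviation "pair_meet i j \<equiv> meet T (tmark T i) (tmark T j)"
abbreviation "pair_meet' i j \<equiv> meet T' (tmark T' i) (tmark T' j)"

lemma T'_meet:
  assumes "i \<in> {1..n}" "j \<in> {1..n}"
  shows "T'.anc (pair_meet' i j) (tmark T' i)" "T'.anc (pair_meet' i j) (tmark T' j)"
    "\<And>w. T'.anc w (tmark T' i) \<Longrightarrow> T'.anc w (tmark T' j) \<Longrightarrow> T'.anc w (pair_meet' i j)"
  using T'.meet_props[OF T'.mark_vert[OF assms(1)] T'.mark_vert[OF assms(2)]] by blast+

lemma T_meet:
  assumes "i \<in> {1..n}" "j \<in> {1..n}"
  shows "T.anc (pair_meet i j) (tmark T i)" "T.anc (pair_meet i j) (tmark T j)"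
    "\<And>w. T.anc w (tmark T i) \<Longrightarrow> T.anc w (tmark T j) \<Longrightarrow> T.anc w (pair_meet i j)"
  using T.meet_props[OF T.mark_vert[OF assms(1)] T.mark_vert[OF assms(2)]] by blast+

section \<open>Behaviour of chains and meets under a contraction\<close>

context
  fixes f assumes f: "contraction n T T' f"
begin

lemma f_vert: "v \<in> tverts T \<Longrightarrow> f v \<in> tverts T'"
  using f unfolding contraction_def by blast

lemma f_mark: "i \<in> {1..n} \<Longrightarrow> f (tmark T i) = tmark T' i"
  using f unfolding contraction_def by blast

lemma f_pre: "(v, w) \<in> tpre T \<Longrightarrow> (f v, f w) \<in> tpre T'"
  using f T.pre_verts unfolding contraction_def by blast

lemma f_adj: "v \<in> tverts T \<Longrightarrow> w \<in> tverts T \<Longrightarrow> tadj T v w \<Longrightarrow> f v = f w \<or> tadj T' (f v) (f w)"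
  using f unfolding contraction_def by blast

lemma f_fiber:
  "v \<in> tverts T \<Longrightarrow> w \<in> tverts T \<Longrightarrow> f v = f w \<Longrightarrow>
    (\<lambda>a b. tadj T a b \<and> a \<in> tverts T \<and> b \<in> tverts T \<and> f a = f v \<and> f b = f v)\<^sup>*\<^sup>* v w"
  using f unfolding contraction_def by blast

lemma f_child:
  assumes "T.child v u"
  shows "f v = f u \<or> T'.child (f v) (f u)"
proof -
  have vu: "v \<in> tverts T" "u \<in> tverts T" "tadj T v u"
    using T.child_verts[OF assms] T.adj_child_iff assms by blast+
  have "level T v \<le> level T u" using T.child_level[OF assms] by simp
  then have "(v, u) \<in> tpre T" using T.level_le_iff vu by blast
  then have "level T' (f v) \<le> level T' (f u)" using f_pre T'.level_mono by blast
  then have "\<not> T'.child (f u) (f v)" using T'.child_level by fastforce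
  then show ?thesis using f_adj[OF vu] T'.adj_child_iff by blast
qed

lemma f_anc:
  assumes "T.anc v u"
  shows "T'.anc (f v) (f u)"
proof -
  have "(\<lambda>x y. T.child y x)\<^sup>*\<^sup>* u v \<Longrightarrow> u \<in> tverts T \<Longrightarrow> T'.anc (f v) (f u)"
  proof (induction rule: rtranclp_induct)
    case base
    then show ?case using T'.anc_refl f_vert by blast
  next
    case (step y z)
    then show ?case using f_child[of z y] T'.anc_child T'.anc_trans by metis
  qed
  then show ?thesis using assms by (auto simp: T.anc_def)
qed

text \<open>Along a chain of ancestors a contraction moves by at most one step at a time, so no
  vertex of the image chain is skipped.\<close>

lemma f_between:
  assumes "T.anc v u" "T'.anc (f v) w" "T'.anc w (f u)"
  shows "\<exists>x. T.anc v x \<and> T.anc x u \<and> f x = w"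
proof -
  have "(\<lambda>x y. T.child y x)\<^sup>*\<^sup>* u v \<Longrightarrow> u \<in> tverts T \<Longrightarrow> T'.anc w (f u) \<Longrightarrow>
      \<exists>x. T.anc v x \<and> T.anc x u \<and> f x = w"
  proof (induction rule: converse_rtranclp_induct)
    case base
    then show ?case using T.anc_refl T'.anc_antisym assms(2) by blast
  next
    case (step u y)
    have y: "y \<in> tverts T" using T.child_verts step by blast
    have anc_u: "T.anc x u" if "T.anc x y" for x using that T.anc_child[OF step(1)] T.anc_trans by blast
    from step.prems(2) show ?case
    proof (cases rule: T'.anc_cases)
      case 1
      have "(\<lambda>x y. T.child y x)\<^sup>*\<^sup>* u v" using step by (auto intro: converse_rtranclp_into_rtranclp)
      then have "T.anc v u" using step.prems by (simp add: T.anc_def)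
      then show ?thesis using 1 T.anc_refl step.prems by blast
    next
      case 2
      have "T'.anc w (f y)"
        using f_child[OF step(1)] 2 step.prems(2) by (auto simp: T'.child_def)
      then show ?thesis using step.IH y anc_u by blast
    qed
  qed
  then show ?thesis using assms by (auto simp: T.anc_def)
qed

text \<open>If the image of the meet lay strictly below the new meet, both branches above
  \<open>pair_meet i j\<close> would contain a vertex over the new meet. The fiber is connected, but
  getting from one branch to the other requires passing through \<open>pair_meet i j\<close>, which
  is not in it.\<close>

lemma contraction_meet:
  assumes i: "i \<in> {1..n}" and j: "j \<in> {1..n}"
  shows "f (pair_meet i j) = pair_meet' i j"
proof (rule ccontr)
  let ?v = "pair_meet i j" and ?w = "pair_meet' i j"
  assume ne: "f ?v \<noteq> ?w"
  note m = T_meet[OF i j] and m' = T'_meet[OF i j]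
  have "T'.anc (f ?v) ?w"
    using m'(3) f_anc[OF m(1)] f_anc[OF m(2)] f_mark[OF i] f_mark[OF j] by simp
  then obtain a b where a: "T.anc ?v a" "T.anc a (tmark T i)" "f a = ?w"
    and b: "T.anc ?v b" "T.anc b (tmark T j)" "f b = ?w"
    using f_between[OF m(1)] f_between[OF m(2)] m'(1,2) f_mark[OF i] f_mark[OF j] by metis
  have "?v \<noteq> a" using a ne by auto
  then obtain c where c: "T.child ?v c" "T.anc c a" using T.ex_child_toward[OF a(1)] by blast
  have V: "a \<in> tverts T" "b \<in> tverts T" using a b T.anc_verts by blast+
  have "(\<lambda>x y. tadj T x y \<and> x \<in> tverts T \<and> y \<in> tverts T \<and> f x = f a \<and> f y = f a)\<^sup>*\<^sup>* a b"
    by (rule f_fiber[OF V]) (use a b in simp)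
  \<comment> \<open>Inside the fiber the path could leave the descendants of \<open>c\<close> only
    through the parent of \<open>c\<close>, which is the excluded vertex \<open>?v\<close>.\<close>
  then have "T.anc c b"
  proof (induction rule: rtranclp_induct)
    case base
    show ?case by (rule c(2))
  next
    case (step x y)
    then have "f y \<noteq> f ?v" using a ne by simp
    then have "y \<noteq> ?v" by auto
    consider "T.child y x" | "T.child x y" using step T.adj_child_iff by blast
    then show ?case
    proof cases
      case 1
      from step.IH show ?thesis
      proof (cases rule: T.anc_cases)
        case eq: 1
        then have "y = ?v" using 1 c(1) T.child_unique by blast
        then show ?thesis using \<open>y \<noteq> ?v\<close> by blast
      next
        case 2
        then show ?thesis using 1 by (simp add: T.child_def)
      qed
    next
      case 2
      then show ?thesis using step.IH T.anc_child T.anc_trans by blast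
    qed
  qed
  then have "T.anc c ?v" using m(3) c a b T.anc_trans by blast
  then show False using T.anc_level_le T.child_level[OF c(1)] by fastforce
qed

lemma contraction_tlev:
  assumes a: "a \<in> labels n" and c: "c \<in> labels n" and le: "T.tlev a \<le> T.tlev c"
  shows "T'.tlev a \<le> T'.tlev c"
proof -
  \<comment> \<open>The label \<open>(0, 0)\<close> has the same level as the diagonal label
    \<open>(k, k)\<close> in both trees, so only pairs remain.\<close>
  obtain k where k: "k \<in> {1..n}" using T.ex_mark_above[OF T.root_vert] by blast
  have "\<exists>i\<in>{1..n}. \<exists>j\<in>{1..n}. T.tlev a = T.tlev (i, j) \<and> T'.tlev a = T'.tlev (i, j)" if "a \<in> labels n" for a
  proof (cases "a = (0, 0)")
    case True
    have "T.tlev a = T.tlev (k, k)" "T'.tlev a = T'.tlev (k, k)"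
      using T.tlev_diag[OF k] T'.tlev_diag[OF k] True by (simp_all add: T.tlev_def T'.tlev_def)
    then show ?thesis using k by blast
  next
    case False
    then show ?thesis using that by (auto simp: labels_def)
  qed
  then obtain i j i' j' where ij: "i \<in> {1..n}" "j \<in> {1..n}" "T.tlev a = T.tlev (i, j)" "T'.tlev a = T'.tlev (i, j)"
    and ij': "i' \<in> {1..n}" "j' \<in> {1..n}" "T.tlev c = T.tlev (i', j')" "T'.tlev c = T'.tlev (i', j')"
    using a c by blast
  have "level T (pair_meet i j) \<le> level T (pair_meet i' j')"
    using le ij ij' by (simp add: T.tlev_pair)
  then have "(pair_meet i j, pair_meet i' j') \<in> tpre T"
    using T.level_le_iff T.meet_vert ij ij' by blast
  then have "level T' (f (pair_meet i j)) \<le> level T' (f (pair_meet i' j'))"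
    using f_pre T'.level_mono by blast
  then show ?thesis
    using contraction_meet ij ij' by (simp add: T'.tlev_pair)
qed

end

text \<open>Every vertex is a meet of marks, and contractions preserve meets.\<close>

lemma contraction_unique:
  assumes "contraction n T T' f" "contraction n T T' g"
  shows "f = g"
proof (rule extensionalityI[of _ "tverts T"])
  fix v assume "v \<in> tverts T"
  then obtain i j where "i \<in> {1..n}" "j \<in> {1..n}" "v = pair_meet i j" using T.ex_meet' by blast
  then show "f v = g v" using contraction_meet[OF assms(1)] contraction_meet[OF assms(2)] by simp
qed (use assms in \<open>auto simp: contraction_def\<close>)

section \<open>The contraction given by a monotone comparison of levels\<close>

context
  assumes mono: "\<And>a c. a \<in> labels n \<Longrightarrow> c \<in> labels n \<Longrightarrow> T.tlev a \<le> T.tlev c \<Longrightarrow> T'.tlev a \<le> T'.tlev c"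
begin

lemma meet_mono:
  assumes "i \<in> {1..n}" "j \<in> {1..n}" "k \<in> {1..n}" "T.anc (pair_meet i j) (tmark T k)"
  shows "T'.anc (pair_meet' i j) (tmark T' k)"
proof -
  have "T.tlev (i, j) \<le> T.tlev (i, k)" using T.anc_meet_iff[OF assms(1-3)] assms(4) by blast
  then have "T'.tlev (i, j) \<le> T'.tlev (i, k)"
    by (rule mono[OF labels_pair[OF assms(1,2)] labels_pair[OF assms(1,3)]])
  then show ?thesis using T'.anc_meet_iff[OF assms(1-3)] by blast
qed

text \<open>Being an ancestor of a mark is a comparison of levels and is preserved by
  \<open>mono\<close>; the images of equal meets are thus ancestors of each other.\<close>

lemma meet_well_defined:
  assumes ij: "i \<in> {1..n}" "j \<in> {1..n}" and kl: "k \<in> {1..n}" "l \<in> {1..n}" and eq: "pair_meet i j = pair_meet k l"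
  shows "pair_meet' i j = pair_meet' k l"
proof -
  have *: "T'.anc (pair_meet' i j) (pair_meet' k l)"
    if "i \<in> {1..n}" "j \<in> {1..n}" "k \<in> {1..n}" "l \<in> {1..n}" "pair_meet i j = pair_meet k l" for i j k l
    using meet_mono[OF that(1,2,3)] meet_mono[OF that(1,2,4)] T_meet[OF that(3,4)] T'_meet(3)[OF that(3,4)] that(5)
    by simp
  show ?thesis
    using *[OF ij kl eq] *[OF kl ij eq[symmetric]] T'.anc_antisym by blast
qed

definition meet_map :: "nat \<Rightarrow> nat" where
  "meet_map = (\<lambda>v\<in>tverts T. SOME w. \<exists>i\<in>{1..n}. \<exists>j\<in>{1..n}. v = pair_meet i j \<and> w = pair_meet' i j)"

lemma meet_map:
  assumes "i \<in> {1..n}" "j \<in> {1..n}"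
  shows "meet_map (pair_meet i j) = pair_meet' i j"
proof -
  define P where "P w \<longleftrightarrow> (\<exists>k\<in>{1..n}. \<exists>l\<in>{1..n}. pair_meet i j = pair_meet k l \<and> w = pair_meet' k l)" for w
  have "P (pair_meet' i j)" using assms unfolding P_def by blast
  then have "P (SOME w. P w)" by (rule someI)
  moreover have "meet_map (pair_meet i j) = (SOME w. P w)"
    using T.meet_vert[OF assms] by (simp add: meet_map_def P_def)
  ultimately have "\<exists>k\<in>{1..n}. \<exists>l\<in>{1..n}. pair_meet i j = pair_meet k l \<and> meet_map (pair_meet i j) = pair_meet' k l"
    by (simp add: P_def)
  then show ?thesis using meet_well_defined assms by metis
qed

lemma meet_map_anc:
  assumes "T.anc v u"
  shows "T'.anc (meet_map v) (meet_map u)"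
proof -
  have "u \<in> tverts T" using assms T.anc_verts by blast
  then obtain i j where ij: "i \<in> {1..n}" "j \<in> {1..n}" "u = pair_meet i j" using T.ex_meet' by blast
  have "T.anc v (tmark T i)" using assms ij T_meet T.anc_trans by blast
  then obtain k where k: "k \<in> {1..n}" "v = pair_meet i k" using T.ex_meet ij by blast
  have "T.tlev (i, k) \<le> T.tlev (i, j)" using T.anc_level_le[OF assms] ij k by (simp add: T.tlev_pair)
  then have "level T' (pair_meet' i k) \<le> level T' (pair_meet' i j)"
    using mono[OF labels_pair labels_pair] ij k by (simp add: T'.tlev_pair)
  then show ?thesis
    using T'.anc_comparable[OF T'_meet(1) T'_meet(1)] meet_map ij k by simp
qed

text \<open>A vertex of \<open>T'\<close> strictly between the two images is some
  \<open>pair_meet' i l\<close>; by monotonicity \<open>pair_meet i l\<close> would then lie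
  strictly between a vertex and its child.\<close>

lemma meet_map_child:
  assumes "T.child v u"
  shows "meet_map v = meet_map u \<or> T'.child (meet_map v) (meet_map u)"
proof (rule ccontr)
  assume *: "\<not> (meet_map v = meet_map u \<or> T'.child (meet_map v) (meet_map u))"
  have anc: "T.anc v u" using assms T.anc_child by blast
  then have "u \<in> tverts T" using T.anc_verts by blast
  then obtain i j where ij: "i \<in> {1..n}" "j \<in> {1..n}" "u = pair_meet i j" using T.ex_meet' by blast
  have vi: "T.anc v (tmark T i)" using anc ij T_meet T.anc_trans by blast
  then obtain k where k: "k \<in> {1..n}" "v = pair_meet i k" using T.ex_meet ij by blast
  have m: "meet_map u = pair_meet' i j" "meet_map v = pair_meet' i k" using meet_map ij k by simp_all
  obtain c where c: "T'.child (meet_map v) c" "T'.anc c (meet_map u)"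
    using T'.ex_child_toward[OF meet_map_anc[OF anc]] * by blast
  have "c \<noteq> meet_map u" using * c by blast
  have "T'.anc (meet_map u) (tmark T' i)" using m T'_meet(1)[OF ij(1,2)] by simp
  then have "T'.anc c (tmark T' i)" by (rule T'.anc_trans[OF c(2)])
  then obtain l where l: "l \<in> {1..n}" "c = pair_meet' i l" using T'.ex_meet ij by blast
  have "level T' (meet_map v) < level T' c" "level T' c < level T' (meet_map u)"
    using T'.child_level[OF c(1)] T'.anc_level[OF c(2) \<open>c \<noteq> meet_map u\<close>] by simp_all
  then have "T'.tlev (i, k) < T'.tlev (i, l)" "T'.tlev (i, l) < T'.tlev (i, j)"
    unfolding m l(2) T'.tlev_pair[OF ij(1)] by simp_all
  then have "\<not> T.tlev (i, l) \<le> T.tlev (i, k)" "\<not> T.tlev (i, j) \<le> T.tlev (i, l)"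
    using mono[of "(i, l)" "(i, k)"] mono[of "(i, j)" "(i, l)"] labels_pair ij k l by fastforce+
  then have lt: "level T v < level T (pair_meet i l)" "level T (pair_meet i l) < level T u"
    using ij k l by (simp_all add: T.tlev_pair)
  then have "T.anc (pair_meet i l) u"
    using T.anc_comparable[OF T_meet(1)[OF ij(1) l(1)] T_meet(1)[OF ij(1,2)]] ij by simp
  then have "T.anc (pair_meet i l) v"
    by (cases rule: T.anc_cases) (use lt assms in \<open>auto simp: T.child_def\<close>)
  then show False using T.anc_level_le lt by fastforce
qed

text \<open>Images along the chain from \<open>v\<close> to its ancestor \<open>x\<close> are
  squeezed between two equal values.\<close>

lemma meet_map_fiber:
  assumes "T.anc x v" "meet_map x = w" "meet_map v = w"
  shows "(\<lambda>a b. tadj T a b \<and> a \<in> tverts T \<and> b \<in> tverts T \<and> meet_map a = w \<and> meet_map b = w)\<^sup>*\<^sup>* v x"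
    (is "?R\<^sup>*\<^sup>* v x")
proof -
  have "(\<lambda>x y. T.child y x)\<^sup>*\<^sup>* v x \<Longrightarrow> v \<in> tverts T \<Longrightarrow> meet_map v = w \<Longrightarrow> ?R\<^sup>*\<^sup>* v x"
  proof (induction rule: converse_rtranclp_induct)
    case (step v y)
    have y: "y \<in> tverts T" using T.child_verts step by blast
    then have "T.anc x y" using step by (simp add: T.anc_def)
    then have "T'.anc w (meet_map y)" "T'.anc (meet_map y) w"
      using meet_map_anc[of x y] meet_map_anc[OF T.anc_child[OF step(1)]] assms(2) step.prems by auto
    then have "meet_map y = w" using T'.anc_antisym by blast
    moreover have "tadj T v y" using step T.adj_child_iff by blast
    ultimately have R: "?R v y" using step.prems y \<open>meet_map y = w\<close> by simp
    show ?case by (rule converse_rtranclp_into_rtranclp[OF R step.IH[OF y \<open>meet_map y = w\<close>]])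
  qed simp
  then show ?thesis using assms by (auto simp: T.anc_def)
qed

lemma contraction_meet_map: "contraction n T T' meet_map"
  unfolding contraction_def
proof (intro conjI ballI impI)
  show "meet_map \<in> extensional (tverts T)" by (simp add: meet_map_def)
  show "meet_map (tmark T i) = tmark T' i" if "i \<in> {1..n}" for i
    using meet_map[OF that that] T.meet_self[OF T.mark_vert[OF that]] T'.meet_self[OF T'.mark_vert[OF that]] by simp
  show "meet_map ` tverts T = tverts T'"
  proof (intro equalityI subsetI)
    fix w assume "w \<in> meet_map ` tverts T"
    then obtain v where "v \<in> tverts T" "w = meet_map v" by blast
    moreover from this obtain i j where "i \<in> {1..n}" "j \<in> {1..n}" "v = pair_meet i j" using T.ex_meet' by blast
    ultimately show "w \<in> tverts T'" using meet_map T'.meet_vert by simp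
  next
    fix w assume "w \<in> tverts T'"
    then obtain i j where "i \<in> {1..n}" "j \<in> {1..n}" "w = pair_meet' i j" using T'.ex_meet' by blast
    then show "w \<in> meet_map ` tverts T"
      using meet_map T.meet_vert by (intro image_eqI[of _ _ "pair_meet i j"]) simp_all
  qed
next
  fix v w assume vw: "v \<in> tverts T" "w \<in> tverts T" "(v, w) \<in> tpre T"
  obtain i j where ij: "i \<in> {1..n}" "j \<in> {1..n}" "v = pair_meet i j" using T.ex_meet' vw by blast
  obtain k l where kl: "k \<in> {1..n}" "l \<in> {1..n}" "w = pair_meet k l" using T.ex_meet' vw by blast
  have "T.tlev (i, j) \<le> T.tlev (k, l)" using T.level_mono[OF vw(3)] ij kl by (simp add: T.tlev_pair)
  then have "level T' (pair_meet' i j) \<le> level T' (pair_meet' k l)"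
    using mono[OF labels_pair labels_pair] ij kl by (simp add: T'.tlev_pair)
  then show "(meet_map v, meet_map w) \<in> tpre T'"
    using T'.level_le_iff T'.meet_vert meet_map ij kl by simp
next
  fix v w assume "tadj T v w"
  then show "meet_map v = meet_map w \<or> tadj T' (meet_map v) (meet_map w)"
    using meet_map_child[of v w] meet_map_child[of w v] T.adj_child_iff T'.adj_child_iff by metis
next
  fix v w assume vw: "v \<in> tverts T" "w \<in> tverts T" "meet_map v = meet_map w"
  let ?R = "\<lambda>a b. tadj T a b \<and> a \<in> tverts T \<and> b \<in> tverts T \<and> meet_map a = meet_map v \<and> meet_map b = meet_map v"
  obtain i j where ij: "i \<in> {1..n}" "j \<in> {1..n}" "v = pair_meet i j" using T.ex_meet' vw by blast
  obtain k l where kl: "k \<in> {1..n}" "l \<in> {1..n}" "w = pair_meet k l" using T.ex_meet' vw by blast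
  \<comment> \<open>If \<open>x\<close> is an ancestor of both \<open>v\<close> and
    \<open>w\<close>, its image is squeezed to the common value, and \<open>x\<close> links them
    inside the fiber. Otherwise \<open>v\<close> and \<open>w\<close> are already
    comparable.\<close>
  define x where "x = pair_meet i k"
  have fx: "T'.anc (meet_map v) (meet_map x)"
    using T'_meet(1)[OF ij(1,2)] T'_meet(1)[OF kl(1,2)] T'_meet(3)[OF ij(1) kl(1)] vw(3) meet_map ij kl
    by (simp add: x_def)
  have vi: "T.anc v (tmark T i)" "T.anc w (tmark T k)" "T.anc x (tmark T i)" "T.anc x (tmark T k)"
    using T_meet ij kl x_def by simp_all
  have "\<exists>y. T.anc y v \<and> T.anc y w \<and> meet_map y = meet_map v"
  proof (cases "T.anc x v \<and> T.anc x w")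
    case True
    then have "meet_map x = meet_map v" using fx meet_map_anc[of x v] T'.anc_antisym by blast
    with True show ?thesis by blast
  next
    case False
    then have "T.anc v x \<or> T.anc w x" using vi T.anc_linear by blast
    then have "T.anc v w \<or> T.anc w v" using vi T.anc_trans T.anc_linear by meson
    then show ?thesis using T.anc_refl vw by metis
  qed
  then obtain y where y: "T.anc y v" "T.anc y w" "meet_map y = meet_map v" by blast
  have "?R\<^sup>*\<^sup>* v y" using meet_map_fiber[OF y(1,3) refl] .
  moreover have "?R\<^sup>*\<^sup>* w y" using meet_map_fiber[OF y(2,3) vw(3)[symmetric]] .
  moreover have "symp ?R" by (rule sympI) (use T.adj_child_iff in auto)
  then have "symp ?R\<^sup>*\<^sup>*" by (rule symp_rtranclp)
  ultimately have "?R\<^sup>*\<^sup>* y w" by (blast dest: sympD)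
  then show "?R\<^sup>*\<^sup>* v w" using \<open>?R\<^sup>*\<^sup>* v y\<close> by (rule rtranclp_trans[rotated])
qed

end

end

section \<open>The level data of a stable line\<close>

lemma dual_tree_simps [simp]:
  "tverts (dual_tree L) = verts L" "troot (dual_tree L) = fst (inf_pt L)"
  "tpre (dual_tree L) = preord L" "tmark (dual_tree L) i = fst (mark L i)"
  "tadj (dual_tree L) v w = (\<exists>x y. {(v, x), (w, y)} \<in> nodes L)"
  by (simp_all add: dual_tree_def)

locale stable_curve =
  fixes n :: nat and L :: mline
  assumes stable: "stable_line n L"
begin

abbreviation "T \<equiv> dual_tree L"
abbreviation "r \<equiv> fst (inf_pt L)"

definition parent :: "nat \<Rightarrow> nat" where
  "parent v = (THE w. tadj T v w \<and> prec (preord L) w v)"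

lemma multiscaled: "multiscaled_line L"
  using stable by (simp add: stable_line_def marked_multiscaled_line_def)

lemma curve: "nodal_curve_genus0 L"
  using multiscaled by (simp add: multiscaled_line_def)

lemma root_vert': "r \<in> verts L" and inf_smooth: "inf_pt L \<notin> \<Union>(nodes L)"
proof -
  have "inf_pt L \<in> smooth_points L" using multiscaled by (simp add: multiscaled_line_def)
  then show "r \<in> verts L" "inf_pt L \<notin> \<Union>(nodes L)"
    by (auto simp: smooth_points_def mem_Times_iff)
qed

lemma finite_verts': "finite (verts L)"
  using curve by (simp add: nodal_curve_genus0_def)

lemma node_verts:
  assumes "{(v, x), (w, y)} \<in> nodes L"
  shows "v \<in> verts L \<and> w \<in> verts L"
proof -
  have "\<forall>e\<in>nodes L. e \<subseteq> verts L \<times> UNIV" using curve by (simp add: nodal_curve_genus0_def)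
  then show ?thesis using assms by auto
qed

lemma node_disjoint:
  assumes "e \<in> nodes L" "e' \<in> nodes L" "p \<in> e" "p \<in> e'"
  shows "e = e'"
proof -
  have "\<forall>e\<in>nodes L. \<forall>e'\<in>nodes L. e \<noteq> e' \<longrightarrow> e \<inter> e' = {}" using curve by (simp add: nodal_curve_genus0_def)
  then show ?thesis using assms by blast
qed

lemma parent:
  assumes "v \<in> verts L" "v \<noteq> r"
  shows "tadj T v (parent v)" "prec (preord L) (parent v) v"
proof -
  have "\<forall>v\<in>verts L. v \<noteq> r \<longrightarrow> (\<exists>!w. tadj T v w \<and> prec (preord L) w v)"
    using multiscaled unfolding multiscaled_line_def by (elim conjE)
  then have "\<exists>!w. tadj T v w \<and> prec (preord L) w v"
    using assms by simp
  from theI'[OF this] show "tadj T v (parent v)" "prec (preord L) (parent v) v"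
    by (simp_all add: parent_def)
qed

lemma prec_irrefl: "\<not> prec (preord L) v v"
  by (simp add: prec_def)

lemma prec_asym: "prec (preord L) v w \<Longrightarrow> \<not> prec (preord L) w v"
  by (simp add: prec_def)

definition node :: "nat \<Rightarrow> (nat \<times> sphere) set" where
  "node v = (SOME e. e \<in> nodes L \<and> (\<exists>x y. e = {(v, x), (parent v, y)}))"

lemma node_ex: "v \<in> verts L \<Longrightarrow> v \<noteq> r \<Longrightarrow> node v \<in> nodes L \<and> (\<exists>x y. node v = {(v, x), (parent v, y)})"
proof -
  assume "v \<in> verts L" "v \<noteq> r"
  then obtain x y where xy: "{(v, x), (parent v, y)} \<in> nodes L" using parent(1)[of v] by auto
  define P where "P e \<longleftrightarrow> e \<in> nodes L \<and> (\<exists>x y. e = {(v, x), (parent v, y)})" for e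
  have "P {(v, x), (parent v, y)}" using xy unfolding P_def by blast
  then have "P (SOME e. P e)" by (rule someI)
  then show "node v \<in> nodes L \<and> (\<exists>x y. node v = {(v, x), (parent v, y)})"
    by (simp add: P_def node_def)
qed

lemma node_inj: "v \<in> verts L \<Longrightarrow> v \<noteq> r \<Longrightarrow> u \<in> verts L \<Longrightarrow> u \<noteq> r \<Longrightarrow>
    {(v, x), (parent v, y)} = {(u, x'), (parent u, y')} \<Longrightarrow> v = u"
proof (rule ccontr)
  assume *: "v \<in> verts L" "v \<noteq> r" "u \<in> verts L" "u \<noteq> r" "{(v, x), (parent v, y)} = {(u, x'), (parent u, y')}" "v \<noteq> u"
  then have "v = parent u" "u = parent v" by (auto simp: doubleton_eq_iff)
  then show False using parent(2)[of v] parent(2)[of u] prec_asym * by metis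
qed

text \<open>Genus 0 leaves exactly as many nodes as there are vertices other than the root. The
  descending nodes of these vertices are pairwise distinct, so there are no further nodes.\<close>

lemma nodes_eq: "nodes L = node ` (verts L - {r})"
proof (rule sym, rule card_subset_eq)
  show "finite (nodes L)" using curve by (simp add: nodal_curve_genus0_def)
  show "node ` (verts L - {r}) \<subseteq> nodes L" using node_ex by blast
  have "inj_on node (verts L - {r})"
    by (rule inj_onI) (metis DiffE insertCI node_ex node_inj)
  then have "card (node ` (verts L - {r})) = card (verts L) - 1"
    using root_vert' finite_verts' by (simp add: card_image)
  moreover have "int (card (nodes L)) - int (card (verts L)) + 1 = 0"
    using curve by (simp add: nodal_curve_genus0_def)
  moreover have "card (verts L) > 0" using root_vert' finite_verts' by (auto simp: card_gt_0_iff)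
  ultimately show "card (node ` (verts L - {r})) = card (nodes L)" by linarith
qed

lemma node_eqI:
  assumes "v \<in> verts L" "v \<noteq> r" "{(v, x), (parent v, y)} \<in> nodes L"
  shows "node v = {(v, x), (parent v, y)}"
proof -
  obtain u where u: "u \<in> verts L" "u \<noteq> r" "{(v, x), (parent v, y)} = node u"
    using assms(3) by (auto simp: nodes_eq)
  then obtain x' y' where "node u = {(u, x'), (parent u, y')}" using node_ex by blast
  then have "v = u" using node_inj[OF assms(1,2) u(1,2)] u(3) by metis
  then show ?thesis using u(3) by simp
qed

text \<open>The point on the component of the parent at which \<open>v\<close> is attached; the
  other branch of this node is \<open>pole v\<close>.\<close>

definition dn :: "nat \<Rightarrow> sphere" where
  "dn v = branch_point L (parent v) v"

abbreviation "pole \<equiv> pole_point L"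

lemma pole_nonroot: "v \<noteq> r \<Longrightarrow> pole v = branch_point L v (parent v)"
  by (simp only: pole_point_def parent_def if_False)

lemma parent_neq: "v \<in> verts L \<Longrightarrow> v \<noteq> r \<Longrightarrow> parent v \<noteq> v"
  using parent(2)[of v] prec_irrefl by metis

lemma branch_points:
  assumes "v \<in> verts L" "v \<noteq> r" "{(v, x), (parent v, y)} \<in> nodes L"
  shows "pole v = x" "dn v = y"
proof -
  note eq = node_eqI[OF assms(1,2)]
  have uniq: "x' = x \<and> y' = y" if "{(v, x'), (parent v, y')} \<in> nodes L" for x' y'
    using eq[OF assms(3)] eq[OF that] parent_neq[OF assms(1,2)] by (auto simp: doubleton_eq_iff)
  show "pole v = x"
    unfolding pole_nonroot[OF assms(2)] branch_point_def
    by (rule the_equality) (use assms(3) uniq in blast)+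
  show "dn v = y"
    unfolding dn_def branch_point_def
  proof (rule the_equality)
    show "\<exists>ya. {(parent v, y), (v, ya)} \<in> nodes L" using assms(3) by (auto simp: insert_commute)
    fix z assume "\<exists>ya. {(parent v, z), (v, ya)} \<in> nodes L"
    then obtain ya where "{(v, ya), (parent v, z)} \<in> nodes L" by (auto simp: insert_commute)
    then show "z = y" using uniq by blast
  qed
qed

lemma node_eq: "v \<in> verts L \<Longrightarrow> v \<noteq> r \<Longrightarrow> node v = {(v, pole v), (parent v, dn v)}"
  using node_ex[of v] branch_points[of v] by force

lemma node_in: "v \<in> verts L \<Longrightarrow> v \<noteq> r \<Longrightarrow> {(v, pole v), (parent v, dn v)} \<in> nodes L"
  using node_ex[of v] node_eq[of v] by metis

lemma nodes_eq': "nodes L = (\<lambda>v. {(v, pole v), (parent v, dn v)}) ` (verts L - {r})"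
  unfolding nodes_eq by (rule image_cong) (auto simp: node_eq)

lemma adj_iff': "(\<exists>x y. {(v, x), (w, y)} \<in> nodes L) \<longleftrightarrow>
    v \<in> verts L \<and> v \<noteq> r \<and> w = parent v \<or> w \<in> verts L \<and> w \<noteq> r \<and> v = parent w"
proof
  assume "\<exists>x y. {(v, x), (w, y)} \<in> nodes L"
  then obtain x y u where "u \<in> verts L" "u \<noteq> r" "{(v, x), (w, y)} = {(u, pole u), (parent u, dn u)}"
    unfolding nodes_eq' by blast
  then show "v \<in> verts L \<and> v \<noteq> r \<and> w = parent v \<or> w \<in> verts L \<and> w \<noteq> r \<and> v = parent w"
    by (auto simp: doubleton_eq_iff)
next
  assume "v \<in> verts L \<and> v \<noteq> r \<and> w = parent v \<or> w \<in> verts L \<and> w \<noteq> r \<and> v = parent w"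
  then show "\<exists>x y. {(v, x), (w, y)} \<in> nodes L"
    using node_in[of v] node_in[of w] by (metis insert_commute)
qed

text \<open>A component has at most one descending node, and every other node on it leads to a
  child. The stability bounds leave at least two children, also at the root, which has no descending
  node.\<close>

lemma children_of_nonterminal:
  assumes v: "v \<in> verts L" and nt: "\<not> terminal T v"
  shows "\<exists>c c'. c \<noteq> c' \<and> c \<in> verts L \<and> c' \<in> verts L \<and> c \<noteq> r \<and> c' \<noteq> r \<and> parent c = v \<and> parent c' = v"
proof (rule ccontr)
  assume no: "\<not> ?thesis"
  define C where "C = {c \<in> verts L. c \<noteq> r \<and> parent c = v}"
  have "\<exists>c. C \<subseteq> {c}"
  proof (cases "C = {}")
    case False
    then obtain c where "c \<in> C" by blast
    moreover from this have "c' = c" if "c' \<in> C" for c'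
      using no that unfolding C_def by blast
    ultimately show ?thesis by (intro exI[of _ c]) blast
  qed simp
  then obtain c where C: "C \<subseteq> {c}" by blast
  have sub: "{e \<in> nodes L. \<exists>x. (v, x) \<in> e} \<subseteq> node ` ({v} - {r} \<union> C)"
  proof
    fix e assume "e \<in> {e \<in> nodes L. \<exists>x. (v, x) \<in> e}"
    then obtain u x where u: "u \<in> verts L" "u \<noteq> r" "e = node u" "(v, x) \<in> e" by (auto simp: nodes_eq)
    then have "v = u \<or> v = parent u" by (auto simp: node_eq)
    then show "e \<in> node ` ({v} - {r} \<union> C)" using u by (auto simp: C_def)
  qed
  have fin: "finite ({v} - {r} \<union> C)" using C finite_subset by auto
  have "node_count L v \<le> card (node ` ({v} - {r} \<union> C))"
    unfolding node_count_def using sub fin by (intro card_mono) auto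
  also have "\<dots> \<le> card ({v} - {r} \<union> C)" using fin by (rule card_image_le)
  also have "\<dots> \<le> card ({v} - {r}) + card C" by (rule card_Un_le)
  also have "card C \<le> 1" using C card_mono[of "{c}" C] by simp
  finally have "node_count L v \<le> card ({v} - {r}) + 1" by simp
  moreover have "node_count L v \<ge> 3 \<or> (node_count L v \<ge> 2 \<and> v = r)"
    using stable v nt by (auto simp: stable_line_def)
  moreover have "card ({v} - {r}) \<le> 1" using card_mono[of "{v}" "{v} - {r}"] by simp
  moreover have "v = r \<Longrightarrow> card ({v} - {r}) = 0" by simp
  ultimately show False by linarith
qed

sublocale level_tree n T parent
proof
  show "finite (tverts T)" using finite_verts' by simp
  show "troot T \<in> tverts T" using root_vert' by simp
  show "parent v \<in> tverts T" if "v \<in> tverts T" "v \<noteq> troot T" for v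
    using parent(1)[of v] that node_verts by auto
  show "prec (tpre T) (parent v) v" if "v \<in> tverts T" "v \<noteq> troot T" for v
    using parent(2)[of v] that by simp
  show "preorder_on (tverts T) (tpre T)" "total_on (tverts T) (tpre T)"
    using multiscaled by (simp_all add: multiscaled_line_def)
  show "tadj T v w = (v \<in> tverts T \<and> v \<noteq> troot T \<and> w = parent v \<or> w \<in> tverts T \<and> w \<noteq> troot T \<and> v = parent w)" for v w
    using adj_iff'[of v w] by simp
  show "sim (tpre T) v w" if "terminal T v" "terminal T w" for v w
    using multiscaled that by (simp add: multiscaled_line_def)
  show "terminal T (tmark T i)" if "i \<in> {1..n}" for i
    using stable that by (simp add: stable_line_def marked_multiscaled_line_def)
  show "\<exists>i\<in>{1..n}. tmark T i = v" if "terminal T v" for v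
    using stable that unfolding stable_line_def by (auto simp: terminal_def)
  show "\<exists>c c'. c \<noteq> c' \<and> c \<in> tverts T \<and> c' \<in> tverts T \<and> c \<noteq> troot T \<and> c' \<noteq> troot T \<and> parent c = v \<and> parent c' = v"
    if "v \<in> tverts T" "\<not> terminal T v" for v
    using children_of_nonterminal that by simp
qed

lemma child_iff: "child v c \<longleftrightarrow> c \<in> verts L \<and> c \<noteq> r \<and> parent c = v"
  by (simp add: child_def)

lemma dn_inj: "child v c \<Longrightarrow> child v c' \<Longrightarrow> dn c = dn c' \<Longrightarrow> c = c'"
proof -
  assume c: "child v c" "child v c'" "dn c = dn c'"
  have "(v, dn c) \<in> node c" "(v, dn c) \<in> node c'"
    using c by (auto simp: child_iff node_eq)
  moreover have "node c \<in> nodes L" "node c' \<in> nodes L" using c node_ex by (auto simp: child_iff)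
  ultimately have "node c = node c'" using node_disjoint by blast
  then show "c = c'" using node_inj[of c c'] c by (metis child_iff node_eq)
qed

lemma dn_neq_pole: "child v c \<Longrightarrow> dn c \<noteq> pole v"
proof
  assume c: "child v c" "dn c = pole v"
  have nc: "(v, dn c) \<in> node c" "node c \<in> nodes L"
    using c(1) node_eq[of c] node_ex[of c] unfolding child_iff by blast+
  show False
  proof (cases "v = r")
    case True
    then have "inf_pt L = (v, dn c)" using c(2) by (simp add: pole_point_def prod_eq_iff)
    then show False using nc inf_smooth by auto
  next
    case False
    have v: "v \<in> verts L" using child_verts[OF c(1)] by simp
    have "(v, dn c) \<in> node v" using c(2) v False by (simp add: node_eq)
    then have "node c = node v" using nc node_disjoint node_ex[OF v False] by blast
    then have "c = v" using node_inj[of c v] c v False by (metis child_iff node_eq)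
    then show False using c(1) child_level by fastforce
  qed
qed

lemma mark_neq_pole:
  assumes "i \<in> {1..n}"
  shows "snd (mark L i) \<noteq> pole (h i)"
proof
  assume eq: "snd (mark L i) = pole (h i)"
  have m: "mark L i \<in> smooth_points L" "mark L i \<noteq> inf_pt L"
    using stable assms by (auto simp: stable_line_def marked_multiscaled_line_def)
  have v: "h i \<in> verts L" using mark_vert[OF assms] by simp
  show False
  proof (cases "h i = r")
    case True
    then have "mark L i = inf_pt L" using eq by (simp add: pole_point_def prod_eq_iff)
    then show False using m by simp
  next
    case False
    then have "mark L i \<in> node (h i)" using v node_eq[of "h i"] eq by (simp add: prod_eq_iff)
    then show False using m(1) node_ex[OF v] False by (auto simp: smooth_points_def)
  qed
qed

section \<open>Affine coordinates on components and periods\<close>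

definition chart :: "nat \<Rightarrow> sphere \<Rightarrow> sphere" where
  "chart v = (SOME \<phi>. \<phi> \<in> sphere_aut \<and> \<phi> (pole v) = Infty \<and> diff_form L v = form \<phi>)"

lemma chart:
  assumes "v \<in> verts L"
  shows "chart v \<in> sphere_aut" "chart v (pole v) = Infty" "diff_form L v = form (chart v)"
proof -
  have *: "meromorphic_diff (diff_form L v)" "\<exists>z. diff_form L v z \<noteq> 0"
      "diff_order (diff_form L v) (pole v) = -2" "\<And>p. p \<noteq> pole v \<Longrightarrow> diff_order (diff_form L v) p = 0"
    using multiscaled assms by (auto simp: multiscaled_line_def)
  have "\<exists>\<phi>. \<phi> \<in> sphere_aut \<and> \<phi> (pole v) = Infty \<and> diff_form L v = form \<phi>"
    by (rule form_classification[OF *(1-3)], fact *(4), intro exI conjI, assumption+)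
  from someI_ex[OF this, folded chart_def]
  show "chart v \<in> sphere_aut" "chart v (pole v) = Infty" "diff_form L v = form (chart v)" by blast+
qed

text \<open>A primitive of the differential, finite away from the pole. It is unique up to
  translation, so only differences of its values are meaningful.\<close>

definition X :: "nat \<Rightarrow> sphere \<Rightarrow> complex" where
  "X v p = pt_val (chart v p)"

lemma chart_finite:
  assumes "v \<in> verts L" "p \<noteq> pole v"
  shows "chart v p = Pt (X v p)"
proof -
  have "chart v p \<noteq> Infty" using inj_sphere_aut[OF chart(1)[OF assms(1)]] chart(2)[OF assms(1)] assms(2)
    by (metis injD)
  then show ?thesis by (cases "chart v p") (auto simp: X_def)
qed

lemma X_inj: "v \<in> verts L \<Longrightarrow> p \<noteq> pole v \<Longrightarrow> q \<noteq> pole v \<Longrightarrow> X v p = X v q \<Longrightarrow> p = q"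
  using chart_finite inj_sphere_aut[OF chart(1)] by (metis injD)

lemma sphere_integral_X:
  assumes "v \<in> verts L" "p \<noteq> pole v" "q \<noteq> pole v"
  shows "sphere_integral (diff_form L v) p q = X v q - X v p"
proof -
  have *: "diff_order (diff_form L v) (pole v) = -2" "\<And>p. p \<noteq> pole v \<Longrightarrow> diff_order (diff_form L v) p = 0"
    using multiscaled assms by (auto simp: multiscaled_line_def)
  show ?thesis
    unfolding X_def chart(3)[OF assms(1)]
    by (rule sphere_integral_form[OF chart(1,2)[OF assms(1)] _ _ assms(2,3)])
      (use * in \<open>simp_all flip: chart(3)[OF assms(1)]\<close>)
qed

lemma toward_eq:
  assumes "child v c" "anc c u"
  shows "toward L v u = dn c"
proof -
  have vu: "anc v u" using assms anc_child anc_trans by blast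
  have "(THE w. tadj T v w \<and> on_path T v u w) = c"
  proof (rule the_equality)
    show "tadj T v c \<and> on_path T v u c"
      using assms adj_child_iff on_path_rev[OF vu] anc_child by blast
    fix w assume w: "tadj T v w \<and> on_path T v u w"
    then have "anc v w" "anc w u" using on_path_rev[OF vu] by blast+
    then have "\<not> child w v" using child_level anc_level_le by fastforce
    then have "child v w" using w adj_child_iff by blast
    then show "w = c" using child_toward_unique assms \<open>anc w u\<close> by blast
  qed
  moreover have "parent c = v" using assms(1) child_iff by blast
  ultimately show ?thesis unfolding toward_def dn_def by simp
qed

text \<open>The point of the component of \<open>v\<close> at which the mark \<open>i\<close> is
  seen; meaningful when \<open>v\<close> is an ancestor of \<open>h i\<close>.\<close>

definition loc :: "nat \<Rightarrow> nat \<Rightarrow> sphere" where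
  "loc v i = (if v = h i then snd (mark L i) else toward L v (h i))"

lemma loc_child: "child v c \<Longrightarrow> anc c (h i) \<Longrightarrow> loc v i = dn c"
  using toward_eq[of v c "h i"] anc_level_le[of c "h i"] child_level[of v c] by (auto simp: loc_def)

lemma loc_neq_pole:
  assumes "i \<in> {1..n}" "anc v (h i)"
  shows "loc v i \<noteq> pole v"
proof (cases "v = h i")
  case True
  then show ?thesis using mark_neq_pole[OF assms(1)] by (simp add: loc_def)
next
  case False
  then obtain c where "child v c" "anc c (h i)" using ex_child_toward assms by blast
  then show ?thesis using loc_child dn_neq_pole by simp
qed

definition I :: "nat \<times> nat \<Rightarrow> complex" where
  "I a = (if a = (0, 0) then 1 else I_map L (fst a) (snd a))"

lemma I_map_eq:
  assumes "i \<in> {1..n}" "j \<in> {1..n}"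
  defines "v \<equiv> meet T (h i) (h j)"
  shows "I_map L i j = X v (loc v j) - X v (loc v i)"
proof -
  note m = meet_props[OF mark_vert[OF assms(1)] mark_vert[OF assms(2)], folded v_def]
  have "v \<in> verts L" using meet_vert[OF assms(1,2)] by (simp add: v_def)
  note int = sphere_integral_X[OF this loc_neq_pole[OF assms(1) m(1)] loc_neq_pole[OF assms(2) m(2)]]
  have v: "v = meet T (fst (mark L i)) (fst (mark L j))" by (simp add: v_def)
  show ?thesis
  proof (cases "h i = h j")
    case True
    then have "v = h i" "v = h j" using meet_self[OF mark_vert[OF assms(1)]] by (simp_all add: v_def)
    then have "loc v i = snd (mark L i)" "loc v j = snd (mark L j)" by (simp_all add: loc_def)
    then show ?thesis using int True v by (simp add: I_map_def Let_def)
  next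
    case False
    then have "v \<noteq> h i" "v \<noteq> h j"
      using m terminal_anc[OF mark_terminal[OF assms(1)], of "h j"] terminal_anc[OF mark_terminal[OF assms(2)], of "h i"]
      by auto
    then have "loc v i = toward L v (h i)" "loc v j = toward L v (h j)" by (simp_all add: loc_def)
    then show ?thesis using int False v by (simp add: I_map_def Let_def)
  qed
qed

lemma loc_eq:
  assumes "i \<in> {1..n}" "j \<in> {1..n}" "anc v (h i)" "anc v (h j)" "v \<noteq> meet T (h i) (h j)"
  shows "loc v i = loc v j"
proof -
  note m = meet_props[OF mark_vert[OF assms(1)] mark_vert[OF assms(2)]]
  obtain c where c: "child v c" "anc c (meet T (h i) (h j))"
    using ex_child_toward[OF m(3)[OF assms(3,4)] assms(5)] by blast
  then have "loc v i = dn c" "loc v j = dn c" using loc_child anc_trans m(1,2) by blast+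
  then show ?thesis by simp
qed

text \<open>From a vertex strictly below the meet both marks are seen through the same node, and the
  difference is 0, as \<open>level_part\<close> prescribes. Periods of several pairs can thus be
  computed on one common component.\<close>

lemma level_part_eq:
  assumes "i \<in> {1..n}" "j \<in> {1..n}" "anc v (h i)" "anc v (h j)"
  shows "level_part tlev I (lv v) (i, j) = X v (loc v j) - X v (loc v i)"
proof -
  note m = meet_props[OF mark_vert[OF assms(1)] mark_vert[OF assms(2)]]
  have iff: "tlev (i, j) = lv v \<longleftrightarrow> v = meet T (h i) (h j)"
    using anc_same_level[OF m(1) assms(3)] assms(1) by (auto simp: tlev_pair)
  show ?thesis
  proof (cases "v = meet T (h i) (h j)")
    case True
    then have "tlev (i, j) = lv v" using iff by blast
    then show ?thesis using I_map_eq[OF assms(1,2)] True assms(1) by (simp add: level_part_def I_def)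
  next
    case False
    then have "tlev (i, j) \<noteq> lv v" using iff by blast
    then show ?thesis using loc_eq[OF assms False] by (simp add: level_part_def)
  qed
qed

text \<open>Below the terminal level the two marks leave their meet through different children,
  hence through different nodes, which the injective coordinate separates.\<close>

lemma I_nonzero:
  assumes "a \<in> labels n" "tlev a < tlev (0, 0)"
  shows "I a \<noteq> 0"
proof -
  have len: "tlev (0, 0) = tree_length T" by (simp add: tlev_def)
  obtain i j where a: "a = (i, j)" by fastforce
  with assms have ij: "i \<in> {1..n}" "j \<in> {1..n}" by (auto simp: labels_def)
  define v where "v = meet T (h i) (h j)"
  note m = meet_props[OF mark_vert[OF ij(1)] mark_vert[OF ij(2)], folded v_def]
  have "lv v < tree_length T" using assms(2) len a ij by (simp add: tlev_pair v_def)
  then have "v \<noteq> h i" "v \<noteq> h j"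
    using level_terminal[OF mark_terminal[OF ij(1)]] level_terminal[OF mark_terminal[OF ij(2)]] by auto
  then obtain c c' where c: "child v c" "anc c (h i)" "child v c'" "anc c' (h j)"
    using ex_child_toward m by metis
  have "c \<noteq> c'"
  proof
    assume "c = c'"
    then have "anc c v" using m(3) c by blast
    then show False using child_level[OF c(1)] anc_level_le by fastforce
  qed
  then have "loc v i \<noteq> loc v j" using loc_child c dn_inj by metis
  then have "X v (loc v i) \<noteq> X v (loc v j)"
    using X_inj[of v] loc_neq_pole[OF ij(1) m(1)] loc_neq_pole[OF ij(2) m(2)] anc_verts[OF m(1)] by auto
  then show ?thesis using I_map_eq[OF ij] a ij by (simp add: I_def v_def)
qed

lemma level_data: "level_data n tlev I"
  unfolding level_data_def
proof (intro conjI ballI allI impI)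
  show "tlev ` labels n = {..tlev (0, 0)}" using tlev_image by (simp add: tlev_def)
  show "I (0, 0) = 1" by (simp add: I_def)
  show "I a \<noteq> 0" if "a \<in> labels n" "tlev a < tlev (0, 0)" for a using I_nonzero that by blast
next
  fix i j k m assume ijk: "i \<in> {1..n}" "j \<in> {1..n}" "k \<in> {1..n}"
    and m: "m = min (tlev (i, j)) (min (tlev (j, k)) (tlev (i, k)))"
  have below: "anc (meet T (h i) (h j)) (h k)"
    if "i \<in> {1..n}" "j \<in> {1..n}" "k \<in> {1..n}" "tlev (i, j) \<le> tlev (i, k)" for i j k
    using anc_meet_iff that by blast
  note mp = meet_props[OF mark_vert mark_vert]
  have sym: "tlev (i, j) = tlev (j, i)" if "i \<in> {1..n}" "j \<in> {1..n}" for i j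
    using that by (simp add: tlev_pair meet_commute[of "h i"] del: dual_tree_simps)
  \<comment> \<open>Among the three pairs, one of lowest level has a meet that is an ancestor of all
    three marks. On its component the relation is a telescoping sum of differences.\<close>
  obtain v where v: "anc v (h i)" "anc v (h j)" "anc v (h k)" "lv v = m"
  proof -
    consider "m = tlev (i, j)" "tlev (i, j) \<le> tlev (i, k)" | "m = tlev (j, k)" "tlev (j, k) \<le> tlev (j, i)"
      | "m = tlev (i, k)" "tlev (i, k) \<le> tlev (i, j)"
      using m sym[OF ijk(1,2)] by linarith
    then show ?thesis
    proof cases
      case 1
      then show ?thesis
        using that[of "meet T (h i) (h j)"] mp[OF ijk(1,2)] below[OF ijk(1,2,3)] ijk by (simp add: tlev_pair)
    next
      case 2
      then show ?thesis
        using that[of "meet T (h j) (h k)"] mp[OF ijk(2,3)] below[OF ijk(2,3,1)] ijk by (simp add: tlev_pair)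
    next
      case 3
      then show ?thesis
        using that[of "meet T (h i) (h k)"] mp[OF ijk(1,3)] below[OF ijk(1,3,2)] ijk by (simp add: tlev_pair)
    qed
  qed
  show "level_part tlev I m (i, j) + level_part tlev I m (j, k) = level_part tlev I m (i, k)"
    using level_part_eq[OF ijk(1,2) v(1,2)] level_part_eq[OF ijk(2,3) v(2,3)] level_part_eq[OF ijk(1,3) v(1,3)]
    by (simp add: v(4))
qed

end

section \<open>Isomorphisms and level data\<close>

locale stable_curve_pair = A: stable_curve n L + B: stable_curve n L' for n L L'
begin

sublocale level_tree_pair n "dual_tree L" A.parent "dual_tree L'" B.parent
  by unfold_locales

lemma isomorphic_imp_rescaled:
  assumes "cp_isomorphic n L L'"
  shows "rescaled_data n A.tlev A.I B.tlev B.I"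
proof -
  obtain \<sigma> f and c :: "nat \<Rightarrow> complex" where bij: "bij_betw \<sigma> (verts L) (verts L')"
    and f_all: "\<forall>v\<in>verts L. f v \<in> sphere_aut"
    and nodes: "nodes L' = (\<lambda>e. (\<lambda>(v, x). (\<sigma> v, f v x)) ` e) ` nodes L"
    and mark_all: "\<forall>i\<in>{1..n}. mark L' i = (\<lambda>(v, x). (\<sigma> v, f v x)) (mark L i)"
    and pre_all: "\<forall>v\<in>verts L. \<forall>w\<in>verts L. (v, w) \<in> preord L \<longleftrightarrow> (\<sigma> v, \<sigma> w) \<in> preord L'"
    and c_all: "\<forall>v\<in>verts L. c v \<noteq> 0 \<and>
           pullback_diff (f v) (diff_form L' (\<sigma> v)) = (\<lambda>z. c v * diff_form L v z)"
    and csim_all: "\<forall>v\<in>verts L. \<forall>w\<in>verts L. sim (preord L) v w \<longrightarrow> c v = c w"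
    and cterm_all: "\<forall>v. terminal (dual_tree L) v \<longrightarrow> c v = 1"
    using assms unfolding cp_isomorphic_def Let_def
    by (elim exE conjE) (rule that; assumption)
  note f = f_all[rule_format] and mark = mark_all[rule_format] and pre = pre_all[rule_format]
    and csim = csim_all[rule_format] and cterm = cterm_all[rule_format]
  have c: "c v \<noteq> 0" and pb: "pullback_diff (f v) (diff_form L' (\<sigma> v)) = (\<lambda>z. c v * diff_form L v z)"
    if "v \<in> verts L" for v
    using c_all that by simp_all
  have \<sigma>V: "\<sigma> v \<in> verts L'" if "v \<in> verts L" for v using bij that by (auto simp: bij_betw_def)
  have \<sigma>inj: "v = w" if "v \<in> verts L" "w \<in> verts L" "\<sigma> v = \<sigma> w" for v w
    using bij that by (auto simp: bij_betw_def inj_on_def)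
  have hV: "A.h i \<in> verts L" if "i \<in> {1..n}" for i using A.mark_vert[OF that] by simp
  have h\<sigma>: "B.h i = \<sigma> (A.h i)" if "i \<in> {1..n}" for i
    using mark[OF that] by (simp add: case_prod_unfold)
  have node: "{(\<sigma> v, f v x), (\<sigma> w, f w y)} \<in> nodes L'" if "{(v, x), (w, y)} \<in> nodes L" for v w x y
    unfolding nodes by (rule image_eqI[OF _ that]) simp
  \<comment> \<open>An isomorphism is a contraction with one-point fibers; this yields its
    compatibility with meets, children and ancestors.\<close>
  have con: "contraction n (dual_tree L) (dual_tree L') (restrict \<sigma> (verts L))"
    unfolding contraction_def
  proof (intro conjI ballI impI)
    show "restrict \<sigma> (verts L) ` A.V = B.V" using bij by (simp add: bij_betw_def)
    show "restrict \<sigma> (verts L) (A.h i) = B.h i" if "i \<in> {1..n}" for i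
      using h\<sigma>[OF that] hV[OF that] by simp
    show "(restrict \<sigma> (verts L) v, restrict \<sigma> (verts L) w) \<in> tpre (dual_tree L')"
      if "v \<in> A.V" "w \<in> A.V" "(v, w) \<in> tpre (dual_tree L)" for v w using pre that by simp
    show "restrict \<sigma> (verts L) v = restrict \<sigma> (verts L) w \<or>
        tadj (dual_tree L') (restrict \<sigma> (verts L) v) (restrict \<sigma> (verts L) w)"
      if vw: "v \<in> A.V" "w \<in> A.V" "tadj (dual_tree L) v w" for v w
    proof -
      obtain x y where "{(v, x), (w, y)} \<in> nodes L" using vw(3) by auto
      from node[OF this] have "tadj (dual_tree L') (\<sigma> v) (\<sigma> w)" by auto
      then show ?thesis using vw(1,2) by simp
    qed
    show "(\<lambda>a b. tadj (dual_tree L) a b \<and> a \<in> A.V \<and> b \<in> A.V \<and>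
        restrict \<sigma> (verts L) a = restrict \<sigma> (verts L) v \<and> restrict \<sigma> (verts L) b = restrict \<sigma> (verts L) v)\<^sup>*\<^sup>* v w"
      if "v \<in> A.V" "w \<in> A.V" "restrict \<sigma> (verts L) v = restrict \<sigma> (verts L) w" for v w
    proof -
      have "v = w" using that \<sigma>inj by simp
      then show ?thesis by simp
    qed
  qed simp
  have meet: "\<sigma> (pair_meet i j) = pair_meet' i j" if "i \<in> {1..n}" "j \<in> {1..n}" for i j
    using contraction_meet[OF con that] A.meet_vert[OF that] by simp
  have child: "B.child (\<sigma> v) (\<sigma> u)" if "A.child v u" for v u
  proof -
    have "v \<noteq> u" "v \<in> verts L" "u \<in> verts L"
      using A.child_level[OF that] A.child_verts[OF that] by auto
    then show ?thesis using f_child[OF con that] \<sigma>inj by auto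
  qed
  have anc: "B.anc (\<sigma> v) (\<sigma> u)" if "A.anc v u" for v u
    using f_anc[OF con that] A.anc_verts[OF that] by simp
  have imA: "A.lv ` verts L = {..tree_length (dual_tree L)}" using A.level_image by simp
  have "(\<lambda>v. B.lv (\<sigma> v)) ` verts L = B.lv ` \<sigma> ` verts L" by (simp add: image_image)
  also have "\<sigma> ` verts L = verts L'" using bij by (simp add: bij_betw_def)
  finally have imB: "(\<lambda>v. B.lv (\<sigma> v)) ` verts L = {..tree_length (dual_tree L')}"
    using B.level_image by simp
  have lv_le: "A.lv v \<le> A.lv w \<longleftrightarrow> B.lv (\<sigma> v) \<le> B.lv (\<sigma> w)" if "v \<in> verts L" "w \<in> verts L" for v w
    using A.level_le_iff[of v w] B.level_le_iff[of "\<sigma> v" "\<sigma> w"] pre[OF that] \<sigma>V that by simp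
  have lv: "A.lv v = B.lv (\<sigma> v)" if "v \<in> verts L" for v
    by (rule rank_unique[OF imA imB lv_le that])
  then have "A.lv ` verts L = (\<lambda>v. B.lv (\<sigma> v)) ` verts L" by (rule image_cong[OF refl])
  then have len: "tree_length (dual_tree L) = tree_length (dual_tree L')"
    using imA imB by simp
  have dn: "B.dn (\<sigma> u) = f v (A.dn u)" if "A.child v u" for v u
  proof -
    have u: "u \<in> verts L" "u \<noteq> A.r" "A.parent u = v" using that A.child_iff by auto
    have u': "\<sigma> u \<in> verts L'" "\<sigma> u \<noteq> B.r" "B.parent (\<sigma> u) = \<sigma> v" using child[OF that] B.child_iff by auto
    have "{(\<sigma> u, f u (A.pole u)), (B.parent (\<sigma> u), f v (A.dn u))} \<in> nodes L'"
      using node[OF A.node_in[OF u(1,2)]] u(3) u'(3) by simp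
    then show ?thesis using B.branch_points(2)[OF u'(1,2)] by blast
  qed
  have loc: "B.loc (\<sigma> v) i = f v (A.loc v i)" if i: "i \<in> {1..n}" "A.anc v (A.h i)" for v i
  proof (cases "v = A.h i")
    case True
    then show ?thesis using mark[OF i(1)] h\<sigma>[OF i(1)] by (simp add: A.loc_def B.loc_def case_prod_unfold)
  next
    case False
    then obtain u where u: "A.child v u" "A.anc u (A.h i)" using A.ex_child_toward i by blast
    have "B.anc (\<sigma> u) (B.h i)" using anc[OF u(2)] h\<sigma>[OF i(1)] by simp
    then show ?thesis using B.loc_child[OF child[OF u(1)]] A.loc_child[OF u] dn[OF u(1)] by simp
  qed
  \<comment> \<open>Both sides are primitives of \<open>c v\<close> times the same form, so they
    differ by a translation, which disappears in periods.\<close>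
  have X: "\<exists>t. \<forall>p. p \<noteq> A.pole v \<longrightarrow> B.X (\<sigma> v) (f v p) = c v * A.X v p + t" if v: "v \<in> verts L" for v
  proof -
    note \<phi> = A.chart[OF v] and \<phi>' = B.chart[OF \<sigma>V[OF v]]
    have "form (B.chart (\<sigma> v) \<circ> f v) = form (affine_map (c v) 0 \<circ> A.chart v)"
      using pb[OF v] pullback_form[OF \<phi>'(1) f[OF v]] form_affine_comp[OF \<phi>(1) c[OF v]] \<phi>(3) \<phi>'(3) by simp
    then obtain t where t: "B.chart (\<sigma> v) \<circ> f v = affine_map 1 t \<circ> (affine_map (c v) 0 \<circ> A.chart v)"
      using form_eq_imp_affine sphere_aut_comp \<phi>'(1) f[OF v] \<phi>(1) sphere_aut_affine_map[OF c[OF v]] by metis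
    have "B.X (\<sigma> v) (f v p) = c v * A.X v p + t" if "p \<noteq> A.pole v" for p
      using fun_cong[OF t, of p] A.chart_finite[OF v that] by (simp add: B.X_def moebius_def)
    then show ?thesis by blast
  qed
  have I: "B.I (i, j) = c (pair_meet i j) * A.I (i, j)" if ij: "i \<in> {1..n}" "j \<in> {1..n}" for i j
  proof -
    define v where "v = pair_meet i j"
    note m = T_meet(1,2)[OF ij, folded v_def]
    have v: "v \<in> verts L" using A.anc_verts[OF m(1)] by simp
    obtain t where t: "\<And>p. p \<noteq> A.pole v \<Longrightarrow> B.X (\<sigma> v) (f v p) = c v * A.X v p + t" using X[OF v] by blast
    have "B.I (i, j) = c v * A.I (i, j)"
      using A.I_map_eq[OF ij, folded v_def] B.I_map_eq[OF ij, folded meet[OF ij] v_def]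
        loc[OF ij(1) m(1)] loc[OF ij(2) m(2)] t[OF A.loc_neq_pole[OF ij(1) m(1)]] t[OF A.loc_neq_pole[OF ij(2) m(2)]] ij
      by (simp add: A.I_def B.I_def right_diff_distrib)
    then show ?thesis by (simp only: v_def)
  qed
  \<comment> \<open>The constants \<open>c v\<close> depend only on the level of \<open>v\<close>.
    Numbers that are not levels receive 1, so that all factors are nonzero.\<close>
  define d where "d m = (if \<exists>v\<in>verts L. A.lv v = m then c (SOME v. v \<in> verts L \<and> A.lv v = m) else 1)" for m
  have d: "d (A.lv v) = c v" if v: "v \<in> verts L" for v
  proof -
    define w where "w = (SOME w. w \<in> verts L \<and> A.lv w = A.lv v)"
    have w: "w \<in> verts L \<and> A.lv w = A.lv v" unfolding w_def by (rule someI[of _ v]) (use v in simp)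
    then have "sim (preord L) w v" using A.level_le_iff[of w v] A.level_le_iff[of v w] v by (simp add: sim_def)
    then have "c w = c v" using csim w v by blast
    then show ?thesis using v unfolding d_def w_def by auto
  qed
  show ?thesis
    unfolding rescaled_data_def
  proof (intro exI[of _ d] conjI allI ballI)
    obtain i where i: "i \<in> {1..n}" using A.ex_mark_above[OF A.root_vert] by blast
    note tm = A.mark_terminal[OF i]
    have top: "A.tlev (0, 0) = A.lv (A.h i)" using A.level_terminal[OF tm] by (simp add: A.tlev_def)
    show d1: "d (A.tlev (0, 0)) = 1" using d[OF hV[OF i]] cterm[OF tm] by (simp only: top)
    show "d m \<noteq> 0" for m
    proof (cases "\<exists>v\<in>verts L. A.lv v = m")
      case True
      then show ?thesis using d c by metis
    next
      case False
      then show ?thesis by (simp add: d_def)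
    qed
    fix a assume a: "a \<in> labels n"
    show "B.tlev a = A.tlev a" "B.I a = d (A.tlev a) * A.I a"
    proof -
      have "B.tlev a = A.tlev a \<and> B.I a = d (A.tlev a) * A.I a"
      proof (cases "a = (0, 0)")
        case True
        then show ?thesis using d1 len by (simp add: A.tlev_def B.tlev_def A.I_def B.I_def)
      next
        case False
        then obtain i j where ij: "a = (i, j)" "i \<in> {1..n}" "j \<in> {1..n}" using a by (auto simp: labels_def)
        have v: "pair_meet i j \<in> verts L" using A.meet_vert[OF ij(2,3)] by simp
        show ?thesis
          using lv[OF v] meet[OF ij(2,3)] I[OF ij(2,3)] d[OF v] ij
          by (simp add: A.tlev_pair B.tlev_pair del: dual_tree_simps)
      qed
      then show "B.tlev a = A.tlev a" "B.I a = d (A.tlev a) * A.I a" by blast+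
    qed
  qed
qed

text \<open>The trees are identified by \<open>meet_map\<close> in both directions. On each
  component the isomorphism is affine in the coordinates \<open>X\<close>, with slope the given
  factor; its translation is fitted at one mark, and equality of periods carries all other marks and
  nodes along.\<close>

lemma rescaled_imp_isomorphic:
  assumes "rescaled_data n A.tlev A.I B.tlev B.I"
  shows "cp_isomorphic n L L'"
proof -
  interpret rev: level_tree_pair n "dual_tree L'" B.parent "dual_tree L" A.parent
    by unfold_locales
  obtain c where c1: "c (A.tlev (0, 0)) = 1" and c0: "\<And>m. c m \<noteq> 0"
    and lev: "\<And>a. a \<in> labels n \<Longrightarrow> B.tlev a = A.tlev a"
    and Ic: "\<And>a. a \<in> labels n \<Longrightarrow> B.I a = c (A.tlev a) * A.I a"
    using assms unfolding rescaled_data_def by blast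
  have mono: "B.tlev a \<le> B.tlev b" if "a \<in> labels n" "b \<in> labels n" "A.tlev a \<le> A.tlev b" for a b
    using lev that by simp
  have mono': "A.tlev a \<le> A.tlev b" if "a \<in> labels n" "b \<in> labels n" "B.tlev a \<le> B.tlev b" for a b
    using lev that by simp
  define \<sigma> where "\<sigma> = meet_map"
  define \<sigma>' where "\<sigma>' = rev.meet_map"
  have meet: "\<sigma> (pair_meet i j) = pair_meet' i j" "\<sigma>' (pair_meet' i j) = pair_meet i j"
    if "i \<in> {1..n}" "j \<in> {1..n}" for i j
    using meet_map[OF mono that] rev.meet_map[OF mono' that] by (simp_all add: \<sigma>_def \<sigma>'_def)
  have con: "contraction n (dual_tree L) (dual_tree L') \<sigma>"
    unfolding \<sigma>_def by (rule contraction_meet_map[OF mono])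
  have V: "\<sigma> v \<in> verts L' \<and> \<sigma>' (\<sigma> v) = v \<and> B.lv (\<sigma> v) = A.lv v" if v: "v \<in> verts L" for v
  proof -
    have "v \<in> A.V" using v by simp
    then obtain i j where ij: "i \<in> {1..n}" "j \<in> {1..n}" "v = pair_meet i j" by (rule A.ex_meet')
    have "B.lv (pair_meet' i j) = A.lv (pair_meet i j)"
      using lev[OF labels_pair[OF ij(1,2)]] ij(1) by (simp add: A.tlev_pair B.tlev_pair del: dual_tree_simps)
    moreover have "pair_meet' i j \<in> B.V" by (rule B.meet_vert[OF ij(1,2)])
    ultimately show ?thesis using meet[OF ij(1,2)] ij(3) by simp
  qed
  have V': "\<sigma>' v \<in> verts L \<and> \<sigma> (\<sigma>' v) = v" if v: "v \<in> verts L'" for v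
  proof -
    have "v \<in> B.V" using v by simp
    then obtain i j where ij: "i \<in> {1..n}" "j \<in> {1..n}" "v = pair_meet' i j" by (rule B.ex_meet')
    have "pair_meet i j \<in> A.V" by (rule A.meet_vert[OF ij(1,2)])
    then show ?thesis using meet[OF ij(1,2)] ij(3) by simp
  qed
  have bij: "bij_betw \<sigma> (verts L) (verts L')"
    by (rule bij_betw_byWitness[where f' = \<sigma>']) (use V V' in auto)
  have h\<sigma>: "\<sigma> (A.h i) = B.h i" if "i \<in> {1..n}" for i using f_mark[OF con that] .
  have child: "B.child (\<sigma> v) (\<sigma> u)" if "A.child v u" for v u
  proof -
    have "A.lv v < A.lv u" "v \<in> verts L" "u \<in> verts L"
      using A.child_level[OF that] A.child_verts[OF that] by auto
    then have "\<sigma> v \<noteq> \<sigma> u" using V by (metis less_irrefl)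
    then show ?thesis using f_child[OF con that] by blast
  qed
  have anc: "B.anc (\<sigma> v) (B.h i)" if "A.anc v (A.h i)" "i \<in> {1..n}" for v i
    using f_anc[OF con that(1)] h\<sigma>[OF that(2)] by simp
  define i0 where "i0 v = (SOME i. i \<in> {1..n} \<and> A.anc v (A.h i))" for v
  have i0: "i0 v \<in> {1..n} \<and> A.anc v (A.h (i0 v))" if "v \<in> verts L" for v
  proof -
    have "v \<in> A.V" using that by simp
    then obtain i where "i \<in> {1..n} \<and> A.anc v (A.h i)" using A.ex_mark_above by blast
    then show ?thesis unfolding i0_def by (rule someI)
  qed
  define d where "d v = B.X (\<sigma> v) (B.loc (\<sigma> v) (i0 v)) - c (A.lv v) * A.X v (A.loc v (i0 v))" for v
  have Xloc: "B.X (\<sigma> v) (B.loc (\<sigma> v) i) = c (A.lv v) * A.X v (A.loc v i) + d v"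
    if v: "A.anc v (A.h i)" "i \<in> {1..n}" for v i
  proof -
    have vV: "v \<in> verts L" using A.anc_verts[OF v(1)] by simp
    note i0v = i0[OF vV, THEN conjunct1] i0[OF vV, THEN conjunct2]
    have "level_part B.tlev B.I (B.lv (\<sigma> v)) (i0 v, i) = c (A.lv v) * level_part A.tlev A.I (A.lv v) (i0 v, i)"
      using lev[OF labels_pair[OF i0v(1) v(2)]] Ic[OF labels_pair[OF i0v(1) v(2)]] V[OF vV]
      by (simp add: level_part_def)
    then show ?thesis
      using A.level_part_eq[OF i0v(1) v(2) i0v(2) v(1)]
        B.level_part_eq[OF i0v(1) v(2) anc[OF i0v(2,1)] anc[OF v]]
      by (simp add: d_def algebra_simps)
  qed
  have "\<forall>v\<in>verts L'. \<exists>\<psi>. \<psi> \<in> sphere_aut \<and> B.chart v \<circ> \<psi> = id"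
    using sphere_aut_inverse[OF B.chart(1)] by blast
  then obtain \<psi> where \<psi>: "\<And>v. v \<in> verts L' \<Longrightarrow> \<psi> v \<in> sphere_aut \<and> B.chart v \<circ> \<psi> v = id" by metis
  \<comment> \<open>In the affine coordinates this is the map with slope \<open>c (A.lv v)\<close>
    and translation \<open>d v\<close>; \<open>\<psi>\<close> inverts the target coordinate.\<close>
  define f where "f v = \<psi> (\<sigma> v) \<circ> (affine_map (c (A.lv v)) (d v) \<circ> A.chart v)" for v
  have f_aut: "f v \<in> sphere_aut" if "v \<in> verts L" for v
    unfolding f_def by (intro sphere_aut_comp sphere_aut_affine_map c0 A.chart(1) that) (use \<psi> V that in simp)
  have f_chart: "B.chart (\<sigma> v) \<circ> f v = affine_map (c (A.lv v)) (d v) \<circ> A.chart v" if "v \<in> verts L" for v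
    unfolding f_def comp_assoc[symmetric] using \<psi> V that by simp
  have f_eq: "f v p = q" if "v \<in> verts L" "B.chart (\<sigma> v) (f v p) = B.chart (\<sigma> v) q" for v p q
    using inj_sphere_aut[OF B.chart(1)] V that by (metis injD)
  have f_pole: "f v (A.pole v) = B.pole (\<sigma> v)" if v: "v \<in> verts L" for v
    by (rule f_eq[OF v])
      (use fun_cong[OF f_chart[OF v], of "A.pole v"] A.chart(2)[OF v] B.chart(2)[of "\<sigma> v"] V[OF v] in simp)
  have f_loc: "f v (A.loc v i) = B.loc (\<sigma> v) i" if v: "A.anc v (A.h i)" "i \<in> {1..n}" for v i
  proof (rule f_eq)
    show vV: "v \<in> verts L" using A.anc_verts[OF v(1)] by simp
    have "A.chart v (A.loc v i) = Pt (A.X v (A.loc v i))"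
      by (rule A.chart_finite[OF vV A.loc_neq_pole[OF v(2,1)]])
    moreover have "B.chart (\<sigma> v) (B.loc (\<sigma> v) i) = Pt (B.X (\<sigma> v) (B.loc (\<sigma> v) i))"
      by (rule B.chart_finite[OF _ B.loc_neq_pole[OF v(2) anc[OF v]]]) (use V vV in blast)
    ultimately show "B.chart (\<sigma> v) (f v (A.loc v i)) = B.chart (\<sigma> v) (B.loc (\<sigma> v) i)"
      using fun_cong[OF f_chart[OF vV], of "A.loc v i"] Xloc[OF v] by (simp add: moebius_def)
  qed
  \<comment> \<open>Some mark lies above the child, and the node is the position at which this mark
    is seen; so nodes are matched like marks.\<close>
  have f_dn: "f v (A.dn u) = B.dn (\<sigma> u)" if "A.child v u" for v u
  proof -
    have "u \<in> A.V" using A.child_verts[OF that] by simp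
    then obtain i where i: "i \<in> {1..n}" "A.anc u (A.h i)" by (rule A.ex_mark_above)
    have "A.anc v (A.h i)" using A.anc_trans[OF A.anc_child[OF that] i(2)] .
    then show ?thesis
      using f_loc[OF _ i(1), of v] A.loc_child[OF that i(2)] B.loc_child[OF child[OF that] anc[OF i(2,1)]] by simp
  qed
  \<comment> \<open>\<open>\<sigma>\<close> preserves children, and the root is the only vertex that
    is not a child.\<close>
  have root: "\<sigma> A.r = B.r"
  proof -
    have "B.r \<in> verts L'" using B.root_vert by simp
    then have r: "\<sigma>' B.r \<in> verts L" "\<sigma> (\<sigma>' B.r) = B.r" using V' by blast+
    have "\<sigma>' B.r = A.r"
    proof (rule ccontr)
      assume "\<sigma>' B.r \<noteq> A.r"
      then have "A.child (A.parent (\<sigma>' B.r)) (\<sigma>' B.r)" using r A.child_iff by blast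
      from child[OF this] show False using r(2) B.child_iff by metis
    qed
    then show ?thesis using r by simp
  qed
  let ?F = "\<lambda>(v, x). (\<sigma> v, f v x)"
  have F_node: "?F ` {(v, A.pole v), (A.parent v, A.dn v)} = {(\<sigma> v, B.pole (\<sigma> v)), (B.parent (\<sigma> v), B.dn (\<sigma> v))}"
    if v: "v \<in> verts L" "v \<noteq> A.r" for v
  proof -
    have ch: "A.child (A.parent v) v" using v A.child_iff by blast
    have "B.parent (\<sigma> v) = \<sigma> (A.parent v)" using child[OF ch] B.child_iff by metis
    then show ?thesis using f_pole[OF v(1)] f_dn[OF ch] by simp
  qed
  show ?thesis
    unfolding cp_isomorphic_def Let_def
  proof (intro exI[of _ \<sigma>] exI[of _ f] exI[of _ "\<lambda>v. c (A.lv v)"] conjI ballI impI allI)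
    have \<sigma>r: "\<sigma> ` (verts L - {A.r}) = verts L' - {B.r}"
    proof -
      have "\<sigma> ` (verts L - {A.r}) = \<sigma> ` verts L - \<sigma> ` {A.r}"
        using bij A.root_vert by (intro inj_on_image_set_diff[of _ "verts L"]) (auto simp: bij_betw_def)
      then show ?thesis using bij root by (simp add: bij_betw_def)
    qed
    have "nodes L' = (\<lambda>v. {(v, B.pole v), (B.parent v, B.dn v)}) ` \<sigma> ` (verts L - {A.r})"
      unfolding \<sigma>r by (rule B.nodes_eq')
    also have "\<dots> = (\<lambda>e. ?F ` e) ` (\<lambda>v. {(v, A.pole v), (A.parent v, A.dn v)}) ` (verts L - {A.r})"
      unfolding image_image by (rule image_cong[OF refl], rule F_node[symmetric]) auto
    finally show "nodes L' = (\<lambda>e. ?F ` e) ` nodes L" using A.nodes_eq' by simp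
    have "A.pole A.r = snd (inf_pt L)" "B.pole B.r = snd (inf_pt L')" by (simp_all add: pole_point_def)
    then show "inf_pt L' = ?F (inf_pt L)"
      using root f_pole[of A.r] A.root_vert by (simp add: case_prod_unfold prod_eq_iff)
    show "mark L' i = ?F (mark L i)" if i: "i \<in> {1..n}" for i
    proof -
      have "A.anc (A.h i) (A.h i)" using A.anc_refl A.mark_vert[OF i] by blast
      from f_loc[OF this i] show ?thesis
        using h\<sigma>[OF i] by (simp add: A.loc_def B.loc_def case_prod_unfold prod_eq_iff)
    qed
    show "(v, w) \<in> preord L \<longleftrightarrow> (\<sigma> v, \<sigma> w) \<in> preord L'" if "v \<in> verts L" "w \<in> verts L" for v w
      using A.level_le_iff[of v w] B.level_le_iff[of "\<sigma> v" "\<sigma> w"] V that by simp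
    show "pullback_diff (f v) (diff_form L' (\<sigma> v)) = (\<lambda>z. c (A.lv v) * diff_form L v z)" if v: "v \<in> verts L" for v
    proof -
      have v': "\<sigma> v \<in> verts L'" using V v by blast
      have "pullback_diff (f v) (diff_form L' (\<sigma> v)) = form (B.chart (\<sigma> v) \<circ> f v)"
        using pullback_form[OF B.chart(1)[OF v'] f_aut[OF v]] B.chart(3)[OF v'] by simp
      also have "\<dots> = (\<lambda>z. c (A.lv v) * form (A.chart v) z)"
        unfolding f_chart[OF v] by (rule form_affine_comp[OF A.chart(1)[OF v] c0])
      finally show ?thesis using A.chart(3)[OF v] by simp
    qed
    show "c (A.lv v) = c (A.lv w)" if "v \<in> verts L" "w \<in> verts L" "sim (preord L) v w" for v w
      using A.level_mono[of v w] A.level_mono[of w v] that by (simp add: sim_def)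
    show "c (A.lv v) = 1" if "terminal (dual_tree L) v" for v
      using c1 A.level_terminal[OF that] by (simp add: A.tlev_def)
  qed (use bij f_aut c0 in auto)
qed

lemma isomorphic_iff: "cp_isomorphic n L L' \<longleftrightarrow> rescaled_data n A.tlev A.I B.tlev B.I"
  using isomorphic_imp_rescaled rescaled_imp_isomorphic by blast

end

section \<open>The stable line with given level data\<close>

locale level_curve =
  fixes n :: nat and lev :: "nat \<times> nat \<Rightarrow> nat" and J :: "nat \<times> nat \<Rightarrow> complex"
  assumes data: "level_data n lev J" and n_pos: "n \<ge> 1"
begin

abbreviation "toplev \<equiv> lev (0, 0)"
abbreviation "N \<equiv> {1..n}"

lemma lev_le: "i \<in> N \<Longrightarrow> j \<in> N \<Longrightarrow> lev (i, j) \<le> toplev"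
  using level_data_le[OF data labels_pair] .

lemma lev_diag: "i \<in> N \<Longrightarrow> lev (i, i) = toplev"
  using level_data_diag[OF data] by blast

lemma lev_sym: "i \<in> N \<Longrightarrow> j \<in> N \<Longrightarrow> lev (j, i) = lev (i, j)"
  using level_data_sym[OF data] by blast

lemma ultra: "i \<in> N \<Longrightarrow> j \<in> N \<Longrightarrow> k \<in> N \<Longrightarrow> m \<le> lev (i, j) \<Longrightarrow> m \<le> lev (j, k) \<Longrightarrow> m \<le> lev (i, k)"
  using level_data_ultrametric[OF data, of i j k] by linarith

lemma ultra_iff: "i \<in> N \<Longrightarrow> j \<in> N \<Longrightarrow> k \<in> N \<Longrightarrow> m \<le> lev (i, j) \<Longrightarrow> m \<le> lev (i, k) \<longleftrightarrow> m \<le> lev (j, k)"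
  using ultra[of i j k m] ultra[of j i k m] lev_sym[of i j] by fastforce

text \<open>
  The vertices on level \<open>m\<close> are the classes of marks that meet on level \<open>m\<close> or above; the class of
  \<open>i\<close> gives a vertex only if two of its marks meet exactly on level \<open>m\<close>, since otherwise its
  component would be unstable. A class is encoded by its least mark.
\<close>

definition rep :: "nat \<Rightarrow> nat \<Rightarrow> nat" where
  "rep i m = Min {k \<in> N. m \<le> lev (i, k)}"

definition vtx :: "nat \<Rightarrow> nat \<Rightarrow> nat" where
  "vtx i m = prod_encode (rep i m, m)"

definition occ :: "nat \<Rightarrow> nat \<Rightarrow> bool" where
  "occ i m \<longleftrightarrow> (\<exists>j\<in>N. lev (i, j) = m)"

lemma rep_cong: "i \<in> N \<Longrightarrow> k \<in> N \<Longrightarrow> m \<le> lev (i, k) \<Longrightarrow> rep i m = rep k m"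
  unfolding rep_def using ultra_iff[of i k] by (intro arg_cong[of _ _ Min]) auto

lemma rep:
  assumes "i \<in> N" "m \<le> toplev"
  shows "rep i m \<in> N" "m \<le> lev (i, rep i m)"
proof -
  have "rep i m \<in> {k \<in> N. m \<le> lev (i, k)}"
    unfolding rep_def using assms lev_diag[OF assms(1)] by (intro Min_in) auto
  then show "rep i m \<in> N" "m \<le> lev (i, rep i m)" by auto
qed

lemma vtx_eq_iff:
  assumes "i \<in> N" "k \<in> N" "m \<le> toplev"
  shows "vtx i m = vtx k m' \<longleftrightarrow> m = m' \<and> m \<le> lev (i, k)"
proof
  assume "vtx i m = vtx k m'"
  then have eq: "rep i m = rep k m" "m = m'" by (auto simp: vtx_def)
  have "m \<le> lev (k, rep i m)" using rep(2)[OF assms(2,3)] eq by simp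
  then have "m \<le> lev (rep i m, k)" using lev_sym[OF assms(2) rep(1)[OF assms(1,3)]] by simp
  then have "m \<le> lev (i, k)"
    using ultra[OF assms(1) rep(1)[OF assms(1,3)] assms(2)] rep(2)[OF assms(1,3)] by blast
  with eq show "m = m' \<and> m \<le> lev (i, k)" by simp
qed (use rep_cong assms in \<open>auto simp: vtx_def\<close>)

lemma occ_le: "i \<in> N \<Longrightarrow> occ i m \<Longrightarrow> m \<le> toplev"
  using lev_le by (auto simp: occ_def)

lemma occ_top: "i \<in> N \<Longrightarrow> occ i toplev"
  using lev_diag unfolding occ_def by blast

lemma occ_lev: "j \<in> N \<Longrightarrow> occ i (lev (i, j))"
  by (auto simp: occ_def)

text \<open>A mark \<open>j\<close> that meets \<open>i\<close> exactly on level \<open>m\<close>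
  also meets \<open>k\<close> there, unless \<open>k\<close> itself meets \<open>i\<close> on level
  \<open>m\<close>; in either case the level is occupied for \<open>k\<close>.\<close>

lemma occ_cong:
  assumes "i \<in> N" "k \<in> N" "m \<le> lev (i, k)" "occ i m"
  shows "occ k m"
proof -
  obtain j where j: "j \<in> N" "lev (i, j) = m" using assms(4) by (auto simp: occ_def)
  show ?thesis
  proof (cases "lev (i, k) = m")
    case True
    then show ?thesis using lev_sym assms(1,2) by (auto simp: occ_def)
  next
    case False
    then have *: "\<not> Suc m \<le> lev (i, j)" "Suc m \<le> lev (i, k)" using assms j by auto
    have "m \<le> lev (k, j)" using ultra_iff[OF assms(1,2) j(1) assms(3)] j by simp
    moreover have "\<not> Suc m \<le> lev (k, j)" using ultra_iff[OF assms(1,2) j(1) *(2)] * by simp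
    ultimately have "lev (k, j) = m" by simp
    then show ?thesis using j by (auto simp: occ_def)
  qed
qed

text \<open>Some pair meets on level 0, and \<open>i\<close> cannot meet both of its marks on a
  higher level. Hence all marks share a vertex on level 0, the root.\<close>

lemma occ_0:
  assumes "i \<in> N"
  shows "occ i 0"
proof (cases "toplev = 0")
  case True
  then show ?thesis using occ_top[OF assms] by simp
next
  case False
  obtain c where c: "c \<in> labels n" "lev c = 0" using level_data_ex[OF data, of 0] by blast
  then obtain a b where ab: "a \<in> N" "b \<in> N" "lev (a, b) = 0" using False by (auto simp: labels_def)
  have "\<not> 1 \<le> lev (i, a) \<or> \<not> 1 \<le> lev (i, b)"
    using ultra[OF ab(1) assms ab(2), of 1] lev_sym[OF assms ab(1)] ab(3) by auto
  then show ?thesis using ab by (auto simp: occ_def not_le less_one)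
qed

text \<open>The level of the parent. Vertices exist only on occupied levels, so an edge may skip
  levels.\<close>

definition below :: "nat \<Rightarrow> nat \<Rightarrow> nat" where
  "below i m = Max {m'. occ i m' \<and> m' < m}"

lemma below:
  assumes "i \<in> N" "0 < m"
  shows "occ i (below i m)" "below i m < m" "occ i m' \<Longrightarrow> m' < m \<Longrightarrow> m' \<le> below i m"
proof -
  have fin: "finite {m'. occ i m' \<and> m' < m}" by simp
  have "below i m \<in> {m'. occ i m' \<and> m' < m}"
    unfolding below_def by (rule Max_in[OF fin]) (use occ_0[OF assms(1)] assms(2) in auto)
  then show "occ i (below i m)" "below i m < m" by auto
  show "occ i m' \<Longrightarrow> m' < m \<Longrightarrow> m' \<le> below i m"
    unfolding below_def using fin by (intro Max_ge) auto
qed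

lemma below_cong: "i \<in> N \<Longrightarrow> k \<in> N \<Longrightarrow> m \<le> lev (i, k) \<Longrightarrow> below i m = below k m"
proof -
  assume ik: "i \<in> N" "k \<in> N" "m \<le> lev (i, k)"
  have "occ i m' \<longleftrightarrow> occ k m'" if "m' < m" for m'
    using occ_cong[OF ik(1,2), of m'] occ_cong[OF ik(2,1), of m'] lev_sym[OF ik(1,2)] ik(3) that by auto
  then have "{m'. occ i m' \<and> m' < m} = {m'. occ k m' \<and> m' < m}" by blast
  then show "below i m = below k m" by (simp add: below_def)
qed

definition above :: "nat \<Rightarrow> nat \<Rightarrow> nat" where
  "above i m = Min {m'. occ i m' \<and> m < m'}"

lemma above:
  assumes "i \<in> N" "occ i m" "m < toplev"
  shows "occ i (above i m)" "m < above i m" "below i (above i m) = m"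
proof -
  have fin: "finite {m'. occ i m' \<and> m < m'}"
    using occ_le[OF assms(1)] by (rule_tac finite_subset[of _ "{..toplev}"]) auto
  have "above i m \<in> {m'. occ i m' \<and> m < m'}"
    unfolding above_def by (rule Min_in[OF fin]) (use occ_top assms in auto)
  then show a: "occ i (above i m)" "m < above i m" by auto
  have min: "above i m \<le> m'" if "occ i m'" "m < m'" for m'
    unfolding above_def using fin that by (intro Min_le) auto
  show "below i (above i m) = m"
    unfolding below_def
  proof (rule Max_eqI)
    fix y assume "y \<in> {m'. occ i m' \<and> m' < above i m}"
    then show "y \<le> m" using min[of y] by fastforce
  qed (use a assms(2) in auto)
qed

text \<open>The position of \<open>j\<close> relative to \<open>i\<close> as seen on level
  \<open>m\<close>; marks that separate only on a higher level coincide there.\<close>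

definition pos :: "nat \<Rightarrow> nat \<Rightarrow> nat \<Rightarrow> complex" where
  "pos m i j = level_part lev J m (i, j)"

lemma pos_add:
  assumes "i \<in> N" "j \<in> N" "k \<in> N" "m \<le> lev (i, j)" "m \<le> lev (j, k)"
  shows "pos m i j + pos m j k = pos m i k"
proof -
  have "m \<le> lev (i, k)" using ultra assms by blast
  define m0 where "m0 = min (lev (i, j)) (min (lev (j, k)) (lev (i, k)))"
  have "m \<le> m0" using assms \<open>m \<le> lev (i, k)\<close> by (simp add: m0_def)
  then show ?thesis
    using level_data_add[OF data assms(1-3) m0_def]
    by (cases "m = m0") (auto simp: pos_def level_part_def m0_def)
qed

lemma pos_zero: "m < lev (i, j) \<Longrightarrow> pos m i j = 0"
  by (simp add: pos_def level_part_def)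

lemma pos_nonzero: "i \<in> N \<Longrightarrow> j \<in> N \<Longrightarrow> lev (i, j) = m \<Longrightarrow> m < toplev \<Longrightarrow> pos m i j \<noteq> 0"
  using level_data_nonzero[OF data labels_pair] by (simp add: pos_def level_part_def)

text \<open>The least mark of the class serves as the origin of the affine coordinate.\<close>

definition offset :: "nat \<Rightarrow> nat \<Rightarrow> complex" where
  "offset i m = pos m (rep i m) i"

lemma offset_diff:
  assumes "i \<in> N" "j \<in> N" "m \<le> lev (i, j)"
  shows "offset j m - offset i m = pos m i j"
proof -
  have m: "m \<le> toplev" using assms lev_le[OF assms(1,2)] by simp
  have "m \<le> lev (rep i m, i)" using rep[OF assms(1) m] lev_sym[OF assms(1)] by simp
  then show ?thesis
    using pos_add[OF rep(1)[OF assms(1) m] assms(1,2) _ assms(3)] rep_cong[OF assms]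
    by (simp add: offset_def diff_eq_eq add.commute)
qed

definition vs :: "nat set" where
  "vs = {vtx i m | i m. i \<in> N \<and> occ i m}"

definition ht :: "nat \<Rightarrow> nat" where
  "ht v = snd (prod_decode v)"

text \<open>An arbitrary mark of the class that forms the vertex; parents and attaching points do
  not depend on the pick.\<close>

definition member :: "nat \<Rightarrow> nat" where
  "member v = (SOME i. i \<in> N \<and> occ i (ht v) \<and> v = vtx i (ht v))"

lemma ht_vtx [simp]: "ht (vtx i m) = m"
  by (simp add: ht_def vtx_def)

lemma member:
  assumes "v \<in> vs"
  shows "member v \<in> N" "occ (member v) (ht v)" "v = vtx (member v) (ht v)"
proof -
  obtain i m where "i \<in> N" "occ i m" "v = vtx i m" using assms by (auto simp: vs_def)
  then have "i \<in> N \<and> occ i (ht v) \<and> v = vtx i (ht v)" by simp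
  from someI[of "\<lambda>i. i \<in> N \<and> occ i (ht v) \<and> v = vtx i (ht v)", OF this, folded member_def]
  show "member v \<in> N" "occ (member v) (ht v)" "v = vtx (member v) (ht v)" by blast+
qed

lemma vtx_in: "i \<in> N \<Longrightarrow> occ i m \<Longrightarrow> vtx i m \<in> vs"
  by (auto simp: vs_def)

lemma member_vtx:
  assumes "i \<in> N" "occ i m"
  shows "m \<le> lev (member (vtx i m), i)"
  using member[OF vtx_in[OF assms]] vtx_eq_iff[of "member (vtx i m)" i m m] occ_le[OF assms] assms(1) by simp

definition par :: "nat \<Rightarrow> nat" where
  "par v = vtx (member v) (below (member v) (ht v))"

definition rootv :: nat where
  "rootv = vtx 1 0"

definition joint :: "nat \<Rightarrow> (nat \<times> sphere) set" where
  "joint v = {(v, Infty), (par v, Pt (offset (member v) (ht (par v))))}"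

lemma one_N: "1 \<in> N"
  using n_pos by simp

lemma rootv_in: "rootv \<in> vs"
  unfolding rootv_def using vtx_in occ_0 one_N by blast

lemma vtx_0: "i \<in> N \<Longrightarrow> vtx i 0 = rootv"
  unfolding rootv_def using vtx_eq_iff[of i 1 0 0] one_N by simp

lemma nonroot_iff: "v \<in> vs \<Longrightarrow> v \<noteq> rootv \<longleftrightarrow> 0 < ht v"
proof -
  assume v: "v \<in> vs"
  have "v = rootv" if "ht v = 0"
    using vtx_0[OF member(1)[OF v]] member(3)[OF v] that by metis
  moreover have "ht rootv = 0" by (simp add: rootv_def)
  ultimately show "v \<noteq> rootv \<longleftrightarrow> 0 < ht v" by auto
qed

lemma par_vtx:
  assumes "i \<in> N" "occ i m" "0 < m"
  shows "par (vtx i m) = vtx i (below i m)"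
    "offset (member (vtx i m)) (below i m) = offset i (below i m)"
proof -
  let ?k = "member (vtx i m)"
  have k: "?k \<in> N" "m \<le> lev (?k, i)" using member[OF vtx_in[OF assms(1,2)]] member_vtx[OF assms(1,2)] by auto
  have b: "below ?k m = below i m" using below_cong[OF k(1) assms(1) k(2)] .
  have lt: "below i m < m" using below[OF assms(1,3)] by blast
  then have le: "below i m \<le> lev (?k, i)" using k by simp
  show "par (vtx i m) = vtx i (below i m)"
    unfolding par_def using vtx_eq_iff[OF k(1) assms(1)] le b lt occ_le[OF assms(1,2)] by simp
  show "offset ?k (below i m) = offset i (below i m)"
    using offset_diff[OF k(1) assms(1) le] pos_zero[of "below i m" ?k i] lt k by simp
qed

lemma joint_vtx:
  assumes "i \<in> N" "occ i m" "0 < m"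
  shows "joint (vtx i m) = {(vtx i m, Infty), (vtx i (below i m), Pt (offset i (below i m)))}"
  using par_vtx[OF assms] by (simp add: joint_def)

lemma par_in:
  assumes "v \<in> vs" "v \<noteq> rootv"
  shows "par v \<in> vs" "ht (par v) < ht v"
  using below[OF member(1)[OF assms(1)], of "ht v"] nonroot_iff[OF assms(1)] assms(2) vtx_in member(1)[OF assms(1)]
  by (auto simp: par_def)

text \<open>Every component carries \<open>dz\<close>, with its pole and its descending node at
  \<open>Infty\<close>; all of \<open>J\<close> is encoded in the positions of nodes and
  marks.\<close>

definition line :: mline where
  "line = \<lparr>verts = vs, nodes = joint ` (vs - {rootv}), inf_pt = (rootv, Infty),
     preord = {(u, v). u \<in> vs \<and> v \<in> vs \<and> ht u \<le> ht v}, diff_form = (\<lambda>_ _. 1),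
     mark = (\<lambda>i. (vtx i toplev, Pt (offset i toplev)))\<rparr>"

lemma line_simps [simp]:
  "verts line = vs" "nodes line = joint ` (vs - {rootv})" "inf_pt line = (rootv, Infty)"
  "preord line = {(u, v). u \<in> vs \<and> v \<in> vs \<and> ht u \<le> ht v}" "diff_form line = (\<lambda>_ _. 1)"
  "mark line i = (vtx i toplev, Pt (offset i toplev))"
  by (simp_all add: line_def)

lemma finite_vs: "finite vs"
proof -
  have "vs \<subseteq> (\<lambda>(i, j). vtx i (lev (i, j))) ` (N \<times> N)" by (auto simp: vs_def occ_def image_iff)
  then show ?thesis by (rule finite_subset) simp
qed

lemma joint_eqD:
  assumes "u \<in> vs" "u \<noteq> rootv" "{(v, x), (w, y)} = joint u"
  shows "v = u \<and> x = Infty \<and> w = par u \<and> y = Pt (offset (member u) (ht (par u))) \<or>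
    w = u \<and> y = Infty \<and> v = par u \<and> x = Pt (offset (member u) (ht (par u)))"
  using assms(3) unfolding joint_def by (auto simp: doubleton_eq_iff)

text \<open>Two children attached at the same point would have marks with period 0 on a level below
  the terminal one, which is possible only if these marks meet on a higher level. Both children
  being next above the same parent, they then coincide.\<close>

lemma joint_disjoint:
  assumes u: "u \<in> vs" "u \<noteq> rootv" and v: "v \<in> vs" "v \<noteq> rootv" and p: "p \<in> joint u" "p \<in> joint v"
  shows "u = v"
proof -
  let ?i = "member u" and ?k = "member v"
  note i = member[OF u(1)] and k = member[OF v(1)]
  have pos: "0 < ht u" "0 < ht v" using nonroot_iff u v by blast+
  define a where "a = below ?i (ht u)"
  have htp: "ht (par u) = a" "ht (par v) = below ?k (ht v)" by (simp_all add: par_def a_def)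
  consider "p = (u, Infty)" "p = (v, Infty)"
    | "par u = par v" "offset ?i (ht (par u)) = offset ?k (ht (par v))"
    using p by (auto simp: joint_def)
  then show ?thesis
  proof cases
    case 2
    then have bk: "below ?k (ht v) = a" using htp by simp
    note bi = below[OF i(1) pos(1), folded a_def] and bk' = below[OF k(1) pos(2), unfolded bk]
    have a: "a < ht u" "a < ht v" "a < toplev" using bi(2) bk'(2) occ_le[OF i(1,2)] by auto
    have "vtx ?i a = vtx ?k a" using 2(1) bk by (simp add: par_def a_def)
    then have le: "a \<le> lev (?i, ?k)" using vtx_eq_iff[OF i(1) k(1)] a by simp
    have "pos a ?i ?k = 0" using offset_diff[OF i(1) k(1) le] 2(2) htp bk by simp
    then have gt: "a < lev (?i, ?k)" using pos_nonzero[OF i(1) k(1)] a(3) le by (metis le_neq_implies_less)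
    have oi: "occ ?i (lev (?i, ?k))" "occ ?k (lev (?i, ?k))"
      using occ_lev[OF k(1)] occ_lev[OF i(1), of ?k] lev_sym[OF i(1) k(1)] by simp_all
    have ge: "ht u \<le> lev (?i, ?k)" "ht v \<le> lev (?i, ?k)"
      using bi(3)[OF oi(1)] bk'(3)[OF oi(2)] gt by fastforce+
    \<comment> \<open>The vertex of lower level would also be a class of the other mark, strictly
      between the vertex of that mark and its parent.\<close>
    have "\<not> ht u < ht v" using bk'(3)[OF occ_cong[OF i(1) k(1) ge(1) i(2)]] a by fastforce
    moreover have "\<not> ht v < ht u"
      using bi(3)[OF occ_cong[OF k(1) i(1) _ k(2)]] ge(2) lev_sym[OF i(1) k(1)] a by fastforce
    ultimately have "ht u = ht v" by simp
    then show ?thesis using i(3) k(3) vtx_eq_iff[OF i(1) k(1), of "ht u"] ge(1) occ_le[OF i(1,2)] by metis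
  qed auto
qed

lemma adj_line_iff: "tadj (dual_tree line) v w \<longleftrightarrow>
    v \<in> vs \<and> v \<noteq> rootv \<and> w = par v \<or> w \<in> vs \<and> w \<noteq> rootv \<and> v = par w"
proof
  assume "tadj (dual_tree line) v w"
  then obtain x y u where "u \<in> vs" "u \<noteq> rootv" "{(v, x), (w, y)} = joint u" by auto
  then show "v \<in> vs \<and> v \<noteq> rootv \<and> w = par v \<or> w \<in> vs \<and> w \<noteq> rootv \<and> v = par w"
    using joint_eqD by blast
next
  assume "v \<in> vs \<and> v \<noteq> rootv \<and> w = par v \<or> w \<in> vs \<and> w \<noteq> rootv \<and> v = par w"
  then have "\<exists>x y. {(v, x), (w, y)} \<in> nodes line"
  proof
    assume v: "v \<in> vs \<and> v \<noteq> rootv \<and> w = par v"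
    then have "joint v \<in> nodes line" by simp
    then show ?thesis using v unfolding joint_def by blast
  next
    assume w: "w \<in> vs \<and> w \<noteq> rootv \<and> v = par w"
    then have "joint w \<in> nodes line" by simp
    then show ?thesis using w unfolding joint_def insert_commute[of "(w, Infty)"] by blast
  qed
  then show "tadj (dual_tree line) v w" by simp
qed

lemma prec_line_iff: "prec (preord line) v w \<longleftrightarrow> v \<in> vs \<and> w \<in> vs \<and> ht v < ht w"
  by (auto simp: prec_def)

sublocale R: rooted_tree "dual_tree line" par
proof
  show "finite (tverts (dual_tree line))" using finite_vs by simp
  show "troot (dual_tree line) \<in> tverts (dual_tree line)" using rootv_in by simp
  show "par v \<in> tverts (dual_tree line)" if "v \<in> tverts (dual_tree line)" "v \<noteq> troot (dual_tree line)" for v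
    using par_in that by simp
  show "prec (tpre (dual_tree line)) (par v) v" if "v \<in> tverts (dual_tree line)" "v \<noteq> troot (dual_tree line)" for v
    using par_in[of v] that prec_line_iff[of "par v" v] by simp
  show "preorder_on (tverts (dual_tree line)) (tpre (dual_tree line))"
    by (auto simp: preorder_on_def refl_on_def trans_def)
  show "total_on (tverts (dual_tree line)) (tpre (dual_tree line))" by (auto simp: total_on_def)
  show "tadj (dual_tree line) v w \<longleftrightarrow> v \<in> tverts (dual_tree line) \<and> v \<noteq> troot (dual_tree line) \<and> w = par v \<or>
      w \<in> tverts (dual_tree line) \<and> w \<noteq> troot (dual_tree line) \<and> v = par w" for v w
    using adj_line_iff[of v w] by (simp del: dual_tree_simps(5))
qed

lemma child_vtx:
  assumes "i \<in> N" "occ i m" "0 < m"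
  shows "R.child (vtx i (below i m)) (vtx i m)"
  using par_vtx(1)[OF assms] vtx_in[OF assms(1,2)] nonroot_iff[OF vtx_in[OF assms(1,2)]] assms(3)
  by (simp add: R.child_def)

lemma child_above: "i \<in> N \<Longrightarrow> occ i m \<Longrightarrow> m < toplev \<Longrightarrow> R.child (vtx i m) (vtx i (above i m))"
  using child_vtx[of i "above i m"] above[of i m] by simp

text \<open>Every level up to the top contains a vertex, so \<open>ht\<close> and the level function
  are rank functions of the same preorder.\<close>

lemma level_line:
  assumes "v \<in> vs"
  shows "R.lv v = ht v"
proof (rule rank_unique[of R.lv vs _ ht toplev])
  show "R.lv ` vs = {..tree_length (dual_tree line)}" using R.level_image by simp
  show "ht ` vs = {..toplev}"
  proof (intro equalityI subsetI)
    fix m assume "m \<in> ht ` vs"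
    then show "m \<in> {..toplev}" using occ_le by (auto simp: vs_def)
  next
    fix m assume "m \<in> {..toplev}"
    then obtain a where a: "a \<in> labels n" "lev a = m" using level_data_ex[OF data] by auto
    have "\<exists>i\<in>N. occ i m"
    proof (cases "a = (0, 0)")
      case True
      then show ?thesis using a occ_top one_N by blast
    next
      case False
      then show ?thesis using a by (auto simp: labels_def occ_def)
    qed
    then obtain i where "i \<in> N" "occ i m" by blast
    then show "m \<in> ht ` vs" using vtx_in by (intro image_eqI[of _ _ "vtx i m"]) auto
  qed
  show "R.lv a \<le> R.lv b \<longleftrightarrow> ht a \<le> ht b" if "a \<in> vs" "b \<in> vs" for a b
    using R.level_le_iff[of a b] that by simp
qed (rule assms)

lemma length_line: "tree_length (dual_tree line) = toplev"
proof -
  have "R.lv (vtx 1 toplev) = toplev" using level_line vtx_in occ_top one_N by simp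
  then have "toplev \<le> tree_length (dual_tree line)"
    using R.level_le_length[of "vtx 1 toplev"] vtx_in occ_top one_N by simp
  moreover have "tree_length (dual_tree line) \<in> R.lv ` vs" using R.level_image by simp
  then obtain v where "v \<in> vs" "tree_length (dual_tree line) = R.lv v" by blast
  then have "tree_length (dual_tree line) \<le> toplev" using level_line member[of v] occ_le by metis
  ultimately show ?thesis by simp
qed

lemma terminal_line_iff: "terminal (dual_tree line) v \<longleftrightarrow> v \<in> vs \<and> ht v = toplev"
proof -
  have "ht v = toplev" if v: "v \<in> vs" "\<forall>c. \<not> R.child v c"
    using child_above[OF member(1,2)[OF v(1)]] member(3)[OF v(1)] v(2) occ_le[OF member(1,2)[OF v(1)]]
    by (metis le_neq_implies_less)
  moreover have "\<not> R.child v c" if v: "v \<in> vs" "ht v = toplev" for c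
  proof
    assume c: "R.child v c"
    then have "c \<in> vs" "R.lv v < R.lv c" using R.child_verts R.child_level by auto
    then show False using level_line v occ_le[OF member(1,2)[of c]] by fastforce
  qed
  ultimately show ?thesis using R.terminal_iff[of v] by auto
qed

section \<open>The constructed curve is a stable line\<close>

lemma curve_line: "nodal_curve_genus0 line"
  unfolding nodal_curve_genus0_def
proof (intro conjI ballI impI)
  show "finite (verts line)" "finite (nodes line)" "verts line \<noteq> {}" using finite_vs rootv_in by auto
  fix e assume "e \<in> nodes line"
  then obtain u where u: "u \<in> vs" "u \<noteq> rootv" "e = joint u" by auto
  then show "card e = 2" "e \<subseteq> verts line \<times> UNIV"
    using par_in[OF u(1,2)] by (auto simp: joint_def card_insert_if)
  fix e' assume "e' \<in> nodes line" "e \<noteq> e'"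
  then obtain v where v: "v \<in> vs" "v \<noteq> rootv" "e' = joint v" by auto
  then show "e \<inter> e' = {}" using joint_disjoint u \<open>e \<noteq> e'\<close> by blast
next
  fix v w assume vw: "v \<in> verts line" "w \<in> verts line"
  have sym: "symp (tadj (dual_tree line))\<^sup>*\<^sup>*"
    by (intro symp_rtranclp sympI) (use adj_line_iff in blast)
  have "(\<lambda>x y. R.child y x)\<^sup>*\<^sup>* \<le> (tadj (dual_tree line))\<^sup>*\<^sup>*"
    by (rule rtranclp_mono) (use R.adj_child_iff in blast)
  moreover have "(\<lambda>x y. R.child y x)\<^sup>*\<^sup>* v rootv" "(\<lambda>x y. R.child y x)\<^sup>*\<^sup>* w rootv"
    using R.anc_root[of v] R.anc_root[of w] vw by (simp_all add: R.anc_def)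
  ultimately have "(tadj (dual_tree line))\<^sup>*\<^sup>* v rootv" "(tadj (dual_tree line))\<^sup>*\<^sup>* w rootv" by blast+
  then show "(tadj (dual_tree line))\<^sup>*\<^sup>* v w"
    using sympD[OF sym] rtranclp_trans[of "tadj (dual_tree line)" v rootv w] by blast
next
  have "inj_on joint (vs - {rootv})"
  proof (rule inj_onI)
    fix u v assume uv: "u \<in> vs - {rootv}" "v \<in> vs - {rootv}" "joint u = joint v"
    have "(u, Infty) \<in> joint u" by (simp add: joint_def)
    then show "u = v" using joint_disjoint[of u v] uv by auto
  qed
  then have "card (nodes line) = card vs - 1" using rootv_in finite_vs by (simp add: card_image)
  moreover have "card vs > 0" using rootv_in finite_vs by (auto simp: card_gt_0_iff)
  ultimately show "int (card (nodes line)) - int (card (verts line)) + 1 = 0" by simp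
qed

lemma descending_line:
  assumes "v \<in> vs" "v \<noteq> rootv"
  shows "tadj (dual_tree line) v w \<and> prec (preord line) w v \<longleftrightarrow> w = par v"
proof
  assume *: "tadj (dual_tree line) v w \<and> prec (preord line) w v"
  then consider "w = par v" | "w \<in> vs" "w \<noteq> rootv" "v = par w" using adj_line_iff by blast
  then show "w = par v"
  proof cases
    case 2
    then show ?thesis using par_in[OF 2(1,2)] * prec_line_iff by fastforce
  qed
qed (use adj_line_iff prec_line_iff par_in assms in blast)

lemma pole_line:
  assumes v: "v \<in> vs"
  shows "pole_point line v = Infty"
proof (cases "v = rootv")
  case True
  then show ?thesis by (simp add: pole_point_def)
next
  case False
  have "(THE w. tadj (dual_tree line) v w \<and> prec (preord line) w v) = par v"
    by (rule the_equality) (use descending_line[OF v False] in blast)+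
  then have "pole_point line v = branch_point line v (par v)"
    using False by (simp only: pole_point_def line_simps fst_conv if_False)
  also have "\<dots> = Infty"
    unfolding branch_point_def
  proof (rule the_equality)
    show "\<exists>y. {(v, Infty), (par v, y)} \<in> nodes line" using v False by (auto simp: joint_def)
    fix x assume "\<exists>y. {(v, x), (par v, y)} \<in> nodes line"
    then obtain y u where u: "u \<in> vs" "u \<noteq> rootv" "{(v, x), (par v, y)} = joint u" by auto
    have "u = v"
    proof (rule ccontr)
      assume "u \<noteq> v"
      then have "u = par v" "v = par u" using joint_eqD[OF u] by auto
      then show False using par_in[OF v False] par_in[OF u(1,2)] by simp
    qed
    then show "x = Infty" using joint_eqD[OF u] par_in[OF v False] by auto
  qed
  finally show ?thesis .
qed

lemma multiscaled_line_line: "multiscaled_line line"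
  unfolding multiscaled_line_def
proof (intro conjI ballI allI impI)
  show "nodal_curve_genus0 line" by (rule curve_line)
  show "inf_pt line \<in> smooth_points line"
    using rootv_in by (auto simp: smooth_points_def joint_def)
  show "preorder_on (verts line) (preord line)" "total_on (verts line) (preord line)"
    using R.preorder R.total by simp_all
  show "\<exists>!w. tadj (dual_tree line) v w \<and> prec (preord line) w v"
    if "v \<in> verts line" "v \<noteq> fst (inf_pt line)" for v
  proof -
    have "v \<in> vs" "v \<noteq> rootv" using that by simp_all
    note * = descending_line[OF this]
    show ?thesis unfolding * by simp
  qed
  show "sim (preord line) v w" if "terminal (dual_tree line) v \<and> terminal (dual_tree line) w" for v w
    using that terminal_line_iff by (simp add: sim_def)
  fix v assume v: "v \<in> verts line"
  then have pole: "pole_point line v = Infty" using pole_line by simp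
  show "meromorphic_diff (diff_form line v)" using meromorphic_diff_one by simp
  show "\<exists>z. diff_form line v z \<noteq> 0" by simp
  show "diff_order (diff_form line v) (pole_point line v) = - 2"
    using meromorphic_diff_one(2) pole by simp
  show "diff_order (diff_form line v) p = 0" if "p \<noteq> pole_point line v" for p
    using that pole meromorphic_diff_one(3) by (cases p) auto
qed

lemma stable_line_line: "stable_line n line"
  unfolding stable_line_def marked_multiscaled_line_def
proof (intro conjI ballI impI)
  show "multiscaled_line line" by (rule multiscaled_line_line)
  fix i assume i: "i \<in> N"
  have v: "vtx i toplev \<in> vs" using vtx_in occ_top i by blast
  have "(vtx i toplev, Pt (offset i toplev)) \<notin> joint u" if u: "u \<in> vs" "u \<noteq> rootv" for u
  proof -
    have "ht (par u) < toplev" using par_in[OF u] occ_le[OF member(1,2)[OF u(1)]] by simp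
    then have "par u \<noteq> vtx i toplev" by auto
    then show ?thesis by (auto simp: joint_def)
  qed
  then show "mark line i \<in> smooth_points line" using v by (auto simp: smooth_points_def)
  show "mark line i \<noteq> inf_pt line" by simp
  show "terminal (dual_tree line) (fst (mark line i))" using terminal_line_iff v by simp
next
  fix v assume "v \<in> verts line"
  then have v: "v \<in> vs" by simp
  note k = member[OF v]
  show "if terminal (dual_tree line) v then \<exists>i\<in>N. fst (mark line i) = v
      else node_count line v \<ge> 3 \<or> (node_count line v \<ge> 2 \<and> v = fst (inf_pt line))"
  proof (cases "ht v = toplev")
    case True
    then have "fst (mark line (member v)) = v" using k(3) by (metis fst_conv line_simps(6))
    then show ?thesis using True terminal_line_iff v k(1) by metis
  next
    case False
    then have lt: "ht v < toplev" using occ_le[OF k(1,2)] by simp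
    \<comment> \<open>A vertex below the top level exists only because a second mark
      \<open>j\<close> separates from \<open>member v\<close> exactly there. The next vertices in
      the direction of the two marks are two different children.\<close>
    obtain j where j: "j \<in> N" "lev (member v, j) = ht v" using k(2) by (auto simp: occ_def)
    have oj: "occ j (ht v)" using occ_cong[OF k(1) j(1) _ k(2)] j(2) by simp
    define c where "c = vtx (member v) (above (member v) (ht v))"
    define c' where "c' = vtx j (above j (ht v))"
    have "vtx j (ht v) = v" using vtx_eq_iff[OF k(1) j(1), of "ht v" "ht v"] lt j k(3) by simp
    then have ch: "R.child v c" "R.child v c'"
      using child_above[OF k(1,2) lt] child_above[OF j(1) oj lt] k(3) by (simp_all add: c_def c'_def)
    have "c \<noteq> c'"
    proof
      assume "c = c'"
      then have "above (member v) (ht v) \<le> lev (member v, j)"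
        unfolding c_def c'_def using vtx_eq_iff[OF k(1) j(1)] occ_le[OF k(1)] above[OF k(1,2) lt] by blast
      then show False using j(2) above(2)[OF k(1,2) lt] by simp
    qed
    have cv: "c \<in> vs" "c \<noteq> rootv" "par c = v" "c' \<in> vs" "c' \<noteq> rootv" "par c' = v"
      using ch by (auto simp: R.child_def)
    let ?E = "{e \<in> nodes line. \<exists>x. (v, x) \<in> e}"
    have fin: "finite ?E" using finite_vs by simp
    have E: "joint c \<in> ?E" "joint c' \<in> ?E"
      using cv by (auto simp: joint_def)
    have ne: "joint a \<noteq> joint b" if "a \<in> vs" "a \<noteq> rootv" "b \<in> vs" "b \<noteq> rootv" "a \<noteq> b" for a b
    proof
      assume "joint a = joint b"
      moreover have "(a, Infty) \<in> joint a" by (simp add: joint_def)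
      ultimately show False using joint_disjoint[OF that(1-4)] that(5) by auto
    qed
    have c2: "card {joint c, joint c'} = 2" using ne[of c c'] cv \<open>c \<noteq> c'\<close> by simp
    have "node_count line v \<ge> 2"
      unfolding node_count_def using card_mono[OF fin, of "{joint c, joint c'}"] E c2 by simp
    moreover have "node_count line v \<ge> 3" if r: "v \<noteq> rootv"
    proof -
      have "joint v \<in> ?E" using v r by (auto simp: joint_def)
      moreover have "v \<noteq> c" "v \<noteq> c'" using R.child_level ch by fastforce+
      then have "card {joint v, joint c, joint c'} = 3"
        using ne[of c c'] ne[of v c] ne[of v c'] cv \<open>c \<noteq> c'\<close> v r by simp
      ultimately show ?thesis
        unfolding node_count_def using card_mono[OF fin, of "{joint v, joint c, joint c'}"] E by simp
    qed
    ultimately show ?thesis using False terminal_line_iff by auto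
  qed
qed

sublocale S: stable_curve n line
  by unfold_locales (rule stable_line_line)

section \<open>Meets and periods of the constructed line\<close>

lemma parent_line: "v \<in> vs \<Longrightarrow> v \<noteq> rootv \<Longrightarrow> S.parent v = par v"
  using S.parent[of v] descending_line[of v "S.parent v"] by simp

lemma child_line_iff: "S.child v c \<longleftrightarrow> R.child v c"
  using parent_line by (auto simp: S.child_def R.child_def)

lemma anc_vtx:
  assumes "i \<in> N" "occ i m" "occ i m'" "m \<le> m'"
  shows "S.anc (vtx i m) (vtx i m')"
  using assms(3,4)
proof (induction m' rule: less_induct)
  case (less m')
  show ?case
  proof (cases "m = m'")
    case True
    then show ?thesis using S.anc_refl vtx_in assms by simp
  next
    case False
    then have m': "0 < m'" "m < m'" using less.prems by auto
    note b = below[OF assms(1) m'(1)]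
    have "S.anc (vtx i m) (vtx i (below i m'))"
      using less.IH[OF b(2,1)] b(3)[OF assms(2) m'(2)] by blast
    moreover have "S.child (vtx i (below i m')) (vtx i m')"
      using child_vtx[OF assms(1) less.prems(1) m'(1)] child_line_iff by blast
    ultimately show ?thesis using S.anc_trans S.anc_child by blast
  qed
qed

lemma anc_vtx_cases:
  assumes "S.anc v (vtx i m')" "i \<in> N" "occ i m'"
  shows "\<exists>m. occ i m \<and> v = vtx i m"
proof -
  have "(\<lambda>x y. S.child y x)\<^sup>*\<^sup>* (vtx i m') v" using assms(1) by (simp add: S.anc_def)
  then show ?thesis
  proof (induction rule: rtranclp_induct)
    case base
    then show ?case using assms by blast
  next
    case (step y z)
    then obtain m where m: "occ i m" "y = vtx i m" by blast
    have "R.child z y" using step child_line_iff by blast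
    then have y: "y \<in> vs" "y \<noteq> rootv" "par y = z" by (auto simp: R.child_def)
    then have "0 < m" using nonroot_iff m by simp
    then show ?case using par_vtx(1)[OF assms(2) m(1)] below(1)[OF assms(2)] y m by metis
  qed
qed

text \<open>The ancestors of the component of a mark are the classes of that mark, and a class
  shared by \<open>i\<close> and \<open>j\<close> has level at most
  \<open>lev (i, j)\<close>.\<close>

lemma meet_line:
  assumes ij: "i \<in> N" "j \<in> N"
  shows "meet (dual_tree line) (S.h i) (S.h j) = vtx i (lev (i, j))"
proof -
  let ?m = "lev (i, j)"
  have le: "?m \<le> toplev" by (rule lev_le[OF ij])
  have o: "occ i ?m" "occ j ?m" using occ_lev[OF ij(2), of i] occ_lev[OF ij(1), of j] lev_sym[OF ij] by simp_all
  have eq: "vtx i ?m = vtx j ?m" using vtx_eq_iff[OF ij le] by simp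
  have "meet (dual_tree line) (vtx i toplev) (vtx j toplev) = vtx i ?m"
  proof (rule S.meet_eqI)
    show "S.anc (vtx i ?m) (vtx i toplev)" by (rule anc_vtx[OF ij(1) o(1) occ_top[OF ij(1)] le])
    show "S.anc (vtx i ?m) (vtx j toplev)" unfolding eq by (rule anc_vtx[OF ij(2) o(2) occ_top[OF ij(2)] le])
    fix w assume w: "S.anc w (vtx i toplev)" "S.anc w (vtx j toplev)"
    obtain a where a: "occ i a" "w = vtx i a" using anc_vtx_cases[OF w(1) ij(1) occ_top[OF ij(1)]] by blast
    obtain b where b: "occ j b" "w = vtx j b" using anc_vtx_cases[OF w(2) ij(2) occ_top[OF ij(2)]] by blast
    have "a \<le> ?m" using vtx_eq_iff[OF ij occ_le[OF ij(1) a(1)]] a b by metis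
    then show "S.anc w (vtx i ?m)" using anc_vtx[OF ij(1) a(1) o(1)] a(2) by simp
  qed
  then show ?thesis by simp
qed

lemma tlev_line: "a \<in> labels n \<Longrightarrow> S.tlev a = lev a"
proof -
  assume a: "a \<in> labels n"
  show "S.tlev a = lev a"
  proof (cases "a = (0, 0)")
    case True
    then show ?thesis using length_line by (simp add: S.tlev_def)
  next
    case False
    then obtain i j where ij: "a = (i, j)" "i \<in> N" "j \<in> N" using a by (auto simp: labels_def)
    show ?thesis
      unfolding ij(1) S.tlev_pair[OF ij(2)] meet_line[OF ij(2,3)]
      using level_line[OF vtx_in[OF ij(2) occ_lev[OF ij(3)]]] by simp
  qed
qed

lemma dn_line:
  assumes "i \<in> N" "occ i m" "0 < m"
  shows "S.dn (vtx i m) = Pt (offset i (below i m))"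
proof -
  have v: "vtx i m \<in> vs" "vtx i m \<noteq> rootv" using vtx_in[OF assms(1,2)] nonroot_iff assms by auto
  have "{(vtx i m, Infty), (S.parent (vtx i m), Pt (offset i (below i m)))} = joint (vtx i m)"
    using joint_vtx[OF assms] par_vtx(1)[OF assms] parent_line[OF v] by simp
  then have "{(vtx i m, Infty), (S.parent (vtx i m), Pt (offset i (below i m)))} \<in> nodes line" using v by simp
  then show ?thesis using S.branch_points(2)[of "vtx i m"] v by simp
qed

lemma loc_line:
  assumes i: "i \<in> N" "occ i m"
  shows "S.loc (vtx i m) i = Pt (offset i m)"
proof (cases "m = toplev")
  case True
  then show ?thesis by (simp add: S.loc_def)
next
  case False
  then have lt: "m < toplev" using occ_le[OF i] by simp
  note a = above[OF i lt]
  have "S.anc (vtx i (above i m)) (S.h i)"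
    using anc_vtx[OF i(1) a(1) occ_top[OF i(1)] occ_le[OF i(1) a(1)]] by simp
  moreover have "S.child (vtx i m) (vtx i (above i m))" using child_above[OF i lt] child_line_iff by blast
  ultimately have "S.loc (vtx i m) i = S.dn (vtx i (above i m))" using S.loc_child by blast
  then show ?thesis using dn_line[OF i(1) a(1)] a by simp
qed

text \<open>All forms are \<open>dz\<close>, so the chosen coordinate agrees with the standard one
  up to a translation.\<close>

lemma X_line:
  assumes "v \<in> vs"
  obtains t where "\<And>z. S.X v (Pt z) = z + t"
proof -
  have v: "v \<in> verts line" using assms by simp
  have "form (S.chart v) = form id" using S.chart(3)[OF v] form_id by simp
  then obtain t where "S.chart v = affine_map 1 t \<circ> id"
    using form_eq_imp_affine[OF S.chart(1)[OF v] sphere_aut_id] by metis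
  then have "S.X v (Pt z) = z + t" for z by (simp add: S.X_def moebius_def)
  then show ?thesis by (rule that)
qed

lemma I_line: "a \<in> labels n \<Longrightarrow> S.I a = J a"
proof -
  assume a: "a \<in> labels n"
  show "S.I a = J a"
  proof (cases "a = (0, 0)")
    case True
    then show ?thesis using data by (simp add: S.I_def level_data_def)
  next
    case False
    then obtain i j where ij: "a = (i, j)" "i \<in> N" "j \<in> N" using a by (auto simp: labels_def)
    let ?m = "lev (i, j)"
    have o: "occ i ?m" "occ j ?m" using occ_lev[OF ij(3), of i] occ_lev[OF ij(2), of j] lev_sym[OF ij(2,3)] by simp_all
    have eq: "vtx i ?m = vtx j ?m" using vtx_eq_iff[OF ij(2,3) lev_le[OF ij(2,3)]] by simp
    have l: "S.loc (vtx i ?m) i = Pt (offset i ?m)" "S.loc (vtx i ?m) j = Pt (offset j ?m)"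
      using loc_line[OF ij(2) o(1)] loc_line[OF ij(3) o(2)] eq by simp_all
    obtain t where t: "\<And>z. S.X (vtx i ?m) (Pt z) = z + t" using X_line[OF vtx_in[OF ij(2) o(1)]] by blast
    have "I_map line i j = offset j ?m - offset i ?m"
      using S.I_map_eq[OF ij(2,3)] unfolding meet_line[OF ij(2,3)] l t by simp
    also have "\<dots> = J (i, j)" using offset_diff[OF ij(2,3) order_refl] by (simp add: pos_def level_part_def)
    finally show ?thesis using False ij by (simp add: S.I_def)
  qed
qed

end

section \<open>The moduli variety\<close>

definition line_level :: "mline \<Rightarrow> nat \<times> nat \<Rightarrow> nat" where
  "line_level L a = (if a = (0, 0) then tree_length (dual_tree L)
     else level (dual_tree L) (meet (dual_tree L) (fst (mark L (fst a))) (fst (mark L (snd a)))))"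

definition line_integral :: "mline \<Rightarrow> nat \<times> nat \<Rightarrow> complex" where
  "line_integral L a = (if a = (0, 0) then 1 else I_map L (fst a) (snd a))"

lemma (in stable_curve) line_level_eq: "tlev = line_level L"
  by (rule ext) (simp add: tlev_def line_level_def)

lemma (in stable_curve) line_integral_eq: "I = line_integral L"
  by (rule ext) (simp add: I_def line_integral_def)

lemma level_data_line:
  assumes "stable_line n L"
  shows "level_data n (line_level L) (line_integral L)"
proof -
  interpret stable_curve n L by unfold_locales (rule assms)
  show ?thesis using level_data by (simp add: line_level_eq line_integral_eq)
qed

lemma cp_isomorphic_iff:
  assumes "stable_line n L" "stable_line n L'"
  shows "cp_isomorphic n L L' \<longleftrightarrow>
    rescaled_data n (line_level L) (line_integral L) (line_level L') (line_integral L')"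
proof -
  interpret stable_curve_pair n L L' by unfold_locales (use assms in auto)
  show ?thesis
    using isomorphic_iff by (simp add: A.line_level_eq A.line_integral_eq B.line_level_eq B.line_integral_eq)
qed

lemma ex_line_with_level_data:
  assumes "level_data n lev J" "n \<ge> 1"
  obtains L where "stable_line n L" "\<And>a. a \<in> labels n \<Longrightarrow> line_level L a = lev a"
    "\<And>a. a \<in> labels n \<Longrightarrow> line_integral L a = J a"
proof -
  interpret level_curve n lev J by unfold_locales (use assms in auto)
  show ?thesis
    by (rule that[OF stable_line_line])
      (use tlev_line I_line in \<open>simp_all add: S.line_level_eq S.line_integral_eq\<close>)
qed

text \<open>Contractions preserve meets, and conversely \<open>meet_map\<close> is a contraction. So
  the definition of \<open>U_chart\<close> becomes a condition on levels and periods.\<close>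

lemma ex_contraction_iff:
  assumes "stable_line n L" "stable_line n L'"
  shows "(\<exists>f. contraction n (dual_tree L) (dual_tree L') f) \<longleftrightarrow>
    (\<forall>a\<in>labels n. \<forall>b\<in>labels n. line_level L a \<le> line_level L b \<longrightarrow> line_level L' a \<le> line_level L' b)"
proof -
  interpret stable_curve_pair n L L' by unfold_locales (use assms in auto)
  show ?thesis
  proof
    assume "\<exists>f. contraction n (dual_tree L) (dual_tree L') f"
    then obtain f where "contraction n (dual_tree L) (dual_tree L') f" by blast
    from contraction_tlev[OF this]
    show "\<forall>a\<in>labels n. \<forall>b\<in>labels n. line_level L a \<le> line_level L b \<longrightarrow> line_level L' a \<le> line_level L' b"
      by (simp add: A.line_level_eq B.line_level_eq)
  next
    assume mono: "\<forall>a\<in>labels n. \<forall>b\<in>labels n. line_level L a \<le> line_level L b \<longrightarrow> line_level L' a \<le> line_level L' b"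
    have "contraction n (dual_tree L) (dual_tree L') meet_map"
      by (rule contraction_meet_map) (use mono in \<open>simp add: A.line_level_eq B.line_level_eq\<close>)
    then show "\<exists>f. contraction n (dual_tree L) (dual_tree L') f" by blast
  qed
qed

text \<open>On one terminal component both sides concern the same integral. For different components
  \<open>Pi_map\<close> is infinite and the period joins different nodes, so neither is
  zero.\<close>

lemma Pi_map_nonzero_iff:
  assumes L: "stable_line n L" and ij: "i \<in> {1..n}" "j \<in> {1..n}"
  shows "Pi_map L i j \<noteq> Pt 0 \<longleftrightarrow> line_integral L (i, j) \<noteq> 0"
proof -
  interpret stable_curve n L by unfold_locales (rule L)
  show ?thesis
  proof (cases "fst (mark L i) = fst (mark L j)")
    case True
    have "meet T (fst (mark L j)) (fst (mark L j)) = fst (mark L j)"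
      using meet_self[OF mark_vert[OF ij(2)]] by simp
    then show ?thesis using True ij by (simp add: Pi_map_def line_integral_def I_map_def Let_def)
  next
    case False
    then have "tlev (i, j) \<noteq> tlev (0, 0)" using tlev_top_iff[OF ij] by (simp add: tlev_def)
    then have "tlev (i, j) < tlev (0, 0)" using level_data_le[OF level_data labels_pair[OF ij]] by simp
    then have "I (i, j) \<noteq> 0" using I_nonzero labels_pair[OF ij] by blast
    then show ?thesis using False by (simp add: Pi_map_def line_integral_eq)
  qed
qed

lemma rescaled_data_refl: "rescaled_data n lev I lev I"
  unfolding rescaled_data_def by (rule exI[of _ "\<lambda>_. 1"]) simp

lemma rescaled_data_sym:
  assumes "rescaled_data n lev I lev' I'"
  shows "rescaled_data n lev' I' lev I"
proof -
  obtain c where c: "c (lev (0, 0)) = 1" "\<And>m. c m \<noteq> 0"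
    "\<And>a. a \<in> labels n \<Longrightarrow> lev' a = lev a \<and> I' a = c (lev a) * I a"
    using assms unfolding rescaled_data_def by blast
  show ?thesis
    unfolding rescaled_data_def using c
    by (intro exI[of _ "\<lambda>m. 1 / c m"]) simp
qed

lemma rescaled_data_trans:
  assumes "rescaled_data n lev I lev' I'" "rescaled_data n lev' I' lev'' I''"
  shows "rescaled_data n lev I lev'' I''"
proof -
  obtain c where c: "c (lev (0, 0)) = 1" "\<And>m. c m \<noteq> 0"
    "\<And>a. a \<in> labels n \<Longrightarrow> lev' a = lev a \<and> I' a = c (lev a) * I a"
    using assms unfolding rescaled_data_def by blast
  obtain d where d: "d (lev' (0, 0)) = 1" "\<And>m. d m \<noteq> 0"
    "\<And>a. a \<in> labels n \<Longrightarrow> lev'' a = lev' a \<and> I'' a = d (lev' a) * I' a"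
    using assms unfolding rescaled_data_def by blast
  show ?thesis
    unfolding rescaled_data_def using c d
    by (intro exI[of _ "\<lambda>m. d m * c m"]) simp
qed

lemma rescaled_data_cong:
  "(\<And>a. a \<in> labels n \<Longrightarrow> lev' a = lev a \<and> I' a = I a) \<Longrightarrow> rescaled_data n lev I lev' I'"
  unfolding rescaled_data_def by (rule exI[of _ "\<lambda>_. 1"]) simp

text \<open>\<open>psi_chart\<close> and \<open>chart_map\<close> are compared only on the domain of
  the chart, so agreement on the points of the source must be enough.\<close>

lemma closed_immersion_cong:
  assumes eq: "\<And>x. x \<in> points X \<Longrightarrow> \<phi> x = \<psi> x" and \<psi>: "closed_immersion \<psi> X Y"
  shows "closed_immersion \<phi> X Y"
proof -
  have im: "\<phi> ` points X = \<psi> ` points X" using eq by simp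
  have inv: "inv_into (points X) \<phi> = inv_into (points X) \<psi>"
    using eq unfolding inv_into_def by (intro ext arg_cong[of _ _ Eps]) auto
  have pre: "{x \<in> points X. \<phi> x \<in> V} = {x \<in> points X. \<psi> x \<in> V}" for V using eq by auto
  have res: "(\<lambda>x \<in> {x \<in> points X. \<psi> x \<in> V}. g (\<phi> x)) = (\<lambda>x \<in> {x \<in> points X. \<psi> x \<in> V}. g (\<psi> x))"
    for V and g :: "'b \<Rightarrow> complex" using eq by (intro restrict_ext) auto
  have mor: "fun_morphism \<phi> X Z \<longleftrightarrow> fun_morphism \<psi> X Z" for Z
    unfolding fun_morphism_def pre res using continuous_map_eq eq by (metis (no_types, lifting))
  have bij: "bij_betw \<phi> (points X) B \<longleftrightarrow> bij_betw \<psi> (points X) B" for B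
    using eq by (rule bij_betw_cong)
  show ?thesis
    using \<psi> unfolding closed_immersion_def fun_isomorphism_def im inv mor bij .
qed

section \<open>Isomorphism classes as level data up to rescaling\<close>

locale moduli =
  fixes n :: nat
  assumes n_pos: "n \<ge> 1"
begin

definition iso_rel :: "(mline \<times> mline) set" where
  "iso_rel = {(L, L'). stable_line n L \<and> stable_line n L' \<and> cp_isomorphic n L L'}"

definition some_line :: "mline set \<Rightarrow> mline" where
  "some_line K = (SOME L. L \<in> K)"

lemma iso_rel_iff: "(L, L') \<in> iso_rel \<longleftrightarrow> stable_line n L \<and> stable_line n L' \<and>
    rescaled_data n (line_level L) (line_integral L) (line_level L') (line_integral L')"
  using cp_isomorphic_iff by (auto simp: iso_rel_def)

lemma equiv_iso_rel: "equiv {L. stable_line n L} iso_rel"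
proof (rule equivI)
  show "iso_rel \<subseteq> {L. stable_line n L} \<times> {L. stable_line n L}" by (auto simp: iso_rel_def)
  show "refl_on {L. stable_line n L} iso_rel" by (simp add: refl_on_def iso_rel_iff rescaled_data_refl)
  show "sym iso_rel" by (rule symI) (use rescaled_data_sym in \<open>auto simp: iso_rel_iff\<close>)
  show "trans iso_rel" by (rule transI) (use rescaled_data_trans in \<open>auto simp: iso_rel_iff\<close>)
qed

lemma moduli_points_eq: "moduli_points n = {L. stable_line n L} // iso_rel"
  by (simp add: moduli_points_def iso_rel_def)

lemma some_line:
  assumes "K \<in> moduli_points n"
  shows "some_line K \<in> K" "stable_line n (some_line K)"
proof -
  show *: "some_line K \<in> K"
    using in_quotient_imp_non_empty[OF equiv_iso_rel] assms
    unfolding some_line_def moduli_points_eq by (simp add: some_in_eq)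
  show "stable_line n (some_line K)"
    using in_quotient_imp_subset[OF equiv_iso_rel] assms * unfolding moduli_points_eq by blast
qed

lemma moduli_points_rel:
  assumes "K \<in> moduli_points n" "L \<in> K"
  shows "(some_line K, L) \<in> iso_rel"
  using quotient_eq_iff[OF equiv_iso_rel, of K K] some_line[OF assms(1)] assms unfolding moduli_points_eq by blast

lemma line_in_moduli:
  assumes "stable_line n L"
  obtains K where "K \<in> moduli_points n" "L \<in> K"
proof (rule that[of "iso_rel `` {L}"])
  show "iso_rel `` {L} \<in> moduli_points n" unfolding moduli_points_eq using assms by (intro quotientI) simp
  show "L \<in> iso_rel `` {L}" using assms by (simp add: iso_rel_iff rescaled_data_refl)
qed

sublocale level_parametrization n "moduli_points n" "\<lambda>K. line_level (some_line K)" "\<lambda>K. line_integral (some_line K)"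
proof
  show "level_data n (line_level (some_line K)) (line_integral (some_line K))" if "K \<in> moduli_points n" for K
    using level_data_line some_line[OF that] by blast
next
  fix K K' assume K: "K \<in> moduli_points n" "K' \<in> moduli_points n"
    "rescaled_data n (line_level (some_line K)) (line_integral (some_line K)) (line_level (some_line K')) (line_integral (some_line K'))"
  then have "(some_line K, some_line K') \<in> iso_rel" using some_line by (simp add: iso_rel_iff)
  then show "K = K'"
    using quotient_eq_iff[OF equiv_iso_rel, of K K'] some_line K(1,2) unfolding moduli_points_eq by blast
next
  fix l J assume D: "level_data n l J"
  obtain L where L: "stable_line n L" "\<And>a. a \<in> labels n \<Longrightarrow> line_level L a = l a"
    "\<And>a. a \<in> labels n \<Longrightarrow> line_integral L a = J a"
    using ex_line_with_level_data[OF D n_pos] by blast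
  obtain K where K: "K \<in> moduli_points n" "L \<in> K" using line_in_moduli[OF L(1)] .
  have "rescaled_data n (line_level (some_line K)) (line_integral (some_line K)) (line_level L) (line_integral L)"
    using moduli_points_rel[OF K] iso_rel_iff by blast
  then have "rescaled_data n (line_level (some_line K)) (line_integral (some_line K)) l J"
    by (rule rescaled_data_trans[OF _ rescaled_data_cong]) (use L in simp)
  then show "\<exists>K\<in>moduli_points n. rescaled_data n (line_level (some_line K)) (line_integral (some_line K)) l J"
    using K by blast
qed

end

section \<open>Identification of the prescribed charts\<close>

locale moduli_chart = moduli n for n +
  fixes L0 :: mline and pr :: "nat \<Rightarrow> nat \<times> nat" and e :: nat
  assumes stable0: "stable_line n L0" and choice: "chart_choice n (dual_tree L0) pr e"
begin

abbreviation "\<Gamma> \<equiv> dual_tree L0"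

definition base_label :: "nat \<Rightarrow> nat \<times> nat" where
  "base_label m = (if m < tree_length \<Gamma> then pr m else (0, 0))"

lemma line_level_star: "line_level L (0, 0) = tree_length (dual_tree L)"
  by (simp add: line_level_def)

lemma pr_label:
  assumes "m < tree_length \<Gamma>"
  shows "fst (pr m) \<in> {1..n}" "snd (pr m) \<in> {1..n}" "line_level L0 (pr m) = m"
proof -
  have "fst (pr m) \<in> {1..n} \<and> snd (pr m) \<in> {1..n} \<and>
      level \<Gamma> (meet \<Gamma> (tmark \<Gamma> (fst (pr m))) (tmark \<Gamma> (snd (pr m)))) = m"
    using choice assms unfolding chart_choice_def by blast
  then show "fst (pr m) \<in> {1..n}" "snd (pr m) \<in> {1..n}" "line_level L0 (pr m) = m"
    by (auto simp: line_level_def)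
qed

sublocale A: stable_curve n L0
  by unfold_locales (rule stable0)

sublocale C: level_chart n "moduli_points n" "\<lambda>K. line_level (some_line K)" "\<lambda>K. line_integral (some_line K)"
  \<Gamma> "line_level L0" "line_integral L0" base_label
proof
  show "level_data n (line_level L0) (line_integral L0)" by (rule level_data_line[OF stable0])
  show "line_level L0 (0, 0) = tree_length \<Gamma>" by (rule line_level_star)
  show "tmark \<Gamma> i \<noteq> tmark \<Gamma> j \<longleftrightarrow> line_level L0 (i, j) < line_level L0 (0, 0)"
    if "i \<in> {1..n}" "j \<in> {1..n}" for i j
    using A.tlev_top_iff[OF that] level_data_le[OF level_data_line[OF stable0] labels_pair[OF that]]
    by (simp add: A.line_level_eq line_level_star order_less_le del: dual_tree_simps)
  show "base_label m \<in> labels n" "line_level L0 (base_label m) = m" if "m \<le> line_level L0 (0, 0)" for m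
    using pr_label[of m] that labels_pair[of "fst (pr m)" n "snd (pr m)"]
    by (auto simp: base_label_def line_level_star)
  show "base_label (line_level L0 (0, 0)) = (0, 0)" by (simp add: base_label_def line_level_star)
qed

lemma same_data:
  assumes "K \<in> moduli_points n" "L \<in> K"
  obtains c where "\<And>m. c m \<noteq> 0" "stable_line n L"
    "\<And>a. a \<in> labels n \<Longrightarrow> line_level L a = line_level (some_line K) a"
    "\<And>a. a \<in> labels n \<Longrightarrow> line_integral L a = c (line_level (some_line K) a) * line_integral (some_line K) a"
  using moduli_points_rel[OF assms] that unfolding iso_rel_iff rescaled_data_def by blast

text \<open>Levels and the vanishing of periods are the same for all representatives of a class, so
  the representative in the definition of \<open>U_chart\<close> may be exchanged for
  \<open>some_line K\<close>.\<close>

lemma chart_domain_eq: "U_chart n \<Gamma> = C.chart_domain"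
proof -
  have "(\<exists>f. contraction n \<Gamma> (dual_tree L) f) \<and>
        (\<forall>i\<in>{1..n}. \<forall>j\<in>{1..n}. tmark \<Gamma> i \<noteq> tmark \<Gamma> j \<longrightarrow> Pi_map L i j \<noteq> Pt 0) \<longleftrightarrow>
      (\<forall>a\<in>labels n. \<forall>b\<in>labels n. line_level L0 a \<le> line_level L0 b \<longrightarrow> line_level (some_line K) a \<le> line_level (some_line K) b) \<and>
      (\<forall>a\<in>labels n. line_level L0 a < line_level L0 (0, 0) \<longrightarrow> line_integral (some_line K) a \<noteq> 0)"
    if K: "K \<in> moduli_points n" "L \<in> K" for K L
  proof -
    obtain c where c: "\<And>m. c m \<noteq> 0" "stable_line n L"
      "\<And>a. a \<in> labels n \<Longrightarrow> line_level L a = line_level (some_line K) a"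
      "\<And>a. a \<in> labels n \<Longrightarrow> line_integral L a = c (line_level (some_line K) a) * line_integral (some_line K) a"
      using same_data[OF K] by blast
    have "(\<forall>a\<in>labels n. line_level L0 a < line_level L0 (0, 0) \<longrightarrow> line_integral (some_line K) a \<noteq> 0) \<longleftrightarrow>
        (\<forall>a\<in>labels n. line_level L0 a < line_level L0 (0, 0) \<longrightarrow> line_integral L a \<noteq> 0)"
      using c(1,4) by auto
    also have "\<dots> \<longleftrightarrow> (\<forall>i\<in>{1..n}. \<forall>j\<in>{1..n}. line_level L0 (i, j) < line_level L0 (0, 0) \<longrightarrow> line_integral L (i, j) \<noteq> 0)"
      by (auto simp: labels_def)
    also have "\<dots> \<longleftrightarrow> (\<forall>i\<in>{1..n}. \<forall>j\<in>{1..n}. tmark \<Gamma> i \<noteq> tmark \<Gamma> j \<longrightarrow> Pi_map L i j \<noteq> Pt 0)"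
      using C.tmark_iff Pi_map_nonzero_iff[OF c(2)] by (simp del: dual_tree_simps)
    finally show ?thesis using ex_contraction_iff[OF stable0 c(2)] c(3) by simp
  qed
  note * = this
  show ?thesis
    unfolding U_chart_def C.chart_domain_def
  proof (intro Collect_cong conj_cong refl)
    fix K assume K: "K \<in> moduli_points n"
    show "(\<exists>L\<in>K. (\<exists>f. contraction n \<Gamma> (dual_tree L) f) \<and>
        (\<forall>i\<in>{1..n}. \<forall>j\<in>{1..n}. tmark \<Gamma> i \<noteq> tmark \<Gamma> j \<longrightarrow> Pi_map L i j \<noteq> Pt 0)) \<longleftrightarrow>
      (\<forall>a\<in>labels n. \<forall>b\<in>labels n. line_level L0 a \<le> line_level L0 b \<longrightarrow> line_level (some_line K) a \<le> line_level (some_line K) b) \<and>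
      (\<forall>a\<in>labels n. line_level L0 a < line_level L0 (0, 0) \<longrightarrow> line_integral (some_line K) a \<noteq> 0)"
      (is "(\<exists>L\<in>K. ?P L) \<longleftrightarrow> ?rhs")
    proof
      assume "\<exists>L\<in>K. ?P L"
      then obtain L where "L \<in> K" "?P L" by (elim bexE)
      then show ?rhs using *[OF K \<open>L \<in> K\<close>] by (simp only:)
    next
      assume ?rhs
      then have "?P (some_line K)" using *[OF K some_line(1)[OF K]] by (simp only:)
      then show "\<exists>L\<in>K. ?P L" using some_line(1)[OF K] by (rule bexI)
    qed
  qed
qed

lemma chart_scale_eq: "chart_scale \<Gamma> pr L m = line_integral L (base_label m)"
  using pr_label[of m] by (auto simp: chart_scale_def base_label_def line_integral_def)

text \<open>The contraction sends meets to meets, which turns the equivalence of image vertices into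
  an equality of levels of reference labels.\<close>

lemma psi_line_eq:
  assumes L: "stable_line n L" and f: "contraction n \<Gamma> (dual_tree L) f"
  shows "psi_line n \<Gamma> pr e L = (\<lambda>k\<in>chart_index n \<Gamma>. case k of
     Zc i j \<Rightarrow> line_integral L (i, j) / line_integral L (base_label (line_level L0 (i, j)))
   | Tc m \<Rightarrow> if line_level L (base_label m) = line_level L (base_label (m - 1))
        then line_integral L (base_label m) / line_integral L (base_label (m - 1)) else 0)"
proof -
  interpret P: stable_curve_pair n L0 L by unfold_locales (rule L)
  have THE: "(THE f. contraction n \<Gamma> (dual_tree L) f) = f"
    using f P.contraction_unique by (intro the_equality) auto
  have vertex: "f (chart_vertex \<Gamma> pr e m) \<in> verts L" "P.B.lv (f (chart_vertex \<Gamma> pr e m)) = line_level L (base_label m)"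
    if "m \<le> tree_length \<Gamma>" for m
  proof -
    have "f (chart_vertex \<Gamma> pr e m) \<in> verts L \<and> P.B.lv (f (chart_vertex \<Gamma> pr e m)) = line_level L (base_label m)"
    proof (cases "m < tree_length \<Gamma>")
      case True
      note p = pr_label[OF True]
      have "f (chart_vertex \<Gamma> pr e m) = P.pair_meet' (fst (pr m)) (snd (pr m))"
        using True P.contraction_meet[OF f p(1,2)] by (simp add: chart_vertex_def del: dual_tree_simps)
      then show ?thesis
        using True p P.B.meet_vert[OF p(1,2)] by (auto simp: base_label_def line_level_def)
    next
      case False
      \<comment> \<open>The terminal vertex is represented by a mark on it, and marks go to marks,
        hence to the terminal level.\<close>
      have "terminal \<Gamma> e" using choice by (simp add: chart_choice_def)
      then obtain i where i: "i \<in> {1..n}" "tmark \<Gamma> i = e" using A.terminal_marked by blast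
      then have "f (chart_vertex \<Gamma> pr e m) = tmark (dual_tree L) i"
        using False P.f_mark[OF f i(1)] by (simp add: chart_vertex_def del: dual_tree_simps)
      then show ?thesis
        using False P.B.mark_vert[OF i(1)] P.B.level_terminal[OF P.B.mark_terminal[OF i(1)]]
        by (simp add: base_label_def line_level_def)
    qed
    then show "f (chart_vertex \<Gamma> pr e m) \<in> verts L" "P.B.lv (f (chart_vertex \<Gamma> pr e m)) = line_level L (base_label m)"
      by blast+
  qed
  have sim: "sim (preord L) (f (chart_vertex \<Gamma> pr e m)) (f (chart_vertex \<Gamma> pr e (m - 1))) \<longleftrightarrow>
      line_level L (base_label m) = line_level L (base_label (m - 1))" if "m \<le> tree_length \<Gamma>" for m
  proof -
    have *: "sim (preord L) v w \<longleftrightarrow> P.B.lv v = P.B.lv w" if "v \<in> verts L" "w \<in> verts L" for v w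
      using P.B.level_le_iff[of v w] P.B.level_le_iff[of w v] that by (auto simp: sim_def)
    show ?thesis using *[OF vertex(1) vertex(1)] vertex(2) that by simp
  qed
  show ?thesis
    unfolding psi_line_def Let_def THE chart_scale_eq
  proof (rule restrict_ext)
    fix k assume k: "k \<in> chart_index n \<Gamma>"
    then consider i j where "k = Zc i j" "1 \<le> i" | m where "k = Tc m" "m \<le> tree_length \<Gamma>"
      by (auto simp: chart_index_def)
    then show "(case k of
        Zc i j \<Rightarrow> I_map L i j / line_integral L (base_label (level \<Gamma> (meet \<Gamma> (tmark \<Gamma> i) (tmark \<Gamma> j))))
      | Tc m \<Rightarrow> if sim (preord L) (f (chart_vertex \<Gamma> pr e m)) (f (chart_vertex \<Gamma> pr e (m - 1)))
           then line_integral L (base_label m) / line_integral L (base_label (m - 1)) else 0) =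
      (case k of Zc i j \<Rightarrow> line_integral L (i, j) / line_integral L (base_label (line_level L0 (i, j)))
      | Tc m \<Rightarrow> if line_level L (base_label m) = line_level L (base_label (m - 1))
           then line_integral L (base_label m) / line_integral L (base_label (m - 1)) else 0)"
      by cases (use sim in \<open>simp_all add: line_integral_def line_level_def\<close>)
  qed
qed

text \<open>The quotients that are formed compare periods of one level, so the factors of a
  rescaling cancel. All representatives give the same coordinates, which \<open>the_elem\<close>
  returns.\<close>

lemma psi_chart_eq:
  assumes K: "K \<in> C.chart_domain"
  shows "psi_chart n \<Gamma> pr e K = C.chart_map K"
proof -
  have KM: "K \<in> moduli_points n" using C.chart_domainD(3)[OF K] .
  have "psi_line n \<Gamma> pr e L = C.chart_map K" if L: "L \<in> K" for L
  proof -
    obtain c where c: "\<And>m. c m \<noteq> 0" "stable_line n L"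
      "\<And>a. a \<in> labels n \<Longrightarrow> line_level L a = line_level (some_line K) a"
      "\<And>a. a \<in> labels n \<Longrightarrow> line_integral L a = c (line_level (some_line K) a) * line_integral (some_line K) a"
      using same_data[OF KM L] by blast
    have "\<exists>f. contraction n \<Gamma> (dual_tree L) f"
      using ex_contraction_iff[OF stable0 c(2)] c(3) C.chart_domainD(1)[OF K] by simp
    then obtain f where f: "contraction n \<Gamma> (dual_tree L) f" by blast
    show ?thesis
      unfolding psi_line_eq[OF c(2) f] C.chart_map_def
    proof (rule restrict_ext)
      fix k assume "k \<in> chart_index n \<Gamma>"
      then consider i j where "k = Zc i j" "i \<in> {1..n}" "j \<in> {1..n}" | m where "k = Tc m" "m \<le> tree_length \<Gamma>"
        by (auto simp: chart_index_def)
      then show "(case k of Zc i j \<Rightarrow> line_integral L (i, j) / line_integral L (base_label (line_level L0 (i, j)))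
        | Tc m \<Rightarrow> if line_level L (base_label m) = line_level L (base_label (m - 1))
           then line_integral L (base_label m) / line_integral L (base_label (m - 1)) else 0) =
        (case k of Zc i j \<Rightarrow> line_integral (some_line K) (i, j) / line_integral (some_line K) (base_label (line_level L0 (i, j)))
        | Tc m \<Rightarrow> if line_level (some_line K) (base_label m) = line_level (some_line K) (base_label (m - 1))
           then line_integral (some_line K) (base_label m) / line_integral (some_line K) (base_label (m - 1)) else 0)"
      proof cases
        case 1
        have l: "(i, j) \<in> labels n" using labels_pair 1 by blast
        note b = C.base[OF C.g_le[OF l]]
        have "line_level (some_line K) (i, j) = line_level (some_line K) (base_label (line_level L0 (i, j)))"
          by (rule C.chart_domainD(5)[OF K l b(1)]) (simp add: b(2))
        then show ?thesis using c(1) c(4)[OF l] c(4)[OF b(1)] 1 by simp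
      next
        case 2
        have "m \<le> line_level L0 (0, 0)" "m - 1 \<le> line_level L0 (0, 0)" using 2 C.top_level by simp_all
        note b = C.base(1)[OF this(1)] C.base(1)[OF this(2)]
        show ?thesis using c(1) c(3)[OF b(1)] c(3)[OF b(2)] c(4)[OF b(1)] c(4)[OF b(2)] 2 by simp
      qed
    qed
  qed
  then have "psi_line n \<Gamma> pr e ` K = {C.chart_map K}" using some_line(1)[OF KM] by (intro equalityI subsetI) (metis imageE singletonI, metis imageI singletonD)
  then show ?thesis by (simp add: psi_chart_def)
qed

lemma closed_immersion_psi_chart:
  "closed_immersion (psi_chart n \<Gamma> pr e) (induced_space embedded_space (U_chart n \<Gamma>)) (chart_target n \<Gamma>)"
  unfolding chart_domain_eq
  by (rule closed_immersion_cong[OF _ C.closed_immersion_chart_map]) (simp add: psi_chart_eq)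

lemma open_U_chart: "openin (zariski embedded_space) (U_chart n \<Gamma>)"
  using C.chart_domain_open by (simp add: chart_domain_eq)

end

section \<open>Existence and uniqueness of the variety structure\<close>

context moduli
begin

lemma ex_chart_choice:
  assumes L: "stable_line n L"
  obtains pr e where "chart_choice n (dual_tree L) pr e"
proof -
  interpret A: stable_curve n L by unfold_locales (rule L)
  have "\<exists>p. fst p \<in> {1..n} \<and> snd p \<in> {1..n} \<and>
      level (dual_tree L) (meet (dual_tree L) (tmark (dual_tree L) (fst p)) (tmark (dual_tree L) (snd p))) = m"
    if m: "m < tree_length (dual_tree L)" for m
  proof -
    have "m \<in> A.lv ` A.V" using A.level_image m by simp
    then obtain v where "v \<in> A.V" "A.lv v = m" by blast
    then obtain i j where "i \<in> {1..n}" "j \<in> {1..n}" "A.lv (meet (dual_tree L) (A.h i) (A.h j)) = m"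
      using A.ex_meet' by metis
    then show ?thesis by (intro exI[of _ "(i, j)"]) simp
  qed
  then obtain pr where "\<And>m. m < tree_length (dual_tree L) \<Longrightarrow> fst (pr m) \<in> {1..n} \<and> snd (pr m) \<in> {1..n} \<and>
      level (dual_tree L) (meet (dual_tree L) (tmark (dual_tree L) (fst (pr m))) (tmark (dual_tree L) (snd (pr m)))) = m"
    by metis
  moreover have "terminal (dual_tree L) (A.h 1)" using A.mark_terminal n_pos by simp
  ultimately show ?thesis using that unfolding chart_choice_def by blast
qed

lemma moduli_structure_embedded_space: "moduli_structure n embedded_space"
  unfolding moduli_structure_def
proof (intro conjI ballI allI impI)
  show "variety embedded_space" using projective_variety_embedded_space by (simp add: projective_variety_def)
  show "points embedded_space = moduli_points n" by simp
next
  fix \<Gamma> assume "\<Gamma> \<in> dual_level_trees n"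
  then obtain L where L: "stable_line n L" "\<Gamma> = dual_tree L" by (auto simp: dual_level_trees_def)
  show "openin (zariski embedded_space) (U_chart n \<Gamma>)"
  proof -
    obtain pr e where "chart_choice n (dual_tree L) pr e" using ex_chart_choice[OF L(1)] .
    then interpret moduli_chart n L pr e by unfold_locales (use L in auto)
    show ?thesis using open_U_chart L(2) by simp
  qed
  show "closed_immersion (psi_chart n \<Gamma> pr e) (induced_space embedded_space (U_chart n \<Gamma>)) (chart_target n \<Gamma>)"
    if c: "chart_choice n \<Gamma> pr e" for pr e
  proof -
    interpret moduli_chart n L pr e by unfold_locales (use L c in auto)
    show ?thesis using closed_immersion_psi_chart L(2) by simp
  qed
qed

text \<open>Each point lies in the chart of its own dual tree: this tree contracts to itself, and
  \<open>Pi_map\<close> is infinite for marks on different components.\<close>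

lemma U_chart_cover: "moduli_points n \<subseteq> \<Union>(U_chart n ` dual_level_trees n)"
proof
  fix K assume K: "K \<in> moduli_points n"
  define L where "L = some_line K"
  have L: "L \<in> K" "stable_line n L" using some_line[OF K] by (simp_all add: L_def)
  have "\<exists>f. contraction n (dual_tree L) (dual_tree L) f" using ex_contraction_iff[OF L(2,2)] by blast
  moreover have "Pi_map L i j \<noteq> Pt 0" if "tmark (dual_tree L) i \<noteq> tmark (dual_tree L) j" for i j
    using that by (simp add: Pi_map_def)
  ultimately have "K \<in> U_chart n (dual_tree L)"
    unfolding U_chart_def using K L(1) by blast
  then show "K \<in> \<Union>(U_chart n ` dual_level_trees n)"
    using L(2) by (auto simp: dual_level_trees_def)
qed

text \<open>Each chart admits a choice of pairs, and its closed immersion then fixes the induced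
  structure; the charts cover, so the structures glue to the same space.\<close>

lemma moduli_structure_unique:
  assumes X: "moduli_structure n X" and Y: "moduli_structure n Y"
  shows "X = Y"
proof (rule fun_space_glue[where \<U> = "U_chart n ` dual_level_trees n"])
  show "space_with_functions X" "space_with_functions Y"
    using X Y by (simp_all add: moduli_structure_def variety_def)
  show pts: "points X = points Y" using X Y by (simp add: moduli_structure_def)
  show "points X \<subseteq> \<Union>(U_chart n ` dual_level_trees n)"
    using U_chart_cover X by (simp add: moduli_structure_def)
  fix U assume "U \<in> U_chart n ` dual_level_trees n"
  then obtain L where L: "stable_line n L" "dual_tree L \<in> dual_level_trees n" "U = U_chart n (dual_tree L)"
    by (auto simp: dual_level_trees_def)
  then show "openin (zariski X) U \<and> openin (zariski Y) U"
    using X Y by (simp add: moduli_structure_def)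
  obtain pr e where "chart_choice n (dual_tree L) pr e" using ex_chart_choice[OF L(1)] .
  then have "closed_immersion (psi_chart n (dual_tree L) pr e) (induced_space X U) (chart_target n (dual_tree L))"
    "closed_immersion (psi_chart n (dual_tree L) pr e) (induced_space Y U) (chart_target n (dual_tree L))"
    using X Y L(2,3) by (simp_all add: moduli_structure_def)
  then show "induced_space X U = induced_space Y U"
    using pts by (rule closed_immersion_unique)
qed

lemma moduli_variety_eq: "moduli_variety n = embedded_space"
  unfolding moduli_variety_def
proof (rule the_equality)
  show "moduli_structure n embedded_space" by (rule moduli_structure_embedded_space)
  show "X = embedded_space" if "moduli_structure n X" for X
    using that moduli_structure_embedded_space by (rule moduli_structure_unique)
qed

end

theorem corollary4p23:
  fixes n :: nat
  assumes "n \<ge> 1"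
  shows "projective_variety (moduli_variety n)"
proof -
  interpret moduli n by unfold_locales (rule assms)
  show ?thesis
    unfolding moduli_variety_eq by (rule projective_variety_embedded_space)
qed

end
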